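(* For every integer $n\ge1$, the functor $\mathcal{A}_n/\mathcal{A}_{n+1}:\mathbf{S}(\mathbf{ab})\to\mathbf{Ab}$ is weakly polynomial of weak degree $n+2$.
   Context: **Categories.** $\mathbf{Ab}$ is the category of abelian groups, $\mathbf{ab}$ its full subcategory of free abelian groups of finite rank. $\mathbf{S}(\mathbf{ab})$ has the same objects as $\mathbf{ab}$ and $\mathbf{S}(\mathbf{ab})(a,b)=\{(u,v)\in\mathbf{ab}(b,a)\times\mathbf{ab}(a,b)\mid u\circ v=\mathrm{Id}_a\}$; it is symmetric monoidal for the direct sum, with unit $0$ initial. **The functors.** For a group $G$, $\gamma_1(G)=G$ and $\gamma_{n+1}(G)=[\gamma_n(G),G]$. Let $\mathcal{G}$ be the category of free groups of finite rank whose morphisms $G\to H$ are pairs $(u,K)$ with $u:G\hookrightarrow H$ an injective homomorphism and $K$ a subgroup of $H$ with $H=K*u(G)$ (composition $(v,L)\circ(u,K)=(vu,L*v(K))$). The functor $\mathrm{Aut}$ from $\mathcal{G}$ to groups sends $G$ to its automorphism group and $(u,K)$ to $\varphi\mapsto K*(u\varphi u^{-1})$ (identity on $K$, $u\varphi u^{-1}$ on $u(G)$). The Johnson–Andreadakis filtration is given by the subfunctors $\mathcal{A}_n(G)=\mathrm{Ker}\big(\mathrm{Aut}(G)\to\mathrm{Aut}(G/\gamma_{n+1}(G))\big)$. Up to isomorphism, the functor $\mathcal{A}_n/\mathcal{A}_{n+1}:\mathcal{G}\to\mathbf{Ab}$ factors uniquely through the functor $\mathcal{G}\to\mathbf{S}(\mathbf{ab})$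 given by $G\mapsto G_{ab}$ on objects (sending $(u,K)$ to $u_{ab}$ together with the retraction $H_{ab}\to G_{ab}$ that kills $K$ and inverts $u$); the resulting functor on $\mathbf{S}(\mathbf{ab})$ is denoted in the same way. **Weak degree.** Let $\mathcal{M}=\mathbf{S}(\mathbf{ab})$ and let $\mathbf{Fct}(\mathcal{M},\mathbf{Ab})$ be the category of functors. For $x\in\mathcal{M}$, $\kappa_x(F)$ and $\delta_x(F)$ are the kernel and cokernel of the map $F\to F(x\oplus-)$ induced by $0\to x$. $F$ is stably null if $\sum_x\kappa_x(F)=F$; stably null functors form a thick (Serre) subcategory and $\mathbf{St}(\mathcal{M},\mathbf{Ab})$ is the quotient of $\mathbf{Fct}(\mathcal{M},\mathbf{Ab})$ by it, on which $\delta_x$ induces an endofunctor $\delta_x$. $\mathcal{P}ol_d\subset\mathbf{St}(\mathcal{M},\mathbf{Ab})$: $\{0\}$ for $d<0$; for $d\ge0$, the $X$ with $\delta_x(X)\in\mathcal{P}ol_{d-1}$ for all $x$. $F$ is weakly polynomial if its image in $\mathbf{St}(\mathcal{M},\mathbf{Ab})$ lies in some $\mathcal{P}ol_d$; its weak degree is the least such $d\in\mathbb{N}\cup\{-\infty\}$. *)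

theory Defs
  imports
    "HOL-Algebra.Algebra"
    "HOL-Library.Nat_Bijection"
    "HOL-Library.Extended_Real"
begin

section \<open>Quotient groups inside a fixed type\<close>

text \<open>Quotients are iterated below (cokernels of cokernels, to any depth), so a quotient must live in
  the same type as the original group: its elements are chosen representatives of the cosets.
  The result is isomorphic to the library's \<open>G Mod N\<close>.\<close>

definition rep_of :: "('a, 'r) monoid_scheme \<Rightarrow> 'a set \<Rightarrow> 'a \<Rightarrow> 'a" where
  "rep_of G N x = (SOME y. y \<in> N #>\<^bsub>G\<^esub> x)"

definition quot :: "('a, 'r) monoid_scheme \<Rightarrow> 'a set \<Rightarrow> 'a monoid" where
  "quot G N = \<lparr>carrier = rep_of G N ` carrier G,
               monoid.mult = (\<lambda>x y. rep_of G N (x \<otimes>\<^bsub>G\<^esub> y)),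
               one = rep_of G N \<one>\<^bsub>G\<^esub>\<rparr>"

lemma (in normal) rep_of_in:
  assumes "x \<in> carrier G"
  shows "rep_of G H x \<in> H #> x" "rep_of G H x \<in> carrier G" "H #> rep_of G H x = H #> x"
proof -
  have "x \<in> H #> x" using assms rcos_self subgroup_axioms by blast
  then show a: "rep_of G H x \<in> H #> x" unfolding rep_of_def by (rule someI)
  then show b: "rep_of G H x \<in> carrier G"
    using assms r_coset_subset_G subset by blast
  show "H #> rep_of G H x = H #> x"
    using repr_independence[OF a assms subgroup_axioms] by simp
qed

lemma (in normal) quot_iso_Mod: "(\<lambda>x. H #> x) \<in> iso (quot G H) (G Mod H)"
proof (rule isoI)
  show "(\<lambda>x. H #> x) \<in> hom (quot G H) (G Mod H)"
  proof -
    have "H #> (x \<otimes> y) = (H #> x) <#> (H #> y)" if "x \<in> carrier G" "y \<in> carrier G" for x y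
      using that by (simp add: rcos_sum)
    then show ?thesis
      by (auto simp: hom_def quot_def FactGroup_def RCOSETS_def rep_of_in simp del: rcos_sum)
  qed
  show "bij_betw (\<lambda>x. H #> x) (carrier (quot G H)) (carrier (G Mod H))"
    unfolding bij_betw_def
  proof
    show "inj_on (\<lambda>x. H #> x) (carrier (quot G H))"
    proof (rule inj_onI)
      fix x y assume "x \<in> carrier (quot G H)" "y \<in> carrier (quot G H)" "H #> x = H #> y"
      then obtain x' y' where *: "x' \<in> carrier G" "y' \<in> carrier G"
        "x = rep_of G H x'" "y = rep_of G H y'"
        by (auto simp: quot_def)
      with \<open>H #> x = H #> y\<close> have "H #> x' = H #> y'" by (simp add: rep_of_in)
      with * show "x = y" by (simp add: rep_of_def)
    qed
    show "(\<lambda>x. H #> x) ` carrier (quot G H) = carrier (G Mod H)"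
      by (auto simp: quot_def FactGroup_def RCOSETS_def image_image rep_of_in)
  qed
qed

corollary (in normal) quot_cong_Mod: "quot G H \<cong> G Mod H"
  using quot_iso_Mod by (rule is_isoI)


section \<open>Categories and group-valued functors\<close>

text \<open>Hom-sets of different pairs of objects need not be disjoint, so composition
  (\<open>Comp C a b c g f\<close> is \<open>g \<circ> f\<close> for \<open>f : a \<rightarrow> b\<close>, \<open>g : b \<rightarrow> c\<close>) and the action of a functor on
  morphisms take the objects as arguments.\<close>

record ('o, 'm) cat =
  Ob :: "'o set"
  Hom :: "'o \<Rightarrow> 'o \<Rightarrow> 'm set"
  Idm :: "'o \<Rightarrow> 'm"
  Comp :: "'o \<Rightarrow> 'o \<Rightarrow> 'o \<Rightarrow> 'm \<Rightarrow> 'm \<Rightarrow> 'm"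

record ('o, 'm, 'b) gfun =
  Fob :: "'o \<Rightarrow> 'b monoid"
  Fmor :: "'o \<Rightarrow> 'o \<Rightarrow> 'm \<Rightarrow> 'b \<Rightarrow> 'b"

definition group_functor :: "('o, 'm) cat \<Rightarrow> ('o, 'm, 'b) gfun \<Rightarrow> bool" where
  "group_functor C F \<longleftrightarrow>
     (\<forall>a\<in>Ob C. group (Fob F a)) \<and>
     (\<forall>a\<in>Ob C. \<forall>b\<in>Ob C. \<forall>f\<in>Hom C a b. Fmor F a b f \<in> hom (Fob F a) (Fob F b)) \<and>
     (\<forall>a\<in>Ob C. \<forall>t\<in>carrier (Fob F a). Fmor F a a (Idm C a) t = t) \<and>
     (\<forall>a\<in>Ob C. \<forall>b\<in>Ob C. \<forall>c\<in>Ob C. \<forall>f\<in>Hom C a b. \<forall>g\<in>Hom C b c. \<forall>t\<in>carrier (Fob F a).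
        Fmor F a c (Comp C a b c g f) t = Fmor F b c g (Fmor F a b f t))"

definition ab_functor :: "('o, 'm) cat \<Rightarrow> ('o, 'm, 'b) gfun \<Rightarrow> bool" where
  "ab_functor C F \<longleftrightarrow> group_functor C F \<and> (\<forall>a\<in>Ob C. comm_group (Fob F a))"

definition nat_trans ::
  "('o, 'm) cat \<Rightarrow> ('o, 'm, 'b) gfun \<Rightarrow> ('o, 'm, 'c) gfun \<Rightarrow> ('o \<Rightarrow> 'b \<Rightarrow> 'c) \<Rightarrow> bool" where
  "nat_trans C F G \<eta> \<longleftrightarrow>
     (\<forall>a\<in>Ob C. \<eta> a \<in> hom (Fob F a) (Fob G a)) \<and>
     (\<forall>a\<in>Ob C. \<forall>b\<in>Ob C. \<forall>f\<in>Hom C a b. \<forall>t\<in>carrier (Fob F a).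
        \<eta> b (Fmor F a b f t) = Fmor G a b f (\<eta> a t))"

definition nat_isomorphic ::
  "('o, 'm) cat \<Rightarrow> ('o, 'm, 'b) gfun \<Rightarrow> ('o, 'm, 'c) gfun \<Rightarrow> bool" where
  "nat_isomorphic C F G \<longleftrightarrow>
     (\<exists>\<eta>. nat_trans C F G \<eta> \<and> (\<forall>a\<in>Ob C. \<eta> a \<in> iso (Fob F a) (Fob G a)))"

definition subfunctor :: "('o, 'm) cat \<Rightarrow> ('o, 'm, 'b) gfun \<Rightarrow> ('o \<Rightarrow> 'b set) \<Rightarrow> bool" where
  "subfunctor C F S \<longleftrightarrow>
     (\<forall>a\<in>Ob C. subgroup (S a) (Fob F a)) \<and>
     (\<forall>a\<in>Ob C. \<forall>b\<in>Ob C. \<forall>f\<in>Hom C a b. Fmor F a b f ` S a \<subseteq> S b)"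

definition Fsub :: "('o, 'm, 'b) gfun \<Rightarrow> ('o \<Rightarrow> 'b set) \<Rightarrow> ('o, 'm, 'b) gfun" where
  "Fsub F S = \<lparr>Fob = (\<lambda>a. (Fob F a)\<lparr>carrier := S a\<rparr>), Fmor = Fmor F\<rparr>"

definition Fquot :: "('o, 'm, 'b) gfun \<Rightarrow> ('o \<Rightarrow> 'b set) \<Rightarrow> ('o, 'm, 'b) gfun" where
  "Fquot F S = \<lparr>Fob = (\<lambda>a. quot (Fob F a) (S a)),
                Fmor = (\<lambda>a b f t. rep_of (Fob F b) (S b) (Fmor F a b f t))\<rparr>"


section \<open>The category of free abelian groups of finite rank with split injections\<close>

text \<open>Objects are all free abelian groups of finite rank whose carrier is a set of natural numbers;
  up to isomorphism these are all free abelian groups of finite rank. Homomorphisms are taken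
  extensional so that equality of morphisms is equality of maps on the carrier.\<close>

definition ext_hom :: "'a monoid \<Rightarrow> 'b monoid \<Rightarrow> ('a \<Rightarrow> 'b) set" where
  "ext_hom A B = hom A B \<inter> extensional (carrier A)"

definition free_abelian_fin_rank :: "'a monoid \<Rightarrow> bool" where
  "free_abelian_fin_rank A \<longleftrightarrow>
     comm_group A \<and> (\<exists>S :: nat set. finite S \<and> A \<cong> free_Abelian_group S)"

type_synonym split_mor = "(nat \<Rightarrow> nat) \<times> (nat \<Rightarrow> nat)"

definition Sab :: "(nat monoid, split_mor) cat" where
  "Sab = \<lparr>Ob = {a. free_abelian_fin_rank a},
          Hom = (\<lambda>a b. {(u, v). u \<in> ext_hom b a \<and> v \<in> ext_hom a b \<and>
                                 (\<forall>t\<in>carrier a. u (v t) = t)}),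
          Idm = (\<lambda>a. (\<lambda>t\<in>carrier a. t, \<lambda>t\<in>carrier a. t)),
          Comp = (\<lambda>a b c (u', v') (u, v).
                    (compose (carrier c) u u', compose (carrier a) v' v))\<rparr>"

text \<open>The direct sum is \<open>a \<times>\<times> b\<close> transported along the pairing bijection on natural numbers.\<close>

definition dsum :: "nat monoid \<Rightarrow> nat monoid \<Rightarrow> nat monoid" where
  "dsum a b = \<lparr>carrier = prod_encode ` carrier (a \<times>\<times> b),
               monoid.mult = (\<lambda>s t. prod_encode (prod_decode s \<otimes>\<^bsub>a \<times>\<times> b\<^esub> prod_decode t)),
               one = prod_encode \<one>\<^bsub>a \<times>\<times> b\<^esub>\<rparr>"

definition dsum_map :: "nat monoid \<Rightarrow> nat monoid \<Rightarrow> (nat \<Rightarrow> nat) \<Rightarrow> (nat \<Rightarrow> nat) \<Rightarrow> nat \<Rightarrow> nat" where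
  "dsum_map a b f g =
     (\<lambda>z\<in>carrier (dsum a b). prod_encode (map_prod f g (prod_decode z)))"

text \<open>\<open>dsum_mor a b a' b' f f'\<close> is \<open>f \<oplus> f' : a \<oplus> a' \<rightarrow> b \<oplus> b'\<close> for \<open>f : a \<rightarrow> b\<close>, \<open>f' : a' \<rightarrow> b'\<close>.\<close>

definition dsum_mor :: "nat monoid \<Rightarrow> nat monoid \<Rightarrow> nat monoid \<Rightarrow> nat monoid \<Rightarrow>
    split_mor \<Rightarrow> split_mor \<Rightarrow> split_mor" where
  "dsum_mor a b a' b' f f' =
     (dsum_map b b' (fst f) (fst f'), dsum_map a a' (snd f) (snd f'))"

definition zero_ob :: "nat monoid" where
  "zero_ob = \<lparr>carrier = {0}, monoid.mult = (\<lambda>_ _. 0), one = 0\<rparr>"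

definition initial_mor :: "nat monoid \<Rightarrow> split_mor" where
  "initial_mor x = (\<lambda>_\<in>carrier x. 0, \<lambda>_\<in>carrier zero_ob. \<one>\<^bsub>x\<^esub>)"

text \<open>The canonical isomorphism \<open>a \<rightarrow> 0 \<oplus> a\<close>.\<close>

definition left_unit :: "nat monoid \<Rightarrow> split_mor" where
  "left_unit a = (\<lambda>z\<in>carrier (dsum zero_ob a). snd (prod_decode z),
                  \<lambda>t\<in>carrier a. prod_encode (0, t))"

text \<open>The morphism \<open>a \<cong> 0 \<oplus> a \<rightarrow> x \<oplus> a\<close> induced by \<open>0 \<rightarrow> x\<close>.\<close>

definition into_sum :: "nat monoid \<Rightarrow> nat monoid \<Rightarrow> split_mor" where
  "into_sum x a =
     Comp Sab a (dsum zero_ob a) (dsum x a)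
       (dsum_mor zero_ob x a a (initial_mor x) (Idm Sab a)) (left_unit a)"

lemma into_sum_eq:
  "into_sum x a = (\<lambda>z\<in>carrier (dsum x a). snd (prod_decode z),
                   \<lambda>t\<in>carrier a. prod_encode (\<one>\<^bsub>x\<^esub>, t))"
  by (rule prod_eqI; rule ext)
     (auto simp: into_sum_def Sab_def dsum_mor_def dsum_map_def initial_mor_def left_unit_def
        compose_def dsum_def zero_ob_def DirProd_def)


section \<open>Weakly polynomial functors on \<open>Sab\<close>\<close>

type_synonym 'b sfun = "(nat monoid, split_mor, 'b) gfun"

definition shift :: "nat monoid \<Rightarrow> 'b sfun \<Rightarrow> 'b sfun" where
  "shift x F = \<lparr>Fob = (\<lambda>a. Fob F (dsum x a)),
                Fmor = (\<lambda>a b f. Fmor F (dsum x a) (dsum x b) (dsum_mor x x a b (Idm Sab x) f))\<rparr>"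

definition to_shift :: "nat monoid \<Rightarrow> 'b sfun \<Rightarrow> nat monoid \<Rightarrow> 'b \<Rightarrow> 'b" where
  "to_shift x F a = Fmor F a (dsum x a) (into_sum x a)"

definition kappa :: "nat monoid \<Rightarrow> 'b sfun \<Rightarrow> nat monoid \<Rightarrow> 'b set" where
  "kappa x F a = kernel (Fob F a) (Fob (shift x F) a) (to_shift x F a)"

definition delta :: "nat monoid \<Rightarrow> 'b sfun \<Rightarrow> 'b sfun" where
  "delta x F = Fquot (shift x F) (\<lambda>a. to_shift x F a ` carrier (Fob F a))"

definition stably_null :: "'b sfun \<Rightarrow> bool" where
  "stably_null F \<longleftrightarrow>
     (\<forall>a\<in>Ob Sab. generate (Fob F a) (\<Union>x\<in>Ob Sab. kappa x F a) = carrier (Fob F a))"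

text \<open>The quotient category St has the same objects as the functor category, and its set of morphisms
  from \<open>F\<close> to \<open>G\<close> is the colimit of \<open>Hom(A, G/B)\<close> over the subfunctors \<open>A\<close> of \<open>F\<close> and \<open>B\<close> of \<open>G\<close>
  such that \<open>F/A\<close> and \<open>B\<close> are stably null.\<close>

definition St_pre_hom :: "'b sfun \<Rightarrow> 'b sfun \<Rightarrow>
    ((nat monoid \<Rightarrow> 'b set) \<times> (nat monoid \<Rightarrow> 'b set) \<times> (nat monoid \<Rightarrow> 'b \<Rightarrow> 'b)) set" where
  "St_pre_hom F G =
     {(A, B, \<phi>). subfunctor Sab F A \<and> stably_null (Fquot F A) \<and>
                 subfunctor Sab G B \<and> stably_null (Fsub G B) \<and>
                 nat_trans Sab (Fsub F A) (Fquot G B) \<phi>}"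

definition St_rel :: "'b sfun \<Rightarrow> 'b sfun \<Rightarrow>
    (((nat monoid \<Rightarrow> 'b set) \<times> (nat monoid \<Rightarrow> 'b set) \<times> (nat monoid \<Rightarrow> 'b \<Rightarrow> 'b)) \<times>
     ((nat monoid \<Rightarrow> 'b set) \<times> (nat monoid \<Rightarrow> 'b set) \<times> (nat monoid \<Rightarrow> 'b \<Rightarrow> 'b))) set" where
  "St_rel F G =
     {((A, B, \<phi>), (A', B', \<phi>')).
        (A, B, \<phi>) \<in> St_pre_hom F G \<and> (A', B', \<phi>') \<in> St_pre_hom F G \<and>
        (\<exists>A'' B''.
           subfunctor Sab F A'' \<and> stably_null (Fquot F A'') \<and>
           subfunctor Sab G B'' \<and> stably_null (Fsub G B'') \<and>
           (\<forall>a\<in>Ob Sab. A'' a \<subseteq> A a \<inter> A' a \<and> B a \<union> B' a \<subseteq> B'' a \<and>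
              (\<forall>t\<in>A'' a. rep_of (Fob G a) (B'' a) (\<phi> a t) = rep_of (Fob G a) (B'' a) (\<phi>' a t))))}"

definition St_hom :: "'b sfun \<Rightarrow> 'b sfun \<Rightarrow>
    ((nat monoid \<Rightarrow> 'b set) \<times> (nat monoid \<Rightarrow> 'b set) \<times> (nat monoid \<Rightarrow> 'b \<Rightarrow> 'b)) set set" where
  "St_hom F G = St_pre_hom F G // St_rel F G"

text \<open>A zero object is one that is both initial and terminal.\<close>

definition St_zero :: "'b sfun \<Rightarrow> bool" where
  "St_zero F \<longleftrightarrow>
     (\<forall>G :: 'b sfun. ab_functor Sab G \<longrightarrow>
        (\<exists>!h. h \<in> St_hom F G) \<and> (\<exists>!h. h \<in> St_hom G F))"

text \<open>\<open>Pol d F\<close>: the image of \<open>F\<close> in St lies in the subcategory of index \<open>d\<close>. The endofunctor of St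
  induced by \<open>\<delta>\<^sub>x\<close> acts on objects as \<open>\<delta>\<^sub>x\<close> does on functors.\<close>

function Pol :: "int \<Rightarrow> 'b sfun \<Rightarrow> bool" where
  "Pol d F \<longleftrightarrow> (if d < 0 then St_zero F else (\<forall>x\<in>Ob Sab. Pol (d - 1) (delta x F)))"
  by pat_completeness auto
termination by (relation "measure (\<lambda>(d, F). nat (d + 1))") auto

declare Pol.simps [simp del]

definition weakly_polynomial :: "'b sfun \<Rightarrow> bool" where
  "weakly_polynomial F \<longleftrightarrow> (\<exists>d. Pol d F)"

text \<open>Meaningful for weakly polynomial functors only. Since all negative indices give the zero
  subcategory, index \<open>-1\<close> stands for \<open>-\<infinity>\<close>.\<close>

definition weak_degree :: "'b sfun \<Rightarrow> ereal" where
  "weak_degree F =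
     (if Pol (-1) F then -\<infinity> else ereal (real (LEAST d :: nat. Pol (int d) F)))"


section \<open>Free groups and the category of their free-factor inclusions\<close>

definition word_val :: "('a, 'r) monoid_scheme \<Rightarrow> ('a \<times> bool) list \<Rightarrow> 'a" where
  "word_val G ws = foldr (\<lambda>(b, e) t. (if e then b else inv\<^bsub>G\<^esub> b) \<otimes>\<^bsub>G\<^esub> t) ws \<one>\<^bsub>G\<^esub>"

definition free_basis :: "('a, 'r) monoid_scheme \<Rightarrow> 'a set \<Rightarrow> bool" where
  "free_basis G B \<longleftrightarrow>
     B \<subseteq> carrier G \<and> generate G B = carrier G \<and>
     (\<forall>ws. ws \<noteq> [] \<and> fst ` set ws \<subseteq> B \<and>
           successively (\<lambda>(b, e) (c, e'). \<not> (b = c \<and> e \<noteq> e')) ws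
           \<longrightarrow> word_val G ws \<noteq> \<one>\<^bsub>G\<^esub>)"

definition free_group_fin_rank :: "('a, 'r) monoid_scheme \<Rightarrow> bool" where
  "free_group_fin_rank G \<longleftrightarrow> group G \<and> (\<exists>B. finite B \<and> free_basis G B)"

text \<open>\<open>H\<close> is the internal free product \<open>K * L\<close>: \<open>K\<close> and \<open>L\<close> generate \<open>H\<close>, and no nonempty alternating
  product of nontrivial elements of \<open>K\<close> and \<open>L\<close> is trivial. As alternation is expressed by membership,
  an element \<open>w \<noteq> 1\<close> of \<open>K \<inter> L\<close> is ruled out by the word \<open>w w\<inverse>\<close>.\<close>

definition internal_free_product :: "('a, 'r) monoid_scheme \<Rightarrow> 'a set \<Rightarrow> 'a set \<Rightarrow> bool" where
  "internal_free_product H K L \<longleftrightarrow>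
     subgroup K H \<and> subgroup L H \<and> generate H (K \<union> L) = carrier H \<and>
     (\<forall>ws. ws \<noteq> [] \<and> set ws \<subseteq> (K \<union> L) - {\<one>\<^bsub>H\<^esub>} \<and>
           successively (\<lambda>s t. s \<in> K \<and> t \<in> L \<or> s \<in> L \<and> t \<in> K) ws
           \<longrightarrow> foldr (\<lambda>s t. s \<otimes>\<^bsub>H\<^esub> t) ws \<one>\<^bsub>H\<^esub> \<noteq> \<one>\<^bsub>H\<^esub>)"

text \<open>Again every free group of finite rank is isomorphic to one carried by a set of natural numbers.\<close>

type_synonym free_mor = "(nat \<Rightarrow> nat) \<times> nat set"

definition Gcat :: "(nat monoid, free_mor) cat" where
  "Gcat = \<lparr>Ob = {G. free_group_fin_rank G},
           Hom = (\<lambda>G H. {(u, K). u \<in> ext_hom G H \<and> inj_on u (carrier G) \<and>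
                                  internal_free_product H K (u ` carrier G)}),
           Idm = (\<lambda>G. (\<lambda>g\<in>carrier G. g, {\<one>\<^bsub>G\<^esub>})),
           Comp = (\<lambda>G H M (v, L) (u, K).
                     (compose (carrier G) v u, generate M (L \<union> v ` K)))\<rparr>"

definition ab_ob :: "nat monoid \<Rightarrow> nat monoid" where
  "ab_ob G = quot G (derived G (carrier G))"

definition ab_proj :: "nat monoid \<Rightarrow> nat \<Rightarrow> nat" where
  "ab_proj G = rep_of G (derived G (carrier G))"

definition ab_mor :: "nat monoid \<Rightarrow> nat monoid \<Rightarrow> free_mor \<Rightarrow> split_mor" where
  "ab_mor G H = (\<lambda>(u, K).
     (THE r. r \<in> ext_hom (ab_ob H) (ab_ob G) \<and>
             (\<forall>k\<in>K. r (ab_proj H k) = \<one>\<^bsub>ab_ob G\<^esub>) \<and>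
             (\<forall>g\<in>carrier G. r (ab_proj H (u g)) = ab_proj G g),
      \<lambda>t\<in>carrier (ab_ob G). ab_proj H (u t)))"

definition along_ab :: "'b sfun \<Rightarrow> (nat monoid, free_mor, 'b) gfun" where
  "along_ab F = \<lparr>Fob = (\<lambda>G. Fob F (ab_ob G)),
                 Fmor = (\<lambda>G H f. Fmor F (ab_ob G) (ab_ob H) (ab_mor G H f))\<rparr>"


section \<open>The Johnson--Andreadakis filtration\<close>

text \<open>The lower central series is indexed from 1; the value at 0 is a dummy.\<close>

fun lower_central :: "('a, 'r) monoid_scheme \<Rightarrow> nat \<Rightarrow> 'a set" where
  "lower_central G 0 = carrier G"
| "lower_central G (Suc 0) = carrier G"
| "lower_central G (Suc (Suc n)) =
     generate G (\<Union>x\<in>lower_central G (Suc n). \<Union>y\<in>carrier G.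
                   {x \<otimes>\<^bsub>G\<^esub> y \<otimes>\<^bsub>G\<^esub> inv\<^bsub>G\<^esub> x \<otimes>\<^bsub>G\<^esub> inv\<^bsub>G\<^esub> y})"

definition Aut_functor :: "(nat monoid, free_mor, nat \<Rightarrow> nat) gfun" where
  "Aut_functor =
     \<lparr>Fob = AutoGroup,
      Fmor = (\<lambda>G H (u, K) \<phi>. THE \<psi>. \<psi> \<in> auto H \<and> (\<forall>k\<in>K. \<psi> k = k) \<and>
                                     (\<forall>g\<in>carrier G. \<psi> (u g) = u (\<phi> g)))\<rparr>"

definition JA :: "nat \<Rightarrow> nat monoid \<Rightarrow> (nat \<Rightarrow> nat) set" where
  "JA n G =
     (let Q = G Mod lower_central G (n + 1)
      in kernel (AutoGroup G) (AutoGroup Q) (\<lambda>\<phi>. \<lambda>C\<in>carrier Q. \<phi> ` C))"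

definition JA_quotient :: "nat \<Rightarrow> (nat monoid, free_mor, nat \<Rightarrow> nat) gfun" where
  "JA_quotient n = Fquot (Fsub Aut_functor (JA n)) (JA (n + 1))"

end

(*
  For free groups with abelianisation V, the Johnson homomorphism embeds A_n/A_{n+1} into the functor
  Hom(V, L_{n+1}(V)), where L_{n+1} = gamma_{n+1}/gamma_{n+2}; its coordinates in a basis are natural
  for the morphisms of S(ab) that map a basis injectively into a basis and kill the rest, and only
  such morphisms are needed.

  Upper bound: given n + 3 summands x_i, map x_0 + ... + x_{n+2} + a to itself plus a disjoint copy
  by moving any set of summands into the copy. An elementary tensor in Hom(V, L_{n+1}(V)) involves at
  most n + 2 basis elements, hence misses a summand, so the alternating sum over all sets of moved
  summands vanishes on Hom(V, L_{n+1}(V)) and on its subfunctor. All terms but the one moving nothing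
  vanish in the (n+3)-fold difference, so every element of the latter is killed by stabilisation.

  Lower bound: the automorphism e_0 -> [e_1, ..., e_{n+1}] e_0 lies in A_n. The coefficient of
  e_0^* tensor e_1 ... e_{n+1} in its Johnson image is 1. Read off from a representation of the free
  group by unitriangular matrices, it is not changed by stabilisation, and it vanishes on everything
  that comes from a sum omitting one of the n + 2 summands spanned by the e_i.
*)
theory Submission
  imports Defs
begin

section \<open>Homomorphisms and quotients\<close>

text \<open>The functor on \<open>Sab\<close> is given only up to a natural isomorphism over the
  category of free groups, so its effect on a morphism has to be read off from a lift to free
  groups. Injections of bases have evident lifts, and a group with basis B is identified with the
  abelianisation of the free group on the set B. Neither Hom(V, L_{n+1}(V)) nor the free Lie ring is
  constructed: an element becomes a family, indexed by a basis, of classes in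
  gamma_{n+1}/gamma_{n+2}, and left-normed commutators, which generate this quotient, serve as
  elementary tensors. The bound n + 2 counts one basis element for the dual factor and n + 1 letters
  of the commutator. Vanishing in the quotient category is turned into an elementwise condition by
  comparing the identity with zero: each element must be sent to 1 by some morphism. Iterated
  cokernels are handled through the canonical surjection from F(x_1 + ... + x_k + a): it sends to 1
  whatever comes from a sum omitting some x_i, and a homomorphism that vanishes on all of this
  vanishes on its kernel.\<close>

lemma hom_eq_on_generate:
  assumes "group G" "group H" "f \<in> hom G H" "g \<in> hom G H"
    and B: "B \<subseteq> carrier G" and eq: "\<And>b. b \<in> B \<Longrightarrow> f b = g b" and x: "x \<in> generate G B"
  shows "f x = g x"
proof -
  interpret f: group_hom G H f using assms by (simp add: group_hom_def group_hom_axioms_def)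
  interpret g: group_hom G H g using assms by (simp add: group_hom_def group_hom_axioms_def)
  have mem: "y \<in> carrier G" if "y \<in> generate G B" for y
    using that B f.G.generate_in_carrier by blast
  show ?thesis
    using x
  proof induct
    case one
    show ?case by simp
  next
    case (incl h)
    then show ?case using eq by simp
  next
    case (inv h)
    then show ?case using eq B by (simp add: subset_iff)
  next
    case (eng h1 h2)
    then show ?case by (simp add: mem)
  qed
qed

lemma ext_homD:
  "f \<in> ext_hom A B \<Longrightarrow> f \<in> hom A B"
  "f \<in> ext_hom A B \<Longrightarrow> f \<in> extensional (carrier A)"
  "f \<in> ext_hom A B \<Longrightarrow> x \<in> carrier A \<Longrightarrow> f x \<in> carrier B"
  by (auto simp: ext_hom_def hom_def)

lemma ext_homI:
  assumes "group A" "f \<in> hom A B"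
  shows "restrict f (carrier A) \<in> ext_hom A B"
proof -
  interpret group A by fact
  show ?thesis using assms(2) by (auto simp: ext_hom_def hom_def)
qed

lemma ext_hom_eqI:
  assumes "f \<in> ext_hom A B" "g \<in> ext_hom A B" "\<And>x. x \<in> carrier A \<Longrightarrow> f x = g x"
  shows "f = g"
  using assms by (auto simp: ext_hom_def intro: extensionalityI)

lemma ext_hom_eq_on_generators:
  assumes "group A" "group B" "f \<in> ext_hom A B" "g \<in> ext_hom A B" "Y \<subseteq> carrier A"
    "generate A Y = carrier A" "\<And>x. x \<in> Y \<Longrightarrow> f x = g x"
  shows "f = g"
proof (rule ext_hom_eqI[OF assms(3,4)])
  fix x assume "x \<in> carrier A"
  then show "f x = g x"
    using hom_eq_on_generate[of A B f g Y x] assms ext_homD(1) by metis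
qed

lemma ext_hom_compose:
  assumes "group A" "f \<in> ext_hom A B" "g \<in> ext_hom B C"
  shows "compose (carrier A) g f \<in> ext_hom A C"
proof -
  interpret group A by fact
  show ?thesis
    using assms(2,3) by (auto simp: ext_hom_def hom_def compose_def Pi_iff)
qed

lemma comm_group_subgroup:
  assumes "comm_group G" "subgroup H G"
  shows "comm_group (G\<lparr>carrier := H\<rparr>)"
proof -
  interpret comm_group G by fact
  interpret H: subgroup H G by fact
  show ?thesis
    by (rule group.group_comm_groupI[OF H.subgroup_is_group[OF is_group]]) (simp add: m_comm)
qed

section \<open>Calculus with chosen coset representatives\<close>

context normal
begin

text \<open>The representative depends only on the coset, and the coset is recovered from its
  representative.\<close>

lemma rep_of_eq_iff:
  assumes "x \<in> carrier G" "y \<in> carrier G"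
  shows "rep_of G H x = rep_of G H y \<longleftrightarrow> x \<otimes> inv y \<in> H"
proof -
  have "rep_of G H x = rep_of G H y \<longleftrightarrow> H #> x = H #> y"
    using rep_of_in(3)[OF assms(1)] rep_of_in(3)[OF assms(2)] by (metis rep_of_def)
  also have "\<dots> \<longleftrightarrow> x \<otimes> inv y \<in> H"
    using rcos_module[OF is_group assms(2,1)] rcos_self[OF assms(1) subgroup_axioms]
      repr_independence[OF _ assms(2) subgroup_axioms, of x] by auto
  finally show ?thesis .
qed

lemma rep_of_rep_of: "x \<in> carrier G \<Longrightarrow> rep_of G H (rep_of G H x) = rep_of G H x"
  using rep_of_in(3)[of x] by (simp add: rep_of_def)

lemma rep_of_mult:
  assumes "x \<in> carrier G" "y \<in> carrier G"
  shows "rep_of G H (rep_of G H x \<otimes> rep_of G H y) = rep_of G H (x \<otimes> y)"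
proof -
  have "H #> (rep_of G H x \<otimes> rep_of G H y) = H #> (x \<otimes> y)"
    using assms rcos_sum[OF rep_of_in(2,2), of x y] rcos_sum[of x y] by (simp add: rep_of_in del: rcos_sum)
  then show ?thesis by (simp add: rep_of_def)
qed

lemma rep_of_hom: "rep_of G H \<in> hom G (quot G H)"
  by (auto simp: hom_def quot_def rep_of_mult)

lemma group_quot: "group (quot G H)"
proof -
  have "group ((quot G H) \<lparr>carrier := rep_of G H ` carrier G, one := rep_of G H \<one>\<rparr>)"
    using hom_imp_img_group[OF rep_of_hom] .
  then show ?thesis by (simp add: quot_def)
qed

lemma quot_surj: "t \<in> carrier (quot G H) \<Longrightarrow> \<exists>x\<in>carrier G. t = rep_of G H x"
  by (auto simp: quot_def)

lemma quot_carrierD: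
  assumes "t \<in> carrier (quot G H)"
  shows "t \<in> carrier G" "rep_of G H t = t"
  using quot_surj[OF assms] by (auto simp: rep_of_in rep_of_rep_of)

lemma rep_of_one_iff:
  assumes "x \<in> carrier G"
  shows "rep_of G H x = \<one>\<^bsub>quot G H\<^esub> \<longleftrightarrow> x \<in> H"
  using rep_of_eq_iff[OF assms one_closed] assms by (simp add: quot_def)

lemma mult_mem_iff:
  assumes "h \<in> H" "y \<in> carrier G"
  shows "h \<otimes> y \<in> H \<longleftrightarrow> y \<in> H"
proof
  assume "h \<otimes> y \<in> H"
  then have "inv h \<otimes> (h \<otimes> y) \<in> H" using assms by simp
  then show "y \<in> H" using assms by (simp flip: m_assoc)
qed (use assms in simp)

text \<open>Main handle on \<open>quot\<close>: passing to the representative multiplies by an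
  element of \<open>H\<close>, which is invisible to every homomorphism that is trivial on
  \<open>H\<close>.\<close>

lemma rep_of_obtain:
  assumes "x \<in> carrier G"
  obtains h where "h \<in> H" "rep_of G H x = h \<otimes> x"
  using rep_of_in(1)[OF assms] by (auto simp: r_coset_def)

end

lemma comm_group_quot:
  assumes "comm_group G" "subgroup H G"
  shows "comm_group (quot G H)"
proof -
  interpret comm_group G by fact
  interpret normal H G by (rule subgroup_imp_normal) fact
  show ?thesis
  proof (rule group.group_comm_groupI[OF group_quot])
    fix x y assume "x \<in> carrier (quot G H)" "y \<in> carrier (quot G H)"
    then show "x \<otimes>\<^bsub>quot G H\<^esub> y = y \<otimes>\<^bsub>quot G H\<^esub> x"
      by (auto simp: quot_def rep_of_in m_comm)
  qed
qed

section \<open>Bases of free abelian groups\<close>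

text \<open>The homomorphism to the free abelian group on \<open>B\<close> expresses the linear independence of \<open>B\<close>.\<close>

definition ab_basis :: "'a monoid \<Rightarrow> 'a set \<Rightarrow> bool" where
  "ab_basis V B \<longleftrightarrow> finite B \<and> B \<subseteq> carrier V \<and> generate V B = carrier V \<and>
     (\<exists>k\<in>hom V (free_Abelian_group B). \<forall>b\<in>B. k b = frag_of b)"

lemma ab_basisD:
  assumes "ab_basis V B"
  shows "finite B" "B \<subseteq> carrier V" "generate V B = carrier V"
  using assms by (auto simp: ab_basis_def)

lemma ab_basis_universal:
  assumes "ab_basis V B" "comm_group H" "f \<in> B \<rightarrow> carrier H"
  obtains h where "h \<in> hom V H" "\<And>b. b \<in> B \<Longrightarrow> h b = f b"
proof -
  interpret H: comm_group H by fact
  obtain k where k: "k \<in> hom V (free_Abelian_group B)" "\<forall>b\<in>B. k b = frag_of b"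
    using assms(1) by (auto simp: ab_basis_def)
  obtain g where g: "g \<in> hom (free_Abelian_group B) H" "\<And>b. b \<in> B \<Longrightarrow> g (frag_of b) = f b"
    using H.free_Abelian_group_universal[of f B] assms(3) by (auto simp: image_subset_iff_funcset)
  show thesis
  proof
    show "g \<circ> k \<in> hom V H" using k g by (simp add: hom_compose)
    show "(g \<circ> k) b = f b" if "b \<in> B" for b using k g that by simp
  qed
qed

text \<open>Coordinates send a basis element to a generator, which is nonzero. This keeps the
  elements (s, 1) and (1, t) of the basis of a direct sum apart, and so allows a summand to be
  recognised from the components.\<close>

lemma ab_basis_one_notin:
  assumes "group V" "ab_basis V B"
  shows "\<one>\<^bsub>V\<^esub> \<notin> B"
proof
  assume "\<one>\<^bsub>V\<^esub> \<in> B"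
  obtain k where k: "k \<in> hom V (free_Abelian_group B)" "\<forall>b\<in>B. k b = frag_of b"
    using assms(2) by (auto simp: ab_basis_def)
  then have "k \<one>\<^bsub>V\<^esub> = 0"
    using hom_one[OF k(1) assms(1)] by simp
  with k \<open>\<one>\<^bsub>V\<^esub> \<in> B\<close> show False by simp
qed

lemma free_Abelian_group_generate: "generate (free_Abelian_group S) (frag_of ` S) = carrier (free_Abelian_group S)"
proof
  interpret group "free_Abelian_group S" by simp
  have sub: "frag_of ` S \<subseteq> carrier (free_Abelian_group S)" by auto
  show "generate (free_Abelian_group S) (frag_of ` S) \<subseteq> carrier (free_Abelian_group S)"
    by (rule generate_incl[OF sub])
  show "carrier (free_Abelian_group S) \<subseteq> generate (free_Abelian_group S) (frag_of ` S)"
  proof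
    fix x assume "x \<in> carrier (free_Abelian_group S)"
    then have "Poly_Mapping.keys x \<subseteq> S" by simp
    then show "x \<in> generate (free_Abelian_group S) (frag_of ` S)"
    proof (rule free_Abelian_group_induct)
      show "0 \<in> generate (free_Abelian_group S) (frag_of ` S)"
        using generate.one[of "free_Abelian_group S"] by simp
    next
      fix x y
      assume xy: "Poly_Mapping.keys x \<subseteq> S" "Poly_Mapping.keys y \<subseteq> S"
        "x \<in> generate (free_Abelian_group S) (frag_of ` S)"
        "y \<in> generate (free_Abelian_group S) (frag_of ` S)"
      then have "x \<otimes>\<^bsub>free_Abelian_group S\<^esub> inv\<^bsub>free_Abelian_group S\<^esub> y \<in> generate (free_Abelian_group S) (frag_of ` S)"
        using generate_m_inv_closed[OF sub] by (meson generate.eng)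
      with xy show "x - y \<in> generate (free_Abelian_group S) (frag_of ` S)" by simp
    next
      fix a assume "a \<in> S"
      then show "frag_of a \<in> generate (free_Abelian_group S) (frag_of ` S)" by (auto intro: generate.incl)
    qed
  qed
qed

lemma ab_basis_iso:
  assumes "comm_group V" "ab_basis V B"
  shows "V \<cong> free_Abelian_group B"
proof -
  interpret V: comm_group V by fact
  obtain k where k: "k \<in> hom V (free_Abelian_group B)" "\<forall>b\<in>B. k b = frag_of b"
    using assms(2) by (auto simp: ab_basis_def)
  obtain g where g: "g \<in> hom (free_Abelian_group B) V" "\<And>b. b \<in> B \<Longrightarrow> g (frag_of b) = b"
    using V.free_Abelian_group_universal[of id B] ab_basisD[OF assms(2)] by auto
  have gk: "(g \<circ> k) x = id x" if "x \<in> carrier V" for x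
  proof (rule hom_eq_on_generate[of V V "g \<circ> k" id B])
    show "g \<circ> k \<in> hom V V" using k g by (simp add: hom_compose)
    show "id \<in> hom V V" by (simp add: hom_def)
  qed (use k g that ab_basisD[OF assms(2)] in auto)
  have kg: "(k \<circ> g) x = id x" if "x \<in> carrier (free_Abelian_group B)" for x
  proof (rule hom_eq_on_generate[of "free_Abelian_group B" "free_Abelian_group B" "k \<circ> g" id "frag_of ` B"])
    show "k \<circ> g \<in> hom (free_Abelian_group B) (free_Abelian_group B)" using k g by (simp add: hom_compose)
    show "id \<in> hom (free_Abelian_group B) (free_Abelian_group B)"
      by (simp add: group_hom_free_Abelian_groups_id)
    show "x \<in> generate (free_Abelian_group B) (frag_of ` B)"
      using that by (simp add: free_Abelian_group_generate)
  qed (use k g in auto)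
  have "bij_betw k (carrier V) (carrier (free_Abelian_group B))"
    using gk kg k(1) g(1) by (intro bij_betwI[of _ _ _ g]) (auto simp: hom_def)
  then show ?thesis using k(1) by (auto simp: is_iso_def iso_def)
qed

text \<open>The index set in the definition consists of natural numbers, so \<open>B\<close> is
  replaced by an equinumerous set of naturals.\<close>

lemma free_abelian_fin_rankI:
  assumes "comm_group V" "ab_basis V B"
  shows "free_abelian_fin_rank V"
proof -
  obtain S :: "nat set" where S: "finite S" "S \<approx> B"
    using ab_basisD(1)[OF assms(2)]
    using eqpoll_iff_card[of "{..<card B}" B] by (metis finite_lessThan card_lessThan)
  have "free_Abelian_group B \<cong> free_Abelian_group S"
    using S(2) by (simp add: isomorphic_free_Abelian_groups eqpoll_sym)
  with ab_basis_iso[OF assms] have "V \<cong> free_Abelian_group S"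
    by (rule iso_trans)
  with S assms(1) show ?thesis by (auto simp: free_abelian_fin_rank_def)
qed

text \<open>The standard generators are transported along an inverse isomorphism; the coordinate map
  relabels each generator by its image in \<open>V\<close>.\<close>

lemma ab_basis_exists:
  assumes "comm_group V" "V \<cong> free_Abelian_group S" "finite S"
  obtains B where "ab_basis V B" "card B = card S"
proof -
  interpret V: comm_group V by fact
  obtain h where h: "h \<in> iso V (free_Abelian_group S)" using assms(2) by (auto simp: is_iso_def)
  then have hh: "h \<in> hom V (free_Abelian_group S)" and hb: "bij_betw h (carrier V) (carrier (free_Abelian_group S))"
    by (auto simp: iso_def)
  define g where "g = inv_into (carrier V) h"
  have gi: "g \<in> iso (free_Abelian_group S) V"
    unfolding g_def using h V.iso_set_sym by blast
  then have gh: "g \<in> hom (free_Abelian_group S) V" by (simp add: iso_def)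
  define B where "B = g ` frag_of ` S"
  have inj: "inj_on (g \<circ> frag_of) S"
  proof (rule comp_inj_on)
    show "inj_on frag_of S" by (simp add: inj_on_def frag_of_eq)
    show "inj_on g (frag_of ` S)"
      by (rule inj_on_subset[of g "carrier (free_Abelian_group S)"]) (use gi in \<open>auto simp: iso_def bij_betw_def\<close>)
  qed
  have hg: "h (g x) = x" if "x \<in> carrier (free_Abelian_group S)" for x
    using hb that unfolding g_def by (simp add: bij_betw_def f_inv_into_f)
  interpret g: group_hom "free_Abelian_group S" V g
    using gh by (simp add: group_hom_def group_hom_axioms_def)
  have gen: "generate V B = carrier V"
  proof -
    have "generate V B = g ` generate (free_Abelian_group S) (frag_of ` S)"
      unfolding B_def by (rule g.generate_img) auto
    then show ?thesis using gi by (auto simp: free_Abelian_group_generate iso_def bij_betw_def)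
  qed
  interpret FB: comm_group "free_Abelian_group B" by (rule abelian_free_Abelian_group)
  obtain r where r: "r \<in> hom (free_Abelian_group S) (free_Abelian_group B)"
    "\<And>s. s \<in> S \<Longrightarrow> r (frag_of s) = frag_of (g (frag_of s))"
  proof (rule FB.free_Abelian_group_universal)
    show "(\<lambda>s. frag_of (g (frag_of s))) ` S \<subseteq> carrier (free_Abelian_group B)"
      by (auto simp: B_def)
  qed blast
  have "r \<circ> h \<in> hom V (free_Abelian_group B)" using r hh by (simp add: hom_compose)
  moreover have "(r \<circ> h) b = frag_of b" if "b \<in> B" for b
    using that r(2) hg by (auto simp: B_def)
  ultimately have "ab_basis V B"
    unfolding ab_basis_def using gen assms(3) gh by (auto simp: B_def hom_def)
  moreover have "card B = card S"
    using card_image[OF inj] by (simp add: B_def image_comp)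
  ultimately show thesis using that by blast
qed

section \<open>The category of free abelian groups with split injections\<close>

lemma Ob_Sab: "a \<in> Ob Sab \<longleftrightarrow> free_abelian_fin_rank a"
  by (simp add: Sab_def)

lemma Ob_Sab_comm_group: "a \<in> Ob Sab \<Longrightarrow> comm_group a"
  by (simp add: Sab_def free_abelian_fin_rank_def)

lemma Ob_Sab_group: "a \<in> Ob Sab \<Longrightarrow> group a"
  using Ob_Sab_comm_group comm_group.axioms(2) by blast

lemma Ob_Sab_basis:
  assumes "a \<in> Ob Sab"
  obtains B where "ab_basis a B"
proof -
  obtain S :: "nat set" where "comm_group a" "finite S" "a \<cong> free_Abelian_group S"
    using assms by (auto simp: Ob_Sab free_abelian_fin_rank_def)
  then show thesis using ab_basis_exists that by metis
qed

lemma Ob_SabI: "comm_group V \<Longrightarrow> ab_basis V B \<Longrightarrow> V \<in> Ob Sab"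
  by (simp add: Ob_Sab free_abelian_fin_rankI)

lemma Hom_Sab:
  "f \<in> Hom Sab a b \<longleftrightarrow>
     fst f \<in> ext_hom b a \<and> snd f \<in> ext_hom a b \<and> (\<forall>t\<in>carrier a. fst f (snd f t) = t)"
  by (cases f) (simp add: Sab_def)

lemma Comp_Sab:
  "Comp Sab a b c g f = (compose (carrier c) (fst f) (fst g), compose (carrier a) (snd g) (snd f))"
  by (cases f; cases g) (simp add: Sab_def)

lemma Idm_Sab: "Idm Sab a = (\<lambda>t\<in>carrier a. t, \<lambda>t\<in>carrier a. t)"
  by (simp add: Sab_def)

lemma Hom_SabD:
  assumes "f \<in> Hom Sab a b"
  shows "fst f \<in> hom b a" "snd f \<in> hom a b" "\<And>t. t \<in> carrier a \<Longrightarrow> fst f (snd f t) = t"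
    "\<And>t. t \<in> carrier a \<Longrightarrow> snd f t \<in> carrier b" "\<And>t. t \<in> carrier b \<Longrightarrow> fst f t \<in> carrier a"
  using assms by (auto simp: Hom_Sab ext_homD)

lemma Sab_mor_eqI:
  assumes "f \<in> Hom Sab a b" "g \<in> Hom Sab a b"
    "\<And>t. t \<in> carrier b \<Longrightarrow> fst f t = fst g t" "\<And>t. t \<in> carrier a \<Longrightarrow> snd f t = snd g t"
  shows "f = g"
  using assms ext_hom_eqI[of "fst f" b a "fst g"] ext_hom_eqI[of "snd f" a b "snd g"]
  by (simp add: Hom_Sab prod_eqI)

lemma Comp_Sab_in:
  assumes "f \<in> Hom Sab a b" "g \<in> Hom Sab b c" "group a" "group c"
  shows "Comp Sab a b c g f \<in> Hom Sab a c"
  using assms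
  by (auto simp: Hom_Sab Comp_Sab ext_hom_compose) (simp add: compose_def ext_homD)

lemma Comp_Sab_apply:
  "t \<in> carrier c \<Longrightarrow> fst (Comp Sab a b c g f) t = fst f (fst g t)"
  "t \<in> carrier a \<Longrightarrow> snd (Comp Sab a b c g f) t = snd g (snd f t)"
  by (simp_all add: Comp_Sab compose_def)

lemma Idm_Sab_apply:
  "t \<in> carrier a \<Longrightarrow> fst (Idm Sab a) t = t"
  "t \<in> carrier a \<Longrightarrow> snd (Idm Sab a) t = t"
  by (simp_all add: Idm_Sab)

lemma Idm_Sab_in: "group a \<Longrightarrow> Idm Sab a \<in> Hom Sab a a"
  by (auto simp: Hom_Sab Idm_Sab ext_hom_def hom_def group.is_monoid monoid.m_closed)

section \<open>Direct sums and their bases\<close>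

lemma dsum_carrier_iff [simp]:
  "prod_encode (s, t) \<in> carrier (dsum a b) \<longleftrightarrow> s \<in> carrier a \<and> t \<in> carrier b"
  by (auto simp: dsum_def)

lemma dsumE:
  assumes "z \<in> carrier (dsum a b)"
  obtains s t where "z = prod_encode (s, t)" "s \<in> carrier a" "t \<in> carrier b"
  using assms by (auto simp: dsum_def)

lemma dsum_mult [simp]:
  "prod_encode (s, t) \<otimes>\<^bsub>dsum a b\<^esub> prod_encode (s', t') = prod_encode (s \<otimes>\<^bsub>a\<^esub> s', t \<otimes>\<^bsub>b\<^esub> t')"
  by (simp add: dsum_def)

lemma dsum_one: "\<one>\<^bsub>dsum a b\<^esub> = prod_encode (\<one>\<^bsub>a\<^esub>, \<one>\<^bsub>b\<^esub>)"
  by (simp add: dsum_def)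

lemma comm_group_dsum:
  assumes "comm_group a" "comm_group b"
  shows "comm_group (dsum a b)"
proof -
  interpret a: comm_group a by fact
  interpret b: comm_group b by fact
  show ?thesis
  proof (rule comm_groupI)
    fix z assume "z \<in> carrier (dsum a b)"
    then obtain s t where z: "z = prod_encode (s, t)" "s \<in> carrier a" "t \<in> carrier b" by (rule dsumE)
    then have "prod_encode (inv\<^bsub>a\<^esub> s, inv\<^bsub>b\<^esub> t) \<in> carrier (dsum a b)"
      "prod_encode (inv\<^bsub>a\<^esub> s, inv\<^bsub>b\<^esub> t) \<otimes>\<^bsub>dsum a b\<^esub> z = \<one>\<^bsub>dsum a b\<^esub>"
      by (auto simp: dsum_one)
    then show "\<exists>y\<in>carrier (dsum a b). y \<otimes>\<^bsub>dsum a b\<^esub> z = \<one>\<^bsub>dsum a b\<^esub>" by blast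
  qed (auto elim!: dsumE simp: dsum_one a.m_ac b.m_ac)
qed

lemma dsum_fst_hom: "(\<lambda>z. fst (prod_decode z)) \<in> hom (dsum a b) a"
  by (auto simp: hom_def elim!: dsumE)

lemma dsum_snd_hom: "(\<lambda>z. snd (prod_decode z)) \<in> hom (dsum a b) b"
  by (auto simp: hom_def elim!: dsumE)

lemma dsum_inl_hom: "group b \<Longrightarrow> (\<lambda>s. prod_encode (s, \<one>\<^bsub>b\<^esub>)) \<in> hom a (dsum a b)"
  by (auto simp: hom_def group.is_monoid monoid.one_closed monoid.l_one)

lemma dsum_inr_hom: "group a \<Longrightarrow> (\<lambda>t. prod_encode (\<one>\<^bsub>a\<^esub>, t)) \<in> hom b (dsum a b)"
  by (auto simp: hom_def group.is_monoid monoid.one_closed monoid.l_one)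

definition dsum_basis :: "nat monoid \<Rightarrow> nat monoid \<Rightarrow> nat set \<Rightarrow> nat set \<Rightarrow> nat set" where
  "dsum_basis a b A B =
     (\<lambda>s. prod_encode (s, \<one>\<^bsub>b\<^esub>)) ` A \<union> (\<lambda>t. prod_encode (\<one>\<^bsub>a\<^esub>, t)) ` B"

text \<open>The coordinate map is the sum of the two given coordinate maps, each relabelled into the
  free abelian group on the joint basis.\<close>

lemma ab_basis_dsum:
  assumes ab: "comm_group a" "comm_group b" and A: "ab_basis a A" and B: "ab_basis b B"
  shows "ab_basis (dsum a b) (dsum_basis a b A B)"
proof -
  interpret a: comm_group a by fact
  interpret b: comm_group b by fact
  interpret ab: comm_group "dsum a b" by (rule comm_group_dsum[OF ab])
  let ?D = "dsum_basis a b A B"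
  let ?F = "free_Abelian_group ?D"
  interpret F: comm_group ?F by (rule abelian_free_Abelian_group)
  note A' = ab_basisD[OF A] and B' = ab_basisD[OF B]
  have sub: "?D \<subseteq> carrier (dsum a b)"
    using A'(2) B'(2) by (auto simp: dsum_basis_def)
  interpret l: group_hom a "dsum a b" "\<lambda>s. prod_encode (s, \<one>\<^bsub>b\<^esub>)"
    by unfold_locales (rule dsum_inl_hom[OF b.is_group])
  interpret r: group_hom b "dsum a b" "\<lambda>t. prod_encode (\<one>\<^bsub>a\<^esub>, t)"
    by unfold_locales (rule dsum_inr_hom[OF a.is_group])
  have gen: "generate (dsum a b) ?D = carrier (dsum a b)"
  proof
    show "generate (dsum a b) ?D \<subseteq> carrier (dsum a b)" by (rule ab.generate_incl[OF sub])
    show "carrier (dsum a b) \<subseteq> generate (dsum a b) ?D"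
    proof
      fix z assume "z \<in> carrier (dsum a b)"
      then obtain s t where z: "z = prod_encode (s, t)" "s \<in> carrier a" "t \<in> carrier b" by (rule dsumE)
      have "prod_encode (s, \<one>\<^bsub>b\<^esub>) \<in> generate (dsum a b) ?D"
        using l.generate_img[OF A'(2)] A'(3) z(2) ab.mono_generate[of "(\<lambda>s. prod_encode (s, \<one>\<^bsub>b\<^esub>)) ` A" ?D]
        by (auto simp: dsum_basis_def)
      moreover have "prod_encode (\<one>\<^bsub>a\<^esub>, t) \<in> generate (dsum a b) ?D"
        using r.generate_img[OF B'(2)] B'(3) z(3) ab.mono_generate[of "(\<lambda>t. prod_encode (\<one>\<^bsub>a\<^esub>, t)) ` B" ?D]
        by (auto simp: dsum_basis_def)
      ultimately have "prod_encode (s, \<one>\<^bsub>b\<^esub>) \<otimes>\<^bsub>dsum a b\<^esub> prod_encode (\<one>\<^bsub>a\<^esub>, t) \<in> generate (dsum a b) ?D"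
        by (rule generate.eng)
      then show "z \<in> generate (dsum a b) ?D" using z by simp
    qed
  qed
  obtain f where f: "f \<in> hom a ?F" "\<And>s. s \<in> A \<Longrightarrow> f s = frag_of (prod_encode (s, \<one>\<^bsub>b\<^esub>))"
    by (rule ab_basis_universal[OF A F.comm_group_axioms, of "\<lambda>s. frag_of (prod_encode (s, \<one>\<^bsub>b\<^esub>))"])
      (auto simp: dsum_basis_def)
  obtain g where g: "g \<in> hom b ?F" "\<And>t. t \<in> B \<Longrightarrow> g t = frag_of (prod_encode (\<one>\<^bsub>a\<^esub>, t))"
    by (rule ab_basis_universal[OF B F.comm_group_axioms, of "\<lambda>t. frag_of (prod_encode (\<one>\<^bsub>a\<^esub>, t))"])
      (auto simp: dsum_basis_def)
  define k where "k = (\<lambda>z. f (fst (prod_decode z)) \<otimes>\<^bsub>?F\<^esub> g (snd (prod_decode z)))"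
  have "k \<in> hom (dsum a b) ?F"
    using F.hom_group_mult[OF hom_compose[OF dsum_fst_hom f(1)] hom_compose[OF dsum_snd_hom g(1)]]
    by (simp add: k_def o_def)
  moreover have "k d = frag_of d" if "d \<in> ?D" for d
    using that f g hom_one[OF f(1)] hom_one[OF g(1)]
    by (auto simp: k_def dsum_basis_def)
  ultimately show ?thesis
    unfolding ab_basis_def using gen sub A'(1) B'(1) by (auto simp: dsum_basis_def)
qed

lemma dsum_in_Ob: "a \<in> Ob Sab \<Longrightarrow> b \<in> Ob Sab \<Longrightarrow> dsum a b \<in> Ob Sab"
  by (metis Ob_SabI Ob_Sab_basis Ob_Sab_comm_group ab_basis_dsum comm_group_dsum)

lemma comm_group_zero_ob: "comm_group zero_ob"
  by (rule comm_groupI) (auto simp: zero_ob_def)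

lemma ab_basis_zero_ob: "ab_basis zero_ob {}"
proof -
  interpret comm_group zero_ob by (rule comm_group_zero_ob)
  have "generate zero_ob {} = carrier zero_ob"
    by (simp add: generate_empty) (simp add: zero_ob_def)
  moreover have "(\<lambda>_. 0) \<in> hom zero_ob (free_Abelian_group {})"
    by (simp add: hom_def)
  ultimately show ?thesis by (auto simp: ab_basis_def)
qed

lemma zero_ob_in_Ob: "zero_ob \<in> Ob Sab"
  using Ob_SabI comm_group_zero_ob ab_basis_zero_ob by blast

section \<open>Adding a fixed summand, and the canonical morphisms into a sum\<close>

abbreviation plus_mor :: "nat monoid \<Rightarrow> nat monoid \<Rightarrow> nat monoid \<Rightarrow> split_mor \<Rightarrow> split_mor" where
  "plus_mor x a b f \<equiv> dsum_mor x x a b (Idm Sab x) f"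

lemma plus_mor_apply:
  "s \<in> carrier x \<Longrightarrow> t \<in> carrier b \<Longrightarrow> fst (plus_mor x a b f) (prod_encode (s, t)) = prod_encode (s, fst f t)"
  "s \<in> carrier x \<Longrightarrow> t \<in> carrier a \<Longrightarrow> snd (plus_mor x a b f) (prod_encode (s, t)) = prod_encode (s, snd f t)"
  by (auto simp: dsum_mor_def dsum_map_def Idm_Sab)

lemma plus_mor_in:
  assumes "x \<in> Ob Sab" "a \<in> Ob Sab" "b \<in> Ob Sab" "f \<in> Hom Sab a b"
  shows "plus_mor x a b f \<in> Hom Sab (dsum x a) (dsum x b)"
proof -
  interpret x: group x using Ob_Sab_group[OF assms(1)] .
  interpret a: group a using Ob_Sab_group[OF assms(2)] .
  interpret b: group b using Ob_Sab_group[OF assms(3)] .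
  note f = Hom_SabD[OF assms(4)]
  have "fst (plus_mor x a b f) \<in> ext_hom (dsum x b) (dsum x a)"
    using f hom_mult[OF f(1)]
    by (auto simp: ext_hom_def hom_def dsum_mor_def dsum_map_def Idm_Sab elim!: dsumE)
  moreover have "snd (plus_mor x a b f) \<in> ext_hom (dsum x a) (dsum x b)"
    using f hom_mult[OF f(2)]
    by (auto simp: ext_hom_def hom_def dsum_mor_def dsum_map_def Idm_Sab elim!: dsumE)
  moreover have "\<forall>t\<in>carrier (dsum x a). fst (plus_mor x a b f) (snd (plus_mor x a b f) t) = t"
    using f by (auto simp: plus_mor_apply elim!: dsumE)
  ultimately show ?thesis by (simp add: Hom_Sab)
qed

lemma plus_mor_Idm:
  assumes "x \<in> Ob Sab" "a \<in> Ob Sab"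
  shows "plus_mor x a a (Idm Sab a) = Idm Sab (dsum x a)"
  by (rule Sab_mor_eqI[of _ "dsum x a" "dsum x a"])
    (use assms in \<open>auto simp: plus_mor_in Idm_Sab_in Ob_Sab_group dsum_in_Ob plus_mor_apply Idm_Sab_apply elim!: dsumE\<close>)

lemma plus_mor_Comp:
  assumes "x \<in> Ob Sab" "a \<in> Ob Sab" "b \<in> Ob Sab" "c \<in> Ob Sab" "f \<in> Hom Sab a b" "g \<in> Hom Sab b c"
  shows "plus_mor x a c (Comp Sab a b c g f)
    = Comp Sab (dsum x a) (dsum x b) (dsum x c) (plus_mor x b c g) (plus_mor x a b f)"
  by (rule Sab_mor_eqI[of _ "dsum x a" "dsum x c"])
    (use assms Hom_SabD[OF assms(5)] Hom_SabD[OF assms(6)] in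
      \<open>auto simp: plus_mor_in Comp_Sab_in Ob_Sab_group dsum_in_Ob plus_mor_apply Comp_Sab_apply elim!: dsumE\<close>)

lemma into_sum_apply:
  "s \<in> carrier x \<Longrightarrow> t \<in> carrier a \<Longrightarrow> fst (into_sum x a) (prod_encode (s, t)) = t"
  "t \<in> carrier a \<Longrightarrow> snd (into_sum x a) t = prod_encode (\<one>\<^bsub>x\<^esub>, t)"
  by (auto simp: into_sum_eq)

lemma into_sum_in:
  assumes "x \<in> Ob Sab" "a \<in> Ob Sab"
  shows "into_sum x a \<in> Hom Sab a (dsum x a)"
proof -
  interpret x: group x using Ob_Sab_group[OF assms(1)] .
  interpret a: group a using Ob_Sab_group[OF assms(2)] .
  interpret xa: group "dsum x a" using Ob_Sab_group[OF dsum_in_Ob[OF assms]] .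
  have "fst (into_sum x a) \<in> ext_hom (dsum x a) a"
    using ext_homI[OF xa.is_group dsum_snd_hom] by (simp add: into_sum_eq)
  moreover have "snd (into_sum x a) \<in> ext_hom a (dsum x a)"
    using ext_homI[OF a.is_group dsum_inr_hom[OF x.is_group]] by (simp add: into_sum_eq)
  ultimately show ?thesis by (simp add: Hom_Sab into_sum_apply)
qed

text \<open>This is what makes the maps F(a) \<rightarrow> F(x + a) a natural
  transformation.\<close>

lemma into_sum_natural:
  assumes "x \<in> Ob Sab" "a \<in> Ob Sab" "b \<in> Ob Sab" "f \<in> Hom Sab a b"
  shows "Comp Sab a b (dsum x b) (into_sum x b) f
    = Comp Sab a (dsum x a) (dsum x b) (plus_mor x a b f) (into_sum x a)"
proof -
  interpret x: group x using Ob_Sab_group[OF assms(1)] .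
  show ?thesis
    by (rule Sab_mor_eqI[of _ a "dsum x b"])
      (use assms Hom_SabD[OF assms(4)] in
        \<open>auto simp: plus_mor_in into_sum_in Comp_Sab_in Ob_Sab_group dsum_in_Ob plus_mor_apply
          into_sum_apply Comp_Sab_apply elim!: dsumE\<close>)
qed

text \<open>Every morphism \<open>f : a \<rightarrow> b\<close> becomes a canonical one after composition with
  \<open>s \<mapsto> (s - v (u s), u s)\<close>, where \<open>f = (u, v)\<close>.\<close>

lemma into_sum_factors:
  assumes a: "a \<in> Ob Sab" and b: "b \<in> Ob Sab" and f: "f \<in> Hom Sab a b"
  obtains h where "h \<in> Hom Sab b (dsum b a)" "Comp Sab a b (dsum b a) h f = into_sum b a"
proof -
  interpret a: comm_group a using Ob_Sab_comm_group[OF a] .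
  interpret b: comm_group b using Ob_Sab_comm_group[OF b] .
  interpret ba: comm_group "dsum b a" using Ob_Sab_comm_group[OF dsum_in_Ob[OF b a]] .
  define u where "u = fst f"
  define v where "v = snd f"
  note f' = Hom_SabD[OF f, folded u_def v_def]
  interpret u: group_hom b a u by unfold_locales (rule f'(1))
  interpret v: group_hom a b v by unfold_locales (rule f'(2))
  \<comment> \<open>The projector of \<open>b\<close> onto the kernel of \<open>u\<close> along the
    image of \<open>v\<close>. It embeds \<open>b\<close> into \<open>b + a\<close> so that the
    summand \<open>v a\<close> lands in the second factor and the kernel of \<open>u\<close> in the
    first.\<close>
  define p where "p = (\<lambda>s. s \<otimes>\<^bsub>b\<^esub> inv\<^bsub>b\<^esub> v (u s))"
  have p: "p \<in> hom b b"
    by (auto simp: hom_def p_def b.inv_mult b.m_ac)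
  have up: "u (p s) = \<one>\<^bsub>a\<^esub>" if "s \<in> carrier b" for s
    using that f'(3) by (simp add: p_def)
  have pc: "p s \<in> carrier b" if "s \<in> carrier b" for s using p that by (auto simp: hom_def)
  have pv: "p (v t) = \<one>\<^bsub>b\<^esub>" if "t \<in> carrier a" for t
    using that f'(3) by (simp add: p_def)
  have pp: "p (p s) = p s" if "s \<in> carrier b" for s
  proof -
    have "p (p s) = p s \<otimes>\<^bsub>b\<^esub> inv\<^bsub>b\<^esub> v (u (p s))" by (simp add: p_def)
    then show ?thesis using up[OF that] pc[OF that] by simp
  qed
  have dec: "p s \<otimes>\<^bsub>b\<^esub> v (u s) = s" if "s \<in> carrier b" for s
    using that by (simp add: p_def b.m_assoc)
  define h where "h = (\<lambda>z\<in>carrier (dsum b a). p (fst (prod_decode z)) \<otimes>\<^bsub>b\<^esub> v (snd (prod_decode z)),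
                       \<lambda>s\<in>carrier b. prod_encode (p s, u s))"
  have h1: "fst h (prod_encode (s, t)) = p s \<otimes>\<^bsub>b\<^esub> v t" if "s \<in> carrier b" "t \<in> carrier a" for s t
    using that by (simp add: h_def)
  have h2: "snd h s = prod_encode (p s, u s)" if "s \<in> carrier b" for s
    using that by (simp add: h_def)
  have "fst h \<in> ext_hom (dsum b a) b"
    unfolding h_def fst_conv
    by (rule ext_homI[OF ba.is_group])
      (auto simp: hom_def pc hom_mult[OF p] b.m_ac elim!: dsumE)
  moreover have "snd h \<in> ext_hom b (dsum b a)"
    unfolding h_def snd_conv
    by (rule ext_homI[OF b.is_group]) (auto simp: hom_def pc hom_mult[OF p])
  moreover have "\<forall>s\<in>carrier b. fst h (snd h s) = s"
    by (simp add: h1 h2 pc pp dec)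
  ultimately have hin: "h \<in> Hom Sab b (dsum b a)" by (simp add: Hom_Sab)
  moreover have "Comp Sab a b (dsum b a) h f = into_sum b a"
  proof (rule Sab_mor_eqI[of _ a "dsum b a"])
    show "Comp Sab a b (dsum b a) h f \<in> Hom Sab a (dsum b a)"
      using Comp_Sab_in f hin by simp
    show "into_sum b a \<in> Hom Sab a (dsum b a)" using into_sum_in a b by simp
    fix z assume "z \<in> carrier (dsum b a)"
    then obtain s t where z: "z = prod_encode (s, t)" "s \<in> carrier b" "t \<in> carrier a" by (rule dsumE)
    then show "fst (Comp Sab a b (dsum b a) h f) z = fst (into_sum b a) z"
      using f'(3) by (simp add: Comp_Sab_apply into_sum_apply h1 pc up flip: u_def)
  next
    fix t assume "t \<in> carrier a"
    then show "snd (Comp Sab a b (dsum b a) h f) t = snd (into_sum b a) t"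
      using f'(3) by (simp add: Comp_Sab_apply into_sum_apply h2 pv flip: v_def)
  qed
  ultimately show thesis by (rule that)
qed

text \<open>Exchanging the summands x and y turns stabilisation by y of the object x + a into x +
  (stabilisation by y of a). It serves to show that differences of stably null functors are stably
  null.\<close>

lemma into_sum_swap:
  assumes "x \<in> Ob Sab" "y \<in> Ob Sab" "a \<in> Ob Sab"
  obtains p where "p \<in> Hom Sab (dsum y (dsum x a)) (dsum x (dsum y a))"
    "Comp Sab (dsum x a) (dsum y (dsum x a)) (dsum x (dsum y a)) p (into_sum y (dsum x a))
      = plus_mor x a (dsum y a) (into_sum y a)"
proof -
  interpret x: comm_group x using Ob_Sab_comm_group[OF assms(1)] .
  interpret y: comm_group y using Ob_Sab_comm_group[OF assms(2)] .
  interpret a: comm_group a using Ob_Sab_comm_group[OF assms(3)] .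
  define w where "w c d = (\<lambda>z\<in>carrier (dsum c (dsum d a)).
    prod_encode (fst (prod_decode (snd (prod_decode z))),
      prod_encode (fst (prod_decode z), snd (prod_decode (snd (prod_decode z))))))" for c d
  have w: "w c d (prod_encode (r, prod_encode (s, t))) = prod_encode (s, prod_encode (r, t))"
    if "r \<in> carrier c" "s \<in> carrier d" "t \<in> carrier a" for c d r s t
    using that by (simp add: w_def)
  have whom: "w c d \<in> ext_hom (dsum c (dsum d a)) (dsum d (dsum c a))"
    if "group c" "group d" for c d
  proof -
    interpret c: group c by fact
    interpret d: group d by fact
    have "w c d \<in> extensional (carrier (dsum c (dsum d a)))" by (simp add: w_def)
    then show ?thesis by (auto simp: ext_hom_def hom_def w elim!: dsumE)
  qed
  define p where "p = (w x y, w y x)"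
  have pin: "p \<in> Hom Sab (dsum y (dsum x a)) (dsum x (dsum y a))"
    by (auto simp: Hom_Sab p_def whom w elim!: dsumE)
  have "Comp Sab (dsum x a) (dsum y (dsum x a)) (dsum x (dsum y a)) p (into_sum y (dsum x a))
      = plus_mor x a (dsum y a) (into_sum y a)"
    by (rule Sab_mor_eqI[of _ "dsum x a" "dsum x (dsum y a)"])
      (use assms pin in \<open>auto simp: plus_mor_in into_sum_in Comp_Sab_in Ob_Sab_group dsum_in_Ob plus_mor_apply
          into_sum_apply Comp_Sab_apply p_def w elim!: dsumE\<close>)
  with pin show thesis by (rule that)
qed

subsection \<open>Morphisms compatible with bases\<close>

text \<open>On the image of \<open>B\<close> the retraction is already forced to invert
  \<open>snd f\<close>, so only the other elements of \<open>C\<close> need a condition. These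
  morphisms correspond to injections of \<open>B\<close> into \<open>C\<close>, by
  \<open>based_eqI\<close> and \<open>based_exists\<close>, and they lift to morphisms of free
  groups.\<close>

definition based :: "nat monoid \<Rightarrow> nat set \<Rightarrow> nat monoid \<Rightarrow> nat set \<Rightarrow> split_mor \<Rightarrow> bool" where
  "based V B W C f \<longleftrightarrow> f \<in> Hom Sab V W \<and> snd f ` B \<subseteq> C \<and> (\<forall>c\<in>C - snd f ` B. fst f c = \<one>\<^bsub>V\<^esub>)"

definition framed :: "nat monoid \<Rightarrow> nat set \<Rightarrow> bool" where
  "framed V B \<longleftrightarrow> V \<in> Ob Sab \<and> ab_basis V B"

lemma framedD:
  assumes "framed V B"
  shows "V \<in> Ob Sab" "ab_basis V B" "comm_group V" "group V" "finite B" "B \<subseteq> carrier V"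
    "generate V B = carrier V"
  using assms ab_basisD[of V B] Ob_Sab_comm_group[of V] Ob_Sab_group[of V] unfolding framed_def by auto

lemma basedD:
  assumes "based V B W C f"
  shows "f \<in> Hom Sab V W" "\<And>b. b \<in> B \<Longrightarrow> snd f b \<in> C" "\<And>c. c \<in> C \<Longrightarrow> c \<notin> snd f ` B \<Longrightarrow> fst f c = \<one>\<^bsub>V\<^esub>"
  using assms by (auto simp: based_def)

lemma based_inj:
  assumes "framed V B" "based V B W C f"
  shows "inj_on (snd f) B"
proof (rule inj_on_inverseI)
  fix b assume "b \<in> B"
  then show "fst f (snd f b) = b"
    using Hom_SabD(3)[OF basedD(1)[OF assms(2)]] framedD(6)[OF assms(1)] by blast
qed

text \<open>Both components are determined on the bases: the retraction inverts \<open>snd f\<close>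
  on the image of \<open>B\<close> and is trivial on the rest of \<open>C\<close>.\<close>

lemma based_eqI:
  assumes V: "framed V B" and W: "framed W C" and f: "based V B W C f" and g: "based V B W C g"
    and eq: "\<And>b. b \<in> B \<Longrightarrow> snd f b = snd g b"
  shows "f = g"
proof -
  note V' = framedD[OF V] and W' = framedD[OF W] and f' = basedD[OF f] and g' = basedD[OF g]
  have "snd f = snd g"
    by (rule ext_hom_eq_on_generators[of V W _ _ B]) (use V' W' f' g' eq in \<open>auto simp: Hom_Sab\<close>)
  moreover have "fst f = fst g"
  proof (rule ext_hom_eq_on_generators[of W V _ _ C])
    fix c assume c: "c \<in> C"
    show "fst f c = fst g c"
    proof (cases "c \<in> snd f ` B")
      case True
      then obtain b where b: "b \<in> B" "c = snd f b" by blast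
      then show ?thesis
        using eq[of b] Hom_SabD(3)[OF f'(1), of b] Hom_SabD(3)[OF g'(1), of b] V'(6) by auto
    next
      case False
      moreover from this have "c \<notin> snd g ` B" using eq by (metis image_cong)
      ultimately show ?thesis using f'(3)[OF c] g'(3)[OF c] by simp
    qed
  qed (use V' W' f' g' in \<open>auto simp: Hom_Sab\<close>)
  ultimately show ?thesis by (rule prod_eqI[rotated])
qed

lemma based_exists:
  assumes V: "framed V B" and W: "framed W C" and inj: "inj_on \<sigma> B" and im: "\<sigma> ` B \<subseteq> C"
  obtains f where "based V B W C f" "\<And>b. b \<in> B \<Longrightarrow> snd f b = \<sigma> b"
proof -
  note V' = framedD[OF V] and W' = framedD[OF W]
  interpret V: comm_group V by (rule V'(3))
  interpret W: comm_group W by (rule W'(3))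
  obtain v where v: "v \<in> hom V W" "\<And>b. b \<in> B \<Longrightarrow> v b = \<sigma> b"
    by (rule ab_basis_universal[OF V'(2) W'(3), of \<sigma>]) (use im W'(6) in auto)
  obtain u where u: "u \<in> hom W V" "\<And>c. c \<in> C \<Longrightarrow> u c = (if c \<in> \<sigma> ` B then inv_into B \<sigma> c else \<one>\<^bsub>V\<^esub>)"
    by (rule ab_basis_universal[OF W'(2) V'(3), of "\<lambda>c. if c \<in> \<sigma> ` B then inv_into B \<sigma> c else \<one>\<^bsub>V\<^esub>"])
      (use V'(6) in \<open>auto simp: inv_into_into subset_iff\<close>)
  have uv: "(u \<circ> v) t = id t" if "t \<in> carrier V" for t
  proof (rule hom_eq_on_generate[of V V "u \<circ> v" id B])
    show "u \<circ> v \<in> hom V V" using u v by (simp add: hom_compose)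
    show "id \<in> hom V V" by (simp add: hom_def)
    show "(u \<circ> v) b = id b" if "b \<in> B" for b
      using that u(2)[of "\<sigma> b"] v(2) im inj by auto
  qed (use that V' in auto)
  define f where "f = (restrict u (carrier W), restrict v (carrier V))"
  have vc: "v t \<in> carrier W" if "t \<in> carrier V" for t using that v(1) by (auto simp: hom_def)
  have fin: "f \<in> Hom Sab V W"
    using ext_homI[OF V'(4) v(1)] ext_homI[OF W'(4) u(1)] uv vc by (auto simp: Hom_Sab f_def)
  have fb: "snd f b = \<sigma> b" if "b \<in> B" for b using that v(2) V'(6) by (auto simp: f_def)
  then have "snd f ` B = \<sigma> ` B" by (simp cong: image_cong)
  then have "based V B W C f"
    using fin im u(2) W'(6) by (auto simp: based_def f_def subset_iff)
  with fb show thesis using that by blast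
qed

lemma based_Comp:
  assumes "framed V B" "framed W C" "framed Z D" "based V B W C f" "based W C Z D g"
  shows "based V B Z D (Comp Sab V W Z g f)"
proof -
  note V = framedD[OF assms(1)] and W = framedD[OF assms(2)] and Z = framedD[OF assms(3)]
  note f = basedD[OF assms(4)] and g = basedD[OF assms(5)]
  have sb: "snd (Comp Sab V W Z g f) b = snd g (snd f b)" if "b \<in> B" for b
    using that V(6) by (auto simp: Comp_Sab_apply)
  have "fst (Comp Sab V W Z g f) d = \<one>\<^bsub>V\<^esub>" if "d \<in> D" "d \<notin> snd (Comp Sab V W Z g f) ` B" for d
  proof (cases "d \<in> snd g ` C")
    case True
    then obtain c where c: "c \<in> C" "d = snd g c" by blast
    then have "c \<notin> snd f ` B" using that sb by auto
    then show ?thesis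
      using c f(3) Hom_SabD(3)[OF g(1), of c] W(6) Z(6) that by (auto simp: Comp_Sab_apply subset_iff)
  next
    case False
    then have "fst g d = \<one>\<^bsub>W\<^esub>" using g(3) that by blast
    moreover have "fst f \<one>\<^bsub>W\<^esub> = \<one>\<^bsub>V\<^esub>"
      using hom_one[OF Hom_SabD(1)[OF f(1)] W(4) V(4)] .
    ultimately show ?thesis using that Z(6) by (auto simp: Comp_Sab_apply subset_iff)
  qed
  then show ?thesis
    unfolding based_def using Comp_Sab_in[OF f(1) g(1) V(4) Z(4)] f(2) g(2) sb by auto
qed

text \<open>Injections of bases with nested images factor through each other. Applied to the
  inclusion of all summands but one, this recognises a morphism that avoids a summand as one that
  comes from the smaller sum.\<close>

lemma based_factors:
  assumes V: "framed V B" and V': "framed V' B'" and W: "framed W C"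
    and f: "based V B W C f" and g: "based V' B' W C g" and sub: "snd f ` B \<subseteq> snd g ` B'"
  obtains h where "based V B V' B' h" "f = Comp Sab V V' W g h"
proof -
  define \<sigma> where "\<sigma> = (\<lambda>b. inv_into B' (snd g) (snd f b))"
  have g\<sigma>: "snd g (\<sigma> b) = snd f b" "\<sigma> b \<in> B'" if "b \<in> B" for b
    using that sub by (auto simp: \<sigma>_def f_inv_into_f inv_into_into)
  have inj: "inj_on \<sigma> B"
    using based_inj[OF V f] g\<sigma> by (metis inj_on_def)
  obtain h where h: "based V B V' B' h" "\<And>b. b \<in> B \<Longrightarrow> snd h b = \<sigma> b"
    using based_exists[OF V V' inj] g\<sigma>(2) by blast
  have "f = Comp Sab V V' W g h"
  proof (rule based_eqI[OF V W f based_Comp[OF V V' W h(1) g]])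
    fix b assume "b \<in> B"
    then show "snd f b = snd (Comp Sab V V' W g h) b"
      using h(2) g\<sigma> framedD(6)[OF V] by (auto simp: Comp_Sab_apply)
  qed
  with h(1) show thesis by (rule that)
qed

lemma framed_dsum:
  assumes "framed x A" "framed a B"
  shows "framed (dsum x a) (dsum_basis x a A B)"
  using assms ab_basis_dsum dsum_in_Ob Ob_Sab_comm_group by (auto simp: framed_def)

lemma based_into_sum:
  assumes x: "framed x A" and a: "framed a B"
  shows "based a B (dsum x a) (dsum_basis x a A B) (into_sum x a)"
proof -
  note x' = framedD[OF x] and a' = framedD[OF a]
  interpret a: group a by (rule a'(4))
  have s: "snd (into_sum x a) ` B = (\<lambda>t. prod_encode (\<one>\<^bsub>x\<^esub>, t)) ` B"
    using a'(6) by (auto simp: into_sum_apply subset_iff intro!: image_cong)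
  show ?thesis
    unfolding based_def s using x'(6) into_sum_in[OF x'(1) a'(1)]
    by (auto simp: dsum_basis_def into_sum_apply subset_iff)
qed

lemma based_plus_mor:
  assumes x: "framed x A" and a: "framed a B" and b: "framed b C" and f: "based a B b C f"
  shows "based (dsum x a) (dsum_basis x a A B) (dsum x b) (dsum_basis x b A C) (plus_mor x a b f)"
proof -
  note x' = framedD[OF x] and a' = framedD[OF a] and b' = framedD[OF b] and f' = basedD[OF f]
  interpret x: group x by (rule x'(4))
  interpret a: group a by (rule a'(4))
  interpret b: group b by (rule b'(4))
  have one: "fst f \<one>\<^bsub>b\<^esub> = \<one>\<^bsub>a\<^esub>" "snd f \<one>\<^bsub>a\<^esub> = \<one>\<^bsub>b\<^esub>"
    using hom_one[OF Hom_SabD(1)[OF f'(1)]] hom_one[OF Hom_SabD(2)[OF f'(1)]] a'(4) b'(4) by auto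
  have s: "snd (plus_mor x a b f) ` dsum_basis x a A B = dsum_basis x b A (snd f ` B)"
    using x'(6) a'(6) one
    by (auto simp: dsum_basis_def image_Un image_image plus_mor_apply subset_iff intro!: arg_cong2[of _ _ _ _ "(\<union>)"] image_cong)
  show ?thesis
    unfolding based_def s using plus_mor_in[OF x'(1) a'(1) b'(1) f'(1)] f' x'(6) b'(6)
    by (auto simp: dsum_basis_def plus_mor_apply dsum_one subset_iff image_iff)
qed

section \<open>Stably null functors and iterated differences\<close>

lemma ab_functorD:
  assumes "ab_functor Sab F"
  shows "\<And>a. a \<in> Ob Sab \<Longrightarrow> comm_group (Fob F a)"
    "\<And>a. a \<in> Ob Sab \<Longrightarrow> group (Fob F a)"
    "\<And>a b f. a \<in> Ob Sab \<Longrightarrow> b \<in> Ob Sab \<Longrightarrow> f \<in> Hom Sab a b \<Longrightarrow> Fmor F a b f \<in> hom (Fob F a) (Fob F b)"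
    "\<And>a t. a \<in> Ob Sab \<Longrightarrow> t \<in> carrier (Fob F a) \<Longrightarrow> Fmor F a a (Idm Sab a) t = t"
    "\<And>a b c f g t. a \<in> Ob Sab \<Longrightarrow> b \<in> Ob Sab \<Longrightarrow> c \<in> Ob Sab \<Longrightarrow> f \<in> Hom Sab a b \<Longrightarrow> g \<in> Hom Sab b c \<Longrightarrow>
       t \<in> carrier (Fob F a) \<Longrightarrow> Fmor F a c (Comp Sab a b c g f) t = Fmor F b c g (Fmor F a b f t)"
    "\<And>a b f t. a \<in> Ob Sab \<Longrightarrow> b \<in> Ob Sab \<Longrightarrow> f \<in> Hom Sab a b \<Longrightarrow> t \<in> carrier (Fob F a)
       \<Longrightarrow> Fmor F a b f t \<in> carrier (Fob F b)"
    "\<And>a b f. a \<in> Ob Sab \<Longrightarrow> b \<in> Ob Sab \<Longrightarrow> f \<in> Hom Sab a b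
       \<Longrightarrow> Fmor F a b f \<one>\<^bsub>Fob F a\<^esub> = \<one>\<^bsub>Fob F b\<^esub>"
proof -
  show grp: "group (Fob F a)" if "a \<in> Ob Sab" for a
    using assms that by (auto simp: ab_functor_def group_functor_def)
  show hom: "Fmor F a b f \<in> hom (Fob F a) (Fob F b)"
    if "a \<in> Ob Sab" "b \<in> Ob Sab" "f \<in> Hom Sab a b" for a b f
    using assms that by (auto simp: ab_functor_def group_functor_def)
  show "Fmor F a b f t \<in> carrier (Fob F b)"
    if "a \<in> Ob Sab" "b \<in> Ob Sab" "f \<in> Hom Sab a b" "t \<in> carrier (Fob F a)" for a b f t
    using hom[OF that(1-3)] that(4) by (auto simp: hom_def)
  show "Fmor F a b f \<one>\<^bsub>Fob F a\<^esub> = \<one>\<^bsub>Fob F b\<^esub>"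
    if "a \<in> Ob Sab" "b \<in> Ob Sab" "f \<in> Hom Sab a b" for a b f
    using hom_one[OF hom[OF that] grp grp] that by simp
qed (use assms in \<open>auto simp: ab_functor_def group_functor_def\<close>)

lemma subfunctorD:
  assumes "subfunctor Sab F S"
  shows "\<And>a. a \<in> Ob Sab \<Longrightarrow> subgroup (S a) (Fob F a)"
    "\<And>a b f t. a \<in> Ob Sab \<Longrightarrow> b \<in> Ob Sab \<Longrightarrow> f \<in> Hom Sab a b \<Longrightarrow> t \<in> S a \<Longrightarrow> Fmor F a b f t \<in> S b"
    "\<And>a t. a \<in> Ob Sab \<Longrightarrow> t \<in> S a \<Longrightarrow> t \<in> carrier (Fob F a)"
proof -
  show "subgroup (S a) (Fob F a)" if "a \<in> Ob Sab" for a
    using assms that by (auto simp: subfunctor_def)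
  then show "t \<in> carrier (Fob F a)" if "a \<in> Ob Sab" "t \<in> S a" for a t
    using that subgroup.mem_carrier by metis
  show "Fmor F a b f t \<in> S b" if "a \<in> Ob Sab" "b \<in> Ob Sab" "f \<in> Hom Sab a b" "t \<in> S a" for a b f t
    using assms that by (fastforce simp: subfunctor_def)
qed

lemma subfunctor_normal:
  assumes "ab_functor Sab F" "subfunctor Sab F S" "a \<in> Ob Sab"
  shows "normal (S a) (Fob F a)"
  using comm_group.subgroup_imp_normal ab_functorD(1)[OF assms(1)] subfunctorD(1)[OF assms(2)] assms(3) by blast

lemma ab_functor_Fsub:
  assumes F: "ab_functor Sab F" and S: "subfunctor Sab F S"
  shows "ab_functor Sab (Fsub F S)"
proof -
  note F' = ab_functorD[OF F] and S' = subfunctorD[OF S]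
  have "comm_group (Fob (Fsub F S) a)" if "a \<in> Ob Sab" for a
    using comm_group_subgroup[OF F'(1)[OF that] S'(1)[OF that]] by (simp add: Fsub_def)
  moreover have "Fmor F a b f \<in> hom ((Fob F a)\<lparr>carrier := S a\<rparr>) ((Fob F b)\<lparr>carrier := S b\<rparr>)"
    if "a \<in> Ob Sab" "b \<in> Ob Sab" "f \<in> Hom Sab a b" for a b f
    using that S'(2)[OF that] S'(3)[OF that(1)] hom_mult[OF F'(3)[OF that]] by (auto simp: hom_def)
  ultimately show ?thesis
    unfolding ab_functor_def group_functor_def
    using F' S'(3) by (auto simp: Fsub_def comm_group.axioms(2))
qed

lemma ab_functor_Fquot:
  assumes F: "ab_functor Sab F" and S: "subfunctor Sab F S"
  shows "ab_functor Sab (Fquot F S)"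
proof -
  note F' = ab_functorD[OF F] and S' = subfunctorD[OF S]
  let ?r = "\<lambda>a. rep_of (Fob F a) (S a)"
  \<comment> \<open>A functor map may be applied to an element or to its representative: the two
    differ by an element of \<open>S\<close>, and its image is again in \<open>S\<close>.\<close>
  have rr: "?r b (Fmor F a b f (?r a t)) = ?r b (Fmor F a b f t)"
    if ab: "a \<in> Ob Sab" "b \<in> Ob Sab" "f \<in> Hom Sab a b" and t: "t \<in> carrier (Fob F a)" for a b f t
  proof -
    interpret a: normal "S a" "Fob F a" by (rule subfunctor_normal[OF F S ab(1)])
    interpret b: normal "S b" "Fob F b" by (rule subfunctor_normal[OF F S ab(2)])
    interpret f: group_hom "Fob F a" "Fob F b" "Fmor F a b f" by unfold_locales (rule F'(3)[OF ab])
    obtain s where s: "s \<in> S a" "?r a t = s \<otimes>\<^bsub>Fob F a\<^esub> t" using a.rep_of_obtain[OF t] .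
    have fs: "Fmor F a b f s \<in> S b" using S'(2)[OF ab s(1)] .
    have "Fmor F a b f (?r a t) \<otimes>\<^bsub>Fob F b\<^esub> inv\<^bsub>Fob F b\<^esub> Fmor F a b f t = Fmor F a b f s"
      using s t fs S'(3)[OF ab(1) s(1)] by (simp add: b.m_assoc)
    then show ?thesis using b.rep_of_eq_iff fs t a.rep_of_in(2) by simp
  qed
  have "comm_group (Fob (Fquot F S) a)" if "a \<in> Ob Sab" for a
    using comm_group_quot[OF F'(1)[OF that] S'(1)[OF that]] by (simp add: Fquot_def)
  moreover have "Fmor (Fquot F S) a b f \<in> hom (Fob (Fquot F S) a) (Fob (Fquot F S) b)"
    if ab: "a \<in> Ob Sab" "b \<in> Ob Sab" "f \<in> Hom Sab a b" for a b f
  proof -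
    interpret a: normal "S a" "Fob F a" by (rule subfunctor_normal[OF F S ab(1)])
    interpret b: normal "S b" "Fob F b" by (rule subfunctor_normal[OF F S ab(2)])
    have "?r b (Fmor F a b f t) \<in> carrier (quot (Fob F b) (S b))" if "t \<in> carrier (quot (Fob F a) (S a))" for t
      using a.quot_carrierD(1)[OF that] F'(6)[OF ab] by (auto simp: quot_def)
    moreover have "?r b (Fmor F a b f (x \<otimes>\<^bsub>quot (Fob F a) (S a)\<^esub> y))
      = ?r b (Fmor F a b f x) \<otimes>\<^bsub>quot (Fob F b) (S b)\<^esub> ?r b (Fmor F a b f y)"
      if "x \<in> carrier (quot (Fob F a) (S a))" "y \<in> carrier (quot (Fob F a) (S a))" for x y
    proof -
      have xy: "x \<in> carrier (Fob F a)" "y \<in> carrier (Fob F a)" using a.quot_carrierD(1) that by auto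
      have "?r b (Fmor F a b f (x \<otimes>\<^bsub>quot (Fob F a) (S a)\<^esub> y)) = ?r b (Fmor F a b f (x \<otimes>\<^bsub>Fob F a\<^esub> y))"
        using rr[OF ab, of "x \<otimes>\<^bsub>Fob F a\<^esub> y"] xy by (simp add: quot_def)
      also have "\<dots> = ?r b (Fmor F a b f x \<otimes>\<^bsub>Fob F b\<^esub> Fmor F a b f y)"
        using hom_mult[OF F'(3)[OF ab]] xy by simp
      also have "\<dots> = ?r b (Fmor F a b f x) \<otimes>\<^bsub>quot (Fob F b) (S b)\<^esub> ?r b (Fmor F a b f y)"
        using b.rep_of_mult F'(6)[OF ab] xy by (simp add: quot_def)
      finally show ?thesis .
    qed
    ultimately show ?thesis by (auto simp: hom_def Fquot_def)
  qed
  moreover have "Fmor (Fquot F S) a a (Idm Sab a) t = t"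
    if a: "a \<in> Ob Sab" and t: "t \<in> carrier (Fob (Fquot F S) a)" for a t
  proof -
    interpret a: normal "S a" "Fob F a" by (rule subfunctor_normal[OF F S a])
    from t have "t \<in> carrier (quot (Fob F a) (S a))" by (simp add: Fquot_def)
    from a.quot_carrierD[OF this] show ?thesis using F'(4)[OF a] by (simp add: Fquot_def)
  qed
  moreover have "Fmor (Fquot F S) a c (Comp Sab a b c g f) t = Fmor (Fquot F S) b c g (Fmor (Fquot F S) a b f t)"
    if abc: "a \<in> Ob Sab" "b \<in> Ob Sab" "c \<in> Ob Sab" "f \<in> Hom Sab a b" "g \<in> Hom Sab b c"
      and t: "t \<in> carrier (Fob (Fquot F S) a)" for a b c f g t
  proof -
    interpret a: normal "S a" "Fob F a" by (rule subfunctor_normal[OF F S abc(1)])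
    from t have "t \<in> carrier (quot (Fob F a) (S a))" by (simp add: Fquot_def)
    from a.quot_carrierD(1)[OF this] show ?thesis
      using F'(5)[OF abc] F'(6)[OF abc(1,2,4)] rr[OF abc(2,3,5)] by (simp add: Fquot_def)
  qed
  ultimately show ?thesis
    unfolding ab_functor_def group_functor_def by (auto simp: comm_group.axioms(2))
qed

lemma ab_functor_shift:
  assumes F: "ab_functor Sab F" and x: "x \<in> Ob Sab"
  shows "ab_functor Sab (shift x F)"
proof -
  note F' = ab_functorD[OF F]
  show ?thesis
    unfolding ab_functor_def group_functor_def
  proof (intro conjI ballI)
    fix a b c f g t
    assume "a \<in> Ob Sab" "b \<in> Ob Sab" "c \<in> Ob Sab" "f \<in> Hom Sab a b" "g \<in> Hom Sab b c"
      "t \<in> carrier (Fob (shift x F) a)"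
    then show "Fmor (shift x F) a c (Comp Sab a b c g f) t = Fmor (shift x F) b c g (Fmor (shift x F) a b f t)"
      using x by (simp add: shift_def plus_mor_Comp F'(5) dsum_in_Ob plus_mor_in)
  qed (use x in \<open>simp_all add: shift_def F'(1-4) dsum_in_Ob plus_mor_in plus_mor_Idm\<close>)
qed

lemma to_shift_hom:
  assumes F: "ab_functor Sab F" and "x \<in> Ob Sab" "a \<in> Ob Sab"
  shows "to_shift x F a \<in> hom (Fob F a) (Fob F (dsum x a))"
  using assms ab_functorD(3)[OF F] by (simp add: to_shift_def dsum_in_Ob into_sum_in)

lemma to_shift_natural:
  assumes F: "ab_functor Sab F" and o: "x \<in> Ob Sab" "a \<in> Ob Sab" "b \<in> Ob Sab" and f: "f \<in> Hom Sab a b"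
    and t: "t \<in> carrier (Fob F a)"
  shows "to_shift x F b (Fmor F a b f t) = Fmor F (dsum x a) (dsum x b) (plus_mor x a b f) (to_shift x F a t)"
  unfolding to_shift_def
  using into_sum_natural[OF o f] ab_functorD(5)[OF F o(2,3) _ f into_sum_in[OF o(1,3)] t]
    ab_functorD(5)[OF F o(2) _ _ into_sum_in[OF o(1,2)] plus_mor_in[OF o f] t] o
  by (simp add: dsum_in_Ob)

abbreviation shift_im :: "nat monoid \<Rightarrow> 'b sfun \<Rightarrow> nat monoid \<Rightarrow> 'b set" where
  "shift_im x F a \<equiv> to_shift x F a ` carrier (Fob F a)"

lemma subfunctor_shift_im:
  assumes F: "ab_functor Sab F" and x: "x \<in> Ob Sab"
  shows "subfunctor Sab (shift x F) (shift_im x F)"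
  unfolding subfunctor_def
proof (intro conjI ballI)
  fix a assume a: "a \<in> Ob Sab"
  interpret group_hom "Fob F a" "Fob F (dsum x a)" "to_shift x F a"
    using ab_functorD(2)[OF F] to_shift_hom[OF F x a] a x by (simp add: group_hom_def group_hom_axioms_def dsum_in_Ob)
  show "subgroup (shift_im x F a) (Fob (shift x F) a)"
    using img_is_subgroup by (simp add: shift_def)
next
  fix a b f assume *: "a \<in> Ob Sab" "b \<in> Ob Sab" "f \<in> Hom Sab a b"
  show "Fmor (shift x F) a b f ` shift_im x F a \<subseteq> shift_im x F b"
    using to_shift_natural[OF F x *] ab_functorD(6)[OF F *] by (auto simp: shift_def simp flip: to_shift_natural[OF F x *])
qed

lemma ab_functor_delta: "ab_functor Sab F \<Longrightarrow> x \<in> Ob Sab \<Longrightarrow> ab_functor Sab (delta x F)"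
  unfolding delta_def by (intro ab_functor_Fquot ab_functor_shift subfunctor_shift_im)

definition killed :: "'b sfun \<Rightarrow> nat monoid \<Rightarrow> 'b \<Rightarrow> bool" where
  "killed F a t \<longleftrightarrow> (\<exists>b\<in>Ob Sab. \<exists>f\<in>Hom Sab a b. Fmor F a b f t = \<one>\<^bsub>Fob F b\<^esub>)"

text \<open>Every morphism f : a \<rightarrow> b becomes the canonical a \<rightarrow> b + a after a
  further morphism, so what f kills is killed canonically.\<close>

lemma killed_into_sum:
  assumes F: "ab_functor Sab F" and a: "a \<in> Ob Sab" and t: "t \<in> carrier (Fob F a)"
  shows "killed F a t \<longleftrightarrow> (\<exists>x\<in>Ob Sab. to_shift x F a t = \<one>\<^bsub>Fob F (dsum x a)\<^esub>)"
proof
  assume "killed F a t"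
  then obtain b f where f: "b \<in> Ob Sab" "f \<in> Hom Sab a b" "Fmor F a b f t = \<one>\<^bsub>Fob F b\<^esub>"
    by (auto simp: killed_def)
  obtain h where h: "h \<in> Hom Sab b (dsum b a)" "Comp Sab a b (dsum b a) h f = into_sum b a"
    by (rule into_sum_factors[OF a f(1,2)])
  have "to_shift b F a t = Fmor F b (dsum b a) h (Fmor F a b f t)"
    using ab_functorD(5)[OF F a f(1) dsum_in_Ob[OF f(1) a] f(2) h(1) t] h(2) by (simp add: to_shift_def)
  also have "\<dots> = \<one>\<^bsub>Fob F (dsum b a)\<^esub>"
    using f ab_functorD(7)[OF F f(1) dsum_in_Ob[OF f(1) a] h(1)] by simp
  finally show "\<exists>x\<in>Ob Sab. to_shift x F a t = \<one>\<^bsub>Fob F (dsum x a)\<^esub>" using f(1) by blast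
next
  assume "\<exists>x\<in>Ob Sab. to_shift x F a t = \<one>\<^bsub>Fob F (dsum x a)\<^esub>"
  then show "killed F a t"
    using a dsum_in_Ob into_sum_in unfolding killed_def to_shift_def by blast
qed

lemma killed_Comp:
  assumes F: "ab_functor Sab F" and ab: "a \<in> Ob Sab" "b \<in> Ob Sab" "f \<in> Hom Sab a b"
    and t: "t \<in> carrier (Fob F a)" and k: "killed F b (Fmor F a b f t)"
  shows "killed F a t"
proof -
  obtain c g where g: "c \<in> Ob Sab" "g \<in> Hom Sab b c" "Fmor F b c g (Fmor F a b f t) = \<one>\<^bsub>Fob F c\<^esub>"
    using k by (auto simp: killed_def)
  then show ?thesis
    using Comp_Sab_in[OF ab(3) g(2)] ab_functorD(5)[OF F ab(1,2) g(1) ab(3) g(2) t] ab(1) Ob_Sab_group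
    unfolding killed_def by (intro bexI[of _ c] bexI[of _ "Comp Sab a b c g f"]) auto
qed

text \<open>Stabilisation is natural: a summand x that kills \<open>t\<close> also kills every image
  of \<open>t\<close>.\<close>

lemma killed_mor:
  assumes F: "ab_functor Sab F" and ab: "a \<in> Ob Sab" "b \<in> Ob Sab" "f \<in> Hom Sab a b"
    and t: "t \<in> carrier (Fob F a)" and k: "killed F a t"
  shows "killed F b (Fmor F a b f t)"
proof -
  obtain x where x: "x \<in> Ob Sab" "to_shift x F a t = \<one>\<^bsub>Fob F (dsum x a)\<^esub>"
    using k killed_into_sum[OF F ab(1) t] by auto
  have "to_shift x F b (Fmor F a b f t) = \<one>\<^bsub>Fob F (dsum x b)\<^esub>"
    using to_shift_natural[OF F x(1) ab t] x(2)
      ab_functorD(7)[OF F dsum_in_Ob[OF x(1) ab(1)] dsum_in_Ob[OF x(1) ab(2)] plus_mor_in[OF x(1) ab]] by simp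
  then show ?thesis using killed_into_sum[OF F ab(2)] ab_functorD(6)[OF F ab t] x(1) by blast
qed

text \<open>A morphism that kills the first factor leaves the image of the second, which is still
  killed by \<open>killed_mor\<close>; composing kills the product.\<close>

lemma killed_mult:
  assumes F: "ab_functor Sab F" and a: "a \<in> Ob Sab"
    and s: "s \<in> carrier (Fob F a)" "killed F a s" and t: "t \<in> carrier (Fob F a)" "killed F a t"
  shows "killed F a (s \<otimes>\<^bsub>Fob F a\<^esub> t)"
proof -
  obtain b f where f: "b \<in> Ob Sab" "f \<in> Hom Sab a b" "Fmor F a b f s = \<one>\<^bsub>Fob F b\<^esub>"
    using s(2) by (auto simp: killed_def)
  interpret a: group "Fob F a" using ab_functorD(2)[OF F a] .
  interpret b: group "Fob F b" using ab_functorD(2)[OF F f(1)] .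
  have "Fmor F a b f (s \<otimes>\<^bsub>Fob F a\<^esub> t) = Fmor F a b f t"
    using hom_mult[OF ab_functorD(3)[OF F a f(1,2)] s(1) t(1)] f(3) ab_functorD(6)[OF F a f(1,2) t(1)] by simp
  then show ?thesis
    using killed_mor[OF F a f(1,2) t] killed_Comp[OF F a f(1,2)] s(1) t(1) by simp
qed

lemma killed_inv:
  assumes F: "ab_functor Sab F" and a: "a \<in> Ob Sab" and t: "t \<in> carrier (Fob F a)" "killed F a t"
  shows "killed F a (inv\<^bsub>Fob F a\<^esub> t)"
proof -
  obtain b f where f: "b \<in> Ob Sab" "f \<in> Hom Sab a b" "Fmor F a b f t = \<one>\<^bsub>Fob F b\<^esub>"
    using t(2) by (auto simp: killed_def)
  interpret group_hom "Fob F a" "Fob F b" "Fmor F a b f"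
    using ab_functorD(2)[OF F] ab_functorD(3)[OF F a f(1,2)] a f(1) by (simp add: group_hom_def group_hom_axioms_def)
  show ?thesis using f t unfolding killed_def by (intro bexI[of _ b] bexI[of _ f]) auto
qed

text \<open>The killed elements already form a subgroup, so the subgroup generated by the kernels of
  stabilisation is just their union.\<close>

lemma stably_null_iff:
  assumes F: "ab_functor Sab F"
  shows "stably_null F \<longleftrightarrow> (\<forall>a\<in>Ob Sab. \<forall>t\<in>carrier (Fob F a). killed F a t)"
proof
  assume null: "stably_null F"
  show "\<forall>a\<in>Ob Sab. \<forall>t\<in>carrier (Fob F a). killed F a t"
  proof (intro ballI)
    fix a t assume a: "a \<in> Ob Sab" and t: "t \<in> carrier (Fob F a)"
    interpret a: group "Fob F a" using ab_functorD(2)[OF F a] .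
    let ?K = "\<Union>x\<in>Ob Sab. kappa x F a"
    have K: "s \<in> carrier (Fob F a)" "killed F a s" if "s \<in> ?K" for s
      using that killed_into_sum[OF F a] by (auto simp: kappa_def kernel_def shift_def)
    have one: "killed F a \<one>\<^bsub>Fob F a\<^esub>"
      using ab_functorD(4)[OF F a a.one_closed] a Idm_Sab_in[OF Ob_Sab_group[OF a]] unfolding killed_def by blast
    have "t \<in> generate (Fob F a) ?K" using null a t by (simp add: stably_null_def)
    then have "t \<in> carrier (Fob F a) \<and> killed F a t"
      by induct (use K one killed_mult[OF F a] killed_inv[OF F a] in auto)
    then show "killed F a t" by simp
  qed
next
  assume *: "\<forall>a\<in>Ob Sab. \<forall>t\<in>carrier (Fob F a). killed F a t"
  show "stably_null F"
    unfolding stably_null_def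
  proof
    fix a assume a: "a \<in> Ob Sab"
    interpret a: group "Fob F a" using ab_functorD(2)[OF F a] .
    have K: "(\<Union>x\<in>Ob Sab. kappa x F a) = carrier (Fob F a)"
      using * a killed_into_sum[OF F a] by (auto simp: kappa_def kernel_def shift_def)
    show "generate (Fob F a) (\<Union>x\<in>Ob Sab. kappa x F a) = carrier (Fob F a)"
      unfolding K using a.generate_incl[of "carrier (Fob F a)"] by (auto intro: generate.incl)
  qed
qed

lemma stably_null_Fsub:
  assumes F: "ab_functor Sab F" and S: "subfunctor Sab F S"
  shows "stably_null (Fsub F S) \<longleftrightarrow> (\<forall>a\<in>Ob Sab. \<forall>t\<in>S a. killed F a t)"
  by (simp add: stably_null_iff[OF ab_functor_Fsub[OF F S]]) (simp add: Fsub_def killed_def)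

text \<open>To die in the quotient is to be moved into \<open>S\<close>; choosing representatives
  does not matter because it changes an element by a member of \<open>S\<close>, whose images stay
  in \<open>S\<close>.\<close>

lemma stably_null_Fquot:
  assumes F: "ab_functor Sab F" and S: "subfunctor Sab F S"
  shows "stably_null (Fquot F S) \<longleftrightarrow>
    (\<forall>a\<in>Ob Sab. \<forall>t\<in>carrier (Fob F a). \<exists>b\<in>Ob Sab. \<exists>f\<in>Hom Sab a b. Fmor F a b f t \<in> S b)"
proof -
  note F' = ab_functorD[OF F] and S' = subfunctorD[OF S]
  have 1: "Fmor (Fquot F S) a b f t = \<one>\<^bsub>Fob (Fquot F S) b\<^esub> \<longleftrightarrow> Fmor F a b f t \<in> S b"
    if "a \<in> Ob Sab" "b \<in> Ob Sab" "f \<in> Hom Sab a b" "t \<in> carrier (Fob F a)" for a b f t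
    using normal.rep_of_one_iff[OF subfunctor_normal[OF F S that(2)]] F'(6)[OF that] by (simp add: Fquot_def)
  have 2: "Fmor F a b f (rep_of (Fob F a) (S a) t) \<in> S b \<longleftrightarrow> Fmor F a b f t \<in> S b"
    if ab: "a \<in> Ob Sab" "b \<in> Ob Sab" "f \<in> Hom Sab a b" and t: "t \<in> carrier (Fob F a)" for a b f t
  proof -
    interpret a: normal "S a" "Fob F a" by (rule subfunctor_normal[OF F S ab(1)])
    interpret b: normal "S b" "Fob F b" by (rule subfunctor_normal[OF F S ab(2)])
    obtain s where s: "s \<in> S a" "rep_of (Fob F a) (S a) t = s \<otimes>\<^bsub>Fob F a\<^esub> t" using a.rep_of_obtain[OF t] .
    have "Fmor F a b f (rep_of (Fob F a) (S a) t) = Fmor F a b f s \<otimes>\<^bsub>Fob F b\<^esub> Fmor F a b f t"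
      using s t S'(3)[OF ab(1)] hom_mult[OF F'(3)[OF ab]] by simp
    moreover have "Fmor F a b f s \<in> S b" using S'(2)[OF ab s(1)] .
    moreover have "Fmor F a b f t \<in> carrier (Fob F b)" using F'(6)[OF ab t] .
    ultimately show ?thesis
      using b.mult_mem_iff by simp
  qed
  show ?thesis
    unfolding stably_null_iff[OF ab_functor_Fquot[OF F S]]
  proof (rule ball_cong[OF refl])
    fix a assume a: "a \<in> Ob Sab"
    interpret a: normal "S a" "Fob F a" by (rule subfunctor_normal[OF F S a])
    have k: "killed (Fquot F S) a t \<longleftrightarrow> (\<exists>b\<in>Ob Sab. \<exists>f\<in>Hom Sab a b. Fmor F a b f t \<in> S b)"
      if "t \<in> carrier (Fob F a)" for t
      using 1[OF a] that by (auto simp: killed_def)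
    show "(\<forall>t\<in>carrier (Fob (Fquot F S) a). killed (Fquot F S) a t) \<longleftrightarrow>
       (\<forall>t\<in>carrier (Fob F a). \<exists>b\<in>Ob Sab. \<exists>f\<in>Hom Sab a b. Fmor F a b f t \<in> S b)"
      using k 2[OF a] a.rep_of_in(2) by (auto simp: Fquot_def quot_def)
  qed
qed

subsection \<open>Zero objects of the stable category\<close>

lemma subfunctor_one: "ab_functor Sab F \<Longrightarrow> subfunctor Sab F (\<lambda>a. {\<one>\<^bsub>Fob F a\<^esub>})"
  unfolding subfunctor_def using ab_functorD(7)[of F] group.triv_subgroup[OF ab_functorD(2)[of F]] by auto

lemma subfunctor_carrier: "ab_functor Sab F \<Longrightarrow> subfunctor Sab F (\<lambda>a. carrier (Fob F a))"
  unfolding subfunctor_def using ab_functorD(6)[of F] group.subgroup_self[OF ab_functorD(2)[of F]] by auto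

lemma subfunctor_Int:
  assumes F: "ab_functor Sab F" and A: "subfunctor Sab F A" and B: "subfunctor Sab F B"
  shows "subfunctor Sab F (\<lambda>a. A a \<inter> B a)"
  unfolding subfunctor_def
  using subfunctorD[OF A] subfunctorD[OF B] group.subgroups_Inter_pair[OF ab_functorD(2)[OF F]] by auto

lemma subfunctor_set_mult:
  assumes F: "ab_functor Sab F" and A: "subfunctor Sab F A" and B: "subfunctor Sab F B"
  shows "subfunctor Sab F (\<lambda>a. A a <#>\<^bsub>Fob F a\<^esub> B a)"
  unfolding subfunctor_def
proof (intro conjI ballI)
  fix a assume a: "a \<in> Ob Sab"
  interpret comm_group "Fob F a" using ab_functorD(1)[OF F a] .
  show "subgroup (A a <#>\<^bsub>Fob F a\<^esub> B a) (Fob F a)"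
    using mult_subgroups subfunctorD(1)[OF A a] subfunctorD(1)[OF B a] by blast
next
  fix a b f assume *: "a \<in> Ob Sab" "b \<in> Ob Sab" "f \<in> Hom Sab a b"
  show "Fmor F a b f ` (A a <#>\<^bsub>Fob F a\<^esub> B a) \<subseteq> A b <#>\<^bsub>Fob F b\<^esub> B b"
  proof
    fix t assume "t \<in> Fmor F a b f ` (A a <#>\<^bsub>Fob F a\<^esub> B a)"
    then obtain u v where uv: "u \<in> A a" "v \<in> B a" "t = Fmor F a b f (u \<otimes>\<^bsub>Fob F a\<^esub> v)"
      by (auto simp: set_mult_def)
    then have "t = Fmor F a b f u \<otimes>\<^bsub>Fob F b\<^esub> Fmor F a b f v"
      using hom_mult[OF ab_functorD(3)[OF F *]] subfunctorD(3)[OF A *(1)] subfunctorD(3)[OF B *(1)] by simp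
    then show "t \<in> A b <#>\<^bsub>Fob F b\<^esub> B b"
      using subfunctorD(2)[OF A * uv(1)] subfunctorD(2)[OF B * uv(2)] by (auto simp: set_mult_def)
  qed
qed

lemma killed_one:
  assumes F: "ab_functor Sab F" and a: "a \<in> Ob Sab"
  shows "killed F a \<one>\<^bsub>Fob F a\<^esub>"
  using ab_functorD(7)[OF F a a] a Idm_Sab_in[OF Ob_Sab_group[OF a]] unfolding killed_def by blast

lemma stably_null_Fsub_one: "ab_functor Sab F \<Longrightarrow> stably_null (Fsub F (\<lambda>a. {\<one>\<^bsub>Fob F a\<^esub>}))"
  by (simp add: stably_null_Fsub subfunctor_one killed_one)

lemma stably_null_Fquot_carrier:
  assumes F: "ab_functor Sab F"
  shows "stably_null (Fquot F (\<lambda>a. carrier (Fob F a)))"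
  unfolding stably_null_Fquot[OF F subfunctor_carrier[OF F]]
proof (intro ballI)
  fix a t assume a: "a \<in> Ob Sab" and t: "t \<in> carrier (Fob F a)"
  then show "\<exists>b\<in>Ob Sab. \<exists>f\<in>Hom Sab a b. Fmor F a b f t \<in> carrier (Fob F b)"
    using ab_functorD(6)[OF F a a Idm_Sab_in t] Idm_Sab_in[OF Ob_Sab_group[OF a]] Ob_Sab_group[OF a] by blast
qed

lemma rep_of_mono:
  assumes "comm_group G" "subgroup B G" "subgroup B' G" "B \<subseteq> B'" "x \<in> carrier G"
  shows "rep_of G B' (rep_of G B x) = rep_of G B' x"
proof -
  interpret comm_group G by fact
  interpret B: normal B G by (rule subgroup_imp_normal) fact
  interpret B': normal B' G by (rule subgroup_imp_normal) fact
  obtain h where h: "h \<in> B" "rep_of G B x = h \<otimes>\<^bsub>G\<^esub> x" using B.rep_of_obtain[OF assms(5)] .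
  then have "rep_of G B x \<otimes>\<^bsub>G\<^esub> inv\<^bsub>G\<^esub> x = h" using assms(5) by (simp add: m_assoc)
  then show ?thesis using B'.rep_of_eq_iff h assms(4,5) B.rep_of_in(2) by auto
qed

lemma rep_of_trivial: "group G \<Longrightarrow> x \<in> carrier G \<Longrightarrow> rep_of G {\<one>\<^bsub>G\<^esub>} x = x"
  by (auto simp: rep_of_def r_coset_def group.is_monoid monoid.l_one)

lemma nat_trans_one:
  assumes F: "ab_functor Sab F" and G: "ab_functor Sab G"
  shows "nat_trans Sab F G (\<lambda>a _. \<one>\<^bsub>Fob G a\<^esub>)"
  unfolding nat_trans_def
  using ab_functorD(7)[OF G] group.is_monoid[OF ab_functorD(2)[OF G]]
  by (auto simp: hom_def monoid.one_closed monoid.l_one)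

lemma St_rel_subset: "St_rel F G \<subseteq> St_pre_hom F G \<times> St_pre_hom F G"
  by (auto simp: St_rel_def)

lemma St_relI:
  assumes "(A, B, \<phi>) \<in> St_pre_hom F G" "(A', B', \<phi>') \<in> St_pre_hom F G"
    and "subfunctor Sab F A''" "stably_null (Fquot F A'')" "subfunctor Sab G B''" "stably_null (Fsub G B'')"
    and "\<And>a. a \<in> Ob Sab \<Longrightarrow> A'' a \<subseteq> A a \<inter> A' a \<and> B a \<union> B' a \<subseteq> B'' a"
    and "\<And>a t. a \<in> Ob Sab \<Longrightarrow> t \<in> A'' a \<Longrightarrow>
      rep_of (Fob G a) (B'' a) (\<phi> a t) = rep_of (Fob G a) (B'' a) (\<phi>' a t)"
  shows "((A, B, \<phi>), (A', B', \<phi>')) \<in> St_rel F G"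
  unfolding St_rel_def mem_Collect_eq prod.case
  by (rule conjI[OF assms(1) conjI[OF assms(2)]], rule exI[of _ A''], rule exI[of _ B'']) (use assms in auto)

lemma St_hom_singleton:
  assumes "St_pre_hom F G \<noteq> {}" "\<And>p q. p \<in> St_pre_hom F G \<Longrightarrow> q \<in> St_pre_hom F G \<Longrightarrow> (p, q) \<in> St_rel F G"
  shows "\<exists>!h. h \<in> St_hom F G"
proof -
  have "St_rel F G = St_pre_hom F G \<times> St_pre_hom F G"
    using assms(2) St_rel_subset by fast
  then have "St_hom F G = {St_pre_hom F G}"
    using assms(1) by (auto simp: St_hom_def quotient_def)
  then show ?thesis by simp
qed

text \<open>For a null \<open>F\<close> the trivial subfunctor has null quotient, so a morphism out
  of \<open>F\<close> may be restricted to it and carries no information. Dually all of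
  \<open>F\<close> is a null subfunctor, so a morphism into \<open>F\<close> may be taken modulo
  everything.\<close>

lemma stably_null_imp_St_zero:
  assumes F: "ab_functor Sab (F :: 'b sfun)" and null: "stably_null F"
  shows "St_zero F"
  unfolding St_zero_def
proof (intro allI impI conjI)
  fix G :: "'b sfun" assume G: "ab_functor Sab G"
  note F' = ab_functorD[OF F] and G' = ab_functorD[OF G]
  have kF: "killed F a t" if "a \<in> Ob Sab" "t \<in> carrier (Fob F a)" for a t
    using null stably_null_iff[OF F] that by blast
  have one_mem: "\<exists>b\<in>Ob Sab. \<exists>f\<in>Hom Sab a b. Fmor F a b f t \<in> {\<one>\<^bsub>Fob F b\<^esub>}"
    if "a \<in> Ob Sab" "t \<in> carrier (Fob F a)" for a t
    using kF[OF that] by (auto simp: killed_def)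
  have F1: "stably_null (Fquot F (\<lambda>a. {\<one>\<^bsub>Fob F a\<^esub>}))"
    using one_mem by (simp add: stably_null_Fquot[OF F subfunctor_one[OF F]])
  have F2: "stably_null (Fsub F (\<lambda>a. carrier (Fob F a)))"
    using kF by (simp add: stably_null_Fsub[OF F subfunctor_carrier[OF F]])
  have G1: "stably_null (Fsub G (\<lambda>a. {\<one>\<^bsub>Fob G a\<^esub>}))"
    by (rule stably_null_Fsub_one[OF G])
  have G2: "stably_null (Fquot G (\<lambda>a. carrier (Fob G a)))"
    by (rule stably_null_Fquot_carrier[OF G])
  have F3: "stably_null (Fsub F (\<lambda>a. {\<one>\<^bsub>Fob F a\<^esub>}))"
    by (rule stably_null_Fsub_one[OF F])
  show "\<exists>!h. h \<in> St_hom F G"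
  proof (rule St_hom_singleton)
    have "(\<lambda>a. {\<one>\<^bsub>Fob F a\<^esub>}, \<lambda>a. {\<one>\<^bsub>Fob G a\<^esub>}, \<lambda>a _. \<one>\<^bsub>Fob (Fquot G (\<lambda>a. {\<one>\<^bsub>Fob G a\<^esub>})) a\<^esub>) \<in> St_pre_hom F G"
      using F1 G1 subfunctor_one[OF F] subfunctor_one[OF G]
        nat_trans_one[OF ab_functor_Fsub[OF F subfunctor_one[OF F]] ab_functor_Fquot[OF G subfunctor_one[OF G]]]
      by (simp add: St_pre_hom_def)
    then show "St_pre_hom F G \<noteq> {}" by blast
  next
    fix p q assume p: "p \<in> St_pre_hom F G" and q: "q \<in> St_pre_hom F G"
    obtain A B \<phi> where p': "p = (A, B, \<phi>)" by (cases p)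
    obtain A' B' \<phi>' where q': "q = (A', B', \<phi>')" by (cases q)
    have A: "subfunctor Sab F A" "subfunctor Sab F A'" and B: "subfunctor Sab G B" "subfunctor Sab G B'"
      and Bn: "stably_null (Fsub G B)" "stably_null (Fsub G B')"
      and nt: "nat_trans Sab (Fsub F A) (Fquot G B) \<phi>" "nat_trans Sab (Fsub F A') (Fquot G B') \<phi>'"
      using p q by (auto simp: St_pre_hom_def p' q')
    \<comment> \<open>Modulo the product of the two null subfunctors both representatives take
      values in the same quotient; an element of the product is killed because both of its factors
      are.\<close>
    let ?B = "\<lambda>a. B a <#>\<^bsub>Fob G a\<^esub> B' a"
    have sB: "subfunctor Sab G ?B" by (rule subfunctor_set_mult[OF G B])
    have "killed G a t" if "a \<in> Ob Sab" "t \<in> ?B a" for a t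
      using that Bn killed_mult[OF G] subfunctorD(3)[OF B(1)] subfunctorD(3)[OF B(2)]
      by (auto simp: stably_null_Fsub[OF G B(1)] stably_null_Fsub[OF G B(2)] set_mult_def)
    then have nB: "stably_null (Fsub G ?B)" by (simp add: stably_null_Fsub[OF G sB])
    have key: "{\<one>\<^bsub>Fob F a\<^esub>} \<subseteq> A a \<inter> A' a \<and> B a \<union> B' a \<subseteq> ?B a \<and>
      (\<forall>t\<in>{\<one>\<^bsub>Fob F a\<^esub>}. rep_of (Fob G a) (?B a) (\<phi> a t) = rep_of (Fob G a) (?B a) (\<phi>' a t))"
      if a: "a \<in> Ob Sab" for a
    proof -
      interpret Ga: comm_group "Fob G a" using G'(1)[OF a] .
      have one: "\<one>\<^bsub>Fob G a\<^esub> \<in> B a" "\<one>\<^bsub>Fob G a\<^esub> \<in> B' a"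
        using subgroup.one_closed subfunctorD(1)[OF B(1) a] subfunctorD(1)[OF B(2) a] by auto
      have BB: "B a \<subseteq> ?B a" "B' a \<subseteq> ?B a"
        using one subfunctorD(3)[OF B(1) a] subfunctorD(3)[OF B(2) a] by (force simp: set_mult_def)+
      have "\<phi> a \<one>\<^bsub>Fob F a\<^esub> = rep_of (Fob G a) (B a) \<one>\<^bsub>Fob G a\<^esub>"
        using hom_one[of "\<phi> a" "Fob (Fsub F A) a" "Fob (Fquot G B) a"] nt(1) a
          ab_functorD(2)[OF ab_functor_Fsub[OF F A(1)]] ab_functorD(2)[OF ab_functor_Fquot[OF G B(1)]]
        by (auto simp: nat_trans_def Fsub_def Fquot_def quot_def)
      moreover have "\<phi>' a \<one>\<^bsub>Fob F a\<^esub> = rep_of (Fob G a) (B' a) \<one>\<^bsub>Fob G a\<^esub>"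
        using hom_one[of "\<phi>' a" "Fob (Fsub F A') a" "Fob (Fquot G B') a"] nt(2) a
          ab_functorD(2)[OF ab_functor_Fsub[OF F A(2)]] ab_functorD(2)[OF ab_functor_Fquot[OF G B(2)]]
        by (auto simp: nat_trans_def Fsub_def Fquot_def quot_def)
      ultimately have "rep_of (Fob G a) (?B a) (\<phi> a \<one>\<^bsub>Fob F a\<^esub>) = rep_of (Fob G a) (?B a) (\<phi>' a \<one>\<^bsub>Fob F a\<^esub>)"
        using rep_of_mono[OF G'(1)[OF a]] subfunctorD(1)[OF B(1) a] subfunctorD(1)[OF B(2) a] subfunctorD(1)[OF sB a] BB
        by simp
      then show ?thesis
        using BB subgroup.one_closed subfunctorD(1)[OF A(1) a] subfunctorD(1)[OF A(2) a] by auto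
    qed
    show "(p, q) \<in> St_rel F G"
      unfolding p' q'
      by (rule St_relI[of _ _ _ _ _ _ _ _ "\<lambda>a. {\<one>\<^bsub>Fob F a\<^esub>}" ?B])
        (use p q F1 subfunctor_one[OF F] sB nB key in \<open>simp_all add: p' q'\<close>)
  qed
  show "\<exists>!h. h \<in> St_hom G F"
  proof (rule St_hom_singleton)
    have "(\<lambda>a. carrier (Fob G a), \<lambda>a. {\<one>\<^bsub>Fob F a\<^esub>}, \<lambda>a _. \<one>\<^bsub>Fob (Fquot F (\<lambda>a. {\<one>\<^bsub>Fob F a\<^esub>})) a\<^esub>) \<in> St_pre_hom G F"
      using G2 F3 subfunctor_carrier[OF G] subfunctor_one[OF F]
        nat_trans_one[OF ab_functor_Fsub[OF G subfunctor_carrier[OF G]] ab_functor_Fquot[OF F subfunctor_one[OF F]]]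
      by (simp add: St_pre_hom_def)
    then show "St_pre_hom G F \<noteq> {}" by blast
  next
    fix p q assume p: "p \<in> St_pre_hom G F" and q: "q \<in> St_pre_hom G F"
    obtain A B \<phi> where p': "p = (A, B, \<phi>)" by (cases p)
    obtain A' B' \<phi>' where q': "q = (A', B', \<phi>')" by (cases q)
    have A: "subfunctor Sab G A" "subfunctor Sab G A'" and B: "subfunctor Sab F B" "subfunctor Sab F B'"
      and An: "stably_null (Fquot G A)" "stably_null (Fquot G A')"
      and nt: "nat_trans Sab (Fsub G A) (Fquot F B) \<phi>" "nat_trans Sab (Fsub G A') (Fquot F B') \<phi>'"
      using p q by (auto simp: St_pre_hom_def p' q')
    let ?A = "\<lambda>a. A a \<inter> A' a"
    have sA: "subfunctor Sab G ?A" by (rule subfunctor_Int[OF G A])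
    have "\<exists>b\<in>Ob Sab. \<exists>f\<in>Hom Sab a b. Fmor G a b f t \<in> ?A b" if a: "a \<in> Ob Sab" "t \<in> carrier (Fob G a)" for a t
    proof -
      obtain b f where f: "b \<in> Ob Sab" "f \<in> Hom Sab a b" "Fmor G a b f t \<in> A b"
        using An(1)[unfolded stably_null_Fquot[OF G A(1)]] a by blast
      obtain c g where g: "c \<in> Ob Sab" "g \<in> Hom Sab b c" "Fmor G b c g (Fmor G a b f t) \<in> A' c"
        using An(2)[unfolded stably_null_Fquot[OF G A(2)]] f(1) G'(6)[OF a(1) f(1,2) a(2)] by blast
      have "Fmor G a c (Comp Sab a b c g f) t \<in> ?A c"
        using g f a subfunctorD(2)[OF A(1) f(1) g(1,2)] G'(5)[OF a(1) f(1) g(1) f(2) g(2) a(2)] by simp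
      then show ?thesis using Comp_Sab_in[OF f(2) g(2)] Ob_Sab_group a(1) g(1) by blast
    qed
    then have nA: "stably_null (Fquot G ?A)" by (simp add: stably_null_Fquot[OF G sA])
    have key: "rep_of (Fob F a) (carrier (Fob F a)) (\<phi> a t) = rep_of (Fob F a) (carrier (Fob F a)) (\<phi>' a t)"
      if a: "a \<in> Ob Sab" and t: "t \<in> ?A a" for a t
    proof -
      interpret Fa: comm_group "Fob F a" using F'(1)[OF a] .
      interpret c: normal "carrier (Fob F a)" "Fob F a" by (rule Fa.normal_self)
      have "\<phi> a t \<in> carrier (Fob F a)"
        using nt(1) a t normal.quot_carrierD(1)[OF subfunctor_normal[OF F B(1) a]]
        by (auto simp: nat_trans_def hom_def Fsub_def Fquot_def)
      moreover have "\<phi>' a t \<in> carrier (Fob F a)"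
        using nt(2) a t normal.quot_carrierD(1)[OF subfunctor_normal[OF F B(2) a]]
        by (auto simp: nat_trans_def hom_def Fsub_def Fquot_def)
      ultimately show ?thesis by (simp add: c.rep_of_eq_iff)
    qed
    show "(p, q) \<in> St_rel G F"
      unfolding p' q'
      by (rule St_relI[of _ _ _ _ _ _ _ _ ?A "\<lambda>a. carrier (Fob F a)"])
        (use p q F2 subfunctor_carrier[OF F] sA nA key subfunctorD(3)[OF B(1)] subfunctorD(3)[OF B(2)]
          in \<open>auto simp: p' q'\<close>)
  qed
qed

text \<open>The identity and the zero endomorphism coincide in the quotient category. Hence there
  are subfunctors A \<subseteq> B of \<open>F\<close> with F/A and B null: every element can be
  moved into A, hence into B, where it is killed.\<close>

lemma St_zero_imp_stably_null:
  assumes F: "ab_functor Sab (F :: 'b sfun)" and zero: "St_zero F"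
  shows "stably_null F"
proof -
  note F' = ab_functorD[OF F]
  let ?C = "\<lambda>a. carrier (Fob F a)" and ?O = "\<lambda>a. {\<one>\<^bsub>Fob F a\<^esub>}"
  \<comment> \<open>Representatives of the identity and of zero, both defined on all of
    \<open>F\<close> and taken modulo the trivial subfunctor.\<close>
  let ?i = "(?C, ?O, \<lambda>a t. t)" and ?z = "(?C, ?O, \<lambda>a t. \<one>\<^bsub>Fob F a\<^esub>)"
  note C = subfunctor_carrier[OF F] and I = subfunctor_one[OF F]
  have triv: "rep_of (Fob F a) {\<one>\<^bsub>Fob F a\<^esub>} t = t" if "a \<in> Ob Sab" "t \<in> carrier (Fob F a)" for a t
    using rep_of_trivial[OF F'(2)[OF that(1)] that(2)] .
  have n1: "stably_null (Fsub F ?O)" by (rule stably_null_Fsub_one[OF F])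
  have n2: "stably_null (Fquot F ?C)"
    by (rule stably_null_Fquot_carrier[OF F])
  have q: "carrier (quot (Fob F a) {\<one>\<^bsub>Fob F a\<^esub>}) = carrier (Fob F a)"
     "x \<otimes>\<^bsub>quot (Fob F a) {\<one>\<^bsub>Fob F a\<^esub>}\<^esub> y = rep_of (Fob F a) {\<one>\<^bsub>Fob F a\<^esub>} (x \<otimes>\<^bsub>Fob F a\<^esub> y)"
    if "a \<in> Ob Sab" for a x y
    using triv[OF that] by (auto simp: quot_def image_def)
  have cl: "x \<otimes>\<^bsub>Fob F a\<^esub> y \<in> carrier (Fob F a)" "\<one>\<^bsub>Fob F a\<^esub> \<in> carrier (Fob F a)"
    "\<one>\<^bsub>Fob F a\<^esub> \<otimes>\<^bsub>Fob F a\<^esub> \<one>\<^bsub>Fob F a\<^esub> = \<one>\<^bsub>Fob F a\<^esub>"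
    if "a \<in> Ob Sab" "x \<in> carrier (Fob F a)" "y \<in> carrier (Fob F a)" for a x y
    using that group.is_monoid[OF F'(2)] by (simp_all add: monoid.m_closed monoid.one_closed monoid.l_one)
  have oc: "\<one>\<^bsub>Fob F a\<^esub> \<in> carrier (Fob F a)" if "a \<in> Ob Sab" for a
    using group.is_monoid[OF F'(2)[OF that]] by (rule monoid.one_closed)
  have iin: "?i \<in> St_pre_hom F F"
    using C I n1 n2 q triv cl F'(6) by (auto simp: St_pre_hom_def nat_trans_def hom_def Fsub_def Fquot_def)
  have zin: "?z \<in> St_pre_hom F F"
    using C I n1 n2 q triv cl oc F'(7) by (auto simp: St_pre_hom_def nat_trans_def hom_def Fsub_def Fquot_def)
  have refl: "(?i, ?i) \<in> St_rel F F"
    by (rule St_relI[of _ _ _ _ _ _ _ _ ?C ?O]) (use iin C I n1 n2 oc in auto)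
  have "St_rel F F `` {?i} \<in> St_hom F F" "St_rel F F `` {?z} \<in> St_hom F F"
    using iin zin by (auto simp: St_hom_def quotient_def)
  then have "St_rel F F `` {?i} = St_rel F F `` {?z}"
    using zero F unfolding St_zero_def by blast
  with refl have "(?z, ?i) \<in> St_rel F F" by blast
  then obtain A B where A: "subfunctor Sab F A" "stably_null (Fquot F A)"
    and B: "subfunctor Sab F B" "stably_null (Fsub F B)"
    and eq: "\<And>a t. a \<in> Ob Sab \<Longrightarrow> t \<in> A a \<Longrightarrow> rep_of (Fob F a) (B a) \<one>\<^bsub>Fob F a\<^esub> = rep_of (Fob F a) (B a) t"
    unfolding St_rel_def by auto
  have AB: "t \<in> B a" if "a \<in> Ob Sab" "t \<in> A a" for a t
    using eq[OF that] normal.rep_of_one_iff[OF subfunctor_normal[OF F B(1) that(1)], of t] subfunctorD(3)[OF A(1) that]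
    by (simp add: quot_def)
  show ?thesis
    unfolding stably_null_iff[OF F]
  proof (intro ballI)
    fix a t assume a: "a \<in> Ob Sab" and t: "t \<in> carrier (Fob F a)"
    obtain b f where f: "b \<in> Ob Sab" "f \<in> Hom Sab a b" "Fmor F a b f t \<in> A b"
      using A(2)[unfolded stably_null_Fquot[OF F A(1)]] a t by blast
    then have "killed F b (Fmor F a b f t)"
      using AB B(2) by (auto simp: stably_null_Fsub[OF F B(1)])
    then show "killed F a t" using killed_Comp[OF F a f(1,2) t] by blast
  qed
qed

lemma St_zero_iff: "ab_functor Sab F \<Longrightarrow> St_zero F \<longleftrightarrow> stably_null F"
  using stably_null_imp_St_zero St_zero_imp_stably_null by blast

subsection \<open>Iterated differences\<close>

fun iter_delta :: "nat monoid list \<Rightarrow> 'b sfun \<Rightarrow> 'b sfun" where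
  "iter_delta [] F = F"
| "iter_delta (x # xs) F = iter_delta xs (delta x F)"

fun msum :: "nat monoid list \<Rightarrow> nat monoid \<Rightarrow> nat monoid" where
  "msum [] a = a"
| "msum (x # xs) a = dsum x (msum xs a)"

fun msum_mor :: "nat monoid list \<Rightarrow> nat monoid \<Rightarrow> nat monoid \<Rightarrow> split_mor \<Rightarrow> split_mor" where
  "msum_mor [] a b f = f"
| "msum_mor (x # xs) a b f = plus_mor x (msum xs a) (msum xs b) (msum_mor xs a b f)"

definition drop_nth :: "nat \<Rightarrow> 'a list \<Rightarrow> 'a list" where
  "drop_nth i xs = take i xs @ drop (Suc i) xs"

lemma drop_nth_simps [simp]:
  "drop_nth 0 (x # xs) = xs"
  "drop_nth (Suc i) (x # xs) = x # drop_nth i xs"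
  by (simp_all add: drop_nth_def)

lemma set_drop_nth: "set (drop_nth i xs) \<subseteq> set xs"
  unfolding drop_nth_def using set_take_subset set_drop_subset by fastforce

text \<open>Inclusion of the summands other than the \<open>i\<close>-th one.\<close>

fun skip_mor :: "nat \<Rightarrow> nat monoid list \<Rightarrow> nat monoid \<Rightarrow> split_mor" where
  "skip_mor 0 (x # xs) a = into_sum x (msum xs a)"
| "skip_mor (Suc i) (x # xs) a = plus_mor x (msum (drop_nth i xs) a) (msum xs a) (skip_mor i xs a)"
| "skip_mor _ [] a = undefined"

lemma msum_in_Ob: "set xs \<subseteq> Ob Sab \<Longrightarrow> a \<in> Ob Sab \<Longrightarrow> msum xs a \<in> Ob Sab"
  by (induction xs) (auto simp: dsum_in_Ob)

lemma msum_mor_in: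
  assumes "set xs \<subseteq> Ob Sab" "a \<in> Ob Sab" "b \<in> Ob Sab" "f \<in> Hom Sab a b"
  shows "msum_mor xs a b f \<in> Hom Sab (msum xs a) (msum xs b)"
  using assms by (induction xs) (auto simp: plus_mor_in msum_in_Ob)

lemma drop_nth_in_Ob: "set xs \<subseteq> Ob Sab \<Longrightarrow> a \<in> Ob Sab \<Longrightarrow> msum (drop_nth i xs) a \<in> Ob Sab"
  using set_drop_nth[of i xs] by (intro msum_in_Ob) auto

lemma skip_mor_in:
  assumes "set xs \<subseteq> Ob Sab" "a \<in> Ob Sab" "i < length xs"
  shows "skip_mor i xs a \<in> Hom Sab (msum (drop_nth i xs) a) (msum xs a)"
  using assms
proof (induction i xs a rule: skip_mor.induct)
  case (1 x xs a)
  then show ?case by (simp add: into_sum_in msum_in_Ob)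
next
  case (2 i x xs a)
  then show ?case by (simp add: plus_mor_in msum_in_Ob drop_nth_in_Ob)
qed auto

text \<open>The canonical surjection of F(x_1 + ... + x_k + a) onto the value at a of the iterated
  difference, one choice of representatives per summand.\<close>

fun proj :: "nat monoid list \<Rightarrow> 'b sfun \<Rightarrow> nat monoid \<Rightarrow> 'b \<Rightarrow> 'b" where
  "proj [] F a t = t"
| "proj (x # xs) F a t =
     proj xs (delta x F) a (rep_of (Fob F (dsum x (msum xs a))) (shift_im x F (msum xs a)) t)"

lemma ab_functor_iter_delta:
  "ab_functor Sab F \<Longrightarrow> set xs \<subseteq> Ob Sab \<Longrightarrow> ab_functor Sab (iter_delta xs F)"
  by (induction xs arbitrary: F) (auto simp: ab_functor_delta)

context
  fixes F :: "'b sfun" and x a :: "nat monoid"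
  assumes F: "ab_functor Sab F" and x: "x \<in> Ob Sab" and a: "a \<in> Ob Sab"
begin

lemma normal_shift_im: "normal (shift_im x F a) (Fob F (dsum x a))"
  using subfunctor_normal[OF ab_functor_shift[OF F x] subfunctor_shift_im[OF F x] a] by (simp add: shift_def)

lemma Fob_delta: "Fob (delta x F) a = quot (Fob F (dsum x a)) (shift_im x F a)"
  by (simp add: delta_def Fquot_def shift_def)

lemma Fmor_delta:
  "Fmor (delta x F) a b f t = rep_of (Fob F (dsum x b)) (shift_im x F b) (Fmor F (dsum x a) (dsum x b) (plus_mor x a b f) t)"
  by (simp add: delta_def Fquot_def shift_def)

lemma rep_of_delta_hom: "rep_of (Fob F (dsum x a)) (shift_im x F a) \<in> hom (Fob F (dsum x a)) (Fob (delta x F) a)"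
  unfolding Fob_delta using normal.rep_of_hom[OF normal_shift_im] .

lemma rep_of_delta_surj:
  "rep_of (Fob F (dsum x a)) (shift_im x F a) ` carrier (Fob F (dsum x a)) = carrier (Fob (delta x F) a)"
  unfolding Fob_delta by (simp add: quot_def)

lemma rep_of_delta_one:
  "t \<in> carrier (Fob F a) \<Longrightarrow> rep_of (Fob F (dsum x a)) (shift_im x F a) (to_shift x F a t) = \<one>\<^bsub>Fob (delta x F) a\<^esub>"
  unfolding Fob_delta
  using normal.rep_of_one_iff[OF normal_shift_im] to_shift_hom[OF F x a] by (auto simp: hom_def)

lemma rep_of_delta_natural:
  assumes b: "b \<in> Ob Sab" and f: "f \<in> Hom Sab a b" and t: "t \<in> carrier (Fob F (dsum x a))"
  shows "Fmor (delta x F) a b f (rep_of (Fob F (dsum x a)) (shift_im x F a) t)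
    = rep_of (Fob F (dsum x b)) (shift_im x F b) (Fmor F (dsum x a) (dsum x b) (plus_mor x a b f) t)"
proof -
  interpret a: normal "shift_im x F a" "Fob F (dsum x a)" by (rule normal_shift_im)
  interpret b: normal "shift_im x F b" "Fob F (dsum x b)"
    using subfunctor_normal[OF ab_functor_shift[OF F x] subfunctor_shift_im[OF F x] b] by (simp add: shift_def)
  let ?f = "Fmor F (dsum x a) (dsum x b) (plus_mor x a b f)"
  interpret f: group_hom "Fob F (dsum x a)" "Fob F (dsum x b)" ?f
    by unfold_locales (use ab_functorD(3)[OF F] x a b f in \<open>simp add: dsum_in_Ob plus_mor_in\<close>)
  obtain s where s: "s \<in> shift_im x F a" "rep_of (Fob F (dsum x a)) (shift_im x F a) t = s \<otimes>\<^bsub>Fob F (dsum x a)\<^esub> t"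
    using a.rep_of_obtain[OF t] .
  have "?f s \<in> shift_im x F b"
    using s(1) to_shift_natural[OF F x a b f] ab_functorD(6)[OF F a b f] by (auto simp flip: to_shift_natural[OF F x a b f])
  moreover have "?f (s \<otimes>\<^bsub>Fob F (dsum x a)\<^esub> t) \<otimes>\<^bsub>Fob F (dsum x b)\<^esub> inv\<^bsub>Fob F (dsum x b)\<^esub> ?f t = ?f s"
    using s(1) t a.mem_carrier[OF s(1)] by (simp add: b.m_assoc)
  ultimately show ?thesis
    unfolding Fmor_delta s(2) using b.rep_of_eq_iff s(1) t a.mem_carrier[OF s(1)] by simp
qed

end

lemma proj_hom:
  assumes "ab_functor Sab F" "set xs \<subseteq> Ob Sab" "a \<in> Ob Sab"
  shows "proj xs F a \<in> hom (Fob F (msum xs a)) (Fob (iter_delta xs F) a)"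
  using assms
proof (induction xs arbitrary: F)
  case Nil
  then show ?case by (simp add: hom_def)
next
  case (Cons x xs)
  have "proj xs (delta x F) a \<circ> rep_of (Fob F (dsum x (msum xs a))) (shift_im x F (msum xs a))
    \<in> hom (Fob F (dsum x (msum xs a))) (Fob (iter_delta xs (delta x F)) a)"
    using Cons by (intro hom_compose[OF rep_of_delta_hom Cons.IH]) (auto simp: msum_in_Ob ab_functor_delta)
  then show ?case by (simp add: o_def)
qed

lemma proj_surj:
  assumes "ab_functor Sab F" "set xs \<subseteq> Ob Sab" "a \<in> Ob Sab"
  shows "proj xs F a ` carrier (Fob F (msum xs a)) = carrier (Fob (iter_delta xs F) a)"
  using assms
proof (induction xs arbitrary: F)
  case Nil
  then show ?case by simp
next
  case (Cons x xs)
  then have "rep_of (Fob F (dsum x (msum xs a))) (shift_im x F (msum xs a)) ` carrier (Fob F (dsum x (msum xs a)))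
    = carrier (Fob (delta x F) (msum xs a))"
    by (intro rep_of_delta_surj) (auto simp: msum_in_Ob)
  with Cons.IH[of "delta x F"] Cons.prems show ?case
    by (simp add: ab_functor_delta flip: image_image)
qed

lemma proj_natural:
  assumes "ab_functor Sab F" "set xs \<subseteq> Ob Sab" "a \<in> Ob Sab" "b \<in> Ob Sab" "f \<in> Hom Sab a b"
    "t \<in> carrier (Fob F (msum xs a))"
  shows "Fmor (iter_delta xs F) a b f (proj xs F a t)
    = proj xs F b (Fmor F (msum xs a) (msum xs b) (msum_mor xs a b f) t)"
  using assms
proof (induction xs arbitrary: F t)
  case Nil
  then show ?case by simp
next
  case (Cons x xs)
  let ?r = "rep_of (Fob F (dsum x (msum xs a))) (shift_im x F (msum xs a))"
  have o: "x \<in> Ob Sab" "msum xs a \<in> Ob Sab" "msum xs b \<in> Ob Sab"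
    "msum_mor xs a b f \<in> Hom Sab (msum xs a) (msum xs b)"
    using Cons.prems by (auto simp: msum_in_Ob msum_mor_in)
  have "?r t \<in> carrier (Fob (delta x F) (msum xs a))"
    using rep_of_delta_hom[OF Cons.prems(1) o(1,2)] Cons.prems(6) by (auto simp: hom_def)
  then show ?case
    using Cons.IH[of "delta x F" "?r t"] Cons.prems rep_of_delta_natural[OF Cons.prems(1) o(1-4)]
    by (simp add: ab_functor_delta)
qed

text \<open>The quotient formed for the i-th summand is by the image of precisely this inclusion,
  and the quotients formed before it commute with the inclusion by naturality.\<close>

lemma proj_skip:
  assumes "ab_functor Sab F" "set xs \<subseteq> Ob Sab" "a \<in> Ob Sab" "i < length xs"
    "t \<in> carrier (Fob F (msum (drop_nth i xs) a))"
  shows "proj xs F a (Fmor F (msum (drop_nth i xs) a) (msum xs a) (skip_mor i xs a) t) = \<one>\<^bsub>Fob (iter_delta xs F) a\<^esub>"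
  using assms
proof (induction i xs a arbitrary: F t rule: skip_mor.induct)
  case (1 x xs a)
  have o: "x \<in> Ob Sab" "msum xs a \<in> Ob Sab" "set xs \<subseteq> Ob Sab" using 1 by (auto simp: msum_in_Ob)
  have "proj xs (delta x F) a \<one>\<^bsub>Fob (delta x F) (msum xs a)\<^esub> = \<one>\<^bsub>Fob (iter_delta xs (delta x F)) a\<^esub>"
    using 1 o ab_functorD(2)[OF ab_functor_delta] ab_functorD(2)[OF ab_functor_iter_delta[OF ab_functor_delta]]
    by (intro hom_one[OF proj_hom]) (auto simp: ab_functor_delta)
  then show ?case
    using rep_of_delta_one[OF 1(1) o(1,2)] 1 by (simp add: to_shift_def)
next
  case (2 i x xs a)
  let ?r = "rep_of (Fob F (dsum x (msum (drop_nth i xs) a))) (shift_im x F (msum (drop_nth i xs) a))"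
  have o: "x \<in> Ob Sab" "msum (drop_nth i xs) a \<in> Ob Sab" "msum xs a \<in> Ob Sab"
    "skip_mor i xs a \<in> Hom Sab (msum (drop_nth i xs) a) (msum xs a)"
    using 2 by (auto simp: msum_in_Ob drop_nth_in_Ob skip_mor_in)
  have t: "t \<in> carrier (Fob F (dsum x (msum (drop_nth i xs) a)))" using 2 by simp
  have "?r t \<in> carrier (Fob (delta x F) (msum (drop_nth i xs) a))"
    using rep_of_delta_hom[OF 2(2) o(1,2)] t by (auto simp: hom_def)
  then show ?case
    using 2(1)[of "delta x F" "?r t"] 2(2-) rep_of_delta_natural[OF 2(2) o(1-4) t]
    by (simp add: ab_functor_delta)
qed auto

text \<open>A representative of a class modulo a subgroup differs from the original element by an element
  of that subgroup, so a homomorphism that vanishes on the subgroup is also a homomorphism on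
  the quotient, without any change of the underlying function.\<close>

lemma proj_kernel:
  assumes "ab_functor Sab F" "set xs \<subseteq> Ob Sab" "a \<in> Ob Sab" "group M"
    and "g \<in> hom (Fob F (msum xs a)) M"
    and "\<And>i t. i < length xs \<Longrightarrow> t \<in> carrier (Fob F (msum (drop_nth i xs) a)) \<Longrightarrow>
      g (Fmor F (msum (drop_nth i xs) a) (msum xs a) (skip_mor i xs a) t) = \<one>\<^bsub>M\<^esub>"
    and "t \<in> carrier (Fob F (msum xs a))" "proj xs F a t = \<one>\<^bsub>Fob (iter_delta xs F) a\<^esub>"
  shows "g t = \<one>\<^bsub>M\<^esub>"
  using assms
proof (induction xs arbitrary: F t)
  case Nil
  then show ?case using hom_one[OF Nil(5)] ab_functorD(2)[OF Nil(1)] by simp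
next
  case (Cons x xs)
  note F = Cons.prems(1)
  have o: "x \<in> Ob Sab" "msum xs a \<in> Ob Sab" "set xs \<subseteq> Ob Sab"
    using Cons.prems by (auto simp: msum_in_Ob)
  let ?G = "Fob F (dsum x (msum xs a))" and ?H = "shift_im x F (msum xs a)"
  let ?r = "rep_of ?G ?H"
  interpret N: normal ?H ?G by (rule normal_shift_im[OF F o(1,2)])
  interpret g: group_hom ?G M g
    using Cons.prems(4,5) N.is_group by (simp add: group_hom_def group_hom_axioms_def)
  \<comment> \<open>The hypothesis for index 0 makes \<open>g\<close> trivial on the image of the
    canonical map of \<open>x\<close>, so \<open>g\<close> descends to the difference; the
    hypotheses for the indices i + 1 become those for the remaining list.\<close>
  have g0: "g h = \<one>\<^bsub>M\<^esub>" if "h \<in> ?H" for h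
    using that Cons.prems(6)[of 0] by (auto simp: to_shift_def)
  have gr: "g (?r s) = g s" if "s \<in> carrier ?G" for s
  proof -
    obtain h where h: "h \<in> ?H" "?r s = h \<otimes>\<^bsub>?G\<^esub> s" by (rule N.rep_of_obtain[OF \<open>s \<in> carrier ?G\<close>])
    then show ?thesis using g0 that N.mem_carrier by simp
  qed
  have "g \<in> hom (Fob (delta x F) (msum xs a)) M"
    unfolding Fob_delta[OF F o(1,2)]
  proof (rule homI)
    fix u v assume "u \<in> carrier (quot ?G ?H)" "v \<in> carrier (quot ?G ?H)"
    then have uv: "u \<in> carrier ?G" "v \<in> carrier ?G" using N.quot_carrierD(1) by auto
    then show "g u \<in> carrier M" by simp
    show "g (u \<otimes>\<^bsub>quot ?G ?H\<^esub> v) = g u \<otimes>\<^bsub>M\<^esub> g v"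
      using uv gr[of "u \<otimes>\<^bsub>?G\<^esub> v"] by (simp add: quot_def)
  qed
  moreover have "g (Fmor (delta x F) (msum (drop_nth i xs) a) (msum xs a) (skip_mor i xs a) s) = \<one>\<^bsub>M\<^esub>"
    if i: "i < length xs" and s: "s \<in> carrier (Fob (delta x F) (msum (drop_nth i xs) a))" for i s
  proof -
    have d: "msum (drop_nth i xs) a \<in> Ob Sab" using drop_nth_in_Ob o(3) Cons.prems(3) by blast
    have m: "skip_mor i xs a \<in> Hom Sab (msum (drop_nth i xs) a) (msum xs a)"
      using skip_mor_in o(3) Cons.prems(3) i by blast
    have s': "s \<in> carrier (Fob F (dsum x (msum (drop_nth i xs) a)))"
      using normal.quot_carrierD(1)[OF normal_shift_im[OF F o(1) d]] s by (simp add: Fob_delta[OF F o(1) d])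
    then show ?thesis
      using gr Cons.prems(6)[of "Suc i" s] i ab_functorD(6)[OF F dsum_in_Ob[OF o(1) d] dsum_in_Ob[OF o(1,2)] plus_mor_in[OF o(1) d o(2) m] s']
      by (simp add: Fmor_delta[OF F o(1) d])
  qed
  moreover have "?r t \<in> carrier (Fob (delta x F) (msum xs a))"
    using Cons.prems(7) rep_of_delta_hom[OF F o(1,2)] by (auto simp: hom_def)
  ultimately have "g (?r t) = \<one>\<^bsub>M\<^esub>"
    using Cons.IH[of "delta x F" "?r t"] Cons.prems o ab_functor_delta[OF F o(1)] by simp
  then show ?case using gr Cons.prems(7) by simp
qed

subsection \<open>The filtration by polynomial degree\<close>

text \<open>Each unfolding of \<open>Pol\<close> takes one difference and index -1 means stably
  null; hence k differences belong to index k - 1, and k = 0 covers the zero subcategory.\<close>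

lemma Pol_iff:
  assumes "ab_functor Sab F"
  shows "Pol (int k - 1) F \<longleftrightarrow> (\<forall>xs. length xs = k \<and> set xs \<subseteq> Ob Sab \<longrightarrow> stably_null (iter_delta xs F))"
  using assms
proof (induction k arbitrary: F)
  case 0
  then show ?case by (simp add: Pol.simps St_zero_iff)
next
  case (Suc k)
  have "Pol (int (Suc k) - 1) F \<longleftrightarrow> (\<forall>x\<in>Ob Sab. Pol (int k - 1) (delta x F))"
    by (simp add: Pol.simps[of "int k"])
  also have "\<dots> \<longleftrightarrow> (\<forall>x\<in>Ob Sab. \<forall>xs. length xs = k \<and> set xs \<subseteq> Ob Sab \<longrightarrow> stably_null (iter_delta (x # xs) F))"
    using Suc.IH[OF ab_functor_delta[OF Suc.prems]] by simp
  also have "\<dots> \<longleftrightarrow> (\<forall>xs. length xs = Suc k \<and> set xs \<subseteq> Ob Sab \<longrightarrow> stably_null (iter_delta xs F))"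
  proof (intro iffI allI impI ballI)
    fix x xs
    assume *: "\<forall>xs. length xs = Suc k \<and> set xs \<subseteq> Ob Sab \<longrightarrow> stably_null (iter_delta xs F)"
      and "x \<in> Ob Sab" "length xs = k \<and> set xs \<subseteq> Ob Sab"
    then show "stably_null (iter_delta (x # xs) F)"
      using spec[OF *, of "x # xs"] by simp
  qed (auto simp: length_Suc_conv)
  finally show ?case .
qed

text \<open>A class is represented by an element of F(x + a), which dies in F(y + x + a) for some y.
  After exchanging x and y it dies in F(x + y + a) under a morphism that comes from a \<rightarrow>
  y + a, and this one acts on the difference.\<close>

lemma stably_null_delta:
  assumes F: "ab_functor Sab F" and x: "x \<in> Ob Sab" and null: "stably_null F"
  shows "stably_null (delta x F)"
  unfolding stably_null_iff[OF ab_functor_delta[OF F x]]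
proof (intro ballI)
  fix a t assume a: "a \<in> Ob Sab" and t: "t \<in> carrier (Fob (delta x F) a)"
  note xa = dsum_in_Ob[OF x a]
  have t': "t \<in> carrier (Fob F (dsum x a))"
    using normal.quot_carrierD(1)[OF normal_shift_im[OF F x a]] t by (simp add: Fob_delta[OF F x a])
  then obtain y where y: "y \<in> Ob Sab" "to_shift y F (dsum x a) t = \<one>\<^bsub>Fob F (dsum y (dsum x a))\<^esub>"
    using null stably_null_iff[OF F] killed_into_sum[OF F xa] xa by blast
  note ya = dsum_in_Ob[OF y(1) a] and xya = dsum_in_Ob[OF x dsum_in_Ob[OF y(1) a]] and yxa = dsum_in_Ob[OF y(1) xa]
  obtain p where p: "p \<in> Hom Sab (dsum y (dsum x a)) (dsum x (dsum y a))"
    "Comp Sab (dsum x a) (dsum y (dsum x a)) (dsum x (dsum y a)) p (into_sum y (dsum x a))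
      = plus_mor x a (dsum y a) (into_sum y a)"
    by (rule into_sum_swap[OF x y(1) a])
  have "Fmor F (dsum x a) (dsum x (dsum y a)) (plus_mor x a (dsum y a) (into_sum y a)) t
    = \<one>\<^bsub>Fob F (dsum x (dsum y a))\<^esub>"
    using ab_functorD(5)[OF F xa yxa xya into_sum_in[OF y(1) xa] p(1) t'] y(2)
      ab_functorD(7)[OF F yxa xya p(1)] by (simp add: p(2) to_shift_def)
  moreover have "rep_of (Fob F (dsum x (dsum y a))) (shift_im x F (dsum y a)) \<one>\<^bsub>Fob F (dsum x (dsum y a))\<^esub>
    = \<one>\<^bsub>Fob (delta x F) (dsum y a)\<^esub>"
    by (simp add: Fob_delta[OF F x ya] quot_def)
  ultimately have "Fmor (delta x F) a (dsum y a) (into_sum y a) t = \<one>\<^bsub>Fob (delta x F) (dsum y a)\<^esub>"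
    by (simp add: Fmor_delta[OF F x a])
  then show "killed (delta x F) a t"
    using ya into_sum_in[OF y(1) a] unfolding killed_def by blast
qed

text \<open>Going up by one index is reduced by taking differences to the statement that differences
  of null functors are null; the functor has to vary in this induction.\<close>

lemma Pol_mono:
  assumes "ab_functor Sab F" "Pol (int k - 1) F" "k \<le> m"
  shows "Pol (int m - 1) F"
proof -
  have step: "Pol (int k - 1) F \<Longrightarrow> Pol (int k) F" if "ab_functor Sab F" for F :: "'b sfun" and k
    using that
  proof (induction k arbitrary: F)
    case 0
    then show ?case
      by (simp add: Pol.simps[of "-1"] Pol.simps[of 0] St_zero_iff ab_functor_delta stably_null_delta)
  next
    case (Suc k)
    then show ?case
      by (simp add: Pol.simps[of "int k"] Pol.simps[of "1 + int k"] ab_functor_delta)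
  qed
  show ?thesis
    using assms(3,2)
  proof (induction m rule: dec_induct)
    case (step m)
    then show ?case using \<open>\<And>k F. ab_functor Sab F \<Longrightarrow> Pol (int k - 1) F \<Longrightarrow> Pol (int k) F\<close>[OF assms(1), of m] by simp
  qed
qed

lemma weak_degreeI:
  assumes F: "ab_functor Sab F" and k: "Pol (int k) F" "\<not> Pol (int k - 1) F"
  shows "weakly_polynomial F \<and> weak_degree F = ereal (real k)"
proof -
  have "\<not> Pol (-1) F" using Pol_mono[OF F, of 0 k] k(2) by auto
  moreover have "(LEAST d :: nat. Pol (int d) F) = k"
  proof (rule Least_equality)
    fix d :: nat assume "Pol (int d) F"
    then show "k \<le> d" using Pol_mono[OF F, of "Suc d" k] k(2) by (cases "k \<le> d") auto
  qed (use k in simp)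
  ultimately show ?thesis using k(1) by (auto simp: weakly_polynomial_def weak_degree_def)
qed

section \<open>The lower central series\<close>

context group
begin

abbreviation commutator :: "'a \<Rightarrow> 'a \<Rightarrow> 'a" where
  "commutator x y \<equiv> x \<otimes> y \<otimes> inv x \<otimes> inv y"

lemma mult_inv_cancel [simp]:
  "x \<in> carrier G \<Longrightarrow> y \<in> carrier G \<Longrightarrow> inv x \<otimes> (x \<otimes> y) = y"
  "x \<in> carrier G \<Longrightarrow> y \<in> carrier G \<Longrightarrow> x \<otimes> (inv x \<otimes> y) = y"
  by (simp_all flip: m_assoc)

abbreviation lcs :: "nat \<Rightarrow> 'a set" where
  "lcs \<equiv> lower_central G"

lemma lcs_Suc:
  assumes "n \<ge> 1"
  shows "lcs (Suc n) = generate G {commutator x y | x y. x \<in> lcs n \<and> y \<in> carrier G}"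
proof -
  obtain m where "n = Suc m" using assms by (cases n) auto
  moreover have "(\<Union>x\<in>lcs n. \<Union>y\<in>carrier G. {commutator x y})
    = {commutator x y | x y. x \<in> lcs n \<and> y \<in> carrier G}" by auto
  ultimately show ?thesis by (simp add: lower_central.simps(3))
qed

declare lower_central.simps(3) [simp del]

lemma lcs_Suc_normal: "normal (lcs (Suc n)) G"
proof (induction n)
  case (Suc n)
  then interpret N: normal "lcs (Suc n)" G by simp
  have "generate G {commutator x y | x y. x \<in> lcs (Suc n) \<and> y \<in> carrier G} \<lhd> G"
  proof (rule normal_generateI)
    show "{commutator x y | x y. x \<in> lcs (Suc n) \<and> y \<in> carrier G} \<subseteq> carrier G" by auto
  next
    fix h g assume h: "h \<in> {commutator x y | x y. x \<in> lcs (Suc n) \<and> y \<in> carrier G}" and g: "g \<in> carrier G"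
    then obtain x y where xy: "x \<in> lcs (Suc n)" "y \<in> carrier G" "h = commutator x y" by auto
    have "g \<otimes> h \<otimes> inv g = commutator (g \<otimes> x \<otimes> inv g) (g \<otimes> y \<otimes> inv g)"
      using xy g by (simp add: m_assoc inv_mult_group)
    moreover have "g \<otimes> x \<otimes> inv g \<in> lcs (Suc n)" using N.inv_op_closed2 g xy(1) by blast
    ultimately show "g \<otimes> h \<otimes> inv g \<in> {commutator x y | x y. x \<in> lcs (Suc n) \<and> y \<in> carrier G}"
      using xy g by blast
  qed
  then show ?case using lcs_Suc[of "Suc n"] by simp
qed (simp add: normal_self)

lemma lcs_normal: "normal (lcs n) G"
  using lcs_Suc_normal by (cases n) (auto simp: normal_self)

lemma lcs_subgroup: "subgroup (lcs n) G"
  using lcs_normal normal_imp_subgroup by blast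

lemma lcs_carrier: "x \<in> lcs n \<Longrightarrow> x \<in> carrier G"
  using lcs_subgroup subgroup.mem_carrier by metis

lemma commutator_in_lcs:
  assumes "n \<ge> 1" "x \<in> lcs n" "y \<in> carrier G"
  shows "commutator x y \<in> lcs (Suc n)" "commutator y x \<in> lcs (Suc n)"
proof -
  show c: "commutator x y \<in> lcs (Suc n)"
    unfolding lcs_Suc[OF assms(1)] using assms(2,3) by (auto intro: generate.incl)
  have "commutator y x = inv (commutator x y)"
    using lcs_carrier[OF assms(2)] assms(3) by (simp add: m_assoc inv_mult_group)
  then show "commutator y x \<in> lcs (Suc n)"
    using c subgroup.m_inv_closed[OF lcs_subgroup] by simp
qed

lemma lcs_Suc_subset: "lcs (Suc n) \<subseteq> lcs n"
proof (cases "n = 0")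
  case False
  interpret N: normal "lcs n" G by (rule lcs_normal)
  have "commutator x y \<in> lcs n" if "x \<in> lcs n" "y \<in> carrier G" for x y
  proof -
    have "x \<otimes> (y \<otimes> inv x \<otimes> inv y) \<in> lcs n"
      using that N.inv_op_closed2 by simp
    then show ?thesis using that by (simp add: m_assoc)
  qed
  then have "{commutator x y | x y. x \<in> lcs n \<and> y \<in> carrier G} \<subseteq> lcs n" by blast
  then show ?thesis
    using lcs_Suc[of n] False generate_subgroup_incl[OF _ lcs_subgroup] by simp
qed simp

lemma lcs_mono: "m \<le> n \<Longrightarrow> lcs n \<subseteq> lcs m"
  using lift_Suc_antimono_le[of lcs m n] lcs_Suc_subset by blast

abbreviation lcs_group :: "nat \<Rightarrow> 'a monoid" where
  "lcs_group n \<equiv> \<lparr>carrier = lcs n, monoid.mult = (\<otimes>), one = \<one>\<rparr>"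

text \<open>The graded piece \<open>\<gamma>\<^sub>n / \<gamma>\<^sub>n\<^sub>+\<^sub>1\<close>, with cosets represented by elements of the group.\<close>

definition gr :: "nat \<Rightarrow> 'a monoid" where
  "gr n = quot (lcs_group n) (lcs (Suc n))"

definition cl :: "nat \<Rightarrow> 'a \<Rightarrow> 'a" where
  "cl n = rep_of (lcs_group n) (lcs (Suc n))"

lemma group_lcs: "group (lcs_group n)"
proof -
  have "group ((\<lparr>carrier = carrier G, monoid.mult = (\<otimes>), one = \<one>\<rparr>)\<lparr>carrier := lcs n\<rparr>)"
  proof (rule subgroup.subgroup_is_group)
    show "group \<lparr>carrier = carrier G, monoid.mult = (\<otimes>), one = \<one>\<rparr>"
      by (rule groupI) (auto simp: m_assoc intro: bexI[of _ "inv _"])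
    show "subgroup (lcs n) \<lparr>carrier = carrier G, monoid.mult = (\<otimes>), one = \<one>\<rparr>"
      using lcs_subgroup[of n] by (auto simp: subgroup_def m_inv_def)
  qed
  then show ?thesis by simp
qed

lemma inv_lcs_group: "x \<in> lcs n \<Longrightarrow> inv\<^bsub>lcs_group n\<^esub> x = inv x"
  using group.inv_equality[OF group_lcs[of n], of "inv x" x] subgroup.m_inv_closed[OF lcs_subgroup]
  by (simp add: lcs_carrier)

lemma normal_lcs_group: "normal (lcs (Suc n)) (lcs_group n)"
proof (rule group.normal_invI[OF group_lcs])
  interpret N: normal "lcs (Suc n)" G by (rule lcs_normal)
  show "subgroup (lcs (Suc n)) (lcs_group n)"
    using lcs_Suc_subset[of n] inv_lcs_group[of _ n] by (auto simp: subgroup_def subset_iff)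
  fix x h assume "x \<in> carrier (lcs_group n)" "h \<in> lcs (Suc n)"
  then show "x \<otimes>\<^bsub>lcs_group n\<^esub> h \<otimes>\<^bsub>lcs_group n\<^esub> inv\<^bsub>lcs_group n\<^esub> x \<in> lcs (Suc n)"
    using inv_lcs_group N.inv_op_closed2 lcs_carrier by simp
qed

lemma group_gr: "group (gr n)"
  unfolding gr_def using normal.group_quot[OF normal_lcs_group] .

lemma cl_hom: "cl n \<in> hom (lcs_group n) (gr n)"
  unfolding gr_def cl_def using normal.rep_of_hom[OF normal_lcs_group] .

lemma cl_mult: "x \<in> lcs n \<Longrightarrow> y \<in> lcs n \<Longrightarrow> cl n (x \<otimes> y) = cl n x \<otimes>\<^bsub>gr n\<^esub> cl n y"
  using hom_mult[OF cl_hom] by simp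

lemma cl_closed: "x \<in> lcs n \<Longrightarrow> cl n x \<in> carrier (gr n)"
  using cl_hom by (auto simp: hom_def)

lemma cl_one_iff: "x \<in> lcs n \<Longrightarrow> cl n x = \<one>\<^bsub>gr n\<^esub> \<longleftrightarrow> x \<in> lcs (Suc n)"
  unfolding gr_def cl_def using normal.rep_of_one_iff[OF normal_lcs_group] by simp

lemma cl_eq_iff: "x \<in> lcs n \<Longrightarrow> y \<in> lcs n \<Longrightarrow> cl n x = cl n y \<longleftrightarrow> x \<otimes> inv y \<in> lcs (Suc n)"
  unfolding cl_def using normal.rep_of_eq_iff[OF normal_lcs_group] inv_lcs_group by simp

lemma gr_carrier: "carrier (gr n) = cl n ` lcs n"
  by (simp add: gr_def cl_def quot_def)

lemma comm_group_gr:
  assumes "n \<ge> 1"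
  shows "comm_group (gr n)"
proof (rule group.group_comm_groupI[OF group_gr])
  fix s t assume "s \<in> carrier (gr n)" "t \<in> carrier (gr n)"
  then obtain x y where xy: "x \<in> lcs n" "y \<in> lcs n" "s = cl n x" "t = cl n y" by (auto simp: gr_carrier)
  have "x \<otimes> y \<in> lcs n" "y \<otimes> x \<in> lcs n" using xy subgroup.m_closed[OF lcs_subgroup] by auto
  moreover have "x \<otimes> y \<otimes> inv (y \<otimes> x) \<in> lcs (Suc n)"
    using commutator_in_lcs(1)[OF assms xy(1), of y] xy lcs_carrier by (simp add: inv_mult_group m_assoc)
  ultimately show "s \<otimes>\<^bsub>gr n\<^esub> t = t \<otimes>\<^bsub>gr n\<^esub> s"
    using xy cl_eq_iff by (simp flip: cl_mult)
qed

text \<open>The commutator induces a bilinear map \<open>\<gamma>\<^sub>n / \<gamma>\<^sub>n\<^sub>+\<^sub>1 \<times> \<gamma>\<^sub>1 / \<gamma>\<^sub>2 \<rightarrow> \<gamma>\<^sub>n\<^sub>+\<^sub>1 / \<gamma>\<^sub>n\<^sub>+\<^sub>2\<close>.\<close>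

lemma cl_commutator_left:
  assumes n: "n \<ge> 1" and x: "x \<in> lcs n" and x': "x' \<in> lcs n" and y: "y \<in> carrier G"
  shows "cl (Suc n) (commutator (x \<otimes> x') y)
    = cl (Suc n) (commutator x y) \<otimes>\<^bsub>gr (Suc n)\<^esub> cl (Suc n) (commutator x' y)"
proof -
  interpret L: comm_group "gr (Suc n)" by (rule comm_group_gr) simp
  let ?d = "commutator x' y"
  have c: "x \<in> carrier G" "x' \<in> carrier G" using x x' lcs_carrier by auto
  have d: "?d \<in> lcs (Suc n)" "commutator x y \<in> lcs (Suc n)" using commutator_in_lcs(1)[OF n] x x' y by auto
  have xd: "commutator x ?d \<in> lcs (Suc (Suc n))"
    using commutator_in_lcs(2)[OF _ d(1) c(1)] by simp
  then have xd': "commutator x ?d \<in> lcs (Suc n)" using lcs_Suc_subset by blast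
  \<comment> \<open>With d = [x', y] the left side is the conjugate of d by x times [x, y];
    conjugating d costs only [x, d], which lies in gamma_{n+2}.\<close>
  have "commutator (x \<otimes> x') y = commutator x ?d \<otimes> (?d \<otimes> commutator x y)"
    using c y by (simp add: m_assoc inv_mult_group)
  then have "cl (Suc n) (commutator (x \<otimes> x') y)
    = cl (Suc n) (commutator x ?d) \<otimes>\<^bsub>gr (Suc n)\<^esub> (cl (Suc n) ?d \<otimes>\<^bsub>gr (Suc n)\<^esub> cl (Suc n) (commutator x y))"
    using cl_mult xd' d subgroup.m_closed[OF lcs_subgroup] by metis
  also have "cl (Suc n) (commutator x ?d) = \<one>\<^bsub>gr (Suc n)\<^esub>" using cl_one_iff xd xd' by blast
  finally show ?thesis using cl_closed d L.m_comm by simp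
qed

text \<open>The mirror image of additivity on the left: [x, yy'] is [x, y] times the conjugate by y
  of e = [x, y'], and the conjugation costs [y, e] in gamma_{n+2}.\<close>

lemma cl_commutator_right:
  assumes n: "n \<ge> 1" and x: "x \<in> lcs n" and y: "y \<in> carrier G" and y': "y' \<in> carrier G"
  shows "cl (Suc n) (commutator x (y \<otimes> y'))
    = cl (Suc n) (commutator x y) \<otimes>\<^bsub>gr (Suc n)\<^esub> cl (Suc n) (commutator x y')"
proof -
  interpret L: comm_group "gr (Suc n)" by (rule comm_group_gr) simp
  let ?e = "commutator x y'"
  have c: "x \<in> carrier G" using x lcs_carrier by auto
  have e: "?e \<in> lcs (Suc n)" "commutator x y \<in> lcs (Suc n)" using commutator_in_lcs(1)[OF n] x y y' by auto
  have ye: "commutator y ?e \<in> lcs (Suc (Suc n))"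
    using commutator_in_lcs(2)[OF _ e(1) y] by simp
  then have ye': "commutator y ?e \<in> lcs (Suc n)" using lcs_Suc_subset by blast
  have "commutator x (y \<otimes> y') = commutator x y \<otimes> (commutator y ?e \<otimes> ?e)"
    using c y y' by (simp add: m_assoc inv_mult_group)
  then have "cl (Suc n) (commutator x (y \<otimes> y'))
    = cl (Suc n) (commutator x y) \<otimes>\<^bsub>gr (Suc n)\<^esub> (cl (Suc n) (commutator y ?e) \<otimes>\<^bsub>gr (Suc n)\<^esub> cl (Suc n) ?e)"
    using cl_mult ye' e subgroup.m_closed[OF lcs_subgroup] by metis
  also have "cl (Suc n) (commutator y ?e) = \<one>\<^bsub>gr (Suc n)\<^esub>" using cl_one_iff ye ye' by blast
  finally show ?thesis using cl_closed e by simp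
qed

text \<open>The class of [x, y] is a homomorphism in y with values in an abelian group, so it is
  trivial on commutators and on what they generate.\<close>

lemma cl_commutator_lcs2:
  assumes n: "n \<ge> 1" and x: "x \<in> lcs n" and b: "b \<in> lcs 2"
  shows "cl (Suc n) (commutator x b) = \<one>\<^bsub>gr (Suc n)\<^esub>"
proof -
  interpret L: comm_group "gr (Suc n)" by (rule comm_group_gr) simp
  interpret h: group_hom G "gr (Suc n)" "\<lambda>y. cl (Suc n) (commutator x y)"
  proof
    show "(\<lambda>y. cl (Suc n) (commutator x y)) \<in> hom G (gr (Suc n))"
      using cl_commutator_right[OF n x] cl_closed commutator_in_lcs(1)[OF n x] by (auto simp: hom_def)
  qed
  have "b \<in> generate G {commutator u v | u v. u \<in> carrier G \<and> v \<in> carrier G}"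
    using b lcs_Suc[of 1] by (simp add: numeral_2_eq_2)
  moreover have "{commutator u v | u v. u \<in> carrier G \<and> v \<in> carrier G} \<subseteq> kernel G (gr (Suc n)) (\<lambda>y. cl (Suc n) (commutator x y))"
  proof
    fix w assume "w \<in> {commutator u v | u v. u \<in> carrier G \<and> v \<in> carrier G}"
    then obtain u v where w: "w = commutator u v" "u \<in> carrier G" "v \<in> carrier G" by auto
    have "cl (Suc n) (commutator x w) = \<one>\<^bsub>gr (Suc n)\<^esub>"
    proof -
      let ?h = "\<lambda>y. cl (Suc n) (commutator x y)"
      have "?h w = ?h u \<otimes>\<^bsub>gr (Suc n)\<^esub> ?h v \<otimes>\<^bsub>gr (Suc n)\<^esub> inv\<^bsub>gr (Suc n)\<^esub> ?h u \<otimes>\<^bsub>gr (Suc n)\<^esub> inv\<^bsub>gr (Suc n)\<^esub> ?h v"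
        using h.hom_mult h.hom_inv w by (metis inv_closed m_closed)
      then show ?thesis using h.hom_closed[OF w(2)] h.hom_closed[OF w(3)] by (simp add: L.m_comm L.m_assoc)
    qed
    with w show "w \<in> kernel G (gr (Suc n)) (\<lambda>y. cl (Suc n) (commutator x y))" by (simp add: kernel_def)
  qed
  ultimately have "b \<in> kernel G (gr (Suc n)) (\<lambda>y. cl (Suc n) (commutator x y))"
    using generate_subgroup_incl[OF _ h.subgroup_kernel] by blast
  then show ?thesis by (simp add: kernel_def)
qed

lemma cl_commutator_lcs_Suc:
  assumes "n \<ge> 1" "x \<in> lcs (Suc n)" "y \<in> carrier G"
  shows "cl (Suc n) (commutator x y) = \<one>\<^bsub>gr (Suc n)\<^esub>"
  using commutator_in_lcs(1)[OF _ assms(2,3)] lcs_Suc_subset[of "Suc n"] cl_one_iff by auto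

text \<open>This set is the equaliser of \<open>h\<close> and the identity modulo \<open>N\<close>.
  It allows a congruence between \<open>h\<close> and the identity to be checked on
  generators.\<close>

lemma hom_diff_subgroup:
  assumes h: "h \<in> hom G G" and N: "N \<lhd> G"
  shows "subgroup {z \<in> carrier G. h z \<otimes> inv z \<in> N} G"
proof -
  interpret N: normal N G by fact
  interpret h: group_hom G G h by unfold_locales (rule h)
  show ?thesis
  proof
    fix x y assume xy: "x \<in> {z \<in> carrier G. h z \<otimes> inv z \<in> N}" "y \<in> {z \<in> carrier G. h z \<otimes> inv z \<in> N}"
    then have "h (x \<otimes> y) \<otimes> inv (x \<otimes> y) = (h x \<otimes> (h y \<otimes> inv y) \<otimes> inv (h x)) \<otimes> (h x \<otimes> inv x)"
      by (simp add: m_assoc inv_mult_group)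
    then show "x \<otimes> y \<in> {z \<in> carrier G. h z \<otimes> inv z \<in> N}"
      using xy N.inv_op_closed2 by simp
  next
    fix x assume x: "x \<in> {z \<in> carrier G. h z \<otimes> inv z \<in> N}"
    have "h (inv x) \<otimes> inv (inv x) = inv (h x) \<otimes> inv (h x \<otimes> inv x) \<otimes> h x"
      using x by (simp add: m_assoc inv_mult_group)
    moreover have "inv (h x) \<otimes> inv (h x \<otimes> inv x) \<otimes> h x \<in> N"
      using x by (intro N.inv_op_closed1) auto
    ultimately show "inv x \<in> {z \<in> carrier G. h z \<otimes> inv z \<in> N}"
      using x by simp
  qed auto
qed

text \<open>Bilinearity: [ax, by] and [x, y] agree modulo gamma_{m+2} if x is in gamma_m, a in
  gamma_{m+1} and b in gamma_2. So triviality on the abelianisation spreads to all graded pieces,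
  which makes the Johnson homomorphism additive.\<close>

lemma trivial_on_graded:
  assumes h: "h \<in> hom G G" and h2: "\<And>g. g \<in> carrier G \<Longrightarrow> h g \<otimes> inv g \<in> lcs 2"
    and m: "m \<ge> 1" and z: "z \<in> lcs m"
  shows "h z \<otimes> inv z \<in> lcs (Suc m)"
  using m z
proof (induction m arbitrary: z rule: dec_induct)
  case base
  then show ?case using h2 by (simp add: numeral_2_eq_2)
next
  case (step m)
  interpret h: group_hom G G h by unfold_locales (rule h)
  interpret L: comm_group "gr (Suc m)" by (rule comm_group_gr) simp
  let ?Z = "{z \<in> carrier G. h z \<otimes> inv z \<in> lcs (Suc (Suc m))}"
  have "commutator x y \<in> ?Z" if x: "x \<in> lcs m" and y: "y \<in> carrier G" for x y
  proof -
    note xc = lcs_carrier[OF x]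
    define a b where "a = h x \<otimes> inv x" and "b = h y \<otimes> inv y"
    have a: "a \<in> lcs (Suc m)" and b: "b \<in> lcs 2" unfolding a_def b_def using step.IH x h2 y by auto
    have ab: "a \<in> carrier G" "b \<in> carrier G" using a b lcs_carrier by auto
    have hx: "h x = a \<otimes> x" and hy: "h y = b \<otimes> y" using xc y by (simp_all add: a_def b_def m_assoc)
    have a': "a \<in> lcs m" using a lcs_Suc_subset by blast
    have c: "commutator x y \<in> lcs (Suc m)" by (rule commutator_in_lcs(1)[OF step.hyps(1) x y])
    have hxm: "h x \<in> lcs m" unfolding hx using a' x subgroup.m_closed[OF lcs_subgroup] by blast
    have hc: "commutator (h x) (h y) \<in> lcs (Suc m)" using commutator_in_lcs(1)[OF step.hyps(1) hxm] y by simp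
    have "cl (Suc m) (commutator (h x) (h y)) = cl (Suc m) (commutator x y)"
      unfolding hx hy
      using cl_commutator_left[OF step.hyps(1) a' x, of "b \<otimes> y"] cl_commutator_lcs_Suc[OF step.hyps(1) a, of "b \<otimes> y"]
        cl_commutator_right[OF step.hyps(1) x ab(2) y] cl_commutator_lcs2[OF step.hyps(1) x b] ab y cl_closed[OF c]
      by simp
    then have "commutator (h x) (h y) \<otimes> inv (commutator x y) \<in> lcs (Suc (Suc m))"
      using cl_eq_iff[OF hc c] by blast
    then show ?thesis using xc y by simp
  qed
  then have "generate G {commutator x y | x y. x \<in> lcs m \<and> y \<in> carrier G} \<subseteq> ?Z"
    by (intro generate_subgroup_incl hom_diff_subgroup[OF h lcs_normal]) auto
  then show ?case using step.prems lcs_Suc[OF step.hyps(1)] by auto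
qed

text \<open>The commutators [...[s_1, s_2], ..., s_n] with entries in \<open>S\<close>; the value at
  0 is a dummy. They take the place of the elementary tensors.\<close>

fun left_normed :: "'a set \<Rightarrow> nat \<Rightarrow> 'a set" where
  "left_normed S 0 = {}"
| "left_normed S (Suc 0) = S"
| "left_normed S (Suc (Suc n)) = {commutator c s | c s. c \<in> left_normed S (Suc n) \<and> s \<in> S}"

lemma left_normed_Suc:
  "n \<ge> 1 \<Longrightarrow> left_normed S (Suc n) = {commutator c s | c s. c \<in> left_normed S n \<and> s \<in> S}"
  by (cases n) auto

lemma left_normed_lcs:
  assumes "S \<subseteq> carrier G" "n \<ge> 1"
  shows "left_normed S n \<subseteq> lcs n"
  using assms(2)
proof (induction n rule: dec_induct)
  case (step n)
  then show ?case
    using commutator_in_lcs(1)[OF step.hyps(1)] assms(1) unfolding left_normed_Suc[OF step.hyps(1)] by blast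
qed (use assms(1) in simp)

lemma hom_preimage_subgroup:
  assumes "group L" "h \<in> hom K L" "group K" "subgroup Z L"
  shows "subgroup {x \<in> carrier K. h x \<in> Z} K"
proof -
  interpret L: group L by fact
  interpret Z: subgroup Z L by fact
  interpret h: group_hom K L h using assms by (simp add: group_hom_def group_hom_axioms_def L.is_group)
  show ?thesis by (rule subgroup.intro) auto
qed

text \<open>The bracket is linear in both arguments: with the last letter fixed, x may be replaced
  by left-normed commutators, and then the last argument by elements of \<open>S\<close>. The
  subgroup \<open>Z\<close> is arbitrary so that the induction hypothesis applies to its preimage
  under x \<mapsto> [x, s].\<close>

lemma gr_generated:
  assumes S: "S \<subseteq> carrier G" "generate G S = carrier G" and n: "n \<ge> 1"
    and Z: "subgroup Z (gr n)" and SZ: "cl n ` left_normed S n \<subseteq> Z" and z: "z \<in> lcs n"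
  shows "cl n z \<in> Z"
  using n Z SZ z
proof (induction n arbitrary: Z z rule: dec_induct)
  case base
  have "subgroup {x \<in> carrier (lcs_group 1). cl 1 x \<in> Z} (lcs_group 1)"
    by (rule hom_preimage_subgroup[OF group_gr cl_hom group_lcs base(1)])
  then have "subgroup {x \<in> carrier G. cl 1 x \<in> Z} G"
    using inv_lcs_group[of _ 1] by (auto simp: subgroup_def)
  then have "generate G S \<subseteq> {x \<in> carrier G. cl 1 x \<in> Z}"
    by (intro generate_subgroup_incl) (use S base in auto)
  then show ?case using S base by auto
next
  case (step n)
  interpret L: comm_group "gr (Suc n)" by (rule comm_group_gr) simp
  interpret Z: subgroup Z "gr (Suc n)" by (rule step.prems(1))
  have 1: "cl (Suc n) (commutator x s) \<in> Z" if x: "x \<in> lcs n" and s: "s \<in> S" for x s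
  proof -
    have sc: "s \<in> carrier G" using s S by blast
    let ?h = "\<lambda>x. cl (Suc n) (commutator x s)"
    have hom: "?h \<in> hom (lcs_group n) (gr (Suc n))"
      using cl_commutator_left[OF step.hyps(1)] cl_closed commutator_in_lcs(1)[OF step.hyps(1) _ sc] sc
      by (auto simp: hom_def)
    interpret h: group_hom "lcs_group n" "gr (Suc n)" ?h
      using hom group_lcs L.is_group by (simp add: group_hom_def group_hom_axioms_def)
    interpret N: normal "lcs (Suc n)" "lcs_group n" by (rule normal_lcs_group)
    \<comment> \<open>The map is trivial on gamma_{n+1}, so it takes the same value on an element
      and on the representative of its class, and descends without change.\<close>
    have hr: "?h (cl n x) = ?h x" if xl: "x \<in> lcs n" for x
    proof -
      obtain k where k: "k \<in> lcs (Suc n)" "cl n x = k \<otimes> x"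
        by (rule N.rep_of_obtain[of x]) (use xl in \<open>auto simp: cl_def\<close>)
      then show ?thesis
        using cl_commutator_left[OF step.hyps(1) _ xl sc, of k] cl_commutator_lcs_Suc[OF step.hyps(1) k(1) sc]
          lcs_Suc_subset[of n] h.hom_closed[of x] xl by auto
    qed
    have "?h \<in> hom (gr n) (gr (Suc n))"
    proof (rule homI)
      fix u v assume "u \<in> carrier (gr n)" "v \<in> carrier (gr n)"
      then have uv: "u \<in> lcs n" "v \<in> lcs n" using N.quot_carrierD(1) by (auto simp: gr_def)
      then show "?h u \<in> carrier (gr (Suc n))" using h.hom_closed by simp
      have "u \<otimes> v \<in> lcs n" using uv subgroup.m_closed[OF lcs_subgroup] by blast
      from hr[OF this] show "?h (u \<otimes>\<^bsub>gr n\<^esub> v) = ?h u \<otimes>\<^bsub>gr (Suc n)\<^esub> ?h v"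
        using uv h.hom_mult[of u v] by (simp add: gr_def quot_def cl_def)
    qed
    then have "subgroup {w \<in> carrier (gr n). ?h w \<in> Z} (gr n)"
      by (rule hom_preimage_subgroup[OF L.is_group _ group_gr step.prems(1)])
    moreover have "cl n ` left_normed S n \<subseteq> {w \<in> carrier (gr n). ?h w \<in> Z}"
    proof
      fix w assume "w \<in> cl n ` left_normed S n"
      then obtain c where c: "c \<in> left_normed S n" "w = cl n c" by blast
      then have "c \<in> lcs n" using left_normed_lcs[OF S(1) step.hyps(1)] by blast
      moreover have "commutator c s \<in> left_normed S (Suc n)"
        using c(1) s left_normed_Suc[OF step.hyps(1)] by blast
      then have "cl (Suc n) (commutator c s) \<in> Z" using step.prems(2) by blast
      ultimately show "w \<in> {w \<in> carrier (gr n). ?h w \<in> Z}"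
        using c hr cl_closed by auto
    qed
    ultimately have "cl n x \<in> {w \<in> carrier (gr n). ?h w \<in> Z}"
      by (rule step.IH[OF _ _ x])
    then show ?thesis using hr[OF x] by simp
  qed
  \<comment> \<open>Now x is fixed and the second argument ranges over the group generated by
    \<open>S\<close>.\<close>
  have 2: "cl (Suc n) (commutator x y) \<in> Z" if x: "x \<in> lcs n" and y: "y \<in> carrier G" for x y
  proof -
    have "(\<lambda>y. cl (Suc n) (commutator x y)) \<in> hom G (gr (Suc n))"
      using cl_commutator_right[OF step.hyps(1) x] cl_closed commutator_in_lcs(1)[OF step.hyps(1) x] by (auto simp: hom_def)
    then have "subgroup {y \<in> carrier G. cl (Suc n) (commutator x y) \<in> Z} G"
      by (rule hom_preimage_subgroup[OF L.is_group _ is_group step.prems(1)])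
    then have "generate G S \<subseteq> {y \<in> carrier G. cl (Suc n) (commutator x y) \<in> Z}"
      by (rule generate_subgroup_incl[rotated]) (use S 1 x in auto)
    then show ?thesis using y S by auto
  qed
  have "subgroup {x \<in> carrier (lcs_group (Suc n)). cl (Suc n) x \<in> Z} (lcs_group (Suc n))"
    by (rule hom_preimage_subgroup[OF L.is_group cl_hom group_lcs step.prems(1)])
  then have "subgroup {x \<in> lcs (Suc n). cl (Suc n) x \<in> Z} G"
    using inv_lcs_group[of _ "Suc n"] lcs_carrier[of _ "Suc n"] by (auto simp: subgroup_def)
  then have "generate G {commutator x y | x y. x \<in> lcs n \<and> y \<in> carrier G} \<subseteq> {x \<in> lcs (Suc n). cl (Suc n) x \<in> Z}"
    by (intro generate_subgroup_incl) (use 2 commutator_in_lcs(1)[OF step.hyps(1)] in auto)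
  then show ?case using step.prems(3) lcs_Suc[OF step.hyps(1)] by blast
qed

end

lemma hom_lower_central:
  assumes "group G" "group H" "h \<in> hom G H"
  shows "h ` lower_central G n \<subseteq> lower_central H n"
proof -
  interpret h: group_hom G H h using assms by (simp add: group_hom_def group_hom_axioms_def)
  have "h ` lower_central G (Suc n) \<subseteq> lower_central H (Suc n)" for n
  proof (induction n)
    case (Suc n)
    have "h ` h.G.lcs (Suc (Suc n))
      = generate H (h ` {x \<otimes>\<^bsub>G\<^esub> y \<otimes>\<^bsub>G\<^esub> inv\<^bsub>G\<^esub> x \<otimes>\<^bsub>G\<^esub> inv\<^bsub>G\<^esub> y | x y. x \<in> h.G.lcs (Suc n) \<and> y \<in> carrier G})"
      unfolding h.G.lcs_Suc[of "Suc n", OF le_add1[of 1 n, unfolded plus_1_eq_Suc]]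
      by (rule h.generate_img[symmetric]) (use h.G.lcs_carrier in auto)
    also have "\<dots> \<subseteq> h.H.lcs (Suc (Suc n))"
    proof (rule h.H.generate_subgroup_incl[OF _ h.H.lcs_subgroup], safe)
      fix x y assume xy: "x \<in> h.G.lcs (Suc n)" "y \<in> carrier G"
      then have "h (h.G.commutator x y) = h.H.commutator (h x) (h y)"
        using h.G.lcs_carrier by simp
      then show "h (h.G.commutator x y) \<in> h.H.lcs (Suc (Suc n))"
        using h.H.commutator_in_lcs(1)[of "Suc n" "h x" "h y"] Suc xy by auto
    qed
    finally show ?case .
  qed auto
  then show ?thesis by (cases n) auto
qed

section \<open>Free groups\<close>

definition reduced :: "('a \<times> bool) list \<Rightarrow> bool" where
  "reduced ws \<longleftrightarrow> successively (\<lambda>(b, e) (c, e'). \<not> (b = c \<and> e \<noteq> e')) ws"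

lemma reduced_simps [simp]:
  "reduced []" "reduced [a]"
  "reduced (a # c # cs) \<longleftrightarrow> \<not> (fst a = fst c \<and> snd a \<noteq> snd c) \<and> reduced (c # cs)"
  by (auto simp: reduced_def split: prod.splits)

lemma reduced_tl: "reduced (a # w) \<Longrightarrow> reduced w"
  by (cases w) auto

lemma reduced_append:
  "u \<noteq> [] \<Longrightarrow> v \<noteq> [] \<Longrightarrow> reduced (u @ v) \<longleftrightarrow>
     reduced u \<and> reduced v \<and> \<not> (fst (last u) = fst (hd v) \<and> snd (last u) \<noteq> snd (hd v))"
  by (auto simp: reduced_def successively_append_iff case_prod_beta)

definition letters_in :: "'a set \<Rightarrow> ('a \<times> bool) list \<Rightarrow> bool" where
  "letters_in B ws \<longleftrightarrow> fst ` set ws \<subseteq> B"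

lemma letters_in_simps [simp]:
  "letters_in B []" "letters_in B (a # ws) \<longleftrightarrow> fst a \<in> B \<and> letters_in B ws" "letters_in B (u @ v) \<longleftrightarrow> letters_in B u \<and> letters_in B v"
  by (auto simp: letters_in_def)

lemma letters_in_mono: "letters_in B ws \<Longrightarrow> B \<subseteq> C \<Longrightarrow> letters_in C ws"
  by (auto simp: letters_in_def)

lemma letters_in_map: "letters_in B ws \<Longrightarrow> f \<in> B \<rightarrow> C \<Longrightarrow> letters_in C (map (apfst f) ws)"
  by (induction ws) auto

lemma letters_in_hd_last: "letters_in B ws \<Longrightarrow> ws \<noteq> [] \<Longrightarrow> fst (hd ws) \<in> B \<and> fst (last ws) \<in> B"
  by (auto simp: letters_in_def)

definition push :: "'a \<times> bool \<Rightarrow> ('a \<times> bool) list \<Rightarrow> ('a \<times> bool) list" where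
  "push a r = (case r of [] \<Rightarrow> [a] | c # cs \<Rightarrow> if fst a = fst c \<and> snd a \<noteq> snd c then cs else a # r)"

lemma push_simps [simp]:
  "push a [] = [a]"
  "push a (c # cs) = (if fst a = fst c \<and> snd a \<noteq> snd c then cs else a # c # cs)"
  by (simp_all add: push_def)

definition reduce :: "('a \<times> bool) list \<Rightarrow> ('a \<times> bool) list" where
  "reduce ws = foldr push ws []"

lemma reduce_simps [simp]: "reduce [] = []" "reduce (a # ws) = push a (reduce ws)"
  by (simp_all add: reduce_def)

lemma reduced_push: "reduced r \<Longrightarrow> reduced (push a r)"
  by (cases r) (auto dest: reduced_tl)

lemma reduced_reduce: "reduced (reduce ws)"
  by (induction ws) (auto simp: reduced_push)

lemma letters_in_push: "fst a \<in> B \<Longrightarrow> letters_in B r \<Longrightarrow> letters_in B (push a r)"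
  by (cases r) auto

lemma letters_in_reduce: "letters_in B ws \<Longrightarrow> letters_in B (reduce ws)"
  by (induction ws) (auto simp: letters_in_push)

lemma reduce_reduced: "reduced ws \<Longrightarrow> reduce ws = ws"
proof (induction ws)
  case (Cons a ws)
  then show ?case by (cases ws) auto
qed simp

lemma reduce_append: "reduce (u @ v) = foldr push u (reduce v)"
  by (simp add: reduce_def)

text \<open>A letter and its formal inverse act on reduced words by mutually inverse maps. This is
  van der Waerden's way to associativity: concatenation followed by reduction amounts to composing
  these actions.\<close>

lemma push_push:
  assumes "reduced r" "fst a = fst c" "snd a \<noteq> snd c"
  shows "push a (push c r) = r"
proof (cases r)
  case (Cons d ds)
  then show ?thesis using assms by (cases ds; cases a; cases c; cases d) auto
qed (use assms in auto)

lemma foldr_push_reduced: "reduced r \<Longrightarrow> reduced (foldr push u r)"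
  by (induction u) (auto simp: reduced_push)

lemma foldr_push_push: "reduced r \<Longrightarrow> foldr push (push a s) r = push a (foldr push s r)"
proof (cases s)
  case (Cons c cs)
  assume "reduced r"
  then have "push a (push c (foldr push cs r)) = foldr push cs r" if "fst a = fst c" "snd a \<noteq> snd c"
    using push_push[OF foldr_push_reduced that] by blast
  then show ?thesis using Cons by auto
qed simp

lemma foldr_push_reduce: "reduced r \<Longrightarrow> foldr push (reduce u) r = foldr push u r"
  by (induction u) (auto simp: foldr_push_push)

lemma reduce_append_left: "reduce (reduce u @ v) = reduce (u @ v)"
  by (simp add: reduce_append foldr_push_reduce reduced_reduce)

lemma reduce_append_right: "reduce (u @ reduce v) = reduce (u @ v)"
  by (simp add: reduce_append reduce_reduced reduced_reduce)

definition inv_word :: "('a \<times> bool) list \<Rightarrow> ('a \<times> bool) list" where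
  "inv_word ws = rev (map (\<lambda>(b, e). (b, \<not> e)) ws)"

lemma letters_in_inv_word [simp]: "letters_in B (inv_word ws) \<longleftrightarrow> letters_in B ws"
  by (induction ws) (auto simp: inv_word_def case_prod_beta)

lemma reduce_inv_word: "reduce (inv_word w @ w) = []"
proof (induction w)
  case (Cons a w)
  have "reduce (inv_word (a # w) @ a # w) = reduce (inv_word w @ reduce ([(fst a, \<not> snd a), a] @ w))"
    by (subst reduce_append_right) (simp add: inv_word_def case_prod_beta)
  also have "reduce ([(fst a, \<not> snd a), a] @ w) = reduce w"
    using push_push[OF reduced_reduce, of "(fst a, \<not> snd a)" a w] by simp
  finally show ?case using Cons by (simp add: reduce_append_right)
qed (simp add: inv_word_def)

section \<open>Evaluation of words in a group\<close>

context group
begin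

lemma word_val_simps [simp]:
  "word_val G [] = \<one>"
  "word_val G (a # ws) = (if snd a then fst a else inv (fst a)) \<otimes> word_val G ws"
  by (auto simp: word_val_def split: prod.splits)

lemma word_val_closed: "letters_in (carrier G) ws \<Longrightarrow> word_val G ws \<in> carrier G"
  by (induction ws) auto

lemma word_val_append:
  "letters_in (carrier G) u \<Longrightarrow> letters_in (carrier G) v \<Longrightarrow> word_val G (u @ v) = word_val G u \<otimes> word_val G v"
  by (induction u) (auto simp: m_assoc word_val_closed)

lemma word_val_inv_word:
  "letters_in (carrier G) ws \<Longrightarrow> word_val G (inv_word ws) = inv (word_val G ws)"
proof (induction ws)
  case (Cons a ws)
  have "word_val G (inv_word (a # ws)) = word_val G (inv_word ws) \<otimes> word_val G [(fst a, \<not> snd a)]"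
  proof -
    have "inv_word (a # ws) = inv_word ws @ [(fst a, \<not> snd a)]"
      by (simp add: inv_word_def case_prod_beta)
    then show ?thesis using Cons.prems word_val_append[of "inv_word ws" "[(fst a, \<not> snd a)]"] by simp
  qed
  then show ?case using Cons by (simp add: inv_mult_group word_val_closed)
qed (simp add: inv_word_def)

lemma word_val_push:
  assumes "f (fst a) \<in> carrier G" "letters_in (carrier G) (map (apfst f) r)"
  shows "word_val G (map (apfst f) (push a r)) = word_val G (map (apfst f) (a # r))"
proof (cases r)
  case (Cons c cs)
  have "word_val G (map (apfst f) cs) \<in> carrier G"
    using assms Cons by (intro word_val_closed) simp
  then show ?thesis using assms Cons by auto
qed simp

lemma word_val_reduce:
  assumes "letters_in B ws" "f \<in> B \<rightarrow> carrier G"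
  shows "word_val G (map (apfst f) (reduce ws)) = word_val G (map (apfst f) ws)"
  using assms
proof (induction ws)
  case (Cons a ws)
  have "letters_in (carrier G) (map (apfst f) (reduce ws))" "f (fst a) \<in> carrier G"
    using Cons.prems letters_in_map[OF letters_in_reduce] by auto
  then show ?case using Cons word_val_push[of f a "reduce ws"] by simp
qed simp

lemma generate_word:
  assumes B: "B \<subseteq> carrier G" and x: "x \<in> generate G B"
  obtains ws where "letters_in B ws" "word_val G ws = x"
proof -
  have "\<exists>ws. letters_in B ws \<and> word_val G ws = x"
    using x
  proof induct
    case one
    then show ?case by (intro exI[of _ "[]"]) simp
  next
    case (incl h)
    then show ?case using B by (intro exI[of _ "[(h, True)]"]) auto
  next
    case (inv h)
    then show ?case using B by (intro exI[of _ "[(h, False)]"]) auto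
  next
    case (eng h1 h2)
    then obtain u v where "letters_in B u" "word_val G u = h1" "letters_in B v" "word_val G v = h2" by blast
    then show ?case using word_val_append[of u v] letters_in_mono[OF _ B] by (intro exI[of _ "u @ v"]) auto
  qed
  then show thesis using that by blast
qed

lemma generate_reduced_word:
  assumes B: "B \<subseteq> carrier G" and x: "x \<in> generate G B"
  obtains ws where "letters_in B ws" "word_val G ws = x" "reduced ws"
proof -
  obtain ws where ws: "letters_in B ws" "word_val G ws = x" by (rule generate_word[OF B x])
  have "word_val G (reduce ws) = x"
    using word_val_reduce[of B ws id] ws B by (auto simp: apfst_def map_prod.id subset_iff)
  then show thesis using that[of "reduce ws"] ws letters_in_reduce reduced_reduce by blast
qed

lemma word_val_generate: "letters_in B ws \<Longrightarrow> word_val G ws \<in> generate G B"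
  by (induction ws) (auto intro: generate.intros)

end

lemma free_basisD:
  assumes "free_basis G B"
  shows "B \<subseteq> carrier G" "generate G B = carrier G"
    "\<And>ws. letters_in B ws \<Longrightarrow> reduced ws \<Longrightarrow> word_val G ws = \<one>\<^bsub>G\<^esub> \<Longrightarrow> ws = []"
  using assms by (auto simp: free_basis_def letters_in_def reduced_def)

text \<open>A word with value 1 in \<open>G\<close> reduces to the empty word, because no nonempty
  reduced word in the basis has value 1; hence its value in \<open>H\<close> is also 1. So the value
  in \<open>H\<close> depends only on the element of \<open>G\<close>, and any word for it may be
  chosen.\<close>

lemma free_basis_universal:
  assumes G: "group G" and B: "free_basis G B" and H: "group H" and f: "f \<in> B \<rightarrow> carrier H"
  obtains h where "h \<in> hom G H" "\<And>b. b \<in> B \<Longrightarrow> h b = f b"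
proof -
  interpret G: group G by fact
  interpret H: group H by fact
  note B' = free_basisD[OF B]
  define val where "val ws = word_val H (map (apfst f) ws)" for ws
  have fm: "letters_in (carrier H) (map (apfst f) ws)" if "letters_in B ws" for ws :: "('a \<times> bool) list"
    using letters_in_map[OF that f] .
  have val1: "val ws = \<one>\<^bsub>H\<^esub>" if ws: "letters_in B ws" "word_val G ws = \<one>\<^bsub>G\<^esub>" for ws
  proof -
    have "word_val G (reduce ws) = \<one>\<^bsub>G\<^esub>"
      using G.word_val_reduce[of B ws id] ws B'(1) by (auto simp: apfst_def map_prod.id subset_iff)
    then have "reduce ws = []"
      using B'(3)[of "reduce ws"] reduced_reduce letters_in_reduce ws(1) by blast
    then show ?thesis using H.word_val_reduce[OF ws(1) f] by (simp add: val_def)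
  qed
  have val_inv: "val (inv_word ws) = inv\<^bsub>H\<^esub> val ws" if "letters_in B ws" for ws
  proof -
    have "map (apfst f) (inv_word ws) = inv_word (map (apfst f) ws)"
      by (simp add: inv_word_def rev_map case_prod_beta apfst_def map_prod_def)
    then show ?thesis using H.word_val_inv_word[OF fm[OF that]] by (simp add: val_def)
  qed
  have val_app: "val (u @ v) = val u \<otimes>\<^bsub>H\<^esub> val v" if "letters_in B u" "letters_in B v" for u v
    using H.word_val_append[OF fm[OF that(1)] fm[OF that(2)]] by (simp add: val_def)
  have val_closed: "val ws \<in> carrier H" if "letters_in B ws" for ws
    using H.word_val_closed[OF fm[OF that]] by (simp add: val_def)
  have val_eq: "val u = val v" if uv: "letters_in B u" "letters_in B v" "word_val G u = word_val G v" for u v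
  proof -
    have c: "letters_in (carrier G) u" "letters_in (carrier G) v" using uv letters_in_mono[OF _ B'(1)] by auto
    have "word_val G (u @ inv_word v) = \<one>\<^bsub>G\<^esub>"
      using G.word_val_append[OF c(1), of "inv_word v"] G.word_val_inv_word[OF c(2)] G.word_val_closed[OF c(2)] c uv(3)
      by simp
    then have "val (u @ inv_word v) = \<one>\<^bsub>H\<^esub>"
      using uv by (intro val1) auto
    then have "val u \<otimes>\<^bsub>H\<^esub> inv\<^bsub>H\<^esub> val v = \<one>\<^bsub>H\<^esub>"
      using val_app[of u "inv_word v"] val_inv[OF uv(2)] uv by simp
    then show ?thesis using val_closed uv(1,2) H.inv_solve_right' by fastforce
  qed
  define wd where "wd x = (SOME ws. letters_in B ws \<and> word_val G ws = x)" for x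
  have wd: "letters_in B (wd x)" "word_val G (wd x) = x" if x: "x \<in> carrier G" for x
  proof -
    have "\<exists>ws. letters_in B ws \<and> word_val G ws = x"
      using G.generate_word[OF B'(1), of x] x B'(2) by metis
    from someI_ex[OF this] show "letters_in B (wd x)" "word_val G (wd x) = x"
      by (simp_all add: wd_def)
  qed
  have val_wd: "val (wd (word_val G ws)) = val ws" if "letters_in B ws" for ws
    using that wd[of "word_val G ws"] G.word_val_closed[OF letters_in_mono[OF that B'(1)]] by (intro val_eq) auto
  show thesis
  proof (rule that)
    show "(\<lambda>x. val (wd x)) \<in> hom G H"
    proof (rule homI)
      fix x y assume xy: "x \<in> carrier G" "y \<in> carrier G"
      have "letters_in B (wd x @ wd y)" using wd(1) xy by auto
      moreover have "word_val G (wd x @ wd y) = x \<otimes>\<^bsub>G\<^esub> y"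
        using G.word_val_append[of "wd x" "wd y"] wd xy letters_in_mono[OF _ B'(1)] by auto
      ultimately have "val (wd (x \<otimes>\<^bsub>G\<^esub> y)) = val (wd x @ wd y)" using val_wd by metis
      then show "val (wd (x \<otimes>\<^bsub>G\<^esub> y)) = val (wd x) \<otimes>\<^bsub>H\<^esub> val (wd y)" using val_app wd(1) xy by simp
    qed (use val_closed wd in auto)
    fix b assume b: "b \<in> B"
    then have "word_val G [(b, True)] = b" using B'(1) by auto
    then have "val (wd b) = val [(b, True)]" using val_wd[of "[(b, True)]"] b by simp
    moreover have "f b \<in> carrier H" using b f by auto
    ultimately show "val (wd b) = f b" by (simp add: val_def)
  qed
qed

text \<open>The endomorphism that fixes \<open>C\<close> and sends \<open>D\<close> to 1 is the
  identity on one subgroup and trivial on the other.\<close>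

lemma generate_Int_trivial:
  assumes G: "group G" and B: "free_basis G (C \<union> D)" and disj: "C \<inter> D = {}"
    and s: "s \<in> generate G C" "s \<in> generate G D"
  shows "s = \<one>\<^bsub>G\<^esub>"
proof -
  interpret G: group G by fact
  note B' = free_basisD[OF B]
  obtain r where r: "r \<in> hom G G" "\<And>b. b \<in> C \<union> D \<Longrightarrow> r b = (if b \<in> C then b else \<one>\<^bsub>G\<^esub>)"
    by (rule free_basis_universal[OF G B G, of "\<lambda>b. if b \<in> C then b else \<one>\<^bsub>G\<^esub>"]) (use B'(1) in auto)
  have "r s = id s"
    by (rule hom_eq_on_generate[OF G G r(1) _ _ _ s(1)]) (use r(2) B'(1) in \<open>auto simp: hom_def\<close>)
  moreover have "r s = (\<lambda>_. \<one>\<^bsub>G\<^esub>) s"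
    by (rule hom_eq_on_generate[OF G G r(1) _ _ _ s(2)]) (use r(2) B'(1) disj in \<open>auto simp: hom_def\<close>)
  ultimately show ?thesis by simp
qed

text \<open>Each factor of an alternating product is written as a nonempty reduced word in the
  letters of its own side. Adjacent words use disjoint alphabets, so nothing cancels where they meet
  and the concatenation is a nonempty reduced word in the basis.\<close>

lemma internal_free_product_generate:
  assumes G: "group G" and B: "free_basis G (C \<union> D)" and disj: "C \<inter> D = {}"
  shows "internal_free_product G (generate G C) (generate G D)"
proof -
  interpret G: group G by fact
  note B' = free_basisD[OF B]
  have CD: "C \<subseteq> carrier G" "D \<subseteq> carrier G" using B'(1) by auto
  let ?K = "generate G C" and ?L = "generate G D"
  let ?alt = "\<lambda>s t. s \<in> ?K \<and> t \<in> ?L \<or> s \<in> ?L \<and> t \<in> ?K"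
  have wK: "\<exists>w. w \<noteq> [] \<and> reduced w \<and> letters_in C w \<and> word_val G w = s" if "s \<in> ?K" "s \<noteq> \<one>\<^bsub>G\<^esub>" for s
    using G.generate_reduced_word[OF CD(1) that(1)] that(2) G.word_val_simps(1) by metis
  have wL: "\<exists>w. w \<noteq> [] \<and> reduced w \<and> letters_in D w \<and> word_val G w = s" if "s \<in> ?L" "s \<noteq> \<one>\<^bsub>G\<^esub>" for s
    using G.generate_reduced_word[OF CD(2) that(1)] that(2) G.word_val_simps(1) by metis
  have KL: "\<not> (s \<in> ?K \<and> s \<in> ?L)" if "s \<noteq> \<one>\<^bsub>G\<^esub>" for s
    using generate_Int_trivial[OF G B disj] that by blast
  \<comment> \<open>The side to which the first letter belongs is carried along, since it is what
    prevents cancellation with the word placed in front.\<close>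
  have main: "\<exists>W. W \<noteq> [] \<and> reduced W \<and> letters_in (C \<union> D) W \<and>
      word_val G W = foldr (\<lambda>s t. s \<otimes>\<^bsub>G\<^esub> t) ws \<one>\<^bsub>G\<^esub> \<and>
      (hd ws \<in> ?K \<longrightarrow> fst (hd W) \<in> C) \<and> (hd ws \<in> ?L \<longrightarrow> fst (hd W) \<in> D)"
    if "ws \<noteq> []" "set ws \<subseteq> (?K \<union> ?L) - {\<one>\<^bsub>G\<^esub>}" "successively ?alt ws" for ws
    using that
  proof (induction ws)
    case (Cons s ws)
    have s: "s \<in> ?K \<union> ?L" "s \<noteq> \<one>\<^bsub>G\<^esub>" using Cons.prems by auto
    have "\<exists>w. w \<noteq> [] \<and> reduced w \<and> word_val G w = s \<and> (s \<in> ?K \<longrightarrow> letters_in C w) \<and> (s \<in> ?L \<longrightarrow> letters_in D w)"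
      using wK[of s] wL[of s] KL[of s] s by blast
    then obtain w where w: "w \<noteq> []" "reduced w" "word_val G w = s"
      "s \<in> ?K \<Longrightarrow> letters_in C w" "s \<in> ?L \<Longrightarrow> letters_in D w" by blast
    have wCD: "letters_in (C \<union> D) w" using w(4,5) s(1) letters_in_mono[of _ w "C \<union> D"] by blast
    have hw: "s \<in> ?K \<Longrightarrow> fst (hd w) \<in> C \<and> fst (last w) \<in> C" "s \<in> ?L \<Longrightarrow> fst (hd w) \<in> D \<and> fst (last w) \<in> D"
      using letters_in_hd_last w(1,4,5) by blast+
    show ?case
    proof (cases "ws = []")
      case True
      then show ?thesis
      proof (intro exI[of _ w] conjI impI)
        have "s \<in> carrier G" using s CD G.generate_incl[OF CD(1)] G.generate_incl[OF CD(2)] by auto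
        then show "word_val G w = foldr (\<lambda>s t. s \<otimes>\<^bsub>G\<^esub> t) (s # ws) \<one>\<^bsub>G\<^esub>"
          using True w(3) by simp
      qed (use w wCD hw in auto)
    next
      case False
      have alt: "?alt s (hd ws)" and succ: "successively ?alt ws"
        using Cons.prems(3) False by (auto simp: successively_Cons)
      obtain W where W: "W \<noteq> []" "reduced W" "letters_in (C \<union> D) W"
        "word_val G W = foldr (\<lambda>s t. s \<otimes>\<^bsub>G\<^esub> t) ws \<one>\<^bsub>G\<^esub>"
        "hd ws \<in> ?K \<Longrightarrow> fst (hd W) \<in> C" "hd ws \<in> ?L \<Longrightarrow> fst (hd W) \<in> D"
        using Cons.IH[OF False _ succ] Cons.prems(2) by auto
      have "fst (last w) \<noteq> fst (hd W)"
        using alt W(5,6) hw disj by (metis disjoint_iff)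
      then have "reduced (w @ W)"
        using w W by (simp add: reduced_append)
      moreover have "word_val G (w @ W) = s \<otimes>\<^bsub>G\<^esub> foldr (\<lambda>s t. s \<otimes>\<^bsub>G\<^esub> t) ws \<one>\<^bsub>G\<^esub>"
        using G.word_val_append[of w W] w(3) W(4) letters_in_mono[OF wCD B'(1)] letters_in_mono[OF W(3) B'(1)] by simp
      ultimately show ?thesis
        using w(1) W(3) wCD hw by (intro exI[of _ "w @ W"]) auto
    qed
  qed simp
  have "generate G (?K \<union> ?L) = carrier G"
  proof
    show "generate G (?K \<union> ?L) \<subseteq> carrier G"
      using G.generate_incl[of "?K \<union> ?L"] G.generate_incl[OF CD(1)] G.generate_incl[OF CD(2)] by blast
    have "C \<union> D \<subseteq> ?K \<union> ?L" by (auto intro: generate.incl)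
    then show "carrier G \<subseteq> generate G (?K \<union> ?L)" using G.mono_generate B'(2) by metis
  qed
  then show ?thesis
    unfolding internal_free_product_def
  proof (intro conjI allI impI)
    fix ws assume ws: "ws \<noteq> [] \<and> set ws \<subseteq> ?K \<union> ?L - {\<one>\<^bsub>G\<^esub>} \<and> successively ?alt ws"
    then obtain W where "W \<noteq> []" "reduced W" "letters_in (C \<union> D) W"
      "word_val G W = foldr (\<lambda>s t. s \<otimes>\<^bsub>G\<^esub> t) ws \<one>\<^bsub>G\<^esub>"
      using main[of ws] by auto
    then show "foldr (\<lambda>s t. s \<otimes>\<^bsub>G\<^esub> t) ws \<one>\<^bsub>G\<^esub> \<noteq> \<one>\<^bsub>G\<^esub>" using B'(3) by metis
  qed (use G.generate_is_subgroup CD in auto)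
qed

subsection \<open>A model carried by the natural numbers\<close>

definition words :: "nat set \<Rightarrow> (nat \<times> bool) list set" where
  "words B = {w. reduced w \<and> letters_in B w}"

definition free_grp :: "nat set \<Rightarrow> nat monoid" where
  "free_grp B = \<lparr>carrier = to_nat ` words B,
                 monoid.mult = (\<lambda>m n. to_nat (reduce (from_nat m @ from_nat n :: (nat \<times> bool) list))),
                 one = to_nat ([] :: (nat \<times> bool) list)\<rparr>"

definition gen :: "nat \<Rightarrow> nat" where
  "gen b = to_nat [(b, True)]"

lemma inj_gen: "inj gen"
  by (simp add: inj_def gen_def)

lemma reduce_in_words: "letters_in B w \<Longrightarrow> reduce w \<in> words B"
  by (simp add: words_def letters_in_reduce reduced_reduce)

lemma free_grp_mult:
  "to_nat u \<otimes>\<^bsub>free_grp B\<^esub> to_nat v = to_nat (reduce (u @ v :: (nat \<times> bool) list))"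
  by (simp add: free_grp_def)

lemma group_free_grp: "group (free_grp B)"
proof (rule groupI)
  fix x assume "x \<in> carrier (free_grp B)"
  then obtain w where w: "w \<in> words B" "x = to_nat w" by (auto simp: free_grp_def)
  have "reduce (inv_word w) \<in> words B"
    using w by (intro reduce_in_words) (auto simp: words_def)
  moreover have "to_nat (reduce (inv_word w)) \<otimes>\<^bsub>free_grp B\<^esub> x = \<one>\<^bsub>free_grp B\<^esub>"
    using reduce_inv_word[of w] by (simp add: w free_grp_mult reduce_append_left) (simp add: free_grp_def)
  ultimately show "\<exists>y\<in>carrier (free_grp B). y \<otimes>\<^bsub>free_grp B\<^esub> x = \<one>\<^bsub>free_grp B\<^esub>"
    by (auto simp: free_grp_def)
next
  fix x y assume "x \<in> carrier (free_grp B)" "y \<in> carrier (free_grp B)"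
  then show "x \<otimes>\<^bsub>free_grp B\<^esub> y \<in> carrier (free_grp B)"
    by (auto simp: free_grp_def intro!: imageI reduce_in_words) (auto simp: words_def)
next
  fix x y z assume "x \<in> carrier (free_grp B)" "y \<in> carrier (free_grp B)" "z \<in> carrier (free_grp B)"
  then show "x \<otimes>\<^bsub>free_grp B\<^esub> y \<otimes>\<^bsub>free_grp B\<^esub> z = x \<otimes>\<^bsub>free_grp B\<^esub> (y \<otimes>\<^bsub>free_grp B\<^esub> z)"
    by (auto simp: free_grp_def reduce_append_left reduce_append_right)
qed (auto simp: free_grp_def words_def reduce_reduced)

lemma free_grp_word_val:
  assumes "letters_in B w"
  shows "word_val (free_grp B) (map (apfst gen) w) = to_nat (reduce w)"
  using assms
proof (induction w)
  case Nil
  then show ?case by (simp add: word_val_def free_grp_def)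
next
  case (Cons a w)
  interpret group "free_grp B" by (rule group_free_grp)
  have one: "\<one>\<^bsub>free_grp B\<^esub> = to_nat ([] :: (nat \<times> bool) list)" by (simp add: free_grp_def)
  have gen: "gen (fst a) \<in> carrier (free_grp B)" "to_nat [(fst a, False)] \<in> carrier (free_grp B)"
    using Cons.prems by (auto simp: free_grp_def gen_def words_def)
  have "to_nat [(fst a, False)] \<otimes>\<^bsub>free_grp B\<^esub> gen (fst a) = \<one>\<^bsub>free_grp B\<^esub>"
    by (simp add: gen_def free_grp_mult one)
  then have "inv\<^bsub>free_grp B\<^esub> gen (fst a) = to_nat [(fst a, False)]"
    using inv_equality gen by blast
  then have "(if snd a then gen (fst a) else inv\<^bsub>free_grp B\<^esub> gen (fst a)) = to_nat [a]"
    by (cases a) (auto simp: gen_def)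
  then have "word_val (free_grp B) (map (apfst gen) (a # w))
    = to_nat [a] \<otimes>\<^bsub>free_grp B\<^esub> word_val (free_grp B) (map (apfst gen) w)"
    by (simp only: list.map word_val_simps fst_apfst snd_apfst)
  moreover have "to_nat [a] \<otimes>\<^bsub>free_grp B\<^esub> to_nat (reduce w) = to_nat (reduce (a # w))"
    by (simp add: free_grp_mult reduce_reduced reduced_reduce)
  ultimately show ?case using Cons.IH Cons.prems by (simp del: list.map)
qed

text \<open>A word in the generators evaluates to the code of its reduction, so a nonempty reduced
  word has a nontrivial value.\<close>

lemma free_basis_free_grp: "free_basis (free_grp B) (gen ` B)"
proof -
  interpret group "free_grp B" by (rule group_free_grp)
  have sub: "gen ` B \<subseteq> carrier (free_grp B)" by (auto simp: free_grp_def gen_def words_def)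
  have lift: "\<exists>w. ws = map (apfst gen) w \<and> letters_in B w" if "letters_in (gen ` B) ws" for ws
    using that
  proof (induction ws)
    case (Cons a ws)
    then obtain w b where "ws = map (apfst gen) w" "letters_in B w" "b \<in> B" "fst a = gen b" by auto
    then show ?case by (intro exI[of _ "(b, snd a) # w"]) (auto simp: prod_eq_iff)
  qed simp
  have red: "reduced (map (apfst gen) w) \<longleftrightarrow> reduced w" for w
    using inj_gen by (simp add: reduced_def successively_map case_prod_beta inj_eq)
  have "carrier (free_grp B) \<subseteq> generate (free_grp B) (gen ` B)"
  proof
    fix x assume "x \<in> carrier (free_grp B)"
    then obtain w where w: "reduced w" "letters_in B w" "x = to_nat w" by (auto simp: free_grp_def words_def)
    then have "x = word_val (free_grp B) (map (apfst gen) w)" by (simp add: free_grp_word_val reduce_reduced)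
    moreover have "letters_in (gen ` B) (map (apfst gen) w)" using letters_in_map[OF w(2), of gen "gen ` B"] by auto
    ultimately show "x \<in> generate (free_grp B) (gen ` B)" using word_val_generate by blast
  qed
  moreover have "word_val (free_grp B) ws \<noteq> \<one>\<^bsub>free_grp B\<^esub>"
    if nz: "ws \<noteq> []" and ov: "letters_in (gen ` B) ws" and rd: "reduced ws" for ws
  proof -
    obtain w where w: "ws = map (apfst gen) w" "letters_in B w" using lift[OF ov] by blast
    then have "word_val (free_grp B) ws = to_nat w"
      using rd red by (simp add: free_grp_word_val reduce_reduced)
    then show ?thesis using nz w(1) by (simp add: free_grp_def)
  qed
  ultimately show ?thesis
    unfolding free_basis_def using sub generate_incl[OF sub] by (auto simp: letters_in_def reduced_def)
qed

lemma gen_in_free_grp: "b \<in> B \<Longrightarrow> gen b \<in> carrier (free_grp B)"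
  using free_basisD(1)[OF free_basis_free_grp] by blast

lemma free_grp_generate: "generate (free_grp B) (gen ` B) = carrier (free_grp B)"
  using free_basisD(2)[OF free_basis_free_grp] .

lemma free_grp_fin_rank: "finite B \<Longrightarrow> free_group_fin_rank (free_grp B)"
  using group_free_grp free_basis_free_grp by (auto simp: free_group_fin_rank_def)

lemma free_grp_universal:
  assumes "group H" "\<And>b. b \<in> B \<Longrightarrow> f b \<in> carrier H"
  obtains h where "h \<in> hom (free_grp B) H" "\<And>b. b \<in> B \<Longrightarrow> h (gen b) = f b"
proof -
  obtain h where h: "h \<in> hom (free_grp B) H" "\<And>x. x \<in> gen ` B \<Longrightarrow> h x = f (inv_into UNIV gen x)"
    by (rule free_basis_universal[OF group_free_grp free_basis_free_grp[of B] assms(1), of "\<lambda>x. f (inv_into UNIV gen x)"])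
      (use assms(2) inj_gen in auto)
  then show thesis using that[of h] inj_gen by simp
qed

lemma free_grp_hom_eqI:
  assumes "group H" "f \<in> hom (free_grp B) H" "g \<in> hom (free_grp B) H" "\<And>b. b \<in> B \<Longrightarrow> f (gen b) = g (gen b)"
    "x \<in> carrier (free_grp B)"
  shows "f x = g x"
  by (rule hom_eq_on_generate[OF group_free_grp assms(1-3), of "gen ` B"])
    (use assms gen_in_free_grp free_grp_generate in auto)

section \<open>Morphisms of free groups induced by injections of bases\<close>

lemma hom_derived_trivial:
  assumes "group G" "comm_group H" "h \<in> hom G H" "x \<in> derived G (carrier G)"
  shows "h x = \<one>\<^bsub>H\<^esub>"
proof -
  interpret H: comm_group H by fact
  interpret h: group_hom G H h using assms by (simp add: group_hom_def group_hom_axioms_def H.is_group)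
  have "h x \<in> h ` derived G (carrier G)" using assms(4) by blast
  also have "\<dots> = derived H (h ` carrier G)" using h.derived_img[of "carrier G"] by simp
  also have "\<dots> = {\<one>\<^bsub>H\<^esub>}" by (rule H.derived_eq_singleton) auto
  finally show ?thesis by simp
qed

context group
begin

lemma comm_group_ab: "comm_group (quot G (derived G (carrier G)))"
proof -
  interpret N: normal "derived G (carrier G)" G by (rule derived_self_is_normal)
  show ?thesis
  proof (rule group.group_comm_groupI[OF N.group_quot])
    fix s t assume "s \<in> carrier (quot G (derived G (carrier G)))" "t \<in> carrier (quot G (derived G (carrier G)))"
    then have st: "s \<in> carrier G" "t \<in> carrier G" using N.quot_carrierD(1) by auto
    have "s \<otimes> t \<otimes> inv s \<otimes> inv t \<in> derived G (carrier G)"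
      unfolding derived_def using st by (intro generate.incl) auto
    moreover have "s \<otimes> t \<otimes> inv (t \<otimes> s) = s \<otimes> t \<otimes> inv s \<otimes> inv t"
      using st by (simp add: m_assoc inv_mult_group)
    ultimately show "s \<otimes>\<^bsub>quot G (derived G (carrier G))\<^esub> t = t \<otimes>\<^bsub>quot G (derived G (carrier G))\<^esub> s"
      using st N.rep_of_eq_iff[of "s \<otimes> t" "t \<otimes> s"] by (simp add: quot_def)
  qed
qed

text \<open>As the elements of the abelianisation are representatives, a homomorphism to an abelian
  group is also a homomorphism on the abelianisation.\<close>

lemma hom_factor_ab:
  assumes H: "comm_group H" and h: "h \<in> hom G H"
  shows "h \<in> hom (quot G (derived G (carrier G))) H"
    "x \<in> carrier G \<Longrightarrow> h (rep_of G (derived G (carrier G)) x) = h x"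
proof -
  interpret N: normal "derived G (carrier G)" G by (rule derived_self_is_normal)
  interpret H: comm_group H by fact
  interpret h: group_hom G H h by unfold_locales (rule h)
  show r: "h (rep_of G (derived G (carrier G)) x) = h x" if x: "x \<in> carrier G" for x
  proof -
    obtain k where k: "k \<in> derived G (carrier G)" "rep_of G (derived G (carrier G)) x = k \<otimes> x"
      by (rule N.rep_of_obtain[OF x])
    then show ?thesis
      using hom_derived_trivial[OF is_group H h k(1)] N.mem_carrier[OF k(1)] x by simp
  qed
  show "h \<in> hom (quot G (derived G (carrier G))) H"
    by (rule homI) (use r N.quot_carrierD(1) in \<open>auto simp: quot_def N.rep_of_in(2)\<close>)
qed

end

section \<open>Abelianisations of free groups\<close>

abbreviation free_ab :: "nat set \<Rightarrow> nat monoid" where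
  "free_ab B \<equiv> ab_ob (free_grp B)"

definition eb :: "nat set \<Rightarrow> nat \<Rightarrow> nat" where
  "eb B b = ab_proj (free_grp B) (gen b)"

lemma comm_group_free_ab: "comm_group (free_ab B)"
  unfolding ab_ob_def by (rule group.comm_group_ab[OF group_free_grp])

lemma ab_proj_hom: "ab_proj (free_grp B) \<in> hom (free_grp B) (free_ab B)"
  unfolding ab_ob_def ab_proj_def
  using normal.rep_of_hom[OF group.derived_self_is_normal[OF group_free_grp]] .

lemma ab_proj_surj: "ab_proj (free_grp B) ` carrier (free_grp B) = carrier (free_ab B)"
  by (simp add: ab_ob_def ab_proj_def quot_def)

lemma free_ab_factor:
  assumes "comm_group H" "h \<in> hom (free_grp B) H"
  shows "h \<in> hom (free_ab B) H" "x \<in> carrier (free_grp B) \<Longrightarrow> h (ab_proj (free_grp B) x) = h x"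
  using group.hom_factor_ab[OF group_free_grp assms] by (simp_all add: ab_ob_def ab_proj_def)

lemma eb_in: "b \<in> B \<Longrightarrow> eb B b \<in> carrier (free_ab B)"
  unfolding eb_def by (rule hom_in_carrier[OF ab_proj_hom gen_in_free_grp])

lemma free_ab_generate: "generate (free_ab B) (eb B ` B) = carrier (free_ab B)"
proof -
  interpret h: group_hom "free_grp B" "free_ab B" "ab_proj (free_grp B)"
    using ab_proj_hom group_free_grp comm_group.axioms(2)[OF comm_group_free_ab]
    by (simp add: group_hom_def group_hom_axioms_def)
  have "generate (free_ab B) (ab_proj (free_grp B) ` gen ` B) = ab_proj (free_grp B) ` generate (free_grp B) (gen ` B)"
    by (rule h.generate_img) (auto simp: gen_in_free_grp)
  then show ?thesis
    by (simp add: free_grp_generate ab_proj_surj eb_def[abs_def] image_image)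
qed

lemma free_ab_coord:
  obtains k where "k \<in> hom (free_ab B) (free_Abelian_group B)" "\<And>b. b \<in> B \<Longrightarrow> k (eb B b) = frag_of b"
proof -
  obtain h where h: "h \<in> hom (free_grp B) (free_Abelian_group B)" "\<And>b. b \<in> B \<Longrightarrow> h (gen b) = frag_of b"
    by (rule free_grp_universal[of "free_Abelian_group B" B frag_of]) auto
  note hf = free_ab_factor[OF abelian_free_Abelian_group h(1)]
  show thesis
    using that[OF hf(1)] hf(2)[OF gen_in_free_grp] h(2) by (simp add: eb_def)
qed

lemma inj_on_eb: "inj_on (eb B) B"
proof -
  obtain k where "\<And>b. b \<in> B \<Longrightarrow> k (eb B b) = frag_of b"
    using free_ab_coord by blast
  then show ?thesis by (metis frag_of_eq inj_onI)
qed

lemma framed_free_ab: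
  assumes "finite B"
  shows "framed (free_ab B) (eb B ` B)"
proof -
  let ?F = "free_Abelian_group (eb B ` B)"
  obtain h where h: "h \<in> hom (free_grp B) ?F" "\<And>b. b \<in> B \<Longrightarrow> h (gen b) = frag_of (eb B b)"
    by (rule free_grp_universal[of ?F B "\<lambda>b. frag_of (eb B b)"]) auto
  note hf = free_ab_factor[OF abelian_free_Abelian_group h(1)]
  have "\<forall>c\<in>eb B ` B. h c = frag_of c"
    using hf(2)[OF gen_in_free_grp] h(2) by (auto simp: eb_def)
  then have "ab_basis (free_ab B) (eb B ` B)"
    unfolding ab_basis_def using assms eb_in free_ab_generate hf(1) by auto
  then show ?thesis
    unfolding framed_def using Ob_SabI comm_group_free_ab by blast
qed

text \<open>The choice is harmless: extensional homomorphisms that agree on the generators are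
  equal.\<close>

definition free_map :: "nat set \<Rightarrow> nat set \<Rightarrow> (nat \<Rightarrow> nat) \<Rightarrow> nat \<Rightarrow> nat" where
  "free_map B C \<sigma> = (SOME h. h \<in> ext_hom (free_grp B) (free_grp C) \<and> (\<forall>b\<in>B. h (gen b) = gen (\<sigma> b)))"

text \<open>The lift to free groups of the based morphism with map of bases \<sigma>; the
  complementary factor is generated by the letters not in the image.\<close>

definition gmor :: "nat set \<Rightarrow> nat set \<Rightarrow> (nat \<Rightarrow> nat) \<Rightarrow> free_mor" where
  "gmor B C \<sigma> = (free_map B C \<sigma>, generate (free_grp C) (gen ` (C - \<sigma> ` B)))"

lemma free_map_props:
  assumes "\<sigma> ` B \<subseteq> C"
  shows "free_map B C \<sigma> \<in> ext_hom (free_grp B) (free_grp C)" "\<And>b. b \<in> B \<Longrightarrow> free_map B C \<sigma> (gen b) = gen (\<sigma> b)"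
proof -
  obtain h where h: "h \<in> hom (free_grp B) (free_grp C)" "\<And>b. b \<in> B \<Longrightarrow> h (gen b) = gen (\<sigma> b)"
    by (rule free_grp_universal[OF group_free_grp, of B "\<lambda>b. gen (\<sigma> b)" C]) (use assms gen_in_free_grp in auto)
  have "restrict h (carrier (free_grp B)) \<in> ext_hom (free_grp B) (free_grp C)"
    by (rule ext_homI[OF group_free_grp h(1)])
  moreover have "\<forall>b\<in>B. restrict h (carrier (free_grp B)) (gen b) = gen (\<sigma> b)"
    using h(2) gen_in_free_grp by simp
  ultimately have ex: "\<exists>h. h \<in> ext_hom (free_grp B) (free_grp C) \<and> (\<forall>b\<in>B. h (gen b) = gen (\<sigma> b))" by blast
  show "free_map B C \<sigma> \<in> ext_hom (free_grp B) (free_grp C)" "\<And>b. b \<in> B \<Longrightarrow> free_map B C \<sigma> (gen b) = gen (\<sigma> b)"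
    using someI_ex[OF ex] by (auto simp: free_map_def)
qed

context
  fixes B C :: "nat set" and \<sigma> :: "nat \<Rightarrow> nat"
  assumes fin: "finite B" "finite C" and inj: "inj_on \<sigma> B" and im: "\<sigma> ` B \<subseteq> C"
begin

abbreviation (input) "inc \<equiv> free_map B C \<sigma>"
abbreviation (input) "cofactor \<equiv> generate (free_grp C) (gen ` (C - \<sigma> ` B))"

lemma free_map_hom: "inc \<in> hom (free_grp B) (free_grp C)"
  using free_map_props(1)[OF im] ext_homD(1) by blast

lemma free_map_gen: "b \<in> B \<Longrightarrow> inc (gen b) = gen (\<sigma> b)"
  using free_map_props(2)[OF im] .

lemma free_map_closed: "x \<in> carrier (free_grp B) \<Longrightarrow> inc x \<in> carrier (free_grp C)"
  using free_map_hom by (auto simp: hom_def)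

text \<open>With values in \<open>free_grp B\<close> this gives a left inverse of
  \<open>inc\<close>, with values in \<open>free_ab B\<close> the retraction that
  \<open>ab_mor\<close> asks for.\<close>

lemma retraction:
  assumes H: "group H" and f: "\<And>b. b \<in> B \<Longrightarrow> f b \<in> carrier H"
  obtains r where "r \<in> hom (free_grp C) H" "\<And>b. b \<in> B \<Longrightarrow> r (gen (\<sigma> b)) = f b"
    "\<And>c. c \<in> C \<Longrightarrow> c \<notin> \<sigma> ` B \<Longrightarrow> r (gen c) = \<one>\<^bsub>H\<^esub>"
proof -
  interpret H: group H by fact
  obtain r where r: "r \<in> hom (free_grp C) H"
    "\<And>c. c \<in> C \<Longrightarrow> r (gen c) = (if c \<in> \<sigma> ` B then f (inv_into B \<sigma> c) else \<one>\<^bsub>H\<^esub>)"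
    by (rule free_grp_universal[OF H, of C "\<lambda>c. if c \<in> \<sigma> ` B then f (inv_into B \<sigma> c) else \<one>\<^bsub>H\<^esub>"])
      (use f inv_into_into[of _ \<sigma> B] in auto)
  show thesis by (rule that[OF r(1)]) (use r(2) inj im in auto)
qed

lemma inj_on_free_map: "inj_on inc (carrier (free_grp B))"
proof -
  obtain r where r: "r \<in> hom (free_grp C) (free_grp B)" "\<And>b. b \<in> B \<Longrightarrow> r (gen (\<sigma> b)) = gen b"
    by (rule retraction[OF group_free_grp, of gen B]) (auto simp: gen_in_free_grp)
  show ?thesis
  proof (rule inj_on_inverseI)
    fix x assume x: "x \<in> carrier (free_grp B)"
    have "(r \<circ> inc) x = id x"
      by (rule free_grp_hom_eqI[OF group_free_grp hom_compose[OF free_map_hom r(1)] _ _ x])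
        (auto simp: hom_def free_map_gen r(2))
    then show "r (inc x) = x" by simp
  qed
qed

lemma free_map_image: "inc ` carrier (free_grp B) = generate (free_grp C) (gen ` \<sigma> ` B)"
proof -
  interpret group_hom "free_grp B" "free_grp C" inc
    using free_map_hom group_free_grp by (simp add: group_hom_def group_hom_axioms_def)
  have "generate (free_grp C) (inc ` gen ` B) = inc ` generate (free_grp B) (gen ` B)"
    by (rule generate_img) (auto simp: gen_in_free_grp)
  moreover have "inc ` gen ` B = gen ` \<sigma> ` B" using free_map_gen by (auto simp: image_iff)
  ultimately show ?thesis by (simp add: free_grp_generate)
qed

lemma gmor_in: "gmor B C \<sigma> \<in> Hom Gcat (free_grp B) (free_grp C)"
proof -
  have d: "gen ` (C - \<sigma> ` B) \<inter> gen ` \<sigma> ` B = {}"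
    using inj_gen by (auto simp: inj_eq)
  have "gen ` (C - \<sigma> ` B) \<union> gen ` \<sigma> ` B = gen ` C" using im by auto
  then have "internal_free_product (free_grp C) cofactor (inc ` carrier (free_grp B))"
    unfolding free_map_image
    using internal_free_product_generate[OF group_free_grp _ d, of C] free_basis_free_grp[of C] by simp
  then show ?thesis
    using free_map_props(1)[OF im] inj_on_free_map by (simp add: Gcat_def gmor_def)
qed

text \<open>Every generator lies in the cofactor or in the image of \<open>inc\<close>, so
  homomorphisms prescribed on these two pieces are unique.\<close>

lemma gen_decomp: "gen ` C \<subseteq> cofactor \<union> inc ` carrier (free_grp B)"
proof
  fix x assume "x \<in> gen ` C"
  then obtain c where c: "c \<in> C" "x = gen c" by blast
  show "x \<in> cofactor \<union> inc ` carrier (free_grp B)"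
  proof (cases "c \<in> \<sigma> ` B")
    case True
    then show ?thesis using c by (auto simp: free_map_image intro!: generate.incl)
  next
    case False
    then show ?thesis using c by (auto intro!: generate.incl)
  qed
qed

lemma extend_hom:
  assumes \<phi>: "\<phi> \<in> hom (free_grp B) (free_grp B)"
  obtains \<psi> where "\<psi> \<in> hom (free_grp C) (free_grp C)" "\<And>k. k \<in> cofactor \<Longrightarrow> \<psi> k = k"
    "\<And>g. g \<in> carrier (free_grp B) \<Longrightarrow> \<psi> (inc g) = inc (\<phi> g)"
proof -
  have \<phi>c: "\<phi> x \<in> carrier (free_grp B)" if "x \<in> carrier (free_grp B)" for x using \<phi> that by (auto simp: hom_def)
  obtain \<psi> where \<psi>: "\<psi> \<in> hom (free_grp C) (free_grp C)"
    "\<And>c. c \<in> C \<Longrightarrow> \<psi> (gen c) = (if c \<in> \<sigma> ` B then inc (\<phi> (gen (inv_into B \<sigma> c))) else gen c)"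
    by (rule free_grp_universal[OF group_free_grp, of C "\<lambda>c. if c \<in> \<sigma> ` B then inc (\<phi> (gen (inv_into B \<sigma> c))) else gen c" C])
      (use inv_into_into[of _ \<sigma> B] \<phi>c free_map_closed gen_in_free_grp in auto)
  show thesis
  proof (rule that[OF \<psi>(1)])
    fix k assume k: "k \<in> cofactor"
    have "\<psi> k = id k"
      by (rule hom_eq_on_generate[OF group_free_grp group_free_grp \<psi>(1) _ _ _ k])
        (auto simp: hom_def \<psi>(2) gen_in_free_grp)
    then show "\<psi> k = k" by simp
  next
    fix g assume g: "g \<in> carrier (free_grp B)"
    have "(\<psi> \<circ> inc) g = (inc \<circ> \<phi>) g"
      by (rule free_grp_hom_eqI[OF group_free_grp hom_compose[OF free_map_hom \<psi>(1)] hom_compose[OF \<phi> free_map_hom] _ g])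
        (use inj im in \<open>auto simp: free_map_gen \<psi>(2)\<close>)
    then show "\<psi> (inc g) = inc (\<phi> g)" by simp
  qed
qed

text \<open>\<open>Aut_functor\<close> is a definite description and needs this to be meaningful.
  The inverse automorphism extends in the same way, and the two extensions are inverse to each other
  on generators, hence everywhere.\<close>

lemma extend_auto_ex1:
  assumes \<phi>: "\<phi> \<in> auto (free_grp B)"
  shows "\<exists>!\<psi>. \<psi> \<in> auto (free_grp C) \<and> (\<forall>k\<in>cofactor. \<psi> k = k) \<and> (\<forall>g\<in>carrier (free_grp B). \<psi> (inc g) = inc (\<phi> g))"
proof -
  interpret GB: group "free_grp B" by (rule group_free_grp)
  interpret GC: group "free_grp C" by (rule group_free_grp)
  have \<phi>h: "\<phi> \<in> hom (free_grp B) (free_grp B)" and \<phi>b: "\<phi> \<in> Bij (carrier (free_grp B))" using \<phi> by (auto simp: auto_def)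
  define \<phi>' where "\<phi>' = restrict (inv_into (carrier (free_grp B)) \<phi>) (carrier (free_grp B))"
  have \<phi>'h: "\<phi>' \<in> hom (free_grp B) (free_grp B)"
    unfolding \<phi>'_def by (rule GB.restrict_inv_into_hom[OF \<phi>h \<phi>b])
  have bb: "bij_betw \<phi> (carrier (free_grp B)) (carrier (free_grp B))" using \<phi>b by (simp add: Bij_def)
  have inv1: "\<phi>' (\<phi> x) = x" "\<phi> (\<phi>' x) = x" if "x \<in> carrier (free_grp B)" for x
    using that bb bij_betw_imp_surj_on[OF bb] bij_betw_apply[OF bb that]
    by (auto simp: \<phi>'_def bij_betw_def f_inv_into_f)
  obtain \<psi> where \<psi>: "\<psi> \<in> hom (free_grp C) (free_grp C)" "\<And>k. k \<in> cofactor \<Longrightarrow> \<psi> k = k"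
    "\<And>g. g \<in> carrier (free_grp B) \<Longrightarrow> \<psi> (inc g) = inc (\<phi> g)"
    using extend_hom[OF \<phi>h] by blast
  obtain \<psi>' where \<psi>': "\<psi>' \<in> hom (free_grp C) (free_grp C)" "\<And>k. k \<in> cofactor \<Longrightarrow> \<psi>' k = k"
    "\<And>g. g \<in> carrier (free_grp B) \<Longrightarrow> \<psi>' (inc g) = inc (\<phi>' g)"
    using extend_hom[OF \<phi>'h] by blast
  have \<phi>c: "\<phi> x \<in> carrier (free_grp B)" "\<phi>' x \<in> carrier (free_grp B)" if "x \<in> carrier (free_grp B)" for x
    using \<phi>h \<phi>'h that by (auto simp: hom_def)
  have cancel: "f (g x) = x" if fg: "f \<in> hom (free_grp C) (free_grp C)" "g \<in> hom (free_grp C) (free_grp C)"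
      "\<And>y. y \<in> cofactor \<Longrightarrow> f (g y) = y" "\<And>y. y \<in> carrier (free_grp B) \<Longrightarrow> f (g (inc y)) = inc y"
    and x: "x \<in> carrier (free_grp C)" for f g x
  proof -
    have "(f \<circ> g) x = id x"
    proof (rule free_grp_hom_eqI[OF group_free_grp hom_compose[OF fg(2,1)] _ _ x])
      fix c assume "c \<in> C"
      then show "(f \<circ> g) (gen c) = id (gen c)" using gen_decomp fg(3,4) by auto
    qed (simp add: hom_def)
    then show ?thesis by simp
  qed
  have "\<psi>' (\<psi> x) = x" "\<psi> (\<psi>' x) = x" if "x \<in> carrier (free_grp C)" for x
    using cancel[OF \<psi>'(1) \<psi>(1) _ _ that] cancel[OF \<psi>(1) \<psi>'(1) _ _ that] \<psi>(2,3) \<psi>'(2,3) inv1 \<phi>c by auto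
  then have "bij_betw \<psi> (carrier (free_grp C)) (carrier (free_grp C))"
    using \<psi>(1) \<psi>'(1) by (intro bij_betwI[of _ _ _ \<psi>']) (auto simp: hom_def)
  then have bb': "bij_betw (restrict \<psi> (carrier (free_grp C))) (carrier (free_grp C)) (carrier (free_grp C))"
    by (simp cong: bij_betw_cong)
  have Kc: "cofactor \<subseteq> carrier (free_grp C)" by (rule GC.generate_incl) (auto simp: gen_in_free_grp)
  show ?thesis
  proof (rule ex1I[of _ "restrict \<psi> (carrier (free_grp C))"])
    have "restrict \<psi> (carrier (free_grp C)) \<in> auto (free_grp C)"
      using ext_homI[OF group_free_grp \<psi>(1)] bb' by (auto simp: auto_def Bij_def ext_hom_def)
    then show "restrict \<psi> (carrier (free_grp C)) \<in> auto (free_grp C) \<and>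
      (\<forall>k\<in>cofactor. restrict \<psi> (carrier (free_grp C)) k = k) \<and>
      (\<forall>g\<in>carrier (free_grp B). restrict \<psi> (carrier (free_grp C)) (inc g) = inc (\<phi> g))"
      using \<psi>(2,3) Kc free_map_closed by auto
  next
    fix \<chi> assume \<chi>: "\<chi> \<in> auto (free_grp C) \<and> (\<forall>k\<in>cofactor. \<chi> k = k) \<and> (\<forall>g\<in>carrier (free_grp B). \<chi> (inc g) = inc (\<phi> g))"
    then have \<chi>h: "\<chi> \<in> hom (free_grp C) (free_grp C)" "\<chi> \<in> extensional (carrier (free_grp C))"
      by (auto simp: auto_def Bij_def)
    have "\<chi> x = \<psi> x" if "x \<in> carrier (free_grp C)" for x
    proof (rule free_grp_hom_eqI[OF group_free_grp \<chi>h(1) \<psi>(1) _ that])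
      fix c assume "c \<in> C"
      then show "\<chi> (gen c) = \<psi> (gen c)" using gen_decomp \<chi> \<psi>(2,3) by auto
    qed
    then show "\<chi> = restrict \<psi> (carrier (free_grp C))"
      using \<chi>h(2) by (auto simp: extensional_def fun_eq_iff)
  qed
qed

lemma Aut_functor_gmor:
  assumes "\<phi> \<in> auto (free_grp B)"
  defines "\<psi> \<equiv> Fmor Aut_functor (free_grp B) (free_grp C) (gmor B C \<sigma>) \<phi>"
  shows "\<psi> \<in> auto (free_grp C)" "\<And>k. k \<in> cofactor \<Longrightarrow> \<psi> k = k" "\<And>g. g \<in> carrier (free_grp B) \<Longrightarrow> \<psi> (inc g) = inc (\<phi> g)"
  using theI'[OF extend_auto_ex1[OF assms(1)]]
  by (simp_all add: \<psi>_def Aut_functor_def gmor_def)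

text \<open>The retraction in \<open>ab_mor\<close> is a definite description. It exists because the
  map inverting \<open>inc\<close> and killing the cofactor factors through the abelianisation, and
  it is unique by \<open>gen_decomp\<close>. So \<open>gmor\<close> lies over the based morphism
  with the same map of bases.\<close>

lemma based_ab_mor:
  "based (free_ab B) (eb B ` B) (free_ab C) (eb C ` C) (ab_mor (free_grp B) (free_grp C) (gmor B C \<sigma>))"
  "b \<in> B \<Longrightarrow> snd (ab_mor (free_grp B) (free_grp C) (gmor B C \<sigma>)) (eb B b) = eb C (\<sigma> b)"
proof -
  interpret AB: comm_group "free_ab B" by (rule comm_group_free_ab)
  interpret AC: comm_group "free_ab C" by (rule comm_group_free_ab)
  interpret GC: group "free_grp C" by (rule group_free_grp)
  let ?pB = "ab_proj (free_grp B)" and ?pC = "ab_proj (free_grp C)"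
  let ?P = "\<lambda>r. r \<in> ext_hom (free_ab C) (free_ab B) \<and> (\<forall>k\<in>cofactor. r (?pC k) = \<one>\<^bsub>free_ab B\<^esub>) \<and>
     (\<forall>g\<in>carrier (free_grp B). r (?pC (inc g)) = ?pB g)"
  obtain q where q: "q \<in> hom (free_grp C) (free_ab B)" "\<And>b. b \<in> B \<Longrightarrow> q (gen (\<sigma> b)) = eb B b"
    "\<And>c. c \<in> C \<Longrightarrow> c \<notin> \<sigma> ` B \<Longrightarrow> q (gen c) = \<one>\<^bsub>free_ab B\<^esub>"
    by (rule retraction[OF AB.is_group, of "eb B"]) (auto simp: eb_in)
  note qf = free_ab_factor[OF comm_group_free_ab q(1)]
  have pCc: "?pC x \<in> carrier (free_ab C)" if "x \<in> carrier (free_grp C)" for x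
    using ab_proj_hom[of C] that by (auto simp: hom_def)
  have Kc: "cofactor \<subseteq> carrier (free_grp C)" by (rule GC.generate_incl) (auto simp: gen_in_free_grp)
  have qK: "q k = \<one>\<^bsub>free_ab B\<^esub>" if k: "k \<in> cofactor" for k
  proof -
    have "q k = (\<lambda>_. \<one>\<^bsub>free_ab B\<^esub>) k"
      by (rule hom_eq_on_generate[OF group_free_grp AB.is_group q(1) _ _ _ k]) (auto simp: hom_def q(3) gen_in_free_grp)
    then show ?thesis by simp
  qed
  have qu: "q (inc g) = ?pB g" if g: "g \<in> carrier (free_grp B)" for g
  proof -
    have "(q \<circ> inc) g = ?pB g"
      by (rule free_grp_hom_eqI[OF AB.is_group hom_compose[OF free_map_hom q(1)] ab_proj_hom _ g])
        (simp add: free_map_gen q(2) eb_def)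
    then show ?thesis by simp
  qed
  define r where "r = restrict q (carrier (free_ab C))"
  have Pr: "?P r"
    using ext_homI[OF AC.is_group qf(1)] qf(2) qK qu pCc Kc free_map_closed by (auto simp: r_def subset_iff)
  have Pr1: "r (?pC k) = \<one>\<^bsub>free_ab B\<^esub>" if "k \<in> cofactor" for k using Pr that by blast
  have Pr2: "r (?pC (inc g)) = ?pB g" if "g \<in> carrier (free_grp B)" for g using Pr that by blast
  have uniq: "r' = r" if P: "?P r'" for r'
  proof (rule ext_hom_eq_on_generators[of "free_ab C" "free_ab B" _ _ "eb C ` C"])
    have P1: "r' (?pC k) = \<one>\<^bsub>free_ab B\<^esub>" if "k \<in> cofactor" for k using P that by blast
    have P2: "r' (?pC (inc g)) = ?pB g" if "g \<in> carrier (free_grp B)" for g using P that by blast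
    fix x assume "x \<in> eb C ` C"
    then obtain c where c: "c \<in> C" "x = ?pC (gen c)" by (auto simp: eb_def)
    then consider "gen c \<in> cofactor" | g where "g \<in> carrier (free_grp B)" "gen c = inc g" using gen_decomp by blast
    then show "r' x = r x"
    proof cases
      case 1
      show ?thesis unfolding c(2) P1[OF 1] Pr1[OF 1] by (rule refl)
    next
      case 2
      show ?thesis unfolding c(2) 2(2) P2[OF 2(1)] Pr2[OF 2(1)] by (rule refl)
    qed
  next
    show "r' \<in> ext_hom (free_ab C) (free_ab B)" "r \<in> ext_hom (free_ab C) (free_ab B)" using P Pr by blast+
  qed (use free_ab_generate eb_in AC.is_group AB.is_group in auto)
  have fst: "fst (ab_mor (free_grp B) (free_grp C) (gmor B C \<sigma>)) = r"
  proof -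
    have "(THE r. ?P r) = r"
    proof (rule the_equality[of ?P])
      show "?P r" by (rule Pr)
      show "r' = r" if "?P r'" for r' using that by (rule uniq)
    qed
    then show ?thesis by (simp only: ab_mor_def gmor_def prod.case fst_conv)
  qed
  define v where "v = snd (ab_mor (free_grp B) (free_grp C) (gmor B C \<sigma>))"
  have v: "v = restrict (?pC \<circ> inc) (carrier (free_ab B))" by (simp add: v_def ab_mor_def gmor_def o_def)
  note pu = free_ab_factor[OF comm_group_free_ab hom_compose[OF free_map_hom ab_proj_hom]]
  have vin: "v \<in> ext_hom (free_ab B) (free_ab C)" unfolding v by (rule ext_homI[OF AB.is_group pu(1)])
  have veb: "v (eb B b) = eb C (\<sigma> b)" if "b \<in> B" for b
    using pu(2)[OF gen_in_free_grp[OF that]] that eb_in[OF that] by (simp add: v eb_def free_map_gen)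
  then show "b \<in> B \<Longrightarrow> snd (ab_mor (free_grp B) (free_grp C) (gmor B C \<sigma>)) (eb B b) = eb C (\<sigma> b)"
    by (simp add: v_def)
  have reb: "r (eb C (\<sigma> b)) = eb B b" if "b \<in> B" for b
    using Pr that gen_in_free_grp[OF that] free_map_gen[OF that] by (auto simp: eb_def)
  have rv: "(r \<circ> v) t = id t" if t: "t \<in> carrier (free_ab B)" for t
  proof (rule hom_eq_on_generate[OF AB.is_group AB.is_group, of "r \<circ> v" id "eb B ` B"])
    show "r \<circ> v \<in> hom (free_ab B) (free_ab B)" using ext_homD(1)[OF vin] Pr ext_homD(1) by (meson hom_compose)
  qed (use t free_ab_generate eb_in veb reb in \<open>auto simp: hom_def\<close>)
  have rc: "r (eb C c) = \<one>\<^bsub>free_ab B\<^esub>" if "c \<in> C" "c \<notin> \<sigma> ` B" for c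
    using Pr that by (auto simp: eb_def intro!: generate.incl)
  have vim: "v ` eb B ` B = eb C ` \<sigma> ` B" using veb by (auto simp: image_iff)
  show "based (free_ab B) (eb B ` B) (free_ab C) (eb C ` C) (ab_mor (free_grp B) (free_grp C) (gmor B C \<sigma>))"
    unfolding based_def Hom_Sab fst v_def[symmetric] vim
    using Pr vin rv rc im by auto
qed

end

section \<open>The Johnson homomorphism\<close>

context group
begin

lemma autoD:
  assumes "\<phi> \<in> auto G"
  shows "\<phi> \<in> hom G G" "\<And>x. x \<in> carrier G \<Longrightarrow> \<phi> x \<in> carrier G" "\<phi> \<in> extensional (carrier G)"
  using assms by (auto simp: auto_def Bij_def hom_def)

lemma AutoGroup_simps [simp]: "carrier (AutoGroup G) = auto G" "\<one>\<^bsub>AutoGroup G\<^esub> = (\<lambda>x\<in>carrier G. x)"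
  by (simp_all add: AutoGroup_def BijGroup_def)

lemma AutoGroup_mult: "\<phi> \<in> auto G \<Longrightarrow> \<psi> \<in> auto G \<Longrightarrow> x \<in> carrier G \<Longrightarrow> (\<phi> \<otimes>\<^bsub>AutoGroup G\<^esub> \<psi>) x = \<phi> (\<psi> x)"
  by (simp add: AutoGroup_def BijGroup_def auto_def compose_def)

lemma AutoGroup_inv:
  assumes "\<phi> \<in> auto G"
  shows "inv\<^bsub>AutoGroup G\<^esub> \<phi> \<in> auto G" "x \<in> carrier G \<Longrightarrow> (inv\<^bsub>AutoGroup G\<^esub> \<phi>) (\<phi> x) = x"
    "x \<in> carrier G \<Longrightarrow> \<phi> ((inv\<^bsub>AutoGroup G\<^esub> \<phi>) x) = x"
proof -
  interpret A: group "AutoGroup G" by (rule AutoGroup)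
  show i: "inv\<^bsub>AutoGroup G\<^esub> \<phi> \<in> auto G" using A.inv_closed assms by simp
  show "(inv\<^bsub>AutoGroup G\<^esub> \<phi>) (\<phi> x) = x" if "x \<in> carrier G"
    using AutoGroup_mult[OF i assms that] A.l_inv[of \<phi>] assms that by simp
  show "\<phi> ((inv\<^bsub>AutoGroup G\<^esub> \<phi>) x) = x" if "x \<in> carrier G"
    using AutoGroup_mult[OF assms i that] A.r_inv[of \<phi>] assms that by simp
qed

lemma auto_lcs: "\<phi> \<in> auto G \<Longrightarrow> x \<in> lcs n \<Longrightarrow> \<phi> x \<in> lcs n"
  using hom_lower_central[OF is_group is_group autoD(1)] by blast

end

text \<open>Acting trivially on the quotient means \<phi>(C) = C for each coset C. The congruence
  gives only \<phi>(C) \<subseteq> C; the other inclusion needs the same for the inverse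
  automorphism, which also preserves gamma_{n+1}.\<close>

lemma JA_eq:
  fixes G :: "nat monoid" (structure)
  assumes "group G"
  shows "JA n G = {\<phi> \<in> auto G. \<forall>g\<in>carrier G. \<phi> g \<otimes> inv g \<in> lower_central G (Suc n)}"
proof -
  interpret group G by fact
  let ?N = "lcs (Suc n)"
  interpret N: normal ?N G by (rule lcs_normal)
  interpret Q: group "G Mod ?N" by (rule N.factorgroup_is_group)
  have cQ: "carrier (G Mod ?N) = {?N #> g | g. g \<in> carrier G}" by (auto simp: FactGroup_def RCOSETS_def)
  have JA: "JA n G = {\<phi> \<in> auto G. \<forall>C\<in>carrier (G Mod ?N). \<phi> ` C = C}"
    by (auto simp: JA_def Let_def kernel_def restrict_def fun_eq_iff)
  have iff: "(\<forall>C\<in>carrier (G Mod ?N). \<phi> ` C = C) \<longleftrightarrow> (\<forall>g\<in>carrier G. \<phi> g \<otimes> inv g \<in> ?N)"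
    if \<phi>: "\<phi> \<in> auto G" for \<phi>
  proof
    assume *: "\<forall>C\<in>carrier (G Mod ?N). \<phi> ` C = C"
    show "\<forall>g\<in>carrier G. \<phi> g \<otimes> inv g \<in> ?N"
    proof
      fix g assume g: "g \<in> carrier G"
      then have "\<phi> ` (?N #> g) = ?N #> g" using * cQ by blast
      moreover have "g \<in> ?N #> g" using rcos_self g N.subgroup_axioms by blast
      ultimately have "\<phi> g \<in> ?N #> g" by blast
      then show "\<phi> g \<otimes> inv g \<in> ?N" using N.rcos_module_imp[OF is_group g] by blast
    qed
  next
    assume *: "\<forall>g\<in>carrier G. \<phi> g \<otimes> inv g \<in> ?N"
    interpret \<phi>: group_hom G G \<phi> by unfold_locales (rule autoD(1)[OF \<phi>])
    let ?\<psi> = "inv\<^bsub>AutoGroup G\<^esub> \<phi>"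
    note \<psi> = AutoGroup_inv[OF \<phi>]
    interpret \<psi>: group_hom G G ?\<psi> by unfold_locales (rule autoD(1)[OF \<psi>(1)])
    have sub: "\<phi> x \<in> ?N #> g" if g: "g \<in> carrier G" and x: "x \<in> ?N #> g" for x g
    proof -
      have xc: "x \<in> carrier G" using N.elemrcos_carrier[OF is_group g x] .
      have "x \<otimes> inv g \<in> ?N" using N.rcos_module_imp[OF is_group g x] .
      moreover have "\<phi> x \<otimes> inv x \<in> ?N" using * xc by blast
      ultimately have "(\<phi> x \<otimes> inv x) \<otimes> (x \<otimes> inv g) \<in> ?N" by simp
      then have "\<phi> x \<otimes> inv g \<in> ?N" using xc g by (simp add: m_assoc)
      then show ?thesis using N.rcos_module_rev[OF is_group g] xc by simp
    qed
    have sub': "?\<psi> x \<in> ?N #> g" if g: "g \<in> carrier G" and x: "x \<in> ?N #> g" for x g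
    proof -
      have xc: "x \<in> carrier G" using N.elemrcos_carrier[OF is_group g x] .
      have "x \<otimes> inv g \<in> ?N" using N.rcos_module_imp[OF is_group g x] .
      moreover have "\<phi> g \<otimes> inv g \<in> ?N" using * g by blast
      ultimately have "(x \<otimes> inv g) \<otimes> inv (\<phi> g \<otimes> inv g) \<in> ?N" by simp
      then have "x \<otimes> inv (\<phi> g) \<in> ?N" using xc g by (simp add: m_assoc inv_mult_group)
      then have "?\<psi> (x \<otimes> inv (\<phi> g)) \<in> ?N" by (rule auto_lcs[OF \<psi>(1)])
      then have "?\<psi> x \<otimes> inv g \<in> ?N" using xc g \<psi>(2) by simp
      then show ?thesis using N.rcos_module_rev[OF is_group g] xc by simp
    qed
    show "\<forall>C\<in>carrier (G Mod ?N). \<phi> ` C = C"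
    proof
      fix C assume "C \<in> carrier (G Mod ?N)"
      then obtain g where g: "g \<in> carrier G" "C = ?N #> g" using cQ by blast
      have "x \<in> \<phi> ` C" if "x \<in> C" for x
      proof
        show "?\<psi> x \<in> C" using sub' that g by blast
        show "x = \<phi> (?\<psi> x)" using \<psi>(3) that g N.elemrcos_carrier[OF is_group] by simp
      qed
      then show "\<phi> ` C = C" using sub g by auto
    qed
  qed
  show ?thesis using iff by (auto simp: JA)
qed

section \<open>The terms of the filtration as normal subgroups\<close>

abbreviation JA_group :: "nat \<Rightarrow> nat monoid \<Rightarrow> (nat \<Rightarrow> nat) monoid" where
  "JA_group n G \<equiv> (AutoGroup G)\<lparr>carrier := JA n G\<rparr>"

context
  fixes G :: "nat monoid" and n :: nat
  assumes G: "group G"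
begin

interpretation group G by (rule G)

lemma JA_auto: "\<phi> \<in> JA n G \<Longrightarrow> \<phi> \<in> auto G"
  by (simp add: JA_eq[OF G])

lemma JA_lcs: "\<phi> \<in> JA n G \<Longrightarrow> g \<in> carrier G \<Longrightarrow> \<phi> g \<otimes>\<^bsub>G\<^esub> inv\<^bsub>G\<^esub> g \<in> lower_central G (Suc n)"
  by (simp add: JA_eq[OF G])

text \<open>Let c(\<phi>, g) be \<phi>(g) times the inverse of g. Then c(\<phi>\<psi>, g) =
  \<phi>(c(\<psi>, g)) c(\<phi>, g), and conjugating \<phi> by \<psi> turns c(\<phi>, h) into its
  image under \<psi>, where h is the preimage of g under \<psi>. Automorphisms preserve gamma_{n+1},
  so all conditions are stable.\<close>

lemma JA_normal: "normal (JA n G) (AutoGroup G)"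
proof -
  interpret A: group "AutoGroup G" by (rule AutoGroup)
  interpret N: normal "lower_central G (Suc n)" G by (rule lcs_normal)
  have sub: "subgroup (JA n G) (AutoGroup G)"
  proof
    show "JA n G \<subseteq> carrier (AutoGroup G)" using JA_auto by auto
    fix \<phi> \<psi> assume \<phi>: "\<phi> \<in> JA n G" and \<psi>: "\<psi> \<in> JA n G"
    note a = JA_auto[OF \<phi>] JA_auto[OF \<psi>]
    interpret \<phi>: group_hom G G \<phi> by unfold_locales (rule autoD(1)[OF a(1)])
    have "(\<phi> \<otimes>\<^bsub>AutoGroup G\<^esub> \<psi>) g \<otimes>\<^bsub>G\<^esub> inv\<^bsub>G\<^esub> g \<in> lower_central G (Suc n)" if g: "g \<in> carrier G" for g
    proof -
      have "(\<phi> \<otimes>\<^bsub>AutoGroup G\<^esub> \<psi>) g \<otimes>\<^bsub>G\<^esub> inv\<^bsub>G\<^esub> g = \<phi> (\<psi> g \<otimes>\<^bsub>G\<^esub> inv\<^bsub>G\<^esub> g) \<otimes>\<^bsub>G\<^esub> (\<phi> g \<otimes>\<^bsub>G\<^esub> inv\<^bsub>G\<^esub> g)"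
        using AutoGroup_mult[OF a g] autoD(2)[OF a(2) g] g by (simp add: m_assoc)
      then show ?thesis using auto_lcs[OF a(1)] JA_lcs[OF \<phi> g] JA_lcs[OF \<psi> g] by simp
    qed
    then show "\<phi> \<otimes>\<^bsub>AutoGroup G\<^esub> \<psi> \<in> JA n G" using A.m_closed a by (simp add: JA_eq[OF G])
  next
    show "\<one>\<^bsub>AutoGroup G\<^esub> \<in> JA n G" using id_in_auto by (simp add: JA_eq[OF G])
  next
    fix \<phi> assume \<phi>: "\<phi> \<in> JA n G"
    note a = JA_auto[OF \<phi>]
    note i = AutoGroup_inv[OF a]
    interpret i: group_hom G G "inv\<^bsub>AutoGroup G\<^esub> \<phi>" by unfold_locales (rule autoD(1)[OF i(1)])
    have "(inv\<^bsub>AutoGroup G\<^esub> \<phi>) g \<otimes>\<^bsub>G\<^esub> inv\<^bsub>G\<^esub> g \<in> lower_central G (Suc n)" if g: "g \<in> carrier G" for g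
    proof -
      have "(inv\<^bsub>AutoGroup G\<^esub> \<phi>) g \<otimes>\<^bsub>G\<^esub> inv\<^bsub>G\<^esub> g = (inv\<^bsub>AutoGroup G\<^esub> \<phi>) (inv\<^bsub>G\<^esub> (\<phi> g \<otimes>\<^bsub>G\<^esub> inv\<^bsub>G\<^esub> g))"
        using i(2)[OF g] autoD(2)[OF a g] g by (simp add: inv_mult_group)
      then show ?thesis using auto_lcs[OF i(1)] JA_lcs[OF \<phi> g] by simp
    qed
    then show "inv\<^bsub>AutoGroup G\<^esub> \<phi> \<in> JA n G" using i(1) by (simp add: JA_eq[OF G])
  qed
  show ?thesis
  proof (rule A.normal_invI[OF sub])
    fix \<psi> \<phi> assume \<psi>: "\<psi> \<in> carrier (AutoGroup G)" and \<phi>: "\<phi> \<in> JA n G"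
    have a: "\<phi> \<in> auto G" "\<psi> \<in> auto G" using JA_auto[OF \<phi>] \<psi> by auto
    note i = AutoGroup_inv[OF a(2)]
    have ab: "\<psi> \<otimes>\<^bsub>AutoGroup G\<^esub> \<phi> \<in> auto G" using A.m_closed a by simp
    interpret \<psi>: group_hom G G \<psi> by unfold_locales (rule autoD(1)[OF a(2)])
    have "(\<psi> \<otimes>\<^bsub>AutoGroup G\<^esub> \<phi> \<otimes>\<^bsub>AutoGroup G\<^esub> inv\<^bsub>AutoGroup G\<^esub> \<psi>) g \<otimes>\<^bsub>G\<^esub> inv\<^bsub>G\<^esub> g \<in> lower_central G (Suc n)"
      if g: "g \<in> carrier G" for g
    proof -
      let ?h = "(inv\<^bsub>AutoGroup G\<^esub> \<psi>) g"
      have h: "?h \<in> carrier G" using autoD(2)[OF i(1) g] .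
      have "(\<psi> \<otimes>\<^bsub>AutoGroup G\<^esub> \<phi> \<otimes>\<^bsub>AutoGroup G\<^esub> inv\<^bsub>AutoGroup G\<^esub> \<psi>) g \<otimes>\<^bsub>G\<^esub> inv\<^bsub>G\<^esub> g
        = \<psi> (\<phi> ?h) \<otimes>\<^bsub>G\<^esub> inv\<^bsub>G\<^esub> \<psi> ?h"
        using AutoGroup_mult[OF ab i(1) g] AutoGroup_mult[OF a(2,1) h] i(3)[OF g] by simp
      also have "\<dots> = \<psi> (\<phi> ?h \<otimes>\<^bsub>G\<^esub> inv\<^bsub>G\<^esub> ?h)"
        using h autoD(2)[OF a(1) h] by simp
      finally show ?thesis using auto_lcs[OF a(2)] JA_lcs[OF \<phi> h] by simp
    qed
    then show "\<psi> \<otimes>\<^bsub>AutoGroup G\<^esub> \<phi> \<otimes>\<^bsub>AutoGroup G\<^esub> inv\<^bsub>AutoGroup G\<^esub> \<psi> \<in> JA n G"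
      using A.m_closed A.inv_closed a by (simp add: JA_eq[OF G])
  qed
qed

end

lemma JA_Suc_subset: "group G \<Longrightarrow> JA (Suc n) G \<subseteq> JA n G"
  using group.lcs_Suc_subset[of G "Suc n"] by (auto simp: JA_eq)

lemma group_JA_group: "group G \<Longrightarrow> group (JA_group n G)"
  using subgroup.subgroup_is_group[OF normal_imp_subgroup[OF JA_normal] group.AutoGroup] .

lemma JA_Suc_normal:
  assumes G: "group G"
  shows "normal (JA (Suc n) G) (JA_group n G)"
proof -
  interpret A: group "AutoGroup G" by (rule group.AutoGroup[OF G])
  interpret P: group "JA_group n G" by (rule group_JA_group[OF G])
  interpret S: subgroup "JA n G" "AutoGroup G" by (rule normal_imp_subgroup[OF JA_normal[OF G]])
  interpret S': normal "JA (Suc n) G" "AutoGroup G" by (rule JA_normal[OF G])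
  have inv: "inv\<^bsub>JA_group n G\<^esub> \<phi> = inv\<^bsub>AutoGroup G\<^esub> \<phi>" if "\<phi> \<in> JA n G" for \<phi>
    using A.m_inv_consistent[OF S.subgroup_axioms that] .
  show ?thesis
  proof (rule P.normal_invI)
    show "subgroup (JA (Suc n) G) (JA_group n G)"
      using JA_Suc_subset[OF G, of n] inv S'.m_inv_closed by (auto simp: subgroup_def subset_iff)
    fix \<psi> \<phi> assume "\<psi> \<in> carrier (JA_group n G)" "\<phi> \<in> JA (Suc n) G"
    then show "\<psi> \<otimes>\<^bsub>JA_group n G\<^esub> \<phi> \<otimes>\<^bsub>JA_group n G\<^esub> inv\<^bsub>JA_group n G\<^esub> \<psi> \<in> JA (Suc n) G"
      using inv S'.inv_op_closed2[of \<psi> \<phi>] S.mem_carrier by simp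
  qed
qed

text \<open>The Johnson homomorphism, kept as a function on the group: the value at g is a class in
  gamma_{n+1}/gamma_{n+2}. Its values at a basis are the coordinates.\<close>

definition johnson :: "nat \<Rightarrow> nat monoid \<Rightarrow> (nat \<Rightarrow> nat) \<Rightarrow> nat \<Rightarrow> nat" where
  "johnson n G \<phi> g = group.cl G (Suc n) (\<phi> g \<otimes>\<^bsub>G\<^esub> inv\<^bsub>G\<^esub> g)"

context
  fixes G :: "nat monoid" and n :: nat
  assumes G: "group G" and n: "n \<ge> 1"
begin

interpretation group G by (rule G)
interpretation P: group "JA_group n G" by (rule group_JA_group[OF G])
interpretation N: normal "JA (Suc n) G" "JA_group n G" by (rule JA_Suc_normal[OF G])

text \<open>By the cocycle identity the value for \<phi>\<psi> is the class of \<phi>(c) d, where c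
  and d are the values for \<psi> and \<phi>, and \<phi> does not change the class of c.\<close>

lemma johnson_mult:
  assumes \<phi>: "\<phi> \<in> JA n G" and \<psi>: "\<psi> \<in> JA n G" and g: "g \<in> carrier G"
  shows "johnson n G (\<phi> \<otimes>\<^bsub>AutoGroup G\<^esub> \<psi>) g = johnson n G \<phi> g \<otimes>\<^bsub>gr (Suc n)\<^esub> johnson n G \<psi> g"
proof -
  note a = JA_auto[OF G \<phi>] JA_auto[OF G \<psi>]
  interpret L: comm_group "gr (Suc n)" by (rule comm_group_gr) simp
  interpret \<phi>: group_hom G G \<phi> by unfold_locales (rule autoD(1)[OF a(1)])
  define c where "c = \<psi> g \<otimes>\<^bsub>G\<^esub> inv\<^bsub>G\<^esub> g"
  define d where "d = \<phi> g \<otimes>\<^bsub>G\<^esub> inv\<^bsub>G\<^esub> g"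
  have c: "c \<in> lcs (Suc n)" and d: "d \<in> lcs (Suc n)"
    unfolding c_def d_def using JA_lcs[OF G] \<phi> \<psi> g by auto
  have \<phi>c: "\<phi> c \<in> lcs (Suc n)" using auto_lcs[OF a(1) c] .
  have "\<phi> c \<otimes>\<^bsub>G\<^esub> inv\<^bsub>G\<^esub> c \<in> lcs (Suc (Suc n))"
  proof (rule trivial_on_graded[OF autoD(1)[OF a(1)] _ _ c])
    \<comment> \<open>Here n \<ge> 1 enters: elements of A_n then act trivially on the
      abelianisation.\<close>
    fix h assume "h \<in> carrier G"
    then show "\<phi> h \<otimes>\<^bsub>G\<^esub> inv\<^bsub>G\<^esub> h \<in> lcs 2"
      using JA_lcs[OF G \<phi>] lcs_mono[of 2 "Suc n"] n by auto
  qed simp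
  then have 1: "cl (Suc n) (\<phi> c) = cl (Suc n) c" using cl_eq_iff[OF \<phi>c c] by blast
  have "(\<phi> \<otimes>\<^bsub>AutoGroup G\<^esub> \<psi>) g \<otimes>\<^bsub>G\<^esub> inv\<^bsub>G\<^esub> g = \<phi> c \<otimes>\<^bsub>G\<^esub> d"
    using AutoGroup_mult[OF a g] autoD(2)[OF a(2) g] g by (simp add: m_assoc c_def d_def)
  then show ?thesis
    using cl_mult[OF \<phi>c d] 1 cl_closed[OF c] cl_closed[OF d] by (simp add: johnson_def L.m_comm flip: c_def d_def)
qed

lemma johnson_closed: "\<phi> \<in> JA n G \<Longrightarrow> g \<in> carrier G \<Longrightarrow> johnson n G \<phi> g \<in> carrier (gr (Suc n))"
  unfolding johnson_def using cl_closed JA_lcs[OF G] by blast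

text \<open>A representative differs by an element of A_{n+1}, on which the Johnson homomorphism is
  trivial.\<close>

lemma johnson_rep_of:
  assumes \<phi>: "\<phi> \<in> JA n G" and g: "g \<in> carrier G"
  shows "johnson n G (rep_of (JA_group n G) (JA (Suc n) G) \<phi>) g = johnson n G \<phi> g"
proof -
  interpret L: comm_group "gr (Suc n)" by (rule comm_group_gr) simp
  obtain \<kappa> where \<kappa>: "\<kappa> \<in> JA (Suc n) G" "rep_of (JA_group n G) (JA (Suc n) G) \<phi> = \<kappa> \<otimes>\<^bsub>JA_group n G\<^esub> \<phi>"
    by (rule N.rep_of_obtain[of \<phi>]) (use \<phi> in auto)
  have \<kappa>': "\<kappa> \<in> JA n G" using \<kappa>(1) JA_Suc_subset[OF G] by blast
  have "johnson n G \<kappa> g = \<one>\<^bsub>gr (Suc n)\<^esub>"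
    unfolding johnson_def using cl_one_iff[OF JA_lcs[OF G \<kappa>' g]] JA_lcs[OF G \<kappa>(1) g] by blast
  then show ?thesis using \<kappa>(2) johnson_mult[OF \<kappa>' \<phi> g] johnson_closed[OF \<phi> g] by simp
qed

lemma johnson_hom:
  assumes "g \<in> carrier G"
  shows "(\<lambda>\<phi>. johnson n G \<phi> g) \<in> hom (quot (JA_group n G) (JA (Suc n) G)) (gr (Suc n))"
proof (rule homI)
  fix \<phi> \<psi>
  assume "\<phi> \<in> carrier (quot (JA_group n G) (JA (Suc n) G))" "\<psi> \<in> carrier (quot (JA_group n G) (JA (Suc n) G))"
  then have p: "\<phi> \<in> JA n G" "\<psi> \<in> JA n G" using N.quot_carrierD(1) by auto
  show "johnson n G \<phi> g \<in> carrier (gr (Suc n))" by (rule johnson_closed[OF p(1) assms])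
  have "\<phi> \<otimes>\<^bsub>AutoGroup G\<^esub> \<psi> \<in> JA n G" using P.m_closed p by simp
  from johnson_rep_of[OF this assms]
  show "johnson n G (\<phi> \<otimes>\<^bsub>quot (JA_group n G) (JA (Suc n) G)\<^esub> \<psi>) g = johnson n G \<phi> g \<otimes>\<^bsub>gr (Suc n)\<^esub> johnson n G \<psi> g"
    using johnson_mult[OF p assms] by (simp add: quot_def)
qed

text \<open>Trivial coordinates put \<phi>(s) and s in the same class modulo gamma_{n+2} for all
  generators s, hence for all elements, which is membership in A_{n+1}.\<close>

lemma johnson_faithful:
  assumes S: "S \<subseteq> carrier G" "generate G S = carrier G"
    and \<phi>: "\<phi> \<in> carrier (quot (JA_group n G) (JA (Suc n) G))"
    and 1: "\<And>s. s \<in> S \<Longrightarrow> johnson n G \<phi> s = \<one>\<^bsub>gr (Suc n)\<^esub>"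
  shows "\<phi> = \<one>\<^bsub>quot (JA_group n G) (JA (Suc n) G)\<^esub>"
proof -
  have p: "\<phi> \<in> JA n G" and r: "rep_of (JA_group n G) (JA (Suc n) G) \<phi> = \<phi>" using N.quot_carrierD[OF \<phi>] by auto
  note a = JA_auto[OF G p]
  have "s \<in> {g \<in> carrier G. \<phi> g \<otimes>\<^bsub>G\<^esub> inv\<^bsub>G\<^esub> g \<in> lcs (Suc (Suc n))}" if "s \<in> S" for s
    using 1[OF that] cl_one_iff[OF JA_lcs[OF G p]] S(1) that by (auto simp: johnson_def)
  then have "generate G S \<subseteq> {g \<in> carrier G. \<phi> g \<otimes>\<^bsub>G\<^esub> inv\<^bsub>G\<^esub> g \<in> lcs (Suc (Suc n))}"
    by (intro generate_subgroup_incl hom_diff_subgroup autoD(1)[OF a] lcs_normal) blast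
  then have "\<phi> \<in> JA (Suc n) G" using S(2) a by (auto simp: JA_eq[OF G])
  then show ?thesis using N.rep_of_one_iff[of \<phi>] p r by simp
qed

end

lemma JA_I:
  assumes "group G" "S \<subseteq> carrier G" "generate G S = carrier G" "\<phi> \<in> auto G"
    "\<And>s. s \<in> S \<Longrightarrow> \<phi> s \<otimes>\<^bsub>G\<^esub> inv\<^bsub>G\<^esub> s \<in> lower_central G (Suc n)"
  shows "\<phi> \<in> JA n G"
proof -
  interpret group G by fact
  have "generate G S \<subseteq> {g \<in> carrier G. \<phi> g \<otimes>\<^bsub>G\<^esub> inv\<^bsub>G\<^esub> g \<in> lcs (Suc n)}"
    by (intro generate_subgroup_incl hom_diff_subgroup autoD(1)[OF assms(4)] lcs_normal) (use assms in auto)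
  then show ?thesis using assms(3,4) by (auto simp: JA_eq[OF assms(1)])
qed

text \<open>The automorphism e_b \<mapsto> z e_b fixing the other generators. As z does not involve
  e_b it is fixed, so replacing z by its inverse gives the inverse automorphism.\<close>

lemma transvection_in_JA:
  assumes b: "b \<in> B" and z: "z \<in> generate (free_grp B) (gen ` (B - {b}))"
    and zl: "z \<in> lower_central (free_grp B) (Suc n)"
  obtains \<phi> where "\<phi> \<in> JA n (free_grp B)" "\<phi> (gen b) = z \<otimes>\<^bsub>free_grp B\<^esub> gen b"
proof -
  let ?G = "free_grp B"
  interpret G: group ?G by (rule group_free_grp)
  have sub: "gen ` (B - {b}) \<subseteq> carrier ?G" by (auto simp: gen_in_free_grp)
  have zc: "z \<in> carrier ?G" by (rule G.generate_in_carrier[OF sub z])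
  have gb: "gen b \<in> carrier ?G" using gen_in_free_grp[OF b] .
  have ex: "\<exists>h. h \<in> hom ?G ?G \<and> h (gen b) = w \<otimes>\<^bsub>?G\<^esub> gen b \<and> (\<forall>c\<in>B - {b}. h (gen c) = gen c) \<and> h z = z"
    if w: "w \<in> carrier ?G" for w
  proof -
    obtain h where h: "h \<in> hom ?G ?G" "\<And>c. c \<in> B \<Longrightarrow> h (gen c) = (if c = b then w \<otimes>\<^bsub>?G\<^esub> gen b else gen c)"
      by (rule free_grp_universal[OF group_free_grp, of B "\<lambda>c. if c = b then w \<otimes>\<^bsub>?G\<^esub> gen b else gen c"])
        (use w gb gen_in_free_grp in auto)
    have "h z = id z"
      by (rule hom_eq_on_generate[OF group_free_grp group_free_grp h(1) _ sub _ z]) (auto simp: hom_def h(2) split: if_splits)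
    then show ?thesis using h b by (intro exI[of _ h]) auto
  qed
  obtain h where h: "h \<in> hom ?G ?G" "h (gen b) = z \<otimes>\<^bsub>?G\<^esub> gen b" "\<And>c. c \<in> B \<Longrightarrow> c \<noteq> b \<Longrightarrow> h (gen c) = gen c" "h z = z"
    using ex[OF zc] by blast
  obtain k where k: "k \<in> hom ?G ?G" "k (gen b) = inv\<^bsub>?G\<^esub> z \<otimes>\<^bsub>?G\<^esub> gen b" "\<And>c. c \<in> B \<Longrightarrow> c \<noteq> b \<Longrightarrow> k (gen c) = gen c" "k z = z"
    using ex[of "inv\<^bsub>?G\<^esub> z"] zc by blast
  interpret h: group_hom ?G ?G h by unfold_locales (rule h(1))
  interpret k: group_hom ?G ?G k by unfold_locales (rule k(1))
  have kh: "(k \<circ> h) x = id x" if "x \<in> carrier ?G" for x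
  proof (rule free_grp_hom_eqI[OF group_free_grp hom_compose[OF h(1) k(1)] _ _ that])
    fix c assume "c \<in> B"
    then show "(k \<circ> h) (gen c) = id (gen c)"
      using h(2,3) k(2-4) zc gb by (cases "c = b") auto
  qed (simp add: hom_def)
  have hk: "(h \<circ> k) x = id x" if "x \<in> carrier ?G" for x
  proof (rule free_grp_hom_eqI[OF group_free_grp hom_compose[OF k(1) h(1)] _ _ that])
    fix c assume "c \<in> B"
    then show "(h \<circ> k) (gen c) = id (gen c)"
      using k(2,3) h(2-4) zc gb by (cases "c = b") auto
  qed (simp add: hom_def)
  have "bij_betw h (carrier ?G) (carrier ?G)"
    using kh hk by (intro bij_betwI[of _ _ _ k]) auto
  then have bb: "bij_betw (restrict h (carrier ?G)) (carrier ?G) (carrier ?G)" by (simp cong: bij_betw_cong)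
  have a: "restrict h (carrier ?G) \<in> auto ?G"
    using ext_homI[OF group_free_grp h(1)] bb by (auto simp: auto_def Bij_def ext_hom_def)
  have "restrict h (carrier ?G) \<in> JA n ?G"
  proof (rule JA_I[OF group_free_grp _ free_grp_generate a])
    fix s assume "s \<in> gen ` B"
    then obtain c where c: "c \<in> B" "s = gen c" by blast
    then have "h s \<otimes>\<^bsub>?G\<^esub> inv\<^bsub>?G\<^esub> s = (if c = b then z else \<one>\<^bsub>?G\<^esub>)"
      using h(2,3) zc gb gen_in_free_grp[OF c(1)] by (auto simp: G.m_assoc)
    then show "restrict h (carrier ?G) s \<otimes>\<^bsub>?G\<^esub> inv\<^bsub>?G\<^esub> s \<in> lower_central ?G (Suc n)"
      using zl c gen_in_free_grp[OF c(1)] subgroup.one_closed[OF G.lcs_subgroup, of "Suc n"] by auto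
  qed (auto simp: gen_in_free_grp)
  then show thesis using that h(2) gb by simp
qed

section \<open>Johnson coordinates of elements of the functor\<close>

text \<open>Values of the functor are known only at abelianisations of free groups, so
  \<open>V\<close> is identified with the abelianisation of the free group whose alphabet is the set
  \<open>B\<close> itself.\<close>

definition frame_iso :: "nat monoid \<Rightarrow> nat set \<Rightarrow> split_mor" where
  "frame_iso V B = (SOME f. based V B (free_ab B) (eb B ` B) f \<and> (\<forall>b\<in>B. snd f b = eb B b))"

lemma frame_iso:
  assumes V: "framed V B"
  shows "based V B (free_ab B) (eb B ` B) (frame_iso V B)" "\<And>b. b \<in> B \<Longrightarrow> snd (frame_iso V B) b = eb B b"
proof -
  obtain f where "based V B (free_ab B) (eb B ` B) f" "\<And>b. b \<in> B \<Longrightarrow> snd f b = eb B b"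
    by (rule based_exists[OF V framed_free_ab[OF framedD(5)[OF V]] inj_on_eb]) auto
  then have ex: "\<exists>f. based V B (free_ab B) (eb B ` B) f \<and> (\<forall>b\<in>B. snd f b = eb B b)" by blast
  show "based V B (free_ab B) (eb B ` B) (frame_iso V B)" "\<And>b. b \<in> B \<Longrightarrow> snd (frame_iso V B) b = eb B b"
    using someI_ex[OF ex] by (auto simp: frame_iso_def)
qed

lemma based_Idm: "framed V B \<Longrightarrow> based V B V B (Idm Sab V)"
  using framedD(6)[of V B] Idm_Sab_in[OF framedD(4)] by (auto simp: based_def Idm_Sab)

lemma frame_iso_inverse:
  assumes V: "framed V B"
  obtains g where "g \<in> Hom Sab (free_ab B) V"
    "Comp Sab V (free_ab B) V g (frame_iso V B) = Idm Sab V"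
    "Comp Sab (free_ab B) V (free_ab B) (frame_iso V B) g = Idm Sab (free_ab B)"
proof -
  note A = framed_free_ab[OF framedD(5)[OF V]] and i = frame_iso[OF V]
  let ?inv = "\<lambda>x. inv_into B (eb B) x"
  have inv: "?inv (eb B b) = b" if "b \<in> B" for b using inj_on_eb that by simp
  have "inj_on ?inv (eb B ` B)" "?inv ` eb B ` B \<subseteq> B" using inv by (auto simp: inj_on_def)
  from based_exists[OF A V this]
  obtain g where g: "based (free_ab B) (eb B ` B) V B g" "\<And>x. x \<in> eb B ` B \<Longrightarrow> snd g x = ?inv x" by blast
  show thesis
  proof (rule that[OF basedD(1)[OF g(1)]])
    show "Comp Sab V (free_ab B) V g (frame_iso V B) = Idm Sab V"
    proof (rule based_eqI[OF V V based_Comp[OF V A V i(1) g(1)] based_Idm[OF V]])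
      fix b assume "b \<in> B"
      then show "snd (Comp Sab V (free_ab B) V g (frame_iso V B)) b = snd (Idm Sab V) b"
        using framedD(6)[OF V] i(2) g(2) inv by (auto simp: Comp_Sab_apply Idm_Sab_apply)
    qed
    show "Comp Sab (free_ab B) V (free_ab B) (frame_iso V B) g = Idm Sab (free_ab B)"
    proof (rule based_eqI[OF A A based_Comp[OF A V A g(1) i(1)] based_Idm[OF A]])
      fix x assume "x \<in> eb B ` B"
      then show "snd (Comp Sab (free_ab B) V (free_ab B) (frame_iso V B) g) x = snd (Idm Sab (free_ab B)) x"
        using eb_in i(2) g(2) inv by (auto simp: Comp_Sab_apply Idm_Sab_apply)
    qed
  qed
qed

abbreviation gcl :: "nat set \<Rightarrow> nat \<Rightarrow> nat \<Rightarrow> nat" where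
  "gcl B \<equiv> group.cl (free_grp B)"

abbreviation ggr :: "nat set \<Rightarrow> nat \<Rightarrow> nat monoid" where
  "ggr B \<equiv> group.gr (free_grp B)"

abbreviation glcs :: "nat set \<Rightarrow> nat \<Rightarrow> nat set" where
  "glcs B \<equiv> lower_central (free_grp B)"

abbreviation JA_quot :: "nat \<Rightarrow> nat set \<Rightarrow> (nat \<Rightarrow> nat) monoid" where
  "JA_quot n B \<equiv> quot (JA_group n (free_grp B)) (JA (Suc n) (free_grp B))"

lemma Fob_JA_quotient: "Fob (JA_quotient n) G = quot (JA_group n G) (JA (Suc n) G)"
  by (simp add: JA_quotient_def Fquot_def Fsub_def Aut_functor_def)

lemma Fmor_JA_quotient:
  "Fmor (JA_quotient n) G H f \<phi> = rep_of (JA_group n H) (JA (Suc n) H) (Fmor Aut_functor G H f \<phi>)"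
  by (simp add: JA_quotient_def Fquot_def Fsub_def Aut_functor_def)

text \<open>The coordinate of \<open>t\<close> at the basis element \<open>b\<close>: transport
  \<open>t\<close> to a free group, take a representing automorphism \<phi>, and form the class of
  \<phi>(b) times the inverse of b.\<close>

definition jc :: "nat \<Rightarrow> 'b sfun \<Rightarrow> (nat monoid \<Rightarrow> 'b \<Rightarrow> nat \<Rightarrow> nat) \<Rightarrow> nat monoid \<Rightarrow> nat set \<Rightarrow> 'b \<Rightarrow> nat \<Rightarrow> nat" where
  "jc n F \<eta> V B t b =
     johnson n (free_grp B) (\<eta> (free_grp B) (Fmor F V (free_ab B) (frame_iso V B) t)) (gen b)"

lemma free_grp_Ob: "finite B \<Longrightarrow> free_grp B \<in> Ob Gcat"
  by (simp add: Gcat_def free_grp_fin_rank)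

context
  fixes n :: nat and F :: "'b sfun" and \<eta> :: "nat monoid \<Rightarrow> 'b \<Rightarrow> nat \<Rightarrow> nat"
  assumes n: "n \<ge> 1" and F: "ab_functor Sab F"
    and nat: "nat_trans Gcat (along_ab F) (JA_quotient n) \<eta>"
    and iso: "\<forall>a\<in>Ob Gcat. \<eta> a \<in> iso (Fob (along_ab F) a) (Fob (JA_quotient n) a)"
begin

lemma eta_iso: "finite B \<Longrightarrow> \<eta> (free_grp B) \<in> iso (Fob F (free_ab B)) (JA_quot n B)"
  using bspec[OF iso free_grp_Ob] by (simp add: along_ab_def Fob_JA_quotient)

lemma eta_hom: "finite B \<Longrightarrow> \<eta> (free_grp B) \<in> hom (Fob F (free_ab B)) (JA_quot n B)"
  using eta_iso by (simp add: iso_def)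

lemma frame_mor_hom:
  assumes V: "framed V B"
  shows "Fmor F V (free_ab B) (frame_iso V B) \<in> hom (Fob F V) (Fob F (free_ab B))"
  using ab_functorD(3)[OF F framedD(1)[OF V] framedD(1)[OF framed_free_ab] basedD(1)[OF frame_iso(1)[OF V]]] framedD(5)[OF V]
  by simp

lemma jc_hom:
  assumes V: "framed V B" and b: "b \<in> B"
  shows "(\<lambda>t. jc n F \<eta> V B t b) \<in> hom (Fob F V) (ggr B (Suc n))"
  using hom_compose[OF hom_compose[OF frame_mor_hom[OF V] eta_hom] johnson_hom[OF group_free_grp n gen_in_free_grp[OF b]]]
    framedD(5)[OF V]
  by (simp add: jc_def o_def)

text \<open>Each map in the definition of the coordinates loses nothing: \<open>frame_iso\<close> is
  invertible, \<eta> is injective, and the Johnson homomorphism is injective on A_n/A_{n+1}.\<close>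

lemma jc_faithful:
  assumes V: "framed V B" and t: "t \<in> carrier (Fob F V)" and 1: "\<And>b. b \<in> B \<Longrightarrow> jc n F \<eta> V B t b = \<one>\<^bsub>ggr B (Suc n)\<^esub>"
  shows "t = \<one>\<^bsub>Fob F V\<^esub>"
proof -
  have fin: "finite B" using framedD(5)[OF V] .
  note oV = framedD(1)[OF V] and oA = framedD(1)[OF framed_free_ab[OF fin]]
  let ?s = "Fmor F V (free_ab B) (frame_iso V B) t"
  have iV: "frame_iso V B \<in> Hom Sab V (free_ab B)" using basedD(1)[OF frame_iso(1)[OF V]] .
  have s: "?s \<in> carrier (Fob F (free_ab B))" by (rule ab_functorD(6)[OF F oV oA iV t])
  have "\<eta> (free_grp B) ?s = \<one>\<^bsub>JA_quot n B\<^esub>"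
  proof (rule johnson_faithful[OF group_free_grp n _ free_grp_generate])
    show "\<eta> (free_grp B) ?s \<in> carrier (JA_quot n B)" using hom_in_carrier[OF eta_hom[OF fin] s] .
  qed (use 1 gen_in_free_grp in \<open>auto simp: jc_def\<close>)
  moreover have "\<eta> (free_grp B) \<one>\<^bsub>Fob F (free_ab B)\<^esub> = \<one>\<^bsub>JA_quot n B\<^esub>"
    by (rule hom_one[OF eta_hom[OF fin] ab_functorD(2)[OF F oA] normal.group_quot[OF JA_Suc_normal[OF group_free_grp]]])
  moreover have "inj_on (\<eta> (free_grp B)) (carrier (Fob F (free_ab B)))"
    using eta_iso[OF fin] by (simp add: iso_def bij_betw_def)
  moreover have "\<one>\<^bsub>Fob F (free_ab B)\<^esub> \<in> carrier (Fob F (free_ab B))"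
    using group.is_monoid[OF ab_functorD(2)[OF F oA]] by (rule monoid.one_closed)
  ultimately have s1: "?s = \<one>\<^bsub>Fob F (free_ab B)\<^esub>" using s by (metis inj_onD)
  obtain g where g: "g \<in> Hom Sab (free_ab B) V" "Comp Sab V (free_ab B) V g (frame_iso V B) = Idm Sab V"
    using frame_iso_inverse[OF V] by metis
  have "t = Fmor F (free_ab B) V g ?s"
    using ab_functorD(5)[OF F oV oA oV iV g(1) t] ab_functorD(4)[OF F oV t] g(2) by simp
  then show ?thesis using ab_functorD(7)[OF F oA oV g(1)] s1 by simp
qed

text \<open>The transvection with parameter z has coordinate z at b; surjectivity of \<eta> and
  invertibility of \<open>frame_iso\<close> bring it back to \<open>V\<close>.\<close>

lemma jc_realize:
  assumes V: "framed V B" and b: "b \<in> B" and z: "z \<in> generate (free_grp B) (gen ` (B - {b}))"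
    and zl: "z \<in> glcs B (Suc n)"
  obtains t where "t \<in> carrier (Fob F V)" "jc n F \<eta> V B t b = gcl B (Suc n) z"
proof -
  have fin: "finite B" using framedD(5)[OF V] .
  interpret G: group "free_grp B" by (rule group_free_grp)
  interpret N: normal "JA (Suc n) (free_grp B)" "JA_group n (free_grp B)" by (rule JA_Suc_normal[OF group_free_grp])
  note oV = framedD(1)[OF V] and oA = framedD(1)[OF framed_free_ab[OF fin]]
  obtain \<phi> where \<phi>: "\<phi> \<in> JA n (free_grp B)" "\<phi> (gen b) = z \<otimes>\<^bsub>free_grp B\<^esub> gen b"
    by (rule transvection_in_JA[OF b z zl])
  have "rep_of (JA_group n (free_grp B)) (JA (Suc n) (free_grp B)) \<phi> \<in> carrier (JA_quot n B)"
    using \<phi>(1) by (simp add: quot_def)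
  then obtain s where s: "s \<in> carrier (Fob F (free_ab B))"
    "\<eta> (free_grp B) s = rep_of (JA_group n (free_grp B)) (JA (Suc n) (free_grp B)) \<phi>"
    using eta_iso[OF fin] unfolding iso_def bij_betw_def by (smt (verit) Int_iff imageE mem_Collect_eq)
  obtain g where g: "g \<in> Hom Sab (free_ab B) V" "Comp Sab (free_ab B) V (free_ab B) (frame_iso V B) g = Idm Sab (free_ab B)"
    using frame_iso_inverse[OF V] by metis
  have iV: "frame_iso V B \<in> Hom Sab V (free_ab B)" using basedD(1)[OF frame_iso(1)[OF V]] .
  let ?t = "Fmor F (free_ab B) V g s"
  have "Fmor F V (free_ab B) (frame_iso V B) ?t = s"
    using ab_functorD(5)[OF F oA oV oA g(1) iV s(1)] ab_functorD(4)[OF F oA s(1)] g(2) by simp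
  then have "jc n F \<eta> V B ?t b = johnson n (free_grp B) \<phi> (gen b)"
    using s(2) johnson_rep_of[OF group_free_grp n \<phi>(1) gen_in_free_grp[OF b]] by (simp add: jc_def)
  also have "\<dots> = gcl B (Suc n) z"
    using \<phi>(2) gen_in_free_grp[OF b] G.lcs_carrier[OF zl] by (simp add: johnson_def G.m_assoc)
  finally show thesis using that[of ?t] ab_functorD(6)[OF F oA oV g(1) s(1)] by blast
qed

text \<open>The lift \<open>gmor\<close> sends \<phi> to the automorphism that acts as \<phi> on the
  image of \<open>B\<close> and trivially on the cofactor: coordinates are carried along the
  injection of bases and are trivial outside. Words z stand for their classes, so that no induced
  map on gamma_{n+1}/gamma_{n+2} has to be named.\<close>

lemma jc_natural:
  assumes V: "framed V B" and W: "framed W C" and f: "based V B W C f" and t: "t \<in> carrier (Fob F V)"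
  shows "\<And>b z. b \<in> B \<Longrightarrow> z \<in> glcs B (Suc n) \<Longrightarrow> jc n F \<eta> V B t b = gcl B (Suc n) z \<Longrightarrow>
      jc n F \<eta> W C (Fmor F V W f t) (snd f b) = gcl C (Suc n) (free_map B C (snd f) z)"
    and "\<And>c. c \<in> C \<Longrightarrow> c \<notin> snd f ` B \<Longrightarrow> jc n F \<eta> W C (Fmor F V W f t) c = \<one>\<^bsub>ggr C (Suc n)\<^esub>"
proof -
  have fin: "finite B" "finite C" using framedD(5) V W by auto
  have inj: "inj_on (snd f) B" by (rule based_inj[OF V f])
  have im: "snd f ` B \<subseteq> C" using basedD(2)[OF f] by blast
  interpret GB: group "free_grp B" by (rule group_free_grp)
  interpret GC: group "free_grp C" by (rule group_free_grp)
  note AB = framed_free_ab[OF fin(1)] and AC = framed_free_ab[OF fin(2)]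
  note iV = frame_iso[OF V] and iW = frame_iso[OF W]
  let ?g = "gmor B C (snd f)" and ?u = "free_map B C (snd f)"
  let ?m = "ab_mor (free_grp B) (free_grp C) ?g"
  note m = based_ab_mor[OF fin inj im]
  \<comment> \<open>Both composites are based and agree on \<open>B\<close>, which is enough for
    equality.\<close>
  have sq: "Comp Sab V W (free_ab C) (frame_iso W C) f = Comp Sab V (free_ab B) (free_ab C) ?m (frame_iso V B)"
  proof (rule based_eqI[OF V AC based_Comp[OF V W AC f iW(1)] based_Comp[OF V AB AC iV(1) m(1)]])
    fix b assume b: "b \<in> B"
    then show "snd (Comp Sab V W (free_ab C) (frame_iso W C) f) b
      = snd (Comp Sab V (free_ab B) (free_ab C) ?m (frame_iso V B)) b"
      using framedD(6)[OF V] iV(2) iW(2) m(2) basedD(2)[OF f b] by (auto simp: Comp_Sab_apply)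
  qed
  let ?s = "Fmor F V (free_ab B) (frame_iso V B) t"
  note o = framedD(1)[OF V] framedD(1)[OF W] framedD(1)[OF AB] framedD(1)[OF AC]
  note h = basedD(1)[OF f] basedD(1)[OF iV(1)] basedD(1)[OF iW(1)] basedD(1)[OF m(1)]
  have s: "?s \<in> carrier (Fob F (free_ab B))" by (rule ab_functorD(6)[OF F o(1,3) h(2) t])
  define \<phi> where "\<phi> = \<eta> (free_grp B) ?s"
  have \<phi>Q: "\<phi> \<in> carrier (JA_quot n B)" unfolding \<phi>_def by (rule hom_in_carrier[OF eta_hom[OF fin(1)] s])
  have \<phi>J: "\<phi> \<in> JA n (free_grp B)" using normal.quot_carrierD(1)[OF JA_Suc_normal[OF group_free_grp] \<phi>Q] by simp
  note \<phi>a = JA_auto[OF group_free_grp \<phi>J]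
  define \<psi> where "\<psi> = Fmor Aut_functor (free_grp B) (free_grp C) ?g \<phi>"
  note \<psi> = Aut_functor_gmor[OF fin inj im \<phi>a, folded \<psi>_def]
  note uh = free_map_hom[OF fin inj im] and ug = free_map_gen[OF fin inj im]
  interpret u: group_hom "free_grp B" "free_grp C" ?u by unfold_locales (rule uh)
  have \<psi>b: "\<psi> (gen (snd f b)) \<otimes>\<^bsub>free_grp C\<^esub> inv\<^bsub>free_grp C\<^esub> gen (snd f b)
    = ?u (\<phi> (gen b) \<otimes>\<^bsub>free_grp B\<^esub> inv\<^bsub>free_grp B\<^esub> gen b)" if b: "b \<in> B" for b
    using \<psi>(3)[OF gen_in_free_grp[OF b]] ug[OF b] gen_in_free_grp[OF b] GB.autoD(2)[OF \<phi>a gen_in_free_grp[OF b]] by simp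
  have \<psi>c: "\<psi> (gen c) \<otimes>\<^bsub>free_grp C\<^esub> inv\<^bsub>free_grp C\<^esub> gen c = \<one>\<^bsub>free_grp C\<^esub>" if c: "c \<in> C" "c \<notin> snd f ` B" for c
  proof -
    have "gen c \<in> generate (free_grp C) (gen ` (C - snd f ` B))" using c by (auto intro: generate.incl)
    then show ?thesis using \<psi>(2) gen_in_free_grp[OF c(1)] by simp
  qed
  have ul: "?u x \<in> glcs C k" if "x \<in> glcs B k" for x k
    using hom_lower_central[OF group_free_grp group_free_grp uh] that by blast
  have \<phi>l: "\<phi> (gen b) \<otimes>\<^bsub>free_grp B\<^esub> inv\<^bsub>free_grp B\<^esub> gen b \<in> glcs B (Suc n)" if "b \<in> B" for b
    using JA_lcs[OF group_free_grp \<phi>J gen_in_free_grp[OF that]] .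
  have \<psi>J: "\<psi> \<in> JA n (free_grp C)"
  proof (rule JA_I[OF group_free_grp _ free_grp_generate \<psi>(1)])
    fix x assume "x \<in> gen ` C"
    then obtain c where c: "c \<in> C" "x = gen c" by blast
    show "\<psi> x \<otimes>\<^bsub>free_grp C\<^esub> inv\<^bsub>free_grp C\<^esub> x \<in> glcs C (Suc n)"
    proof (cases "c \<in> snd f ` B")
      case True
      then obtain b where b: "b \<in> B" "c = snd f b" by blast
      show ?thesis unfolding c(2) b(2) \<psi>b[OF b(1)] by (rule ul[OF \<phi>l[OF b(1)]])
    next
      case False
      show ?thesis unfolding c(2) \<psi>c[OF c(1) False] by (rule subgroup.one_closed[OF GC.lcs_subgroup])
    qed
  qed (auto simp: gen_in_free_grp)
  have "Fmor F W (free_ab C) (frame_iso W C) (Fmor F V W f t) = Fmor F (free_ab B) (free_ab C) ?m ?s"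
    using ab_functorD(5)[OF F o(1,2,4) h(1,3) t] ab_functorD(5)[OF F o(1,3,4) h(2,4) t] sq by simp
  \<comment> \<open>Naturality of \<eta> is available exactly because this morphism comes from
    \<open>gmor\<close>.\<close>
  moreover have "\<eta> (free_grp C) (Fmor F (free_ab B) (free_ab C) ?m ?s)
    = rep_of (JA_group n (free_grp C)) (JA (Suc n) (free_grp C)) \<psi>"
    using nat gmor_in[OF fin inj im] free_grp_Ob fin s
    by (simp add: nat_trans_def along_ab_def Fmor_JA_quotient \<psi>_def \<phi>_def)
  ultimately have Jc: "jc n F \<eta> W C (Fmor F V W f t) c = johnson n (free_grp C) \<psi> (gen c)" if "c \<in> C" for c
    using johnson_rep_of[OF group_free_grp n \<psi>J gen_in_free_grp[OF that]] by (simp add: jc_def)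
  show "jc n F \<eta> W C (Fmor F V W f t) c = \<one>\<^bsub>ggr C (Suc n)\<^esub>" if c: "c \<in> C" "c \<notin> snd f ` B" for c
    using Jc[OF c(1)] \<psi>c[OF c] GC.cl_one_iff[of "\<one>\<^bsub>free_grp C\<^esub>" "Suc n"] subgroup.one_closed[OF GC.lcs_subgroup]
    by (simp add: johnson_def)
  fix b z assume b: "b \<in> B" and z: "z \<in> glcs B (Suc n)" and Jz: "jc n F \<eta> V B t b = gcl B (Suc n) z"
  let ?w = "\<phi> (gen b) \<otimes>\<^bsub>free_grp B\<^esub> inv\<^bsub>free_grp B\<^esub> gen b"
  have "gcl B (Suc n) ?w = gcl B (Suc n) z" using Jz by (simp add: jc_def johnson_def \<phi>_def)
  then have "?w \<otimes>\<^bsub>free_grp B\<^esub> inv\<^bsub>free_grp B\<^esub> z \<in> glcs B (Suc (Suc n))"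
    using GB.cl_eq_iff[OF \<phi>l[OF b] z] by blast
  then have "?u ?w \<otimes>\<^bsub>free_grp C\<^esub> inv\<^bsub>free_grp C\<^esub> ?u z \<in> glcs C (Suc (Suc n))"
    using ul GB.lcs_carrier[OF z] GB.lcs_carrier[OF \<phi>l[OF b]] by fastforce
  then have "gcl C (Suc n) (?u ?w) = gcl C (Suc n) (?u z)"
    using GC.cl_eq_iff[OF ul[OF \<phi>l[OF b]] ul[OF z]] by blast
  then show "jc n F \<eta> W C (Fmor F V W f t) (snd f b) = gcl C (Suc n) (?u z)"
    using Jc[OF basedD(2)[OF f b]] \<psi>b[OF b] by (simp add: johnson_def)
qed

end

section \<open>Alternating products\<close>

text \<open>For distinct indices this is the product over all sets S of indices of f(S) to the power
  (-1)^|S|, in other words an iterated difference of \<open>f\<close> at the empty set.\<close>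

fun altprod :: "('m, 'r) monoid_scheme \<Rightarrow> nat list \<Rightarrow> (nat set \<Rightarrow> 'm) \<Rightarrow> 'm" where
  "altprod M [] f = f {}"
| "altprod M (i # is) f = altprod M is f \<otimes>\<^bsub>M\<^esub> inv\<^bsub>M\<^esub> altprod M is (\<lambda>S. f (insert i S))"

context comm_group
begin

lemma altprod_in_subgroup:
  "subgroup Z G \<Longrightarrow> (\<And>S. S \<subseteq> set is \<Longrightarrow> f S \<in> Z) \<Longrightarrow> altprod G is f \<in> Z"
proof (induction "is" arbitrary: f)
  case (Cons i "is")
  interpret Z: subgroup Z G by fact
  have "altprod G is f \<in> Z"
    by (rule Cons.IH[OF Cons.prems(1)]) (use Cons.prems(2) in auto)
  moreover have "altprod G is (\<lambda>S. f (insert i S)) \<in> Z"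
    by (rule Cons.IH[OF Cons.prems(1)], rule Cons.prems(2)) auto
  ultimately show ?case by simp
qed simp

lemma altprod_closed: "(\<And>S. f S \<in> carrier G) \<Longrightarrow> altprod G is f \<in> carrier G"
  using altprod_in_subgroup[OF subgroup_self] by blast

lemma altprod_mult:
  "(\<And>S. f S \<in> carrier G) \<Longrightarrow> (\<And>S. g S \<in> carrier G) \<Longrightarrow>
     altprod G is (\<lambda>S. f S \<otimes> g S) = altprod G is f \<otimes> altprod G is g"
  by (induction "is" arbitrary: f g) (simp_all add: altprod_closed inv_mult m_ac)

lemma altprod_one: "altprod G is (\<lambda>_. \<one>) = \<one>"
  by (induction "is") auto

text \<open>The factors for S and S \<union> {i} are equal and occur with opposite signs.\<close>

lemma altprod_cancel:
  "(\<And>S. f S \<in> carrier G) \<Longrightarrow> i \<in> set is \<Longrightarrow> (\<And>S. f (insert i S) = f S) \<Longrightarrow> altprod G is f = \<one>"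
proof (induction "is" arbitrary: f)
  case (Cons j "is")
  show ?case
  proof (cases "i = j")
    case True
    then show ?thesis using Cons.prems by (simp add: altprod_closed)
  next
    case False
    then have "altprod G is f = \<one>" "altprod G is (\<lambda>S. f (insert j S)) = \<one>"
      using Cons.prems by (auto intro!: Cons.IH simp: insert_commute[of j i])
    then show ?thesis by simp
  qed
qed simp

text \<open>Modulo \<open>Z\<close> only the factor for the empty set is left.\<close>

lemma altprod_first_in_subgroup:
  assumes Z: "subgroup Z G" and f: "\<And>S. f S \<in> carrier G"
    and fZ: "\<And>S. S \<noteq> {} \<Longrightarrow> S \<subseteq> set is \<Longrightarrow> f S \<in> Z" and alt: "altprod G is f \<in> Z"
  shows "f {} \<in> Z"
proof -
  interpret Z: subgroup Z G by fact
  have "\<exists>z\<in>Z. altprod G is f = f {} \<otimes> z"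
    using f fZ
  proof (induction "is" arbitrary: f)
    case Nil
    then show ?case by (auto intro!: bexI[of _ \<one>])
  next
    case (Cons i "is")
    have "\<exists>z\<in>Z. altprod G is f = f {} \<otimes> z"
      by (rule Cons.IH) (use Cons.prems in auto)
    then obtain z where z: "z \<in> Z" "altprod G is f = f {} \<otimes> z" by blast
    have w: "altprod G is (\<lambda>S. f (insert i S)) \<in> Z"
      by (rule altprod_in_subgroup[OF Z], rule Cons.prems(2)) auto
    have "altprod G (i # is) f = f {} \<otimes> (z \<otimes> inv altprod G is (\<lambda>S. f (insert i S)))"
      using z w Cons.prems(1) by (simp add: m_assoc)
    then show ?case using z(1) w by blast
  qed
  then obtain z where z: "z \<in> Z" "altprod G is f = f {} \<otimes> z" by blast
  then have "f {} = altprod G is f \<otimes> inv z" using f by (simp add: m_assoc)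
  then show ?thesis using alt z(1) by simp
qed

end

lemma altprod_hom:
  assumes "comm_group M" "comm_group M'" "h \<in> hom M M'" "\<And>S. f S \<in> carrier M"
  shows "h (altprod M is f) = altprod M' is (\<lambda>S. h (f S))"
proof -
  interpret M: comm_group M by fact
  interpret M': comm_group M' by fact
  interpret h: group_hom M M' h by unfold_locales fact
  show ?thesis
    using assms(4) by (induction "is" arbitrary: f) (simp_all add: M.altprod_closed)
qed

section \<open>Blocks of a basis of a multiple direct sum\<close>

definition some_basis :: "nat monoid \<Rightarrow> nat set" where
  "some_basis x = (SOME B. ab_basis x B)"

lemma framed_some_basis: "x \<in> Ob Sab \<Longrightarrow> framed x (some_basis x)"
  using Ob_Sab_basis someI_ex[of "ab_basis x"] by (metis framed_def some_basis_def)

fun msum_basis :: "nat monoid list \<Rightarrow> nat monoid \<Rightarrow> nat set \<Rightarrow> nat set" where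
  "msum_basis [] a A = A"
| "msum_basis (x # xs) a A = dsum_basis x (msum xs a) (some_basis x) (msum_basis xs a A)"

text \<open>The index of the summand containing a basis element; it is \<open>length xs\<close> for the last summand \<open>a\<close>.\<close>

fun blk :: "nat monoid list \<Rightarrow> nat monoid \<Rightarrow> nat \<Rightarrow> nat" where
  "blk [] a c = 0"
| "blk (x # xs) a c =
     (if snd (prod_decode c) = \<one>\<^bsub>msum xs a\<^esub> then 0 else Suc (blk xs a (snd (prod_decode c))))"

fun last_mor :: "nat monoid list \<Rightarrow> nat monoid \<Rightarrow> split_mor" where
  "last_mor [] a = Idm Sab a"
| "last_mor (x # xs) a = Comp Sab a (msum xs a) (dsum x (msum xs a)) (into_sum x (msum xs a)) (last_mor xs a)"

lemma framed_msum:
  "set xs \<subseteq> Ob Sab \<Longrightarrow> framed a A \<Longrightarrow> framed (msum xs a) (msum_basis xs a A)"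
  by (induction xs) (auto simp: framed_dsum framed_some_basis)

lemma framed_one_notin: "framed V B \<Longrightarrow> \<one>\<^bsub>V\<^esub> \<notin> B"
  using ab_basis_one_notin framedD(2,4) by blast

lemma based_msum_mor:
  assumes "set xs \<subseteq> Ob Sab" "framed a A" "framed b B" "based a A b B f"
  shows "based (msum xs a) (msum_basis xs a A) (msum xs b) (msum_basis xs b B) (msum_mor xs a b f)"
  using assms by (induction xs) (auto simp: based_plus_mor framed_some_basis framed_msum)

lemma framed_drop_nth:
  "set xs \<subseteq> Ob Sab \<Longrightarrow> framed a A \<Longrightarrow> framed (msum (drop_nth i xs) a) (msum_basis (drop_nth i xs) a A)"
  using set_drop_nth[of i xs] by (intro framed_msum) auto

lemma based_skip_mor:
  assumes "set xs \<subseteq> Ob Sab" "framed a A" "i < length xs"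
  shows "based (msum (drop_nth i xs) a) (msum_basis (drop_nth i xs) a A) (msum xs a) (msum_basis xs a A) (skip_mor i xs a)"
  using assms
proof (induction i xs a rule: skip_mor.induct)
  case (1 x xs a)
  then show ?case by (simp add: based_into_sum framed_msum framed_some_basis)
next
  case (2 i x xs a)
  then show ?case by (simp add: based_plus_mor framed_msum framed_drop_nth framed_some_basis)
qed auto

lemma based_last_mor:
  assumes "set xs \<subseteq> Ob Sab" "framed a A"
  shows "based a A (msum xs a) (msum_basis xs a A) (last_mor xs a)"
  using assms
proof (induction xs)
  case (Cons x xs)
  then show ?case
    using based_Comp[OF Cons.prems(2) framed_msum[of xs a A] framed_msum[of "x # xs" a A]]
      based_into_sum[OF framed_some_basis framed_msum[of xs a A], of x] by simp
qed (simp add: based_Idm)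

context
  fixes x :: "nat monoid" and xs :: "nat monoid list" and a :: "nat monoid" and A :: "nat set"
  assumes xs: "set (x # xs) \<subseteq> Ob Sab" and a: "framed a A"
begin

text \<open>The two kinds of basis elements are distinguished by whether the second component is the
  identity, which is never a basis element; this is what \<open>blk\<close> tests.\<close>

lemma msum_basis_Cons_cases:
  assumes "c \<in> msum_basis (x # xs) a A"
  obtains s where "s \<in> some_basis x" "c = prod_encode (s, \<one>\<^bsub>msum xs a\<^esub>)" "s \<in> carrier x"
      "\<one>\<^bsub>msum xs a\<^esub> \<in> carrier (msum xs a)" "blk (x # xs) a c = 0"
    | c' where "c' \<in> msum_basis xs a A" "c = prod_encode (\<one>\<^bsub>x\<^esub>, c')" "c' \<in> carrier (msum xs a)"
      "\<one>\<^bsub>x\<^esub> \<in> carrier x" "blk (x # xs) a c = Suc (blk xs a c')"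
proof -
  have m: "framed (msum xs a) (msum_basis xs a A)" using framed_msum[OF _ a] xs by simp
  have fx: "framed x (some_basis x)" using framed_some_basis xs by simp
  have nt: "\<one>\<^bsub>msum xs a\<^esub> \<notin> msum_basis xs a A" by (rule framed_one_notin[OF m])
  have oc: "\<one>\<^bsub>msum xs a\<^esub> \<in> carrier (msum xs a)" "\<one>\<^bsub>x\<^esub> \<in> carrier x"
    using framedD(4)[OF m] framedD(4)[OF fx] by (simp_all add: group.is_monoid monoid.one_closed)
  have "c \<in> dsum_basis x (msum xs a) (some_basis x) (msum_basis xs a A)" using assms by simp
  then consider s where "s \<in> some_basis x" "c = prod_encode (s, \<one>\<^bsub>msum xs a\<^esub>)"
    | c' where "c' \<in> msum_basis xs a A" "c = prod_encode (\<one>\<^bsub>x\<^esub>, c')"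
    by (auto simp: dsum_basis_def)
  then show thesis
  proof cases
    case (1 s)
    then show thesis using that(1)[of s] framedD(6)[OF fx] oc by auto
  next
    case (2 c')
    then have "c' \<noteq> \<one>\<^bsub>msum xs a\<^esub>" using nt by blast
    then show thesis using that(2)[of c'] 2 framedD(6)[OF m] oc by auto
  qed
qed

end

lemma snd_Hom_one: "f \<in> Hom Sab a b \<Longrightarrow> a \<in> Ob Sab \<Longrightarrow> b \<in> Ob Sab \<Longrightarrow> snd f \<one>\<^bsub>a\<^esub> = \<one>\<^bsub>b\<^esub>"
  using hom_one[OF Hom_SabD(2)] Ob_Sab_group by blast

text \<open>Together with \<open>based_factors\<close> this turns avoiding the block i into
  factoring through the sum without the i-th summand.\<close>

lemma skip_mor_image:
  assumes "set xs \<subseteq> Ob Sab" "framed a A" "i < length xs"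
  shows "snd (skip_mor i xs a) ` msum_basis (drop_nth i xs) a A = {c \<in> msum_basis xs a A. blk xs a c \<noteq> i}"
  using assms
proof (induction i xs a rule: skip_mor.induct)
  case (1 x xs a)
  have m: "framed (msum xs a) (msum_basis xs a A)" using framed_msum 1 by simp
  have nt: "\<one>\<^bsub>msum xs a\<^esub> \<notin> msum_basis xs a A" by (rule framed_one_notin[OF m])
  have "snd (into_sum x (msum xs a)) ` msum_basis xs a A = (\<lambda>c. prod_encode (\<one>\<^bsub>x\<^esub>, c)) ` msum_basis xs a A"
    using framedD(6)[OF m] by (intro image_cong) (auto simp: into_sum_apply)
  then show ?case using nt by (auto simp: dsum_basis_def)
next
  case (2 i x xs a)
  let ?d = "msum (drop_nth i xs) a" and ?D = "msum_basis (drop_nth i xs) a A" and ?f = "skip_mor i xs a"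
  have fx: "framed x (some_basis x)" using framed_some_basis 2 by simp
  have m: "framed (msum xs a) (msum_basis xs a A)" using framed_msum 2 by simp
  have d: "framed ?d ?D" using framed_drop_nth 2 by simp
  have f: "?f \<in> Hom Sab ?d (msum xs a)" using skip_mor_in[of xs a i] 2 framedD(1) by simp
  have f1: "snd ?f \<one>\<^bsub>?d\<^esub> = \<one>\<^bsub>msum xs a\<^esub>" using snd_Hom_one[OF f] framedD(1) m d by blast
  have oc: "\<one>\<^bsub>?d\<^esub> \<in> carrier ?d" "\<one>\<^bsub>x\<^esub> \<in> carrier x"
    using framedD(4)[OF d] framedD(4)[OF fx] by (simp_all add: group.is_monoid monoid.one_closed)
  have IH: "snd ?f ` ?D = {c \<in> msum_basis xs a A. blk xs a c \<noteq> i}" using 2 by simp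
  have nt: "\<one>\<^bsub>msum xs a\<^esub> \<notin> msum_basis xs a A" by (rule framed_one_notin[OF m])
  have "snd (plus_mor x ?d (msum xs a) ?f) ` dsum_basis x ?d (some_basis x) ?D
    = (\<lambda>s. prod_encode (s, \<one>\<^bsub>msum xs a\<^esub>)) ` some_basis x \<union> (\<lambda>c. prod_encode (\<one>\<^bsub>x\<^esub>, c)) ` snd ?f ` ?D"
    unfolding dsum_basis_def image_Un image_image
    using framedD(6)[OF fx] framedD(6)[OF d] oc f1
    by (intro arg_cong2[of _ _ _ _ "(\<union>)"] image_cong) (auto simp: plus_mor_apply)
  also have "\<dots> = {c \<in> msum_basis (x # xs) a A. blk (x # xs) a c \<noteq> Suc i}"
    unfolding IH using nt by (auto simp: dsum_basis_def)
  finally show ?case by simp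
qed auto

text \<open>The second claim serves to tell the image of \<open>a\<close> apart from other basis
  elements that lie in the last block of the target.\<close>

lemma blk_msum_mor:
  assumes "set xs \<subseteq> Ob Sab" "framed a A" "framed b B" "based a A b B f" "c \<in> msum_basis xs a A"
  shows "blk xs b (snd (msum_mor xs a b f) c) = blk xs a c"
    and "blk xs a c = length xs \<Longrightarrow> snd (msum_mor xs a b f) c \<in> snd (last_mor xs b) ` snd f ` A"
  using assms
proof (induction xs arbitrary: c)
  case Nil
  {
    case 1
    then show ?case by simp
  next
    case 2
    have "snd f c \<in> carrier b" using basedD(2)[OF 2(5), of c] 2(6) framedD(6)[OF 2(4)] by auto
    then have "snd (msum_mor [] a b f) c = snd (last_mor [] b) (snd f c)" by (simp add: Idm_Sab_apply)
    moreover have "snd (last_mor [] b) (snd f c) \<in> snd (last_mor [] b) ` snd f ` A"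
      by (intro imageI) (use 2(6) in simp)
    ultimately show ?case by (simp only:)
  }
next
  case (Cons x xs)
  have *: "blk (x # xs) b (snd (msum_mor (x # xs) a b f) c) = blk (x # xs) a c \<and>
    (blk (x # xs) a c = length (x # xs) \<longrightarrow> snd (msum_mor (x # xs) a b f) c \<in> snd (last_mor (x # xs) b) ` snd f ` A)"
    if xs: "set (x # xs) \<subseteq> Ob Sab" and a: "framed a A" and b: "framed b B" and f: "based a A b B f"
      and c: "c \<in> msum_basis (x # xs) a A" for c
  proof -
    have xs': "set xs \<subseteq> Ob Sab" using xs by simp
    have mb: "framed (msum xs b) (msum_basis xs b B)" using framed_msum[OF xs' b] .
    note g = based_msum_mor[OF xs' a b f]
    show ?thesis
      using c
    proof (cases rule: msum_basis_Cons_cases[OF xs a, consumes 1, case_names head tail])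
      case (head s)
      have "snd (msum_mor xs a b f) \<one>\<^bsub>msum xs a\<^esub> = \<one>\<^bsub>msum xs b\<^esub>"
        using snd_Hom_one[OF basedD(1)[OF g]] framedD(1)[OF framed_msum[OF xs' a]] framedD(1)[OF mb] by blast
      then show ?thesis using head by (simp add: plus_mor_apply)
    next
      case (tail c')
      let ?d = "snd (msum_mor xs a b f) c'"
      have d: "?d \<in> msum_basis xs b B" using basedD(2)[OF g tail(1)] .
      then have "?d \<noteq> \<one>\<^bsub>msum xs b\<^esub>" using framed_one_notin[OF mb] by metis
      moreover have "?d \<in> snd (last_mor xs b) ` snd f ` A" if "blk xs a c' = length xs"
        using Cons.IH(2)[OF that xs' a b f tail(1)] .
      moreover have "prod_encode (\<one>\<^bsub>x\<^esub>, ?d) \<in> snd (last_mor (x # xs) b) ` snd f ` A"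
        if img: "?d \<in> snd (last_mor xs b) ` snd f ` A"
      proof -
        obtain w where w: "w \<in> A" "?d = snd (last_mor xs b) (snd f w)" using img by blast
        have "snd f w \<in> carrier b" using basedD(2)[OF f w(1)] framedD(6)[OF b] by blast
        moreover have "?d \<in> carrier (msum xs b)" using d framedD(6)[OF mb] by blast
        ultimately have "prod_encode (\<one>\<^bsub>x\<^esub>, ?d) = snd (last_mor (x # xs) b) (snd f w)"
          using w(2) by (simp add: Comp_Sab_apply into_sum_apply)
        then show ?thesis using w(1) by blast
      qed
      ultimately show ?thesis
        using tail Cons.IH(1)[OF xs' a b f tail(1)] by (auto simp: plus_mor_apply)
    qed
  qed
  {
    case 1
    show ?case by (rule conjunct1[OF *[OF 1]])
  next
    case 2
    show ?case by (rule mp[OF conjunct2[OF *[OF 2(2-6)]] 2(1)])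
  }
qed

lemma blk_last_mor:
  assumes "set xs \<subseteq> Ob Sab" "framed a A" "c \<in> A"
  shows "blk xs a (snd (last_mor xs a) c) = length xs"
  using assms
proof (induction xs)
  case (Cons x xs)
  have m: "framed (msum xs a) (msum_basis xs a A)" using framed_msum Cons.prems by simp
  have l: "based a A (msum xs a) (msum_basis xs a A) (last_mor xs a)" using based_last_mor Cons.prems by simp
  have "snd (last_mor xs a) c \<in> msum_basis xs a A" using basedD(2)[OF l Cons.prems(3)] .
  moreover have "c \<in> carrier a" using framedD(6)[OF Cons.prems(2)] Cons.prems(3) by blast
  ultimately show ?case
    using framed_one_notin[OF m] framedD(6)[OF m] Cons by (auto simp: Comp_Sab_apply into_sum_apply)
qed simp

section \<open>The upper bound\<close>

text \<open>Generation of the graded piece, lifted to elements: a subgroup that contains gamma_{n+1}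
  is determined by its image in the quotient.\<close>

lemma (in group) lcs_generated:
  assumes S: "S \<subseteq> carrier G" "generate G S = carrier G" and n: "n \<ge> 1"
    and Z: "subgroup Z (lcs_group n)" and sub: "lcs (Suc n) \<subseteq> Z" and SZ: "left_normed S n \<subseteq> Z"
  shows "lcs n \<subseteq> Z"
proof
  fix z assume z: "z \<in> lcs n"
  interpret L: group "lcs_group n" by (rule group_lcs)
  interpret h: group_hom "lcs_group n" "gr n" "cl n"
    using cl_hom group_gr by (simp add: group_hom_def group_hom_axioms_def L.is_group)
  interpret Z: subgroup Z "lcs_group n" by fact
  have "subgroup (cl n ` Z) (gr n)" by (rule h.subgroup_img_is_subgroup[OF Z])
  then have "cl n z \<in> cl n ` Z" by (rule gr_generated[OF S n]) (use SZ z in auto)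
  then obtain z' where z': "z' \<in> Z" "cl n z = cl n z'" by blast
  have zl: "z' \<in> lcs n" using Z.mem_carrier[OF z'(1)] by simp
  then have "z \<otimes> inv z' \<in> Z" using cl_eq_iff[OF z zl] z'(2) sub by blast
  then have "(z \<otimes> inv z') \<otimes> z' \<in> Z" using Z.m_closed z'(1) by simp
  then show "z \<in> Z" using lcs_carrier z zl by (simp add: m_assoc)
qed

text \<open>Each bracket adds at most one letter, so weight bounds the number of letters.\<close>

lemma left_normed_support:
  assumes "z \<in> group.left_normed (free_grp B) (gen ` B) m"
  obtains D where "D \<subseteq> B" "finite D" "card D \<le> m" "z \<in> generate (free_grp B) (gen ` D)"
proof -
  interpret group "free_grp B" by (rule group_free_grp)
  have "\<exists>D\<subseteq>B. finite D \<and> card D \<le> m \<and> z \<in> generate (free_grp B) (gen ` D)"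
    using assms
  proof (induction m arbitrary: z)
    case (Suc m)
    show ?case
    proof (cases "m = 0")
      case True
      then obtain b where "b \<in> B" "z = gen b" using Suc.prems by auto
      then show ?thesis by (intro exI[of _ "{b}"]) (auto intro: generate.incl)
    next
      case False
      then obtain c b where cb: "c \<in> left_normed (gen ` B) m" "b \<in> B" "z = commutator c (gen b)"
        using Suc.prems left_normed_Suc[of m "gen ` B"] by auto
      from Suc.IH[OF cb(1)] obtain D where D: "D \<subseteq> B" "finite D" "card D \<le> m" "c \<in> generate (free_grp B) (gen ` D)" by blast
      let ?H = "generate (free_grp B) (gen ` insert b D)"
      have "gen ` insert b D \<subseteq> carrier (free_grp B)" using D(1) cb(2) gen_in_free_grp by auto
      then interpret H: subgroup ?H "free_grp B" by (rule generate_is_subgroup)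
      have "c \<in> ?H" using D(4) mono_generate[of "gen ` D" "gen ` insert b D"] by auto
      moreover have "gen b \<in> ?H" by (auto intro: generate.incl)
      ultimately have "z \<in> ?H" unfolding cb(3) by (intro H.m_closed H.m_inv_closed)
      moreover have "card (insert b D) \<le> Suc m" using D(2,3) by (simp add: card_insert_if)
      ultimately show ?thesis using D cb(2) by (intro exI[of _ "insert b D"]) auto
    qed
  qed simp
  then show thesis using that by blast
qed

context
  fixes n :: nat and F :: "'b sfun" and \<eta> :: "nat monoid \<Rightarrow> 'b \<Rightarrow> nat \<Rightarrow> nat"
  assumes n: "n \<ge> 1" and F: "ab_functor Sab F"
    and nat: "nat_trans Gcat (along_ab F) (JA_quotient n) \<eta>"
    and iso: "\<forall>a\<in>Ob Gcat. \<eta> a \<in> iso (Fob (along_ab F) a) (Fob (JA_quotient n) a)"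
begin

text \<open>In \<open>Hom(V, L\<^sub>n\<^sub>+\<^sub>1(V))\<close> an elementary tensor involves at most \<open>n + 2\<close> basis elements, hence misses
  one of the blocks if there are more than that; moving this block or not has no effect, so the terms
  of the alternating product cancel in pairs.\<close>

lemma altprod_trivial:
  assumes V: "framed V B" and W: "framed W C" and t: "t \<in> carrier (Fob F V)"
    and \<phi>: "\<And>S. based V B W C (\<phi> S)" and \<phi>b: "\<And>S b. b \<in> B \<Longrightarrow> snd (\<phi> S) b = (if \<beta> b \<in> S then j1 b else j0 b)"
    and inj: "inj_on j0 B" "inj_on j1 B" and disj: "j0 ` B \<inter> j1 ` B = {}" and N: "N > n + 2"
  shows "altprod (Fob F W) [0..<N] (\<lambda>S. Fmor F V W (\<phi> S) t) = \<one>\<^bsub>Fob F W\<^esub>"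
proof -
  note oV = framedD(1)[OF V] and oW = framedD(1)[OF W]
  interpret FW: comm_group "Fob F W" by (rule ab_functorD(1)[OF F oW])
  interpret GB: group "free_grp B" by (rule group_free_grp)
  interpret GC: group "free_grp C" by (rule group_free_grp)
  interpret L: comm_group "ggr C (Suc n)" by (rule GC.comm_group_gr) simp
  have \<phi>im: "snd (\<phi> S) ` B \<subseteq> C" for S using basedD(2)[OF \<phi>] by blast
  have u: "free_map B C (snd (\<phi> S)) \<in> hom (free_grp B) (free_grp C)" for S
    using free_map_props(1)[OF \<phi>im] ext_homD(1) by blast
  have ul: "free_map B C (snd (\<phi> S)) z \<in> glcs C k" if "z \<in> glcs B k" for S z k
    using hom_lower_central[OF group_free_grp group_free_grp u] that by blast
  have tc: "Fmor F V W (\<phi> S) t \<in> carrier (Fob F W)" for S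
    using ab_functorD(6)[OF F oV oW basedD(1)[OF \<phi>] t] .
  show ?thesis
  proof (rule jc_faithful[OF n F nat iso W FW.altprod_closed[OF tc]])
    fix c assume c: "c \<in> C"
    define f where "f S = jc n F \<eta> W C (Fmor F V W (\<phi> S) t) c" for S
    have "jc n F \<eta> W C (altprod (Fob F W) [0..<N] (\<lambda>S. Fmor F V W (\<phi> S) t)) c = altprod (ggr C (Suc n)) [0..<N] f"
      unfolding f_def
      using altprod_hom[OF FW.comm_group_axioms L.comm_group_axioms jc_hom[OF n F nat iso W c] tc] .
    also have "\<dots> = \<one>\<^bsub>ggr C (Suc n)\<^esub>"
    proof (cases "c \<in> j0 ` B \<union> j1 ` B")
      case False
      then have "c \<notin> snd (\<phi> S) ` B" for S using \<phi>b by auto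
      then have "f S = \<one>\<^bsub>ggr C (Suc n)\<^esub>" for S
        unfolding f_def using jc_natural(2)[OF n F nat iso V W \<phi> t c] by blast
      then have "f = (\<lambda>_. \<one>\<^bsub>ggr C (Suc n)\<^esub>)" by blast
      then show ?thesis by (simp add: L.altprod_one)
    next
      case True
      \<comment> \<open>The flag p tells in which of the two copies c lies. The copies are disjoint
        and the maps injective, so c is hit by the S-th morphism only through b, and only when
        membership of the block of b in S agrees with p.\<close>
      obtain b p where b: "b \<in> B" and cb: "c = (if p then j1 b else j0 b)"
        using True by (metis (full_types) UnE imageE)
      have mem: "snd (\<phi> S) b = c" if "(\<beta> b \<in> S) = p" for S using \<phi>b[OF b] cb that by simp
      have nmem: "c \<notin> snd (\<phi> S) ` B" if "(\<beta> b \<in> S) \<noteq> p" for S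
      proof
        assume "c \<in> snd (\<phi> S) ` B"
        then obtain b' where b': "b' \<in> B" "c = (if \<beta> b' \<in> S then j1 b' else j0 b')" using \<phi>b by auto
        show False
        proof (cases "(\<beta> b' \<in> S) = p")
          case True
          then have "b' = b" using b' b cb inj by (auto split: if_splits dest: inj_onD)
          then show False using True that by blast
        next
          case False
          then show False using b' b cb disj by (auto split: if_splits)
        qed
      qed
      have "jc n F \<eta> V B t b \<in> carrier (ggr B (Suc n))" using hom_in_carrier[OF jc_hom[OF n F nat iso V b] t] .
      then obtain z where z: "z \<in> glcs B (Suc n)" "jc n F \<eta> V B t b = gcl B (Suc n) z" by (auto simp: GB.gr_carrier)
      \<comment> \<open>The coordinate at c as a function of a word z for the coordinate of
        \<open>t\<close> at b. Its alternating product is a homomorphism in z, so left-normed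
        commutators suffice.\<close>
      define h where "h z S = (if (\<beta> b \<in> S) = p then gcl C (Suc n) (free_map B C (snd (\<phi> S)) z) else \<one>\<^bsub>ggr C (Suc n)\<^esub>)" for z S
      have fh: "f = h z"
      proof
        fix S
        show "f S = h z S"
          using jc_natural(1)[OF n F nat iso V W \<phi> t b z, of S] jc_natural(2)[OF n F nat iso V W \<phi> t c, of S]
            mem[of S] nmem[of S] by (auto simp: f_def h_def)
      qed
      have hc: "h w S \<in> carrier (ggr C (Suc n))" if "w \<in> glcs B (Suc n)" for w S
        using GC.cl_closed[OF ul[OF that]] by (auto simp: h_def)
      have hm: "h (v \<otimes>\<^bsub>free_grp B\<^esub> w) = (\<lambda>S. h v S \<otimes>\<^bsub>ggr C (Suc n)\<^esub> h w S)"
        if "v \<in> glcs B (Suc n)" "w \<in> glcs B (Suc n)" for v w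
        using that hom_mult[OF u GB.lcs_carrier GB.lcs_carrier] GC.cl_mult[OF ul ul] by (auto simp: h_def)
      have hom: "(\<lambda>w. altprod (ggr C (Suc n)) [0..<N] (h w)) \<in> hom (GB.lcs_group (Suc n)) (ggr C (Suc n))"
        by (rule homI) (simp_all add: hm hc L.altprod_mult L.altprod_closed)
      interpret H: group_hom "GB.lcs_group (Suc n)" "ggr C (Suc n)" "\<lambda>w. altprod (ggr C (Suc n)) [0..<N] (h w)"
        using hom GB.group_lcs L.is_group by (simp add: group_hom_def group_hom_axioms_def)
      let ?K = "kernel (GB.lcs_group (Suc n)) (ggr C (Suc n)) (\<lambda>w. altprod (ggr C (Suc n)) [0..<N] (h w))"
      have "glcs B (Suc n) \<subseteq> ?K"
      proof (rule GB.lcs_generated[OF _ free_grp_generate _ H.subgroup_kernel])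
        show "glcs B (Suc (Suc n)) \<subseteq> ?K"
        proof
          fix w assume w: "w \<in> glcs B (Suc (Suc n))"
          have w': "w \<in> glcs B (Suc n)" using w GB.lcs_Suc_subset by blast
          have "h w = (\<lambda>_. \<one>\<^bsub>ggr C (Suc n)\<^esub>)"
            using GC.cl_one_iff[OF ul[OF w']] ul[OF w] by (auto simp: h_def)
          then show "w \<in> ?K" using w' by (simp add: kernel_def L.altprod_one)
        qed
        show "GB.left_normed (gen ` B) (Suc n) \<subseteq> ?K"
        proof
          fix w assume w: "w \<in> GB.left_normed (gen ` B) (Suc n)"
          have w': "w \<in> glcs B (Suc n)"
            using w GB.left_normed_lcs[of "gen ` B" "Suc n"] gen_in_free_grp by auto
          obtain D where D: "D \<subseteq> B" "finite D" "card D \<le> Suc n" "w \<in> generate (free_grp B) (gen ` D)"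
            by (rule left_normed_support[OF w])
          \<comment> \<open>The block of b and those of the at most n + 1 letters of w make at most
            n + 2 < N blocks, so some block i < N is missed; adding i to S then changes neither the
            selected copy of b nor the image of w.\<close>
          have "card (insert (\<beta> b) (\<beta> ` D)) \<le> Suc (card D)"
            using card_image_le[OF D(2), of \<beta>] D(2) by (simp add: card_insert_if)
          then have "card (insert (\<beta> b) (\<beta> ` D)) < card {..<N}" using D(3) N by simp
          then have "\<not> {..<N} \<subseteq> insert (\<beta> b) (\<beta> ` D)" using card_mono[of "insert (\<beta> b) (\<beta> ` D)" "{..<N}"] D(2) by auto
          then obtain i where i: "i < N" "i \<noteq> \<beta> b" "i \<notin> \<beta> ` D" by blast
          have "free_map B C (snd (\<phi> (insert i S))) w = free_map B C (snd (\<phi> S)) w" for S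
          proof (rule hom_eq_on_generate[OF group_free_grp group_free_grp u u _ _ D(4)])
            show "gen ` D \<subseteq> carrier (free_grp B)" using D(1) gen_in_free_grp by blast
            fix g assume "g \<in> gen ` D"
            then obtain d where d: "d \<in> D" "g = gen d" by blast
            then have dB: "d \<in> B" and di: "\<beta> d \<noteq> i" using D(1) i by auto
            show "free_map B C (snd (\<phi> (insert i S))) g = free_map B C (snd (\<phi> S)) g"
              unfolding d(2) free_map_props(2)[OF \<phi>im dB] using \<phi>b[OF dB] di by simp
          qed
          then have "h w (insert i S) = h w S" for S using i(2) by (simp add: h_def)
          then have "altprod (ggr C (Suc n)) [0..<N] (h w) = \<one>\<^bsub>ggr C (Suc n)\<^esub>"
            using i(1) by (intro L.altprod_cancel[of _ i] hc[OF w']) auto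
          then show "w \<in> ?K" using w' by (simp add: kernel_def)
        qed
      qed (auto simp: gen_in_free_grp)
      then show ?thesis using z(1) fh by (auto simp: kernel_def)
    qed
    finally show "jc n F \<eta> W C (altprod (Fob F W) [0..<N] (\<lambda>S. Fmor F V W (\<phi> S) t)) c = \<one>\<^bsub>ggr C (Suc n)\<^esub>" .
  qed
qed

text \<open>Room for the disjoint copy is made by stabilising \<open>a\<close> to V + a, where V is
  the whole sum: the copy of V sits inside the last summand, and the morphism that moves nothing is
  the one induced by stabilisation itself. So the surviving term of the alternating product is the
  stabilised element.\<close>

lemma stably_null_iter_delta:
  assumes xs: "set xs \<subseteq> Ob Sab" "length xs = n + 3"
  shows "stably_null (iter_delta xs F)"
  unfolding stably_null_iff[OF ab_functor_iter_delta[OF F xs(1)]]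
proof (intro ballI)
  fix a s assume oa: "a \<in> Ob Sab" and s: "s \<in> carrier (Fob (iter_delta xs F) a)"
  define N where "N = length xs"
  define A where "A = some_basis a"
  define V where "V = msum xs a"
  define B where "B = msum_basis xs a A"
  \<comment> \<open>The new last summand: the copy of V together with the old
    \<open>a\<close>.\<close>
  define e where "e = dsum V a"
  define E where "E = dsum_basis V a B A"
  define W where "W = msum xs e"
  define C where "C = msum_basis xs e E"
  have a: "framed a A" unfolding A_def by (rule framed_some_basis[OF oa])
  have V: "framed V B" unfolding V_def B_def by (rule framed_msum[OF xs(1) a])
  have e: "framed e E" unfolding e_def E_def by (rule framed_dsum[OF V a])
  have W: "framed W C" unfolding W_def C_def by (rule framed_msum[OF xs(1) e])
  note o = framedD(1)[OF V] framedD(1)[OF W] framedD(1)[OF e]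
  obtain t where t: "t \<in> carrier (Fob F V)" "s = proj xs F a t"
    using s proj_surj[OF F xs(1) oa] unfolding V_def by blast
  have incl: "based a A e E (into_sum V a)" unfolding e_def E_def by (rule based_into_sum[OF V a])
  have m: "based V B W C (msum_mor xs a e (into_sum V a))"
    using based_msum_mor[OF xs(1) a e incl] by (simp only: V_def B_def W_def C_def)
  have l: "based e E W C (last_mor xs e)" unfolding W_def C_def by (rule based_last_mor[OF xs(1) e])
  define \<beta> where "\<beta> = blk xs a"
  define j0 where "j0 = snd (msum_mor xs a e (into_sum V a))"
  define inl where "inl b = prod_encode (b, \<one>\<^bsub>a\<^esub>)" for b
  define j1 where "j1 b = snd (last_mor xs e) (inl b)" for b
  have inlE: "inl b \<in> E" if "b \<in> B" for b using that by (auto simp: inl_def E_def dsum_basis_def)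
  have inj0: "inj_on j0 B" unfolding j0_def by (rule based_inj[OF V m])
  have injl: "inj_on (snd (last_mor xs e)) E" by (rule based_inj[OF e l])
  have inj1: "inj_on j1 B"
  proof (rule inj_onI)
    fix b b' assume "b \<in> B" "b' \<in> B" "j1 b = j1 b'"
    then have "inl b = inl b'" using injl inlE by (simp add: j1_def inj_on_eq_iff)
    then show "b = b'" by (simp add: inl_def)
  qed
  have j0C: "j0 b \<in> C" if "b \<in> B" for b unfolding j0_def using basedD(2)[OF m that] .
  have j1C: "j1 b \<in> C" if "b \<in> B" for b unfolding j1_def using basedD(2)[OF l inlE[OF that]] .
  have blk0: "blk xs e (j0 b) = \<beta> b" if "b \<in> B" for b
    unfolding j0_def \<beta>_def using blk_msum_mor(1)[OF xs(1) a e incl] that by (simp add: B_def)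
  have blk1: "blk xs e (j1 b) = N" if "b \<in> B" for b
    unfolding j1_def N_def using blk_last_mor[OF xs(1) e inlE[OF that]] .
  \<comment> \<open>The images can meet only in the last block, where those coming from
    \<open>a\<close> have the form (1, w) and those of the copy the form (b', 1); equality would
    make the identity a basis element of V.\<close>
  have disj: "j0 ` B \<inter> j1 ` B = {}"
  proof (rule ccontr)
    assume "j0 ` B \<inter> j1 ` B \<noteq> {}"
    then obtain b b' where bb: "b \<in> B" "b' \<in> B" "j0 b = j1 b'" by auto
    then have "\<beta> b = length xs" using blk0 blk1 by (metis N_def)
    then have "j0 b \<in> snd (last_mor xs e) ` snd (into_sum V a) ` A"
      using blk_msum_mor(2)[OF xs(1) a e incl] bb(1) by (simp add: j0_def \<beta>_def B_def)
    then obtain w where w: "w \<in> A" "j0 b = snd (last_mor xs e) (snd (into_sum V a) w)" by blast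
    have "snd (into_sum V a) w = inl b'"
      using injl basedD(2)[OF incl w(1)] inlE[OF bb(2)] bb(3) w(2) by (simp add: j1_def inj_on_eq_iff)
    then have "b' = \<one>\<^bsub>V\<^esub>" using w(1) framedD(6)[OF a] by (auto simp: into_sum_apply inl_def)
    then show False using framed_one_notin[OF V] bb(2) by blast
  qed
  have ex: "\<exists>f. based V B W C f \<and> (\<forall>b\<in>B. snd f b = (if \<beta> b \<in> S then j1 b else j0 b))" for S
  proof -
    let ?\<sigma> = "\<lambda>b. if \<beta> b \<in> S then j1 b else j0 b"
    have ne: "j0 b \<noteq> j1 b'" if "b \<in> B" "b' \<in> B" for b b' using disj that by blast
    have inj: "inj_on ?\<sigma> B"
    proof (rule inj_onI)
      fix b b' assume "b \<in> B" "b' \<in> B" "?\<sigma> b = ?\<sigma> b'"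
      then show "b = b'"
        using inj_onD[OF inj0, of b b'] inj_onD[OF inj1, of b b'] ne[of b b'] ne[of b' b]
        by (cases "\<beta> b \<in> S"; cases "\<beta> b' \<in> S") simp_all
    qed
    have im: "?\<sigma> ` B \<subseteq> C" using j0C j1C by auto
    obtain f where "based V B W C f" "\<And>b. b \<in> B \<Longrightarrow> snd f b = ?\<sigma> b"
      using based_exists[OF V W inj im] by blast
    then show ?thesis by blast
  qed
  then obtain \<phi> where \<phi>: "\<And>S. based V B W C (\<phi> S)"
    "\<And>S b. b \<in> B \<Longrightarrow> snd (\<phi> S) b = (if \<beta> b \<in> S then j1 b else j0 b)" by metis
  have \<phi>0: "\<phi> {} = msum_mor xs a e (into_sum V a)"
    by (rule based_eqI[OF V W \<phi>(1) m]) (simp add: \<phi>(2) j0_def)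
  interpret FW: comm_group "Fob F W" by (rule ab_functorD(1)[OF F o(2)])
  interpret D: comm_group "Fob (iter_delta xs F) e"
    by (rule ab_functorD(1)[OF ab_functor_iter_delta[OF F xs(1)] o(3)])
  have pr: "proj xs F e \<in> hom (Fob F W) (Fob (iter_delta xs F) e)"
    unfolding W_def by (rule proj_hom[OF F xs(1) o(3)])
  have tc: "Fmor F V W (\<phi> S) t \<in> carrier (Fob F W)" for S
    using ab_functorD(6)[OF F o(1,2) basedD(1)[OF \<phi>(1)] t(1)] .
  let ?f = "\<lambda>S. proj xs F e (Fmor F V W (\<phi> S) t)"
  have fc: "?f S \<in> carrier (Fob (iter_delta xs F) e)" for S using hom_in_carrier[OF pr tc] .
  have "altprod (Fob (iter_delta xs F) e) [0..<N] ?f = proj xs F e (altprod (Fob F W) [0..<N] (\<lambda>S. Fmor F V W (\<phi> S) t))"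
    using altprod_hom[OF FW.comm_group_axioms D.comm_group_axioms pr tc] by simp
  also have "altprod (Fob F W) [0..<N] (\<lambda>S. Fmor F V W (\<phi> S) t) = \<one>\<^bsub>Fob F W\<^esub>"
    by (rule altprod_trivial[OF V W t(1) \<phi> inj0 inj1 disj]) (simp_all add: N_def xs(2))
  also have "proj xs F e \<one>\<^bsub>Fob F W\<^esub> = \<one>\<^bsub>Fob (iter_delta xs F) e\<^esub>"
    by (rule hom_one[OF pr FW.is_group D.is_group])
  finally have alt: "altprod (Fob (iter_delta xs F) e) [0..<N] ?f = \<one>\<^bsub>Fob (iter_delta xs F) e\<^esub>" .
  \<comment> \<open>If i is in S, the basis elements of block i have moved to the last block, so the
    morphism avoids block i and its value dies in the iterated difference.\<close>
  have f1: "?f S = \<one>\<^bsub>Fob (iter_delta xs F) e\<^esub>" if S: "S \<noteq> {}" "S \<subseteq> set [0..<N]" for S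
  proof -
    obtain i where "i \<in> S" using S(1) by blast
    then have i: "i \<in> S" "i < N" using S(2) by auto
    let ?W' = "msum (drop_nth i xs) e" and ?C' = "msum_basis (drop_nth i xs) e E"
    have W': "framed ?W' ?C'" by (rule framed_drop_nth[OF xs(1) e])
    have sk: "based ?W' ?C' W C (skip_mor i xs e)"
      unfolding W_def C_def using based_skip_mor[OF xs(1) e] i(2) by (simp add: N_def)
    have "snd (\<phi> S) b \<in> C \<and> blk xs e (snd (\<phi> S) b) \<noteq> i" if "b \<in> B" for b
      using \<phi>(2)[OF that] j0C[OF that] j1C[OF that] blk0[OF that] blk1[OF that] i by auto
    then have "snd (\<phi> S) ` B \<subseteq> snd (skip_mor i xs e) ` ?C'"
      using skip_mor_image[OF xs(1) e, of i] i(2) by (auto simp: C_def N_def)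
    then obtain h where h: "based V B ?W' ?C' h" "\<phi> S = Comp Sab V ?W' W (skip_mor i xs e) h"
      using based_factors[OF V W' W \<phi>(1) sk] by blast
    have "Fmor F V W (\<phi> S) t = Fmor F ?W' W (skip_mor i xs e) (Fmor F V ?W' h t)"
      unfolding h(2) by (rule ab_functorD(5)[OF F o(1) framedD(1)[OF W'] o(2) basedD(1)[OF h(1)] basedD(1)[OF sk] t(1)])
    then show ?thesis
      using proj_skip[OF F xs(1) o(3), of i] i(2) ab_functorD(6)[OF F o(1) framedD(1)[OF W'] basedD(1)[OF h(1)] t(1)]
      by (simp add: W_def N_def)
  qed
  have "?f {} \<in> {\<one>\<^bsub>Fob (iter_delta xs F) e\<^esub>}"
    by (rule D.altprod_first_in_subgroup[OF D.triv_subgroup fc, of "[0..<N]"]) (use f1 alt in auto)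
  then have "Fmor (iter_delta xs F) a e (into_sum V a) s = \<one>\<^bsub>Fob (iter_delta xs F) e\<^esub>"
    using proj_natural[OF F xs(1) oa o(3) basedD(1)[OF incl]] t by (simp add: \<phi>0 V_def W_def)
  then show "killed (iter_delta xs F) a s" using o(3) basedD(1)[OF incl] unfolding killed_def by blast
qed

end

section \<open>Integral unitriangular matrices\<close>

text \<open>The matrices are infinite, but as they are upper triangular, the sums in a product are finite.\<close>

definition tri :: "(nat \<Rightarrow> nat \<Rightarrow> int) monoid" where
  "tri = \<lparr>carrier = {M. \<forall>i j. j < i \<longrightarrow> M i j = 0},
          monoid.mult = (\<lambda>M N i j. \<Sum>k=i..j. M i k * N k j),
          one = (\<lambda>i j. if i = j then 1 else 0)\<rparr>"

lemma tri_simps [simp]: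
  "M \<in> carrier tri \<longleftrightarrow> (\<forall>i j. j < i \<longrightarrow> M i j = 0)"
  "(M \<otimes>\<^bsub>tri\<^esub> N) i j = (\<Sum>k=i..j. M i k * N k j)"
  "\<one>\<^bsub>tri\<^esub> i j = (if i = j then 1 else 0)"
  by (simp_all add: tri_def)

lemma monoid_tri: "monoid tri"
proof (rule monoidI)
  fix M N P assume M: "M \<in> carrier tri" and N: "N \<in> carrier tri" and P: "P \<in> carrier tri"
  show "M \<otimes>\<^bsub>tri\<^esub> N \<otimes>\<^bsub>tri\<^esub> P = M \<otimes>\<^bsub>tri\<^esub> (N \<otimes>\<^bsub>tri\<^esub> P)"
  proof (intro ext)
    fix i j
    have "(M \<otimes>\<^bsub>tri\<^esub> N \<otimes>\<^bsub>tri\<^esub> P) i j = (\<Sum>k=i..j. \<Sum>l=i..j. M i l * N l k * P k j)"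
      unfolding tri_simps sum_distrib_right
      by (intro sum.cong refl sum.mono_neutral_left) (use N in auto)
    also have "\<dots> = (\<Sum>l=i..j. \<Sum>k=i..j. M i l * N l k * P k j)" by (rule sum.swap)
    also have "\<dots> = (M \<otimes>\<^bsub>tri\<^esub> (N \<otimes>\<^bsub>tri\<^esub> P)) i j"
      unfolding tri_simps sum_distrib_left mult.assoc
      by (intro sum.cong refl sum.mono_neutral_right) (use N in auto)
    finally show "(M \<otimes>\<^bsub>tri\<^esub> N \<otimes>\<^bsub>tri\<^esub> P) i j = (M \<otimes>\<^bsub>tri\<^esub> (N \<otimes>\<^bsub>tri\<^esub> P)) i j" .
  qed
next
  fix M assume M: "M \<in> carrier tri"
  show "\<one>\<^bsub>tri\<^esub> \<otimes>\<^bsub>tri\<^esub> M = M"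
    using M by (intro ext) (auto simp: if_distrib[of "\<lambda>x. x * _"] sum.delta' cong: if_cong)
  show "M \<otimes>\<^bsub>tri\<^esub> \<one>\<^bsub>tri\<^esub> = M"
    using M by (intro ext) (auto simp: if_distrib[of "\<lambda>x. _ * x"] sum.delta cong: if_cong)
qed auto

definition tri_units :: "(nat \<Rightarrow> nat \<Rightarrow> int) monoid" where
  "tri_units = units_of tri"

lemma group_tri_units: "group tri_units"
  unfolding tri_units_def by (rule monoid.units_group[OF monoid_tri])

lemma tri_units_simps:
  "M \<in> carrier tri_units \<Longrightarrow> j < i \<Longrightarrow> M i j = 0"
  "(M \<otimes>\<^bsub>tri_units\<^esub> N) i j = (\<Sum>k=i..j. M i k * N k j)"
  "\<one>\<^bsub>tri_units\<^esub> i j = (if i = j then 1 else 0)"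
  by (auto simp: tri_units_def units_of_def Units_def)

text \<open>The matrix 1 + e E_{p,p+1}.\<close>

definition elem_mat :: "int \<Rightarrow> nat \<Rightarrow> nat \<Rightarrow> nat \<Rightarrow> int" where
  "elem_mat e p i j = (if i = j then 1 else if i = p \<and> j = Suc p then e else 0)"

lemma elem_mat_mult: "elem_mat e p \<otimes>\<^bsub>tri\<^esub> elem_mat (- e) p = \<one>\<^bsub>tri\<^esub>"
proof (intro ext)
  fix i j
  have "(\<Sum>k=i..j. elem_mat e p i k * elem_mat (- e) p k j)
    = (\<Sum>k\<in>{i..j} \<inter> {i, Suc i}. elem_mat e p i k * elem_mat (- e) p k j)"
    by (rule sum.mono_neutral_right) (auto simp: elem_mat_def)
  also have "\<dots> = (if i = j then 1 else 0)"
  proof (cases "i < j")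
    case True
    then have "{i..j} \<inter> {i, Suc i} = {i, Suc i}" by auto
    then show ?thesis using True by (auto simp: elem_mat_def)
  next
    case False
    then have "{i..j} \<inter> {i, Suc i} = (if i = j then {i} else {})" by auto
    then show ?thesis by (auto simp: elem_mat_def)
  qed
  finally show "(elem_mat e p \<otimes>\<^bsub>tri\<^esub> elem_mat (- e) p) i j = \<one>\<^bsub>tri\<^esub> i j" by simp
qed

lemma elem_mat_in: "elem_mat 1 p \<in> carrier tri_units"
proof -
  have "elem_mat e p \<in> carrier tri" for e by (simp add: elem_mat_def)
  moreover have "elem_mat (- 1) p \<otimes>\<^bsub>tri\<^esub> elem_mat 1 p = \<one>\<^bsub>tri\<^esub>" using elem_mat_mult[of "- 1" p] by simp
  ultimately show ?thesis
    using elem_mat_mult[of 1 p] unfolding tri_units_def units_of_def Units_def by auto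
qed

text \<open>Unitriangular matrices whose first m - 1 superdiagonals vanish; the m-th term of the
  lower central series of a group of unitriangular matrices falls into it.\<close>

definition superdiag :: "nat \<Rightarrow> (nat \<Rightarrow> nat \<Rightarrow> int) set" where
  "superdiag m = {M \<in> carrier tri_units. (\<forall>i. M i i = 1) \<and> (\<forall>i j. i < j \<and> j < i + m \<longrightarrow> M i j = 0)}"

text \<open>Given triangularity, these are the unitriangular matrices that are block diagonal with a
  cut between the indices r - 1 and r.\<close>

definition block_mat :: "nat \<Rightarrow> (nat \<Rightarrow> nat \<Rightarrow> int) set" where
  "block_mat r = {M \<in> superdiag 1. \<forall>i j. i < r \<and> r \<le> j \<longrightarrow> M i j = 0}"

lemma superdiagD:
  assumes "M \<in> superdiag m"
  shows "M \<in> carrier tri_units" "M i i = 1" "i < j \<Longrightarrow> j < i + m \<Longrightarrow> M i j = 0" "j < i \<Longrightarrow> M i j = 0"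
  using assms tri_units_simps(1) by (auto simp: superdiag_def)

lemma superdiagI:
  assumes "M \<in> carrier tri_units" "\<And>i. M i i = 1" "\<And>i j. i < j \<Longrightarrow> j < i + m \<Longrightarrow> M i j = 0"
  shows "M \<in> superdiag m"
  using assms by (simp add: superdiag_def)

lemma superdiag_mono:
  assumes "M \<in> superdiag m" "l \<le> m"
  shows "M \<in> superdiag l"
proof (rule superdiagI)
  fix i j assume "i < j" "j < i + l"
  then show "M i j = 0" using superdiagD(3)[OF assms(1), of i j] assms(2) by linarith
qed (use superdiagD(1,2)[OF assms(1)] in auto)

lemma sum_ends:
  fixes f :: "nat \<Rightarrow> int"
  assumes "i < j" "\<And>k. i < k \<Longrightarrow> k < j \<Longrightarrow> f k = 0"
  shows "(\<Sum>k=i..j. f k) = f i + f j"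
proof -
  have "(\<Sum>k=i..j. f k) = (\<Sum>k\<in>{i, j}. f k)"
    by (rule sum.mono_neutral_right) (use assms in auto)
  then show ?thesis using assms(1) by simp
qed

lemma superdiag_mult_entry:
  assumes M: "M \<in> superdiag m" and N: "N \<in> superdiag l" and ij: "i < j" "j < i + m + l"
    and z: "\<And>k. i < k \<Longrightarrow> k < j \<Longrightarrow> M i k * N k j = 0"
  shows "(M \<otimes>\<^bsub>tri_units\<^esub> N) i j = M i j + N i j"
  unfolding tri_units_simps using sum_ends[OF ij(1), of "\<lambda>k. M i k * N k j", OF z] superdiagD(2)[OF M] superdiagD(2)[OF N] by simp

lemma tri_mult_diag:
  assumes "M \<in> superdiag m" "N \<in> superdiag l"
  shows "(M \<otimes>\<^bsub>tri_units\<^esub> N) i i = 1"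
  using superdiagD(2)[OF assms(1)] superdiagD(2)[OF assms(2)] by (simp add: tri_units_simps)

text \<open>Up to the m-th superdiagonal entries are additive, since every mixed term contains an
  entry from the zero band of \<open>M\<close>.\<close>

lemma superdiag_mult_low:
  assumes M: "M \<in> superdiag m" and N: "N \<in> superdiag 1" and ij: "i < j" "j \<le> i + m"
  shows "(M \<otimes>\<^bsub>tri_units\<^esub> N) i j = M i j + N i j" "(N \<otimes>\<^bsub>tri_units\<^esub> M) i j = M i j + N i j"
proof -
  have "M i k * N k j = 0" if "i < k" "k < j" for k using superdiagD(3)[OF M, of i k] that ij by simp
  then show "(M \<otimes>\<^bsub>tri_units\<^esub> N) i j = M i j + N i j"
    using superdiag_mult_entry[OF M N ij(1)] ij(2) by simp
  have "N i k * M k j = 0" if "i < k" "k < j" for k using superdiagD(3)[OF M, of k j] that ij by simp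
  then show "(N \<otimes>\<^bsub>tri_units\<^esub> M) i j = M i j + N i j"
    using superdiag_mult_entry[OF N M ij(1)] ij(2) by simp
qed

lemma superdiag_subgroup: "subgroup (superdiag m) tri_units"
proof -
  interpret group tri_units by (rule group_tri_units)
  show ?thesis
  proof
    show "superdiag m \<subseteq> carrier tri_units" by (auto simp: superdiag_def)
  next
    fix M N assume M: "M \<in> superdiag m" and N: "N \<in> superdiag m"
    have "(M \<otimes>\<^bsub>tri_units\<^esub> N) i j = 0" if ij: "i < j" "j < i + m" for i j
    proof -
      have "M i k * N k j = 0" if "i < k" "k < j" for k using superdiagD(3)[OF M, of i k] that ij by simp
      then show ?thesis
        using superdiag_mult_entry[OF M N ij(1)] ij superdiagD(3)[OF M ij] superdiagD(3)[OF N ij] by simp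
    qed
    then show "M \<otimes>\<^bsub>tri_units\<^esub> N \<in> superdiag m"
      using tri_mult_diag[OF M N] m_closed superdiagD(1)[OF M] superdiagD(1)[OF N] by (simp add: superdiag_def)
  next
    show "\<one>\<^bsub>tri_units\<^esub> \<in> superdiag m" using one_closed by (auto simp: superdiag_def tri_units_simps)
  next
    fix M assume M: "M \<in> superdiag m"
    note Mc = superdiagD(1)[OF M]
    let ?N = "inv\<^bsub>tri_units\<^esub> M"
    have Nc: "?N \<in> carrier tri_units" using Mc by simp
    have NM: "(\<Sum>k=i..j. ?N i k * M k j) = (if i = j then 1 else 0)" for i j
      using fun_cong[OF fun_cong[OF l_inv[OF Mc]], of i j] by (simp add: tri_units_simps)
    have 1: "?N i i = 1" for i using NM[of i i] superdiagD(2)[OF M] by simp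
    have "?N i j = 0" if ij: "i < j" "j < i + m" for i j
    proof -
      have "(\<Sum>k=i..j. ?N i k * M k j) = ?N i i * M i j + ?N i j * M j j"
        by (rule sum_ends[OF ij(1)]) (use superdiagD(3)[OF M, of _ j] ij in simp)
      then show ?thesis using NM[of i j] ij superdiagD(3)[OF M ij] superdiagD(2)[OF M] by simp
    qed
    then show "?N \<in> superdiag m" using 1 Nc by (simp add: superdiag_def)
  qed
qed

lemma block_mat_subgroup: "subgroup (block_mat r) tri_units"
proof -
  interpret group tri_units by (rule group_tri_units)
  interpret S: subgroup "superdiag 1" tri_units by (rule superdiag_subgroup)
  show ?thesis
  proof
    show "block_mat r \<subseteq> carrier tri_units" using S.subset by (auto simp: block_mat_def)
  next
    fix M N assume M: "M \<in> block_mat r" and N: "N \<in> block_mat r"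
    have "(M \<otimes>\<^bsub>tri_units\<^esub> N) i j = 0" if "i < r" "r \<le> j" for i j
    proof -
      have "M i k * N k j = 0" for k
        using M N that by (cases "k < r") (auto simp: block_mat_def)
      then show ?thesis unfolding tri_units_simps by (intro sum.neutral) blast
    qed
    moreover have "M \<otimes>\<^bsub>tri_units\<^esub> N \<in> superdiag 1"
      by (rule S.m_closed) (use M N in \<open>simp_all add: block_mat_def\<close>)
    ultimately show "M \<otimes>\<^bsub>tri_units\<^esub> N \<in> block_mat r" unfolding block_mat_def by blast
  next
    show "\<one>\<^bsub>tri_units\<^esub> \<in> block_mat r"
      unfolding block_mat_def using S.one_closed tri_units_simps(3) by auto
  next
    fix M assume M: "M \<in> block_mat r"
    then have M1: "M \<in> superdiag 1" by (simp add: block_mat_def)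
    note Mc = superdiagD(1)[OF M1]
    let ?N = "inv\<^bsub>tri_units\<^esub> M"
    have NM: "(\<Sum>k=i..j. ?N i k * M k j) = (if i = j then 1 else 0)" for i j
      using fun_cong[OF fun_cong[OF l_inv[OF Mc]], of i j] by (simp add: tri_units_simps)
    \<comment> \<open>The row i is solved from left to right: a column k < r contributes nothing
      because \<open>M\<close> is block diagonal, a column k \<ge> r with k < j by
      induction.\<close>
    have "?N i j = 0" if i: "i < r" and j: "r \<le> j" for i j
      using j
    proof (induction j rule: less_induct)
      case (less j)
      have "?N i k * M k j = 0" if "k < j" for k
        using less that M by (cases "k < r") (auto simp: block_mat_def)
      then have "(\<Sum>k=i..j. ?N i k * M k j) = (\<Sum>k\<in>{j}. ?N i k * M k j)"
        using i less.prems by (intro sum.mono_neutral_right) auto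
      then show ?case using NM[of i j] i less.prems superdiagD(2)[OF M1] by simp
    qed
    then show "?N \<in> block_mat r" using S.m_inv_closed[OF M1] by (simp add: block_mat_def)
  qed
qed

text \<open>MN and NM agree up to the m-th superdiagonal, so the commutator C, which satisfies C(NM)
  = MN, has none of these entries. On the next superdiagonal C is the difference MN - NM, the Lie
  bracket of the leading superdiagonals.\<close>

lemma superdiag_commutator:
  assumes m: "m \<ge> 1" and M: "M \<in> superdiag m" and N: "N \<in> superdiag 1"
  defines "C \<equiv> M \<otimes>\<^bsub>tri_units\<^esub> N \<otimes>\<^bsub>tri_units\<^esub> inv\<^bsub>tri_units\<^esub> M \<otimes>\<^bsub>tri_units\<^esub> inv\<^bsub>tri_units\<^esub> N"
  shows "C \<in> superdiag (Suc m)"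
    "C i (Suc (i + m)) = M i (i + m) * N (i + m) (Suc (i + m)) - N i (Suc i) * M (Suc i) (Suc (i + m))"
proof -
  interpret group tri_units by (rule group_tri_units)
  interpret S: subgroup "superdiag 1" tri_units by (rule superdiag_subgroup)
  have M1: "M \<in> superdiag 1" by (rule superdiag_mono[OF M m])
  note Mc = superdiagD(1)[OF M] and Nc = superdiagD(1)[OF N]
  have C1: "C \<in> superdiag 1" unfolding C_def using M1 N by (intro S.m_closed S.m_inv_closed)
  define A where "A = M \<otimes>\<^bsub>tri_units\<^esub> N"
  define A' where "A' = N \<otimes>\<^bsub>tri_units\<^esub> M"
  have A'1: "A' \<in> superdiag 1" unfolding A'_def using M1 N by (intro S.m_closed)
  \<comment> \<open>Multiplying by NM removes the inverses, whose entries would otherwise have to be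
    computed.\<close>
  have CA: "C \<otimes>\<^bsub>tri_units\<^esub> A' = A" using Mc Nc by (simp add: C_def A_def A'_def m_assoc)
  have entry: "(\<Sum>k=i..j. C i k * A' k j) = A i j" for i j
    using fun_cong[OF fun_cong[OF CA], of i j] by (simp add: tri_units_simps)
  have low: "A i j = A' i j" if "i < j" "j \<le> i + m" for i j
    using superdiag_mult_low[OF M N that] by (simp add: A_def A'_def)
  have C0: "C i j = 0" if ij: "i < j" "j \<le> i + m" for i j
    using ij
  proof (induction j rule: less_induct)
    case (less j)
    have "(\<Sum>k=i..j. C i k * A' k j) = C i i * A' i j + C i j * A' j j"
      by (rule sum_ends[OF less.prems(1)]) (use less in simp)
    then show ?case
      using entry[of i j] low[OF less.prems] superdiagD(2)[OF C1] superdiagD(2)[OF A'1] by simp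
  qed
  then show "C \<in> superdiag (Suc m)" using superdiagD(1,2)[OF C1] by (intro superdiagI) auto
  let ?j = "Suc (i + m)"
  have "(\<Sum>k=i..?j. C i k * A' k ?j) = C i i * A' i ?j + C i ?j * A' ?j ?j"
    by (rule sum_ends) (use C0 in auto)
  then have "C i ?j = A i ?j - A' i ?j"
    using entry[of i ?j] superdiagD(2)[OF C1] superdiagD(2)[OF A'1] by simp
  moreover have "A i ?j = M i i * N i ?j + M i (i + m) * N (i + m) ?j + M i ?j * N ?j ?j"
  proof -
    have "A i ?j = (\<Sum>k\<in>{i, i + m, ?j}. M i k * N k ?j)"
      unfolding A_def tri_units_simps
      by (rule sum.mono_neutral_right) (use superdiagD(3)[OF M, of i] in auto)
    then show ?thesis using m by simp
  qed
  moreover have "A' i ?j = N i i * M i ?j + N i (Suc i) * M (Suc i) ?j + N i ?j * M ?j ?j"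
  proof -
    have "A' i ?j = (\<Sum>k\<in>{i, Suc i, ?j}. N i k * M k ?j)"
      unfolding A'_def tri_units_simps
      by (rule sum.mono_neutral_right) (use superdiagD(3)[OF M, of _ ?j] in auto)
    then show ?thesis using m by simp
  qed
  ultimately show "C i ?j = M i (i + m) * N (i + m) ?j - N i (Suc i) * M (Suc i) ?j"
    using superdiagD(2)[OF M] superdiagD(2)[OF N] by simp
qed

lemma elem_mat_superdiag: "elem_mat 1 p \<in> superdiag 1"
  using elem_mat_in by (auto simp: superdiag_def elem_mat_def)

text \<open>The only off-diagonal entry, at (p, p + 1), crosses the cut at r exactly when r = p +
  1.\<close>

lemma elem_mat_block: "Suc p \<noteq> r \<Longrightarrow> elem_mat 1 p \<in> block_mat r"
  using elem_mat_superdiag by (auto simp: block_mat_def elem_mat_def)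

section \<open>The lower bound\<close>

text \<open>Each commutator pushes the first possibly nonzero superdiagonal one step
  outwards.\<close>

lemma lower_central_superdiag:
  assumes G: "group G" and \<rho>: "\<rho> \<in> hom G tri_units" and 1: "\<And>g. g \<in> carrier G \<Longrightarrow> \<rho> g \<in> superdiag 1"
    and m: "m \<ge> 1" and z: "z \<in> lower_central G m"
  shows "\<rho> z \<in> superdiag m"
  using m z
proof (induction m arbitrary: z rule: dec_induct)
  case base
  then show ?case using 1 by simp
next
  case (step m)
  interpret G: group G by fact
  interpret \<rho>: group_hom G tri_units \<rho> using \<rho> group_tri_units by (simp add: group_hom_def group_hom_axioms_def G)
  have "generate G {G.commutator x y | x y. x \<in> G.lcs m \<and> y \<in> carrier G} \<subseteq> {x \<in> carrier G. \<rho> x \<in> superdiag (Suc m)}"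
  proof (rule G.generate_subgroup_incl)
    show "subgroup {x \<in> carrier G. \<rho> x \<in> superdiag (Suc m)} G"
      by (rule G.hom_preimage_subgroup[OF group_tri_units \<rho> G superdiag_subgroup])
    show "{G.commutator x y | x y. x \<in> G.lcs m \<and> y \<in> carrier G} \<subseteq> {x \<in> carrier G. \<rho> x \<in> superdiag (Suc m)}"
      using superdiag_commutator(1)[OF step.hyps(1) step.IH 1] G.lcs_carrier by auto
  qed
  then show ?case using step.prems G.lcs_Suc[OF step.hyps(1)] by blast
qed

text \<open>Left-normed, with letters numbered from 1: the index 0 is reserved for the generator
  moved by the transvection.\<close>

fun nested_commutator :: "('a, 'r) monoid_scheme \<Rightarrow> (nat \<Rightarrow> 'a) \<Rightarrow> nat \<Rightarrow> 'a" where
  "nested_commutator G g 0 = \<one>\<^bsub>G\<^esub>"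
| "nested_commutator G g (Suc 0) = g 1"
| "nested_commutator G g (Suc (Suc m)) =
     nested_commutator G g (Suc m) \<otimes>\<^bsub>G\<^esub> g (Suc (Suc m)) \<otimes>\<^bsub>G\<^esub>
       inv\<^bsub>G\<^esub> nested_commutator G g (Suc m) \<otimes>\<^bsub>G\<^esub> inv\<^bsub>G\<^esub> g (Suc (Suc m))"

lemma nested_commutator_in:
  assumes "group G" "subgroup H G" "\<And>i. 1 \<le> i \<Longrightarrow> i \<le> m \<Longrightarrow> g i \<in> H"
  shows "nested_commutator G g m \<in> H"
proof -
  interpret subgroup H G by fact
  interpret group G by fact
  show ?thesis
    using assms(3)
  proof (induction m)
    case (Suc m)
    then have "nested_commutator G g m \<in> H" "g (Suc m) \<in> H" by auto
    then show ?case by (cases m) auto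
  qed simp
qed

lemma nested_commutator_cong:
  "(\<And>i. 1 \<le> i \<Longrightarrow> i \<le> m \<Longrightarrow> f i = g i) \<Longrightarrow> nested_commutator G f m = nested_commutator G g m"
proof (induction m)
  case (Suc m)
  then have "nested_commutator G f m = nested_commutator G g m" "f (Suc m) = g (Suc m)" by auto
  then show ?case by (cases m) auto
qed simp

lemma nested_commutator_lcs:
  assumes "group G" "m \<ge> 1" "\<And>i. 1 \<le> i \<Longrightarrow> i \<le> m \<Longrightarrow> g i \<in> carrier G"
  shows "nested_commutator G g m \<in> lower_central G m"
  using assms(2,3)
proof (induction m rule: dec_induct)
  case (step m)
  interpret group G by fact
  obtain k where k: "m = Suc k" using step.hyps by (cases m) auto
  show ?case
    using commutator_in_lcs(1)[OF step.hyps(1) step.IH, of "g (Suc m)"] step.prems by (simp add: k)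
qed simp

lemma nested_commutator_hom:
  assumes "group G" "group H" "h \<in> hom G H" "\<And>i. 1 \<le> i \<Longrightarrow> i \<le> m \<Longrightarrow> g i \<in> carrier G"
  shows "h (nested_commutator G g m) = nested_commutator H (\<lambda>i. h (g i)) m"
  using assms(4)
proof (induction m)
  case 0
  then show ?case using hom_one[OF assms(3,1,2)] by simp
next
  case (Suc m)
  interpret h: group_hom G H h using assms by (simp add: group_hom_def group_hom_axioms_def)
  show ?case
  proof (cases m)
    case (Suc k)
    have "nested_commutator G g m \<in> carrier G"
      by (rule nested_commutator_in[OF assms(1) h.G.subgroup_self]) (use Suc.prems in auto)
    then show ?thesis using Suc.IH Suc.prems Suc by simp
  qed simp
qed

text \<open>The letter i is 1 + E_{i-1,i}. The leading part of the commutator gains E_{01} E_{12}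
  ... = E_{0,m+1} with coefficient 1; the other term of the bracket contains the entry (0, 1) of the
  new letter, which is 0.\<close>

lemma nested_commutator_elem_mat:
  "nested_commutator tri_units (\<lambda>i. elem_mat 1 (i - 1)) (Suc m) \<in> superdiag (Suc m) \<and>
   nested_commutator tri_units (\<lambda>i. elem_mat 1 (i - 1)) (Suc m) 0 (Suc m) = 1"
proof (induction m)
  case 0
  have "elem_mat 1 0 0 (Suc 0) = 1" by (simp add: elem_mat_def)
  then show ?case using elem_mat_superdiag[of 0] by simp
next
  case (Suc m)
  let ?M = "nested_commutator tri_units (\<lambda>i. elem_mat 1 (i - 1)) (Suc m)"
  have "elem_mat 1 (Suc m) (Suc m) (Suc (Suc m)) = 1" "elem_mat 1 (Suc m) 0 (Suc 0) = 0"
    by (simp_all add: elem_mat_def)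
  then show ?case
    using superdiag_commutator(1)[OF _ conjunct1[OF Suc] elem_mat_superdiag[of "Suc m"]]
      superdiag_commutator(2)[OF _ conjunct1[OF Suc] elem_mat_superdiag[of "Suc m"], of 0] conjunct2[OF Suc] by simp
qed

lemma blk_surj:
  assumes "set xs \<subseteq> Ob Sab" "framed a A" "\<And>x. x \<in> set xs \<Longrightarrow> some_basis x \<noteq> {}" "i < length xs"
  shows "\<exists>c\<in>msum_basis xs a A. blk xs a c = i"
  using assms
proof (induction xs arbitrary: i)
  case (Cons x xs)
  have m: "framed (msum xs a) (msum_basis xs a A)" using framed_msum Cons.prems by simp
  show ?case
  proof (cases i)
    case 0
    obtain s where "s \<in> some_basis x" using Cons.prems(3) by fastforce
    then show ?thesis using 0 by (intro bexI[of _ "prod_encode (s, \<one>\<^bsub>msum xs a\<^esub>)"]) (auto simp: dsum_basis_def)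
  next
    case (Suc j)
    then obtain c where c: "c \<in> msum_basis xs a A" "blk xs a c = j" using Cons by auto
    moreover have "c \<noteq> \<one>\<^bsub>msum xs a\<^esub>" using c(1) framed_one_notin[OF m] by blast
    ultimately show ?thesis
      using Suc by (intro bexI[of _ "prod_encode (\<one>\<^bsub>x\<^esub>, c)"]) (auto simp: dsum_basis_def)
  qed
qed simp

text \<open>The abelianisation of the free group on one letter: an empty basis would force the
  generator to be the identity.\<close>

lemma exists_nontrivial_object:
  obtains x where "x \<in> Ob Sab" "some_basis x \<noteq> {}"
proof -
  let ?x = "free_ab {0}"
  have x: "framed ?x (eb {0} ` {0})" by (rule framed_free_ab) simp
  have b: "framed ?x (some_basis ?x)" by (rule framed_some_basis[OF framedD(1)[OF x]])
  have "some_basis ?x \<noteq> {}"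
  proof
    assume "some_basis ?x = {}"
    then have "carrier ?x = {\<one>\<^bsub>?x\<^esub>}" using framedD(7)[OF b] group.generate_empty[OF framedD(4)[OF b]] by simp
    then show False using framedD(6)[OF x] framed_one_notin[OF x] by auto
  qed
  then show thesis using that framedD(1)[OF x] by blast
qed

context
  fixes n :: nat and F :: "'b sfun" and \<eta> :: "nat monoid \<Rightarrow> 'b \<Rightarrow> nat \<Rightarrow> nat"
  assumes n: "n \<ge> 1" and F: "ab_functor Sab F"
    and nat: "nat_trans Gcat (along_ab F) (JA_quotient n) \<eta>"
    and iso: "\<forall>a\<in>Ob Gcat. \<eta> a \<in> iso (Fob (along_ab F) a) (Fob (JA_quotient n) a)"
begin

text \<open>The coefficient of \<open>c\<^sub>0\<^sup>* \<otimes> c\<^sub>1 \<cdots> c\<^sub>n\<^sub>+\<^sub>1\<close> of the Johnson image is read off as a corner entry of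
  the representation sending \<open>c\<^sub>i\<close> to the \<open>i\<close>-th elementary matrix.\<close>

lemma corner_functional:
  assumes W: "framed W C" and c: "\<And>i. i \<le> n + 1 \<Longrightarrow> c i \<in> C" and inj: "inj_on c {..n + 1}"
  obtains l where "l \<in> hom (Fob F W) integer_group"
    "\<And>V B f t i. framed V B \<Longrightarrow> based V B W C f \<Longrightarrow> t \<in> carrier (Fob F V) \<Longrightarrow> i \<le> n + 1 \<Longrightarrow>
       c i \<notin> snd f ` B \<Longrightarrow> l (Fmor F V W f t) = 0"
    "\<And>s. s \<in> carrier (Fob F W) \<Longrightarrow>
       jc n F \<eta> W C s (c 0) = gcl C (Suc n) (nested_commutator (free_grp C) (\<lambda>i. gen (c i)) (Suc n)) \<Longrightarrow> l s = 1"
proof -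
  interpret GC: group "free_grp C" by (rule group_free_grp)
  define idx where "idx d = inv_into {..n + 1} c d" for d
  have idx: "idx (c i) = i" if "i \<le> n + 1" for i using inj that by (simp add: idx_def)
  \<comment> \<open>c_i for i \<ge> 1 goes to 1 + E_{i-1,i}; c_0 and all other letters go to
    1.\<close>
  obtain \<rho> where \<rho>: "\<rho> \<in> hom (free_grp C) tri_units"
    "\<And>d. d \<in> C \<Longrightarrow> \<rho> (gen d) = (if d \<in> c ` {1..n + 1} then elem_mat 1 (idx d - 1) else \<one>\<^bsub>tri_units\<^esub>)"
    by (rule free_grp_universal[OF group_tri_units, of C "\<lambda>d. if d \<in> c ` {1..n + 1} then elem_mat 1 (idx d - 1) else \<one>\<^bsub>tri_units\<^esub>"])
      (use elem_mat_in group.is_monoid[OF group_tri_units] monoid.one_closed in auto)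
  interpret \<rho>: group_hom "free_grp C" tri_units \<rho>
    using \<rho>(1) group_tri_units by (simp add: group_hom_def group_hom_axioms_def GC.is_group)
  have \<rho>c: "\<rho> (gen (c i)) = elem_mat 1 (i - 1)" if "1 \<le> i" "i \<le> n + 1" for i
    using \<rho>(2)[OF c[OF that(2)]] idx[OF that(2)] that by auto
  have gen_mem: "\<rho> w \<in> Z" if Z: "subgroup Z tri_units" and D: "D \<subseteq> C"
      and gD: "\<And>d. d \<in> D \<Longrightarrow> \<rho> (gen d) \<in> Z" and w: "w \<in> generate (free_grp C) (gen ` D)" for Z D w
  proof -
    have "generate (free_grp C) (gen ` D) \<subseteq> {x \<in> carrier (free_grp C). \<rho> x \<in> Z}"
      by (rule GC.generate_subgroup_incl[OF _ GC.hom_preimage_subgroup[OF group_tri_units \<rho>(1) GC.is_group Z]])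
        (use D gD gen_in_free_grp in auto)
    then show ?thesis using w by blast
  qed
  have one1: "\<one>\<^bsub>tri_units\<^esub> \<in> superdiag 1" and oneb: "\<one>\<^bsub>tri_units\<^esub> \<in> block_mat r" for r
    using subgroup.one_closed[OF superdiag_subgroup] subgroup.one_closed[OF block_mat_subgroup] by auto
  have \<rho>1: "\<rho> g \<in> superdiag 1" if "g \<in> carrier (free_grp C)" for g
    by (rule gen_mem[OF superdiag_subgroup, of C])
      (use \<rho>(2) elem_mat_superdiag one1 that free_grp_generate in auto)
  have \<rho>l: "\<rho> z \<in> superdiag m" if "m \<ge> 1" "z \<in> glcs C m" for z m
    by (rule lower_central_superdiag[OF group_free_grp \<rho>(1) _ that]) (rule \<rho>1)
  \<comment> \<open>On gamma_{n+1} all nearer superdiagonals vanish, so the entry (0, n + 1) is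
    additive; on gamma_{n+2} it is 0, and it passes to the quotient.\<close>
  define cor where "cor z = \<rho> z 0 (n + 1)" for z
  have cor_mult: "cor (x \<otimes>\<^bsub>free_grp C\<^esub> y) = cor x + cor y" if xy: "x \<in> glcs C (Suc n)" "y \<in> glcs C (Suc n)" for x y
  proof -
    have x: "\<rho> x \<in> superdiag (Suc n)" and y: "\<rho> y \<in> superdiag 1"
      using \<rho>l[OF _ xy(1)] \<rho>1 GC.lcs_carrier[OF xy(2)] by auto
    have "\<rho> (x \<otimes>\<^bsub>free_grp C\<^esub> y) = \<rho> x \<otimes>\<^bsub>tri_units\<^esub> \<rho> y"
      using GC.lcs_carrier xy by simp
    then show ?thesis using superdiag_mult_low(1)[OF x y, of 0 "n + 1"] by (simp add: cor_def)
  qed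
  have cor_zero: "cor z = 0" if "z \<in> glcs C (Suc (Suc n))" for z
    using superdiagD(3)[OF \<rho>l[OF _ that], of 0 "n + 1"] by (simp add: cor_def)
  interpret N: normal "glcs C (Suc (Suc n))" "GC.lcs_group (Suc n)" by (rule GC.normal_lcs_group)
  have cor_cl: "cor (gcl C (Suc n) z) = cor z" if z: "z \<in> glcs C (Suc n)" for z
  proof -
    obtain k where k: "k \<in> glcs C (Suc (Suc n))" "gcl C (Suc n) z = k \<otimes>\<^bsub>free_grp C\<^esub> z"
      by (rule N.rep_of_obtain[of z]) (use z in \<open>auto simp: GC.cl_def\<close>)
    moreover have "k \<in> glcs C (Suc n)" using k(1) GC.lcs_Suc_subset[of "Suc n"] by blast
    ultimately show ?thesis using cor_mult[OF _ z] cor_zero by simp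
  qed
  have cor_hom: "cor \<in> hom (ggr C (Suc n)) integer_group"
  proof (rule homI)
    fix x y assume "x \<in> carrier (ggr C (Suc n))" "y \<in> carrier (ggr C (Suc n))"
    then have xy: "x \<in> glcs C (Suc n)" "y \<in> glcs C (Suc n)" using N.quot_carrierD(1) by (auto simp: GC.gr_def)
    then have "x \<otimes>\<^bsub>free_grp C\<^esub> y \<in> glcs C (Suc n)" using subgroup.m_closed[OF GC.lcs_subgroup] by blast
    from cor_cl[OF this] show "cor (x \<otimes>\<^bsub>ggr C (Suc n)\<^esub> y) = cor x \<otimes>\<^bsub>integer_group\<^esub> cor y"
      using cor_mult[OF xy] by (simp add: GC.gr_def GC.cl_def quot_def)
  qed simp
  have c0: "c 0 \<in> C" using c by simp
  define l where "l s = cor (jc n F \<eta> W C s (c 0))" for s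
  have lhom: "l \<in> hom (Fob F W) integer_group"
    using hom_compose[OF jc_hom[OF n F nat iso W c0] cor_hom] by (simp add: l_def[abs_def] o_def)
  have l1: "l s = 1" if "jc n F \<eta> W C s (c 0) = gcl C (Suc n) (nested_commutator (free_grp C) (\<lambda>i. gen (c i)) (Suc n))" for s
  proof -
    have gc: "gen (c i) \<in> carrier (free_grp C)" if "i \<le> Suc n" for i using gen_in_free_grp[OF c] that by simp
    have "nested_commutator (free_grp C) (\<lambda>i. gen (c i)) (Suc n) \<in> glcs C (Suc n)"
      by (rule nested_commutator_lcs[OF group_free_grp]) (use gc in auto)
    then have "l s = \<rho> (nested_commutator (free_grp C) (\<lambda>i. gen (c i)) (Suc n)) 0 (n + 1)"
      using cor_cl that by (simp add: l_def cor_def)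
    also have "\<rho> (nested_commutator (free_grp C) (\<lambda>i. gen (c i)) (Suc n)) = nested_commutator tri_units (\<lambda>i. \<rho> (gen (c i))) (Suc n)"
      by (rule nested_commutator_hom[OF group_free_grp group_tri_units \<rho>(1)]) (use gc in auto)
    also have "\<dots> = nested_commutator tri_units (\<lambda>i. elem_mat 1 (i - 1)) (Suc n)"
      by (rule nested_commutator_cong) (simp add: \<rho>c)
    finally show ?thesis using nested_commutator_elem_mat[of n] by simp
  qed
  have l0: "l (Fmor F V W f t) = 0" if V: "framed V B" and f: "based V B W C f" and t: "t \<in> carrier (Fob F V)"
      and i: "i \<le> n + 1" and ci: "c i \<notin> snd f ` B" for V B f t i
  \<comment> \<open>If c_0 is not hit, the coordinate at c_0 is trivial. Otherwise the missing c_i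
    has i \<ge> 1 and is a letter that the coordinate at c_0 cannot involve.\<close>
  proof (cases "c 0 \<in> snd f ` B")
    case False
    have "jc n F \<eta> W C (Fmor F V W f t) (c 0) = \<one>\<^bsub>ggr C (Suc n)\<^esub>"
      by (rule jc_natural(2)[OF n F nat iso V W f t c0 False])
    then show ?thesis
      using hom_one[OF cor_hom GC.group_gr group_integer_group] by (simp add: l_def)
  next
    case True
    then obtain b where b: "b \<in> B" "c 0 = snd f b" by blast
    interpret GB: group "free_grp B" by (rule group_free_grp)
    have im: "snd f ` B \<subseteq> C" using basedD(2)[OF f] by blast
    have uh: "free_map B C (snd f) \<in> hom (free_grp B) (free_grp C)" using free_map_props(1)[OF im] ext_homD(1) by blast
    have "jc n F \<eta> V B t b \<in> carrier (ggr B (Suc n))" using hom_in_carrier[OF jc_hom[OF n F nat iso V b(1)] t] .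
    then obtain z where z: "z \<in> glcs B (Suc n)" "jc n F \<eta> V B t b = gcl B (Suc n) z" by (auto simp: GB.gr_carrier)
    let ?w = "free_map B C (snd f) z"
    have w: "?w \<in> glcs C (Suc n)" using hom_lower_central[OF group_free_grp group_free_grp uh] z(1) by blast
    have "l (Fmor F V W f t) = \<rho> ?w 0 (n + 1)"
      using jc_natural(1)[OF n F nat iso V W f t b(1) z] b(2) cor_cl[OF w] by (simp add: l_def cor_def)
    \<comment> \<open>The only generator whose matrix crosses the cut at i is c_i, which does not
      occur in the word.\<close>
    moreover have "\<rho> ?w \<in> block_mat i"
    proof (rule gen_mem[OF block_mat_subgroup im])
      interpret u: group_hom "free_grp B" "free_grp C" "free_map B C (snd f)" by unfold_locales (rule uh)
      have "free_map B C (snd f) ` generate (free_grp B) (gen ` B) = generate (free_grp C) (free_map B C (snd f) ` gen ` B)"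
        by (rule u.generate_img[symmetric]) (auto simp: gen_in_free_grp)
      moreover have "free_map B C (snd f) ` gen ` B = gen ` snd f ` B"
        using free_map_props(2)[OF im] by (auto simp: image_iff)
      ultimately show "?w \<in> generate (free_grp C) (gen ` snd f ` B)"
        using GB.lcs_carrier[OF z(1)] by (auto simp: free_grp_generate)
    next
      fix d assume d: "d \<in> snd f ` B"
      show "\<rho> (gen d) \<in> block_mat i"
      proof (cases "d \<in> c ` {1..n + 1}")
        case True
        then obtain j where j: "1 \<le> j" "j \<le> n + 1" "d = c j" by auto
        then have "j \<noteq> i" using d ci by blast
        then show ?thesis using \<rho>c[OF j(1,2)] j elem_mat_block[of "j - 1" i] by simp
      next
        case False
        then show ?thesis using \<rho>(2) d im oneb by auto
      qed
    qed
    \<comment> \<open>So 0 < i \<le> n + 1, and the corner (0, n + 1) lies in the off-diagonal block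
      that vanishes.\<close>
    moreover have "i \<noteq> 0" using ci True by (cases i) auto
    ultimately show ?thesis using i by (simp add: block_mat_def)
  qed
  show thesis by (rule that[OF lhom]) (use l0 l1 in blast)+
qed

text \<open>The witness is the class of a transvection in the difference along n + 2 copies of a
  nonzero object, evaluated at 0. If some stabilisation killed it, the corner functional would
  vanish on it by \<open>proj_kernel\<close>, yet its value is 1 after every stabilisation.\<close>

lemma not_stably_null_iter_delta:
  obtains xs where "set xs \<subseteq> Ob Sab" "length xs = n + 2" "\<not> stably_null (iter_delta xs F)"
proof -
  obtain x where x: "x \<in> Ob Sab" "some_basis x \<noteq> {}" by (rule exists_nontrivial_object)
  define xs where "xs = replicate (n + 2) x"
  have xs: "set xs \<subseteq> Ob Sab" "length xs = n + 2" "\<And>y. y \<in> set xs \<Longrightarrow> some_basis y \<noteq> {}"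
    using x by (auto simp: xs_def)
  have a: "framed zero_ob {}" using zero_ob_in_Ob ab_basis_zero_ob by (simp add: framed_def)
  note oa = framedD(1)[OF a]
  define V where "V = msum xs zero_ob"
  define B where "B = msum_basis xs zero_ob {}"
  have V: "framed V B" unfolding V_def B_def by (rule framed_msum[OF xs(1) a])
  \<comment> \<open>One basis element per block: these are e_0, ..., e_{n+1}.\<close>
  obtain b where b: "\<And>i. i \<le> n + 1 \<Longrightarrow> b i \<in> B \<and> blk xs zero_ob (b i) = i"
    using blk_surj[OF xs(1) a xs(3)] xs(2) unfolding B_def by (metis Suc_eq_plus1 add_2_eq_Suc' le_imp_less_Suc)
  have binj: "b i \<noteq> b j" if "i \<le> n + 1" "j \<le> n + 1" "i \<noteq> j" for i j using b that by metis
  interpret GB: group "free_grp B" by (rule group_free_grp)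
  let ?z = "nested_commutator (free_grp B) (\<lambda>i. gen (b i)) (Suc n)"
  have gb: "gen (b i) \<in> carrier (free_grp B)" if "i \<le> Suc n" for i using gen_in_free_grp b that by simp
  have zl: "?z \<in> glcs B (Suc n)" by (rule nested_commutator_lcs[OF group_free_grp]) (use gb in auto)
  have zg: "?z \<in> generate (free_grp B) (gen ` (B - {b 0}))"
  proof (rule nested_commutator_in[OF group_free_grp GB.generate_is_subgroup])
    show "gen ` (B - {b 0}) \<subseteq> carrier (free_grp B)" using gen_in_free_grp by auto
    fix i assume i: "1 \<le> i" "i \<le> Suc n"
    then show "gen (b i) \<in> generate (free_grp B) (gen ` (B - {b 0}))"
      using b[of i] binj[of i 0] by (intro generate.incl imageI) auto
  qed
  have b0: "b 0 \<in> B" using b by simp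
  obtain t where t: "t \<in> carrier (Fob F V)" "jc n F \<eta> V B t (b 0) = gcl B (Suc n) ?z"
    by (rule jc_realize[OF n F nat iso V b0 zg zl])
  have "\<not> killed (iter_delta xs F) zero_ob (proj xs F zero_ob t)"
  proof
    assume k: "killed (iter_delta xs F) zero_ob (proj xs F zero_ob t)"
    have pt: "proj xs F zero_ob t \<in> carrier (Fob (iter_delta xs F) zero_ob)"
      using hom_in_carrier[OF proj_hom[OF F xs(1) oa]] t(1) by (simp add: V_def)
    obtain y where y: "y \<in> Ob Sab"
      "to_shift y (iter_delta xs F) zero_ob (proj xs F zero_ob t) = \<one>\<^bsub>Fob (iter_delta xs F) (dsum y zero_ob)\<^esub>"
      using k killed_into_sum[OF ab_functor_iter_delta[OF F xs(1)] oa pt] by blast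
    define e where "e = dsum y zero_ob"
    define E where "E = dsum_basis y zero_ob (some_basis y) {}"
    have e: "framed e E" unfolding e_def E_def by (rule framed_dsum[OF framed_some_basis[OF y(1)] a])
    have incl: "based zero_ob {} e E (into_sum y zero_ob)"
      unfolding e_def E_def by (rule based_into_sum[OF framed_some_basis[OF y(1)] a])
    define W where "W = msum xs e"
    define C where "C = msum_basis xs e E"
    have W: "framed W C" unfolding W_def C_def by (rule framed_msum[OF xs(1) e])
    define f where "f = msum_mor xs zero_ob e (into_sum y zero_ob)"
    have f: "based V B W C f"
      unfolding V_def B_def W_def C_def f_def by (rule based_msum_mor[OF xs(1) a e incl])
    define c where "c i = snd f (b i)" for i
    have c: "c i \<in> C" "blk xs e (c i) = i" if "i \<le> n + 1" for i
      using basedD(2)[OF f, of "b i"] b[OF that] blk_msum_mor(1)[OF xs(1) a e incl, of "b i"]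
      by (auto simp: c_def f_def B_def)
    have cinj: "inj_on c {..n + 1}" by (rule inj_on_inverseI[of _ "blk xs e"]) (use c(2) in simp)
    obtain l where l: "l \<in> hom (Fob F W) integer_group"
      "\<And>V B f t b i. framed V B \<Longrightarrow> based V B W C f \<Longrightarrow> t \<in> carrier (Fob F V) \<Longrightarrow> i \<le> n + 1 \<Longrightarrow>
         c i \<notin> snd f ` B \<Longrightarrow> l (Fmor F V W f t) = 0"
      "\<And>s. s \<in> carrier (Fob F W) \<Longrightarrow>
         jc n F \<eta> W C s (c 0) = gcl C (Suc n) (nested_commutator (free_grp C) (\<lambda>i. gen (c i)) (Suc n)) \<Longrightarrow> l s = 1"
      using corner_functional[OF W c(1) cinj] by metis
    let ?s = "Fmor F V W f t"
    have s: "?s \<in> carrier (Fob F W)"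
      using ab_functorD(6)[OF F framedD(1)[OF V] framedD(1)[OF W] basedD(1)[OF f] t(1)] .
    have im: "snd f ` B \<subseteq> C" using basedD(2)[OF f] by blast
    have uh: "free_map B C (snd f) \<in> hom (free_grp B) (free_grp C)" using free_map_props(1)[OF im] ext_homD(1) by blast
    have "jc n F \<eta> W C ?s (c 0) = gcl C (Suc n) (free_map B C (snd f) ?z)"
      unfolding c_def by (rule jc_natural(1)[OF n F nat iso V W f t(1) b0 zl t(2)])
    also have "free_map B C (snd f) ?z = nested_commutator (free_grp C) (\<lambda>i. free_map B C (snd f) (gen (b i))) (Suc n)"
      by (rule nested_commutator_hom[OF group_free_grp group_free_grp uh]) (use gb in auto)
    also have "\<dots> = nested_commutator (free_grp C) (\<lambda>i. gen (c i)) (Suc n)"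
      by (rule nested_commutator_cong) (use free_map_props(2)[OF im] b in \<open>simp add: c_def\<close>)
    finally have "l ?s = 1" using l(3)[OF s] by blast
    \<comment> \<open>The functional is trivial on whatever comes from the sum without the i-th
      summand, since c_i lies in the block i; hence it is trivial on the kernel of the canonical
      surjection.\<close>
    moreover have "l ?s = \<one>\<^bsub>integer_group\<^esub>"
    proof (rule proj_kernel[OF F xs(1) framedD(1)[OF e] group_integer_group])
      show "l \<in> hom (Fob F (msum xs e)) integer_group" using l(1) by (simp add: W_def)
      show "?s \<in> carrier (Fob F (msum xs e))" using s by (simp add: W_def)
      show "proj xs F e ?s = \<one>\<^bsub>Fob (iter_delta xs F) e\<^esub>"
        using y(2) proj_natural[OF F xs(1) oa framedD(1)[OF e] basedD(1)[OF incl]] t(1)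
        by (simp add: to_shift_def V_def W_def f_def e_def)
      fix i r assume i: "i < length xs" and r: "r \<in> carrier (Fob F (msum (drop_nth i xs) e))"
      have "l (Fmor F (msum (drop_nth i xs) e) W (skip_mor i xs e) r) = 0"
      proof (rule l(2)[OF framed_drop_nth[OF xs(1) e] _ r])
        show "based (msum (drop_nth i xs) e) (msum_basis (drop_nth i xs) e E) W C (skip_mor i xs e)"
          unfolding W_def C_def by (rule based_skip_mor[OF xs(1) e i])
        show "i \<le> n + 1" using i xs(2) by simp
        then show "c i \<notin> snd (skip_mor i xs e) ` msum_basis (drop_nth i xs) e E"
          using skip_mor_image[OF xs(1) e i] c(2) by auto
      qed
      then show "l (Fmor F (msum (drop_nth i xs) e) (msum xs e) (skip_mor i xs e) r) = \<one>\<^bsub>integer_group\<^esub>"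
        by (simp add: W_def)
    qed
    ultimately show False by simp
  qed
  moreover have "proj xs F zero_ob t \<in> carrier (Fob (iter_delta xs F) zero_ob)"
    using hom_in_carrier[OF proj_hom[OF F xs(1) oa]] t(1) by (simp add: V_def)
  ultimately have "\<not> stably_null (iter_delta xs F)"
    using stably_null_iff[OF ab_functor_iter_delta[OF F xs(1)]] oa by blast
  then show thesis using that xs(1,2) by blast
qed

end

theorem proposition5p3:
  fixes n :: nat and F :: "(nat monoid, split_mor, 'b) gfun"
  assumes "n \<ge> 1"
    and "ab_functor Sab F"
    and "nat_isomorphic Gcat (along_ab F) (JA_quotient n)"
  shows "weakly_polynomial F \<and> weak_degree F = ereal (real (n + 2))"
proof (rule weak_degreeI[OF assms(2)])
  obtain \<eta> where \<eta>: "nat_trans Gcat (along_ab F) (JA_quotient n) \<eta>"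
    "\<forall>a\<in>Ob Gcat. \<eta> a \<in> iso (Fob (along_ab F) a) (Fob (JA_quotient n) a)"
    using assms(3) by (auto simp: nat_isomorphic_def)
  \<comment> \<open>Degree at most n + 2 means that all (n + 3)-fold differences are stably null,
    and degree at most n + 1 the same for (n + 2)-fold ones.\<close>
  have "Pol (int (n + 3) - 1) F"
    using Pol_iff[OF assms(2), of "n + 3"] stably_null_iter_delta[OF assms(1,2) \<eta>] by blast
  then show "Pol (int (n + 2)) F" by (simp add: algebra_simps)
  show "\<not> Pol (int (n + 2) - 1) F"
    using Pol_iff[OF assms(2), of "n + 2"] not_stably_null_iter_delta[OF assms(1,2) \<eta>] by metis
qed

end
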